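(* Let $n\ge2$ and let the tensor $\mathbb A$ satisfy the relaxed ellipticity condition with constant $C_{\mathbb A}>0$. If $\mathbf f\in\dot{\mathbf H}_\#^{-1}$, then the anisotropic Navier-Stokes equation $$-\boldsymbol{\mathfrak L}\mathbf u+\nabla p+(\mathbf u\cdot\nabla)\mathbf u=\mathbf f$$ has a solution $(\mathbf u,p)\in\dot{\mathbf H}_{\#\sigma}^1\times\dot H_{q\#}^0$ (in the sense of distributions), where $q=2$ for $n\in\{2,3,4\}$, and $q=n/(n-2)$ for $n\ge5$. Moreover, the following estimate holds: $$\|\mathbf u\|_{\dot{\mathbf H}_\#^1}\le\pi^{-2}C_{\mathbb A}\|\mathbf f\|_{\dot{\mathbf H}_\#^{-1}}.$$
   Context: Repeated indices are summed from $1$ to $n$; $\partial_j=\partial/\partial x_j$. All functions and distributions are real-valued. $\mathbb A=(a_{kj}^{\alpha\beta})_{1\le k,j,\alpha,\beta\le n}$ is a tensor of real constants with the symmetry $a_{kj}^{\alpha\beta}=a_{\alpha j}^{k\beta}=a_{k\beta}^{\alpha j}$ (standing assumption). Relaxed ellipticity condition: there is a constant $C_{\mathbb A}>0$ such that $C_{\mathbb A}a_{kj}^{\alpha\beta}\zeta_{k\alpha}\zeta_{j\beta}\ge|\boldsymbol\zeta|^2:=\zeta_{k\alpha}\zeta_{k\alpha}$ for all $\boldsymbol\zeta\in\mathbb R^{n\times n}$ with $\boldsymbol\zeta=\boldsymbol\zeta^\top$ and $\sum_k\zeta_{kk}=0$. $(\boldsymbol{\mathfrak L}\mathbf u)_k:=\partial_\alpha(a_{kj}^{\alpha\beta}E_{j\beta}(\mathbf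 u))=\partial_\alpha(a_{kj}^{\alpha\beta}\partial_\beta u_j)$ with $E_{j\beta}(\mathbf u)=\frac12(\partial_ju_\beta+\partial_\beta u_j)$. $((\mathbf u\cdot\nabla)\mathbf u)_k=u_j\partial_ju_k$. $\mathbb T=[0,1)^n$ is the flat torus; functions/distributions on it are identified with $1$-periodic ones on $\mathbb R^n$. Fourier coefficients: $\hat g(\boldsymbol\xi)=\int_{\mathbb T}e^{-2\pi i\mathbf x\cdot\boldsymbol\xi}g(\mathbf x)d\mathbf x$, $\boldsymbol\xi\in\mathbb Z^n$, extended to periodic distributions. $H^s_\#$ is the space of periodic distributions with finite norm $\|g\|_{H^s_\#}=\big(\sum_{\boldsymbol\xi\in\mathbb Z^n}(1+|\boldsymbol\xi|^2)^s|\hat g(\boldsymbol\xi)|^2\big)^{1/2}$; $\dot H^s_\#=\{g\in H^s_\#:\hat g(\mathbf 0)=0\}$ with the same norm. $\dot H^0_{q\#}=\dot L_{q\#}$ is the space of zero-mean $1$-periodic functions belonging to $L_q(\mathbb T)$. Bold symbols denote $n$-component vector versions; $\dot{\mathbf H}^s_{\#\sigma}=\{\mathbf w\in\dot{\mathbf H}^s_\#:\mathrm{div}\,\mathbf w=0\}$. *)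

theory Defs
  imports "HOL-Analysis.Analysis"
begin

section \<open>Periodic functions and test functions on the flat torus\<close>

definition torus :: "(real ^ 'n) set" where
  "torus = {x. \<forall>i. 0 \<le> x $ i \<and> x $ i < 1}"

definition periodic :: "(real ^ 'n \<Rightarrow> real) \<Rightarrow> bool" where
  "periodic g \<longleftrightarrow> (\<forall>x i. g (x + axis i 1) = g x)"

definition partial :: "'n \<Rightarrow> (real ^ 'n \<Rightarrow> real) \<Rightarrow> real ^ 'n \<Rightarrow> real" where
  "partial j \<phi> = (\<lambda>x. frechet_derivative \<phi> (at x) (axis j 1))"

definition partials :: "'n list \<Rightarrow> (real ^ 'n \<Rightarrow> real) \<Rightarrow> real ^ 'n \<Rightarrow> real" where
  "partials js \<phi> = foldr partial js \<phi>"

text \<open>The real-valued periodic infinitely smooth functions: all iterated partial derivatives exist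
  and are (Frechet) differentiable everywhere.\<close>

definition test_fun :: "(real ^ 'n \<Rightarrow> real) set" where
  "test_fun = {\<phi>. periodic \<phi> \<and> (\<forall>js. partials js \<phi> differentiable_on UNIV)}"

definition Ck_norm :: "nat \<Rightarrow> (real ^ 'n \<Rightarrow> real) \<Rightarrow> real" where
  "Ck_norm m \<phi> = (SUP (js, x) \<in> {js. length js \<le> m} \<times> UNIV. \<bar>partials js \<phi> x\<bar>)"

section \<open>Real periodic distributions\<close>

text \<open>A periodic distribution is a continuous linear functional on \<open>test_fun\<close>. It is represented by a
  functional on all functions, of which only the values on test functions are ever used; accordingly,
  equality of distributions always means equality on test functions.\<close>

type_synonym 'n distr = "(real ^ 'n \<Rightarrow> real) \<Rightarrow> real"

definition distribution :: "'n::finite distr \<Rightarrow> bool" where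
  "distribution T \<longleftrightarrow>
     (\<forall>\<phi>\<in>test_fun. \<forall>\<psi>\<in>test_fun. T (\<lambda>x. \<phi> x + \<psi> x) = T \<phi> + T \<psi>) \<and>
     (\<forall>c. \<forall>\<phi>\<in>test_fun. T (\<lambda>x. c * \<phi> x) = c * T \<phi>) \<and>
     (\<exists>C m. \<forall>\<phi>\<in>test_fun. \<bar>T \<phi>\<bar> \<le> C * Ck_norm m \<phi>)"

definition distr_of :: "(real ^ 'n::finite \<Rightarrow> real) \<Rightarrow> 'n distr" where
  "distr_of g = (\<lambda>\<phi>. LINT x:torus|lebesgue. g x * \<phi> x)"

text \<open>The identification of periodic integrable functions with distributions.\<close>

definition represents :: "(real ^ 'n::finite \<Rightarrow> real) \<Rightarrow> 'n distr \<Rightarrow> bool" where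
  "represents g T \<longleftrightarrow>
     periodic g \<and> g absolutely_integrable_on torus \<and> (\<forall>\<phi>\<in>test_fun. T \<phi> = distr_of g \<phi>)"

text \<open>\<open>R\<close> is the pointwise product of \<open>S\<close> and \<open>T\<close>; this requires that both factors and the product be
  integrable functions.\<close>

definition is_product :: "'n::finite distr \<Rightarrow> 'n distr \<Rightarrow> 'n distr \<Rightarrow> bool" where
  "is_product S T R \<longleftrightarrow>
     (\<exists>g h. represents g S \<and> represents h T \<and> represents (\<lambda>x. g x * h x) R)"

definition dpartial :: "'n::finite \<Rightarrow> 'n distr \<Rightarrow> 'n distr" where
  "dpartial j T = (\<lambda>\<phi>. - T (partial j \<phi>))"

section \<open>Fourier coefficients and periodic Sobolev spaces\<close>

definition freq :: "int ^ 'n \<Rightarrow> real ^ 'n" where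
  "freq \<xi> = (\<chi> i. real_of_int (\<xi> $ i))"

text \<open>The complex-linear extension of \<open>T\<close> applied to
  $e^{-2\pi i x\cdot\xi} = \cos (2\pi x\cdot\xi) - i \sin (2\pi x\cdot\xi)$.\<close>

definition fourier :: "'n::finite distr \<Rightarrow> int ^ 'n \<Rightarrow> complex" where
  "fourier T \<xi> = Complex (T (\<lambda>x. cos (2 * pi * (x \<bullet> freq \<xi>)))) (- T (\<lambda>x. sin (2 * pi * (x \<bullet> freq \<xi>))))"

definition Hterm :: "real \<Rightarrow> 'n::finite distr \<Rightarrow> int ^ 'n \<Rightarrow> real" where
  "Hterm s T \<xi> = (1 + (norm (freq \<xi>))\<^sup>2) powr s * (cmod (fourier T \<xi>))\<^sup>2"

definition Hnorm :: "real \<Rightarrow> 'n::finite distr \<Rightarrow> real" where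
  "Hnorm s T = sqrt (\<Sum>\<^sub>\<infinity>\<xi>\<in>UNIV. Hterm s T \<xi>)"

definition Hspace :: "real \<Rightarrow> 'n::finite distr set" where
  "Hspace s = {T. distribution T \<and> Hterm s T summable_on UNIV}"

definition Hdot :: "real \<Rightarrow> 'n::finite distr set" where
  "Hdot s = {T \<in> Hspace s. fourier T 0 = 0}"

definition Hdot_vec :: "real \<Rightarrow> ('n::finite \<Rightarrow> 'n distr) set" where
  "Hdot_vec s = {w. \<forall>k. w k \<in> Hdot s}"

definition Hnorm_vec :: "real \<Rightarrow> ('n::finite \<Rightarrow> 'n distr) \<Rightarrow> real" where
  "Hnorm_vec s w = sqrt (\<Sum>k\<in>UNIV. (Hnorm s (w k))\<^sup>2)"

definition divergence :: "('n::finite \<Rightarrow> 'n distr) \<Rightarrow> 'n distr" where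
  "divergence w = (\<lambda>\<phi>. \<Sum>k\<in>UNIV. dpartial k (w k) \<phi>)"

definition Hdot_sol :: "real \<Rightarrow> ('n::finite \<Rightarrow> 'n distr) set" where
  "Hdot_sol s = {w \<in> Hdot_vec s. \<forall>\<phi>\<in>test_fun. divergence w \<phi> = 0}"

definition Lq_dot :: "real \<Rightarrow> (real ^ 'n \<Rightarrow> real) set" where
  "Lq_dot q = {g. periodic g \<and> g \<in> borel_measurable lebesgue \<and>
     set_integrable lebesgue torus (\<lambda>x. \<bar>g x\<bar> powr q) \<and>
     (LINT x:torus|lebesgue. g x) = 0}"

section \<open>The anisotropic Navier--Stokes system\<close>

text \<open>\<open>a k j \<alpha> \<beta>\<close> stands for $a_{kj}^{\alpha\beta}$.\<close>

type_synonym 'n tensor = "'n \<Rightarrow> 'n \<Rightarrow> 'n \<Rightarrow> 'n \<Rightarrow> real"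

definition tensor_symmetric :: "'n tensor \<Rightarrow> bool" where
  "tensor_symmetric a \<longleftrightarrow>
     (\<forall>k j \<alpha> \<beta>. a k j \<alpha> \<beta> = a \<alpha> j k \<beta> \<and> a k j \<alpha> \<beta> = a k \<beta> \<alpha> j)"

definition relaxed_elliptic :: "'n::finite tensor \<Rightarrow> real \<Rightarrow> bool" where
  "relaxed_elliptic a C \<longleftrightarrow>
     (\<forall>\<zeta> :: real ^ 'n ^ 'n. transpose \<zeta> = \<zeta> \<and> (\<Sum>k\<in>UNIV. \<zeta> $ k $ k) = 0 \<longrightarrow>
        C * (\<Sum>k\<in>UNIV. \<Sum>j\<in>UNIV. \<Sum>\<alpha>\<in>UNIV. \<Sum>\<beta>\<in>UNIV. a k j \<alpha> \<beta> * \<zeta> $ k $ \<alpha> * \<zeta> $ j $ \<beta>)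
          \<ge> (\<Sum>k\<in>UNIV. \<Sum>\<alpha>\<in>UNIV. \<zeta> $ k $ \<alpha> * \<zeta> $ k $ \<alpha>))"

definition strain :: "('n::finite \<Rightarrow> 'n distr) \<Rightarrow> 'n \<Rightarrow> 'n \<Rightarrow> 'n distr" where
  "strain u j \<beta> = (\<lambda>\<phi>. (dpartial j (u \<beta>) \<phi> + dpartial \<beta> (u j) \<phi>) / 2)"

definition stokes_op :: "'n::finite tensor \<Rightarrow> ('n \<Rightarrow> 'n distr) \<Rightarrow> 'n \<Rightarrow> 'n distr" where
  "stokes_op a u k = (\<lambda>\<phi>. \<Sum>\<alpha>\<in>UNIV.
     dpartial \<alpha> (\<lambda>\<psi>. \<Sum>j\<in>UNIV. \<Sum>\<beta>\<in>UNIV. a k j \<alpha> \<beta> * strain u j \<beta> \<psi>) \<phi>)"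

text \<open>\<open>N j k\<close> is the product of \<open>u j\<close> and \<open>dpartial j (u k)\<close>, so that the sum of \<open>N j k\<close> over \<open>j\<close> is the
  $k$-th component of the convection term.\<close>

definition navier_stokes ::
    "'n::finite tensor \<Rightarrow> ('n \<Rightarrow> 'n distr) \<Rightarrow> (real ^ 'n \<Rightarrow> real) \<Rightarrow> ('n \<Rightarrow> 'n distr) \<Rightarrow> bool" where
  "navier_stokes a u p f \<longleftrightarrow>
     (\<exists>N. (\<forall>j k. is_product (u j) (dpartial j (u k)) (N j k)) \<and>
          (\<forall>k. \<forall>\<phi>\<in>test_fun.
             - stokes_op a u k \<phi> + dpartial k (distr_of p) \<phi> + (\<Sum>j\<in>UNIV. N j k \<phi>) = f k \<phi>))"

end

theory Submission
  imports Defs "HOL-Probability.Probability"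
begin

text \<open>The velocity is a limit of Galerkin approximations on the Fourier side. On the real solenoidal
  trigonometric fields with frequencies in a box the convection term does no work, and the relaxed
  ellipticity, applied to the symmetric part of $\xi\otimes\hat u(\xi)$ (trace-free as \<open>u\<close> is solenoidal), makes the
  remaining vector field coercive; Brouwer's theorem yields a zero together with the energy estimate.
  A coefficientwise convergent subsequence solves the equation at every frequency, because the energy
  controls the tails of the convolutions.

  The pressure is recovered as $-\mathrm{div}\,\Delta^{-1}$ applied to the residual of the equation. The linear
  part of the residual contributes an \<open>L\<^sub>2\<close> function. With $m=\max(n,3)$, the Sobolev inequality puts
  the velocity in $L_{2m/(m-2)}$, hence the convection term in $L_{m/(m-1)}$, and $\nabla\Delta^{-1}$
  maps this space to $L_{m/(m-2)}$. Both inequalities are proved by splitting the frequencies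
  dyadically (with Gaussian multipliers in the second case) and balancing low against high frequencies
  at each height of the function.\<close>

section \<open>Zeros of coercive vector fields\<close>

text \<open>The velocity is constructed from coefficients alone; functions are attached to them
  afterwards by Riesz-Fischer, and distributions are compared through their Fourier coefficients.
  Brouwer's theorem lives on the full space of coefficients, not on the subspace of real solenoidal
  ones, so the defect from the subspace is added to the projected equation. The constant
  \<open>C / pi\<^sup>2\<close> combines \<open>4 pi^2\<close> from two derivatives, a factor 1/2
  lost by symmetrizing, and \<open>1 + |\<xi>|^2 <= 2 |\<xi>|^2\<close> for
  \<open>\<xi> \<noteq> 0\<close>. For the pressure, \<open>m / (m - 2)\<close> would be infinite at
  m = 2 and the dyadic sums would stop being geometric. Working with m = 3 in dimension 2 is
  harmless: the linear part limits the pressure to the exponent 2 anyway, and the exponent of the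
  theorem is the smaller of 2 and \<open>m / (m - 2)\<close>. The integral bound for the kernel
  pieces avoids any formula for the kernel in x: pairing a piece with a trigonometric polynomial is
  a difference of Gaussian averages at two widths, and the derivative in the width is an average
  against z times the Gaussian density.\<close>

lemma compact_fun_box:
  fixes B :: "'i \<Rightarrow> 'b::topological_space set"
  assumes "\<And>i. compact (B i)"
  shows "compact {x. \<forall>i. x i \<in> B i}"
proof -
  have "compactin (product_topology (\<lambda>i. euclidean) UNIV) (PiE UNIV B)"
    unfolding compactin_PiE using assms by auto
  then have "compact (PiE UNIV B)"
    by (simp add: euclidean_product_topology)
  moreover have "PiE UNIV B = {x. \<forall>i. x i \<in> B i}" by (auto simp: PiE_def Pi_def)
  ultimately show ?thesis by simp
qed

lemma tendsto_fun_iff: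
  fixes X :: "'k \<Rightarrow> 'i \<Rightarrow> 'b::topological_space"
  shows "(X \<longlongrightarrow> x) F \<longleftrightarrow> (\<forall>i. ((\<lambda>n. X n i) \<longlongrightarrow> x i) F)"
proof -
  have "limitin (product_topology (\<lambda>i. euclidean) UNIV) X x F \<longleftrightarrow> (\<forall>i. ((\<lambda>n. X n i) \<longlongrightarrow> x i) F)"
    by (simp add: limitin_componentwise)
  then show ?thesis by (simp add: euclidean_product_topology)
qed

text \<open>The dimension is a number here because the Galerkin spaces grow. Kuhn's combinatorial
  lemma on grids of mesh \<open>1 / Suc p\<close> yields, for each p, a small cell in which every
  coordinate is labelled both ways; a limit point of these cells satisfies both inequalities between
  \<open>f x i\<close> and \<open>x i\<close>. Grid points are 0 from coordinate n on, so they lie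
  in the compact cube \<open>K\<close>.\<close>

lemma brouwer_fun:
  fixes f :: "(nat \<Rightarrow> real) \<Rightarrow> nat \<Rightarrow> real"
  defines "K \<equiv> {x. \<forall>i. x i \<in> {0..1}}"
  assumes cont: "\<And>i. i < n \<Longrightarrow> continuous_on K (\<lambda>x. f x i)"
    and map: "\<And>i x. i < n \<Longrightarrow> x \<in> K \<Longrightarrow> f x i \<in> {0..1}"
  shows "\<exists>x\<in>K. \<forall>i<n. f x i = x i"
proof -
  define pt where "pt p q = (\<lambda>i. if i < n then real (q i) / real p else 0)" for p :: nat and q :: "nat \<Rightarrow> nat"
  have ptK: "pt p q \<in> K" if "\<forall>i<n. q i \<le> p" "p > 0" for p q
    using that by (auto simp: K_def pt_def)
  \<comment> \<open>Label 0 means that \<open>f\<close> does not lower the coordinate. The clause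
    \<open>x i < p\<close> forces label 1 on the upper face, as Kuhn's lemma requires; on the lower
    face label 0 is automatic because \<open>f\<close> is nonnegative there.\<close>
  define label where "label p x i = (if x i < p \<and> pt p x i \<le> f (pt p x) i then 0 else 1::nat)"
    for p :: nat and x i
  define near where "near q r \<longleftrightarrow> (\<forall>j<n. q j \<le> r j \<and> r j \<le> q j + (1::nat))" for q r
  have ex: "\<exists>q. (\<forall>i<n. q i < Suc p) \<and> (\<forall>i<n. \<exists>r s. near q r \<and> near q s
      \<and> label (Suc p) r i \<noteq> label (Suc p) s i)" for p
  proof -
    obtain q where q: "\<forall>i<n. q i < Suc p"
      and "\<forall>i<n. \<exists>r s. (\<forall>j<n. q j \<le> r j \<and> r j \<le> q j + 1) \<and>
        (\<forall>j<n. q j \<le> s j \<and> s j \<le> q j + 1) \<and> label (Suc p) r i \<noteq> label (Suc p) s i"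
    proof (rule kuhn_lemma[of "Suc p" n "label (Suc p)"])
      show "\<forall>x. (\<forall>i<n. x i \<le> Suc p) \<longrightarrow> (\<forall>i<n. x i = 0 \<longrightarrow> label (Suc p) x i = 0)"
      proof (intro allI impI)
        fix x i assume "\<forall>i<n. x i \<le> Suc p" "i < n" "x i = (0::nat)"
        with map[OF \<open>i < n\<close> ptK[of x "Suc p"]] show "label (Suc p) x i = 0"
          by (auto simp: label_def pt_def)
      qed
    qed (auto simp: label_def)
    then show ?thesis unfolding near_def by blast
  qed
  then obtain q where q: "\<And>p i. i < n \<Longrightarrow> q p i < Suc p"
    and ex2: "\<And>p i. i < n \<Longrightarrow> \<exists>r s. near (q p) r \<and> near (q p) s \<and> label (Suc p) r i \<noteq> label (Suc p) s i"
    by metis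
  have "\<exists>r. i < n \<longrightarrow> near (q p) r \<and> label (Suc p) r i = b" if "b = 0 \<or> b = 1" for p i b
  proof (cases "i < n")
    case True
    then obtain r s where rs: "near (q p) r" "near (q p) s" "label (Suc p) r i \<noteq> label (Suc p) s i"
      using ex2 by blast
    then have "label (Suc p) r i = b \<or> label (Suc p) s i = b"
      using that by (auto simp: label_def split: if_splits)
    then show ?thesis using rs by blast
  qed auto
  then have ex3: "\<forall>p i. \<exists>r. i < n \<longrightarrow> near (q p) r \<and> label (Suc p) r i = 0"
    "\<forall>p i. \<exists>r. i < n \<longrightarrow> near (q p) r \<and> label (Suc p) r i = 1" by auto
  obtain R where R0: "\<forall>p i. i < n \<longrightarrow> near (q p) (R p i) \<and> label (Suc p) (R p i) i = 0"
    using ex3(1) unfolding choice_iff by blast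
  obtain S where S0: "\<forall>p i. i < n \<longrightarrow> near (q p) (S p i) \<and> label (Suc p) (S p i) i = 1"
    using ex3(2) unfolding choice_iff by blast
  have R: "\<And>p i j. i < n \<Longrightarrow> j < n \<Longrightarrow> q p j \<le> R p i j \<and> R p i j \<le> q p j + (1::nat)"
    and S: "\<And>p i j. i < n \<Longrightarrow> j < n \<Longrightarrow> q p j \<le> S p i j \<and> S p i j \<le> q p j + (1::nat)"
    and l0: "\<And>p i. i < n \<Longrightarrow> label (Suc p) (R p i) i = 0"
    and l1: "\<And>p i. i < n \<Longrightarrow> label (Suc p) (S p i) i = 1"
    using R0 S0 by (auto simp: near_def)
  define X where "X p = pt (Suc p) (q p)" for p
  have XK: "X p \<in> K" for p unfolding X_def by (rule ptK) (use q[of _ p] in \<open>auto simp: less_Suc_eq_le intro: le_SucI\<close>)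
  have "compact K" unfolding K_def by (rule compact_fun_box) auto
  then obtain x r where x: "x \<in> K" "strict_mono (r :: nat \<Rightarrow> nat)" "(X \<circ> r) \<longlonglongrightarrow> x"
    using XK by (meson compact_imp_seq_compact seq_compactE)
  have lim: "(\<lambda>p. pt (Suc (r p)) (Y (r p)) j) \<longlonglongrightarrow> x j"
    if Y: "\<And>p j. j < n \<Longrightarrow> q p j \<le> Y p j \<and> Y p j \<le> q p j + (1::nat)" for Y j
  proof -
    have "(\<lambda>p. X (r p) j) \<longlonglongrightarrow> x j" using x(3) by (simp add: tendsto_fun_iff o_def)
    moreover have "(\<lambda>p. pt (Suc (r p)) (Y (r p)) j - X (r p) j) \<longlonglongrightarrow> 0"
    proof (rule Lim_null_comparison)
      show "\<forall>\<^sub>F p in sequentially. norm (pt (Suc (r p)) (Y (r p)) j - X (r p) j) \<le> inverse (real (Suc (r p)))"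
      proof (rule always_eventually, rule allI)
        fix p show "norm (pt (Suc (r p)) (Y (r p)) j - X (r p) j) \<le> inverse (real (Suc (r p)))"
          using Y[of j "r p"]
          by (auto simp: pt_def X_def diff_divide_distrib[symmetric] divide_simps)
      qed
      show "(\<lambda>p. inverse (real (Suc (r p)))) \<longlonglongrightarrow> 0"
        using LIMSEQ_subseq_LIMSEQ[OF LIMSEQ_inverse_real_of_nat x(2)] by (simp add: o_def)
    qed
    ultimately show ?thesis using tendsto_add by fastforce
  qed
  have limf: "(\<lambda>p. f (pt (Suc (r p)) (Y (r p))) i) \<longlonglongrightarrow> f x i"
    if "i < n" and Y: "\<And>p j. j < n \<Longrightarrow> q p j \<le> Y p j \<and> Y p j \<le> q p j + (1::nat)" for Y i
  proof (rule continuous_on_tendsto_compose[OF cont[OF \<open>i < n\<close>] _ x(1)])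
    show "(\<lambda>p. pt (Suc (r p)) (Y (r p))) \<longlonglongrightarrow> x" using lim[OF Y] by (simp add: tendsto_fun_iff)
    have "pt (Suc (r p)) (Y (r p)) \<in> K" for p
      by (rule ptK) (use q[of _ "r p"] Y[of _ "r p"] in force)+
    then show "\<forall>\<^sub>F p in sequentially. pt (Suc (r p)) (Y (r p)) \<in> K" by simp
  qed
  have "f x i = x i" if i: "i < n" for i
  proof (rule antisym)
    show "x i \<le> f x i"
    proof (rule LIMSEQ_le[OF lim[of "\<lambda>p. R p i" i] limf[OF i, of "\<lambda>p. R p i"]])
      have "pt (Suc (r p)) (R (r p) i) i \<le> f (pt (Suc (r p)) (R (r p) i)) i" for p
        using l0[OF i, of "r p"] by (auto simp: label_def split: if_splits)
      then show "\<exists>N. \<forall>p\<ge>N. pt (Suc (r p)) (R (r p) i) i \<le> f (pt (Suc (r p)) (R (r p) i)) i" by blast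
    qed (use R i in auto)
    show "f x i \<le> x i"
    proof (rule LIMSEQ_le[OF limf[OF i, of "\<lambda>p. S p i"] lim[of "\<lambda>p. S p i" i]])
      have "f (pt (Suc (r p)) (S (r p) i)) i \<le> pt (Suc (r p)) (S (r p) i) i" for p
      \<comment> \<open>On the upper face label 1 carries no information about \<open>f\<close>, but
        there the coordinate equals 1, which bounds \<open>f\<close> anyway.\<close>
      proof (cases "S (r p) i i < Suc (r p)")
        case True then show ?thesis using l1[OF i, of "r p"] by (auto simp: label_def split: if_splits)
      next
        case False
        then have "S (r p) i i = Suc (r p)" using S[OF i i, of "r p"] q[OF i, of "r p"] by auto
        then have "pt (Suc (r p)) (S (r p) i) i = 1" using i by (simp add: pt_def)
        moreover have "pt (Suc (r p)) (S (r p) i) \<in> K"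
          by (rule ptK) (use q[of _ "r p"] S[OF i, of _ "r p"] in force)+
        ultimately show ?thesis using map[OF i] by fastforce
      qed
      then show "\<exists>N. \<forall>p\<ge>N. f (pt (Suc (r p)) (S (r p) i)) i \<le> pt (Suc (r p)) (S (r p) i) i" by blast
    qed (use S i in auto)
  qed
  then show ?thesis using x(1) by blast
qed

text \<open>If \<open>P\<close> had no zero, the map \<open>- R P / |P|\<close> would send the ball
  into its sphere. A fixed point x would have norm R and
  \<open>x \<bullet> P x = - R |P x| < 0\<close>, against coercivity. \<open>rho\<close> and
  \<open>h\<close> transport this map to the unit cube.\<close>

lemma coercive_zero_nat:
  fixes P :: "(nat \<Rightarrow> real) \<Rightarrow> nat \<Rightarrow> real"
  assumes R: "R > 0"
    and cont: "\<And>i. i < n \<Longrightarrow> continuous_on UNIV (\<lambda>x. P x i)"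
    and coer: "\<And>x. (\<Sum>i<n. (x i)\<^sup>2) = R\<^sup>2 \<Longrightarrow> (\<Sum>i<n. x i * P x i) \<ge> 0"
  shows "\<exists>x. \<forall>i<n. P x i = 0"
proof (rule ccontr)
  assume "\<not> ?thesis"
  then have nz: "\<And>x. \<exists>i<n. P x i \<noteq> 0" by blast
  define nr where "nr x = sqrt (\<Sum>i<n. (x i)\<^sup>2)" for x :: "nat \<Rightarrow> real"
  have nrP: "nr (P x) > 0" for x
  proof -
    obtain i where "i < n" "P x i \<noteq> 0" using nz by blast
    then have "(\<Sum>i<n. (P x i)\<^sup>2) > 0" by (intro sum_pos2[of _ i]) auto
    then show ?thesis by (simp add: nr_def)
  qed
  have comp_le: "\<bar>x i\<bar> \<le> nr x" if "i < n" for x i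
  proof -
    have "(x i)\<^sup>2 \<le> (\<Sum>i<n. (x i)\<^sup>2)" using that by (intro member_le_sum) auto
    then show ?thesis unfolding nr_def by (simp add: real_le_rsqrt)
  qed
  \<comment> \<open>The radial retraction onto the ball of radius R. The fixed point found below has
    norm exactly R, where \<open>rho\<close> is the identity.\<close>
  define rho where "rho x = (\<lambda>i::nat. R / max R (nr x) * x i)" for x
  define h where "h y = (\<lambda>i::nat. 2 * R * y i - R)" for y :: "nat \<Rightarrow> real"
  define g where "g x = (\<lambda>i::nat. - R * P (rho x) i / nr (P (rho x)))" for x
  define F where "F y = (\<lambda>i::nat. (g (h y) i + R) / (2 * R))" for y
  have cc: "continuous_on UNIV (\<lambda>y::nat\<Rightarrow>real. y i)" for i by (rule continuous_on_product_coordinates)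
  have cnr: "continuous_on UNIV nr" unfolding nr_def by (intro continuous_intros cc)
  have crho: "continuous_on UNIV rho" unfolding rho_def
    by (intro continuous_on_coordinatewise_then_product continuous_intros cc cnr)
       (use R in \<open>auto simp: max_def\<close>)
  have ch: "continuous_on UNIV h" unfolding h_def
    by (intro continuous_on_coordinatewise_then_product continuous_intros cc)
  have crh: "continuous_on UNIV (\<lambda>y. rho (h y))"
    using continuous_on_compose[OF ch, of rho] crho continuous_on_subset by (fastforce simp: o_def)
  have cP: "continuous_on UNIV (\<lambda>y. P (rho (h y)) i)" if "i < n" for i
    using continuous_on_compose[OF crh, of "\<lambda>x. P x i"] cont[OF that] continuous_on_subset by (fastforce simp: o_def)
  have cnP: "continuous_on UNIV (\<lambda>y. nr (P (rho (h y))))" unfolding nr_def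
    by (intro continuous_intros cP) auto
  have cF: "continuous_on UNIV (\<lambda>y. F y i)" if "i < n" for i
    unfolding F_def g_def
    by (intro continuous_intros cP cnP that) (use R nrP less_imp_neq[OF nrP] in \<open>auto simp: less_le\<close>)
  have nrg: "nr (g x) = R" for x
  proof -
    have "(\<Sum>i<n. (g x i)\<^sup>2) = R\<^sup>2 / (nr (P (rho x)))\<^sup>2 * (\<Sum>i<n. (P (rho x) i)\<^sup>2)"
      by (simp add: g_def sum_distrib_left power_divide power_mult_distrib)
    also have "(\<Sum>i<n. (P (rho x) i)\<^sup>2) = (nr (P (rho x)))\<^sup>2"
      by (simp add: nr_def sum_nonneg)
    finally show ?thesis using nrP[of "rho x"] R by (simp add: nr_def[of "g x"])
  qed
  obtain y where y: "\<And>i. i < n \<Longrightarrow> F y i = y i"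
  proof -
    have "\<exists>x\<in>{x. \<forall>i. x i \<in> {0..1}}. \<forall>i<n. F x i = x i"
    proof (rule brouwer_fun)
      fix i and x :: "nat \<Rightarrow> real" assume "i < n"
      then show "continuous_on {x. \<forall>i. x i \<in> {0..1}} (\<lambda>x. F x i)" using cF continuous_on_subset by blast
      have "\<bar>g (h x) i\<bar> \<le> R" using comp_le[OF \<open>i < n\<close>, of "g (h x)"] nrg by simp
      then show "F x i \<in> {0..1}" using R by (auto simp: F_def abs_le_iff divide_simps)
    qed
    then show ?thesis using that by blast
  qed
  define x where "x = h y"
  have gx: "g x i = x i" if "i < n" for i
    using y[OF that] R by (simp add: F_def x_def h_def field_simps)
  have "nr x = R" using nrg[of x] gx by (simp add: nr_def)
  then have rx: "rho x = x" using R by (auto simp: rho_def)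
  have "(\<Sum>i<n. (x i)\<^sup>2) = R\<^sup>2" using \<open>nr x = R\<close> by (metis nr_def real_sqrt_pow2 sum_nonneg zero_le_power2)
  then have "0 \<le> (\<Sum>i<n. x i * P x i)" by (rule coer)
  also have "\<dots> = (\<Sum>i<n. - (R / nr (P x)) * (P x i)\<^sup>2)"
    by (intro sum.cong refl) (simp add: gx[symmetric] g_def rx power2_eq_square del: gx)
  also have "\<dots> = - (R / nr (P x)) * (nr (P x))\<^sup>2"
    by (simp add: nr_def sum_nonneg sum_distrib_left)
  also have "\<dots> < 0" using R nrP[of x] by simp
  finally show False by simp
qed

text \<open>Each complex unknown is split into its real and imaginary part, indexed by a boolean;
  \<open>Re (cnj z * z')\<close> is then the Euclidean inner product of the pairs.\<close>

lemma coercive_zero_complex: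
  fixes P :: "('i \<Rightarrow> complex) \<Rightarrow> 'i \<Rightarrow> complex"
  assumes I: "finite I" and R: "R > 0"
    and cont: "\<And>i. i \<in> I \<Longrightarrow> continuous_on UNIV (\<lambda>v. P v i)"
    and coer: "\<And>v. (\<Sum>i\<in>I. (cmod (v i))\<^sup>2) = R\<^sup>2 \<Longrightarrow> (\<Sum>i\<in>I. Re (cnj (v i) * P v i)) \<ge> 0"
  shows "\<exists>v. \<forall>i\<in>I. P v i = 0"
proof -
  define J where "J = I \<times> (UNIV::bool set)"
  have "finite J" using I by (simp add: J_def)
  then obtain \<beta> where \<beta>: "bij_betw \<beta> {..<card J} J"
    using ex_bij_betw_nat_finite[of J] by (auto simp: atLeast0LessThan)
  define \<gamma> where "\<gamma> = inv_into {..<card J} \<beta>"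
  have \<gamma>: "bij_betw \<gamma> J {..<card J}" unfolding \<gamma>_def by (rule bij_betw_inv_into[OF \<beta>])
  have \<gamma>\<beta>: "\<gamma> (\<beta> k) = k" if "k < card J" for k
    using \<beta> that by (simp add: \<gamma>_def bij_betw_inv_into_left)
  define V where "V x = (\<lambda>i. Complex (x (\<gamma> (i, True))) (x (\<gamma> (i, False))))" for x :: "nat \<Rightarrow> real"
  define part where "part b z = (if b then Re z else Im z)" for b z
  define Q where "Q x k = (case \<beta> k of (i, b) \<Rightarrow> part b (P (V x) i))" for x k
  have cc: "continuous_on UNIV (\<lambda>y::nat\<Rightarrow>real. y i)" for i by (rule continuous_on_product_coordinates)
  have cV: "continuous_on UNIV V"
    unfolding V_def complex_eq
    by (intro continuous_on_coordinatewise_then_product continuous_intros cc)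
  have sumJ: "(\<Sum>k<card J. G (\<beta> k)) = (\<Sum>i\<in>I. G (i, True) + G (i, False))" for G :: "_ \<Rightarrow> real"
  proof -
    have "(\<Sum>k<card J. G (\<beta> k)) = sum G J" by (rule sum.reindex_bij_betw[OF \<beta>])
    also have "\<dots> = (\<Sum>i\<in>I. \<Sum>b\<in>UNIV. G (i, b))" unfolding J_def by (simp add: sum.cartesian_product)
    finally show ?thesis by (simp add: UNIV_bool add.commute)
  qed
  have "\<exists>x. \<forall>k<card J. Q x k = 0"
  proof (rule coercive_zero_nat[OF R])
    fix k assume "k < card J"
    then have "\<beta> k \<in> J" using \<beta> by (auto simp: bij_betw_def)
    then have i: "fst (\<beta> k) \<in> I" by (auto simp: J_def)
    have "continuous_on UNIV (\<lambda>x. P (V x) (fst (\<beta> k)))"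
      using continuous_on_compose[OF cV, of "\<lambda>v. P v (fst (\<beta> k))"] cont[OF i] continuous_on_subset
      by (fastforce simp: o_def)
    then show "continuous_on UNIV (\<lambda>x. Q x k)"
      unfolding Q_def part_def case_prod_beta by (cases "snd (\<beta> k)") (auto intro!: continuous_intros)
  next
    fix x :: "nat \<Rightarrow> real" assume x: "(\<Sum>k<card J. (x k)\<^sup>2) = R\<^sup>2"
    have "(\<Sum>i\<in>I. (cmod (V x i))\<^sup>2) = (\<Sum>k<card J. (x (\<gamma> (\<beta> k)))\<^sup>2)"
      by (subst sumJ) (simp add: V_def cmod_power2)
    also have "\<dots> = R\<^sup>2" unfolding x[symmetric] using \<gamma>\<beta> by (intro sum.cong) auto
    finally have "0 \<le> (\<Sum>i\<in>I. Re (cnj (V x i) * P (V x) i))" by (rule coer)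
    also have "\<dots> = (\<Sum>k<card J. x (\<gamma> (\<beta> k)) * (case \<beta> k of (i, b) \<Rightarrow> part b (P (V x) i)))"
      by (subst sumJ) (simp add: V_def part_def)
    also have "\<dots> = (\<Sum>k<card J. x k * Q x k)"
      unfolding Q_def using \<gamma>\<beta> by (intro sum.cong) auto
    finally show "0 \<le> (\<Sum>k<card J. x k * Q x k)" .
  qed
  then obtain x where x: "\<And>k. k < card J \<Longrightarrow> Q x k = 0" by blast
  have "P (V x) i = 0" if "i \<in> I" for i
  proof -
    have "part b (P (V x) i) = 0" for b
    proof -
      have "(i, b) \<in> J" using that by (simp add: J_def)
      then obtain k where "k < card J" "\<beta> k = (i, b)"
        using \<beta> unfolding bij_betw_def by (metis imageE lessThan_iff)
      with x[of k] show ?thesis by (simp add: Q_def)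
    qed
    from this[of True] this[of False] show ?thesis by (simp add: part_def complex_eq_iff)
  qed
  then show ?thesis by blast
qed

section \<open>Integration over the torus\<close>

text \<open>Borel sets are used instead of Lebesgue sets, since translations and Fubini's theorem
  are smoother for Borel functions; \<open>set_integral_torus\<close> leads back to the integrals
  over \<open>lebesgue\<close>. The measure is a probability measure.\<close>

definition tor :: "(real ^ 'n::finite) measure" where
  "tor = restrict_space lborel torus"

lemma torus_borel [measurable]: "(torus :: (real ^ 'n::finite) set) \<in> sets borel"
proof -
  have "(torus :: (real ^ 'n::finite) set) = {x \<in> space borel. \<forall>i. 0 \<le> x $ i \<and> x $ i < 1}"
    by (simp add: torus_def)
  also have "\<dots> \<in> sets borel" by measurable
  finally show ?thesis .
qed

lemma space_tor [simp]: "space tor = torus"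
  by (simp add: tor_def space_restrict_space)

lemma sets_tor: "sets tor = sets (restrict_space borel torus)"
  by (simp add: tor_def sets_restrict_space)

lemma measurable_tor: "f \<in> measurable borel N \<Longrightarrow> f \<in> measurable tor N"
  by (simp add: tor_def measurable_restrict_space1)

lemma emeasure_torus: "emeasure lborel (torus :: (real ^ 'n::finite) set) = 1"
proof (rule antisym)
  let ?u = "\<chi> i. 1 :: real ^ 'n"
  have 1: "?u \<bullet> b = 1" if "b \<in> Basis" for b :: "real ^ 'n"
    using that by (auto simp: Basis_vec_def inner_axis)
  have "emeasure lborel (torus :: (real ^ 'n) set) \<le> emeasure lborel (cbox 0 (\<chi> i. 1 :: real ^ 'n))"
    by (rule emeasure_mono) (auto simp: torus_def mem_box_cart less_imp_le)
  also have "\<dots> = 1" by (subst emeasure_lborel_cbox) (auto simp: 1)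
  finally show "emeasure lborel (torus :: (real ^ 'n) set) \<le> 1" .
  have "1 = emeasure lborel (box 0 (\<chi> i. 1 :: real ^ 'n))" by (subst emeasure_lborel_box) (auto simp: 1)
  also have "\<dots> \<le> emeasure lborel (torus :: (real ^ 'n) set)"
    by (rule emeasure_mono) (auto simp: torus_def mem_box_cart less_imp_le)
  finally show "1 \<le> emeasure lborel (torus :: (real ^ 'n) set)" .
qed

interpretation tor: prob_space "tor :: (real ^ 'n::finite) measure"
  by standard (simp add: tor_def emeasure_restrict_space space_restrict_space emeasure_torus)

lemma set_integral_torus:
  fixes f :: "real ^ 'n::finite \<Rightarrow> real"
  assumes "f \<in> borel_measurable borel"
  shows "(LINT x:torus|lebesgue. f x) = (LINT x|tor. f x)"
    "set_integrable lebesgue torus f \<longleftrightarrow> integrable tor f"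
proof -
  have m: "(\<lambda>x. indicator torus x *\<^sub>R f x) \<in> borel_measurable lborel" using assms by measurable
  show "(LINT x:torus|lebesgue. f x) = (LINT x|tor. f x)"
    unfolding set_lebesgue_integral_def integral_completion[OF m] tor_def
    by (subst integral_restrict_space) auto
  show "set_integrable lebesgue torus f \<longleftrightarrow> integrable tor f"
    unfolding set_integrable_def tor_def
    by (subst integrable_restrict_space, simp, subst integrable_completion[OF m]) simp
qed

lemma freq_add: "freq (\<xi> + \<eta>) = freq \<xi> + freq \<eta>"
  and freq_uminus: "freq (- \<xi>) = - freq \<xi>"
  and freq_0 [simp]: "freq 0 = 0"
  and freq_nth [simp]: "freq \<xi> $ i = real_of_int (\<xi> $ i)"
  by (simp_all add: freq_def vec_eq_iff)

lemma freq_eq_0_iff [simp]: "freq \<xi> = 0 \<longleftrightarrow> \<xi> = 0"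
  by (simp add: vec_eq_iff)

lemma norm_freq_ge_1: "\<xi> \<noteq> 0 \<Longrightarrow> norm (freq \<xi>) \<ge> 1"
proof -
  assume "\<xi> \<noteq> 0"
  then obtain i where "\<xi> $ i \<noteq> 0" by (auto simp: vec_eq_iff)
  then have "1 \<le> \<bar>freq \<xi> $ i\<bar>" by simp
  also have "\<dots> \<le> norm (freq \<xi>)" by (rule component_le_norm_cart)
  finally show ?thesis .
qed

section \<open>Invariance under translations\<close>

definition frac_part :: "real ^ 'n \<Rightarrow> real ^ 'n::finite" where
  "frac_part x = (\<chi> i. frac (x $ i))"

definition floor_vec :: "real ^ 'n \<Rightarrow> int ^ 'n::finite" where
  "floor_vec x = (\<chi> i. \<lfloor>x $ i\<rfloor>)"

lemma frac_part_eq: "frac_part x = x - freq (floor_vec x)"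
  by (simp add: frac_part_def floor_vec_def vec_eq_iff frac_def)

lemma frac_part_torus [simp]: "frac_part x \<in> torus"
  by (simp add: frac_part_def torus_def frac_ge_0 frac_lt_1)

lemma frac_part_id: "x \<in> torus \<Longrightarrow> frac_part x = x"
  by (simp add: frac_part_def torus_def vec_eq_iff frac_eq)

lemma torus_minus_freq_iff: "x - freq \<xi> \<in> torus \<longleftrightarrow> \<xi> = floor_vec x"
  unfolding torus_def floor_vec_def vec_eq_iff
  by (auto simp: floor_eq_iff intro!: floor_unique[symmetric]) (smt (verit) floor_eq_iff)+

lemma frac_part_shift: "frac_part (x + freq \<xi>) = frac_part x"
  by (simp add: frac_part_def frac_def vec_eq_iff)

lemma frac_part_measurable [measurable]: "frac_part \<in> borel_measurable borel"
  by (subst borel_measurable_euclidean_space) (auto simp: Basis_vec_def inner_axis frac_part_def frac_def)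

lemma nn_integral_lborel_translate:
  fixes g :: "'a::euclidean_space \<Rightarrow> ennreal"
  assumes [measurable]: "g \<in> borel_measurable borel"
  shows "(\<integral>\<^sup>+x. g (x + a) \<partial>lborel) = (\<integral>\<^sup>+x. g x \<partial>lborel)"
proof -
  have "(\<integral>\<^sup>+x. g x \<partial>lborel) = (\<integral>\<^sup>+x. g x \<partial>distr lborel borel ((+) a))"
    by (simp add: lborel_distr_plus)
  also have "\<dots> = (\<integral>\<^sup>+x. g (a + x) \<partial>lborel)" by (rule nn_integral_distr) simp_all
  finally show ?thesis by (simp add: add.commute)
qed

text \<open>Both \<open>torus\<close> and its translates are fundamental domains for the lattice: summing the indicator
  of one over all lattice translates gives 1, which is inserted into the integral over the other.\<close>

lemma nn_integral_tor_frac_part: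
  fixes h :: "real ^ 'n::finite \<Rightarrow> ennreal"
  assumes [measurable]: "h \<in> borel_measurable borel"
  shows "(\<integral>\<^sup>+x. h (frac_part (x + a)) \<partial>tor) = (\<integral>\<^sup>+x. h x \<partial>tor)"
proof -
  define g where "g x = h (frac_part x)" for x
  have [measurable]: "g \<in> borel_measurable borel" unfolding g_def by measurable
  have gshift: "g (x + freq \<xi>) = g x" for x \<xi> by (simp add: g_def frac_part_shift)
  let ?T = "\<lambda>x. indicator torus x :: ennreal"
  let ?cs = "count_space (UNIV :: (int ^ 'n) set)"
  interpret cs: sigma_finite_measure ?cs by (rule sigma_finite_measure_count_space)
  interpret ps: pair_sigma_finite ?cs "lborel :: (real ^ 'n) measure" ..
  have one: "(\<integral>\<^sup>+\<xi>. ?T (x - freq \<xi>) \<partial>?cs) = 1" for x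
  proof -
    have "(\<integral>\<^sup>+\<xi>. ?T (x - freq \<xi>) \<partial>?cs) = (\<integral>\<^sup>+\<xi>. indicator {floor_vec x} \<xi> \<partial>?cs)"
      by (intro nn_integral_cong) (auto simp: torus_minus_freq_iff indicator_def)
    also have "\<dots> = 1" by simp
    finally show ?thesis .
  qed
  have m1: "(\<lambda>(\<xi>, x). F x * ?T (x - freq \<xi> + b)) \<in> borel_measurable (?cs \<Otimes>\<^sub>M lborel)"
    if [measurable]: "F \<in> borel_measurable borel" for F b
    by (rule measurable_pair_measure_countable1) (auto simp: case_prod_beta)
  have key: "(\<integral>\<^sup>+x. F x \<partial>lborel) = (\<integral>\<^sup>+\<xi>. \<integral>\<^sup>+x. F x * ?T (x - freq \<xi>) \<partial>lborel \<partial>?cs)"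
    if [measurable]: "F \<in> borel_measurable borel" for F
  proof -
    have "(\<integral>\<^sup>+x. F x \<partial>lborel) = (\<integral>\<^sup>+x. \<integral>\<^sup>+\<xi>. F x * ?T (x - freq \<xi>) \<partial>?cs \<partial>lborel)"
      by (subst nn_integral_cmult) (auto simp: one)
    also have "\<dots> = (\<integral>\<^sup>+\<xi>. \<integral>\<^sup>+x. F x * ?T (x - freq \<xi>) \<partial>lborel \<partial>?cs)"
      by (rule ps.Fubini') (use m1[OF that, of 0] in simp)
    finally show ?thesis .
  qed
  have "(\<integral>\<^sup>+x. g (x + a) \<partial>tor) = (\<integral>\<^sup>+x. g (x + a) * ?T x \<partial>lborel)"
    unfolding tor_def by (subst nn_integral_restrict_space) auto
  also have "\<dots> = (\<integral>\<^sup>+x. g x * ?T (x - a) \<partial>lborel)"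
    using nn_integral_lborel_translate[of "\<lambda>x. g x * ?T (x - a)" a] by simp
  also have "\<dots> = (\<integral>\<^sup>+\<xi>. \<integral>\<^sup>+x. g x * ?T (x - a) * ?T (x - freq \<xi>) \<partial>lborel \<partial>?cs)"
    by (rule key) measurable
  also have "\<dots> = (\<integral>\<^sup>+\<xi>. \<integral>\<^sup>+x. g x * ?T x * ?T (x - a + freq \<xi>) \<partial>lborel \<partial>?cs)"
  proof (rule nn_integral_cong)
    fix \<xi>
    show "(\<integral>\<^sup>+x. g x * ?T (x - a) * ?T (x - freq \<xi>) \<partial>lborel) = (\<integral>\<^sup>+x. g x * ?T x * ?T (x - a + freq \<xi>) \<partial>lborel)"
      using nn_integral_lborel_translate[of "\<lambda>x. g x * ?T (x - a) * ?T (x - freq \<xi>)" "freq \<xi>"]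
      by (simp add: gshift mult_ac algebra_simps)
  qed
  also have "\<dots> = (\<integral>\<^sup>+\<xi>. \<integral>\<^sup>+x. g x * ?T x * ?T (x - freq \<xi> - a) \<partial>lborel \<partial>?cs)"
    using nn_integral_bij_count_space[of uminus UNIV UNIV "\<lambda>\<xi>. \<integral>\<^sup>+x. g x * ?T x * ?T (x - freq \<xi> - a) \<partial>lborel"]
    by (simp add: freq_uminus bij_uminus algebra_simps)
  also have "\<dots> = (\<integral>\<^sup>+x. \<integral>\<^sup>+\<xi>. g x * ?T x * ?T (x - freq \<xi> - a) \<partial>?cs \<partial>lborel)"
    by (rule ps.Fubini'[symmetric]) (use m1[of "\<lambda>x. g x * ?T x" "-a"] in simp)
  also have "\<dots> = (\<integral>\<^sup>+x. g x * ?T x \<partial>lborel)"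
  proof (intro nn_integral_cong)
    fix x
    have "(\<integral>\<^sup>+\<xi>. g x * ?T x * ?T (x - freq \<xi> - a) \<partial>?cs) = g x * ?T x * (\<integral>\<^sup>+\<xi>. ?T (x - a - freq \<xi>) \<partial>?cs)"
      by (subst nn_integral_cmult) (auto simp: algebra_simps)
    then show "(\<integral>\<^sup>+\<xi>. g x * ?T x * ?T (x - freq \<xi> - a) \<partial>?cs) = g x * ?T x" by (simp add: one)
  qed
  also have "\<dots> = (\<integral>\<^sup>+x. g x \<partial>tor)"
    unfolding tor_def by (subst nn_integral_restrict_space) auto
  also have "\<dots> = (\<integral>\<^sup>+x. h x \<partial>tor)"
    by (intro nn_integral_cong) (simp add: g_def frac_part_id)
  finally show ?thesis by (simp add: g_def)
qed

text \<open>Stated as an identity of image measures, the invariance passes from nonnegative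
  integrands to Bochner integrals of vector-valued functions.\<close>

lemma distr_tor_frac_part: "distr tor tor (\<lambda>x. frac_part (x + a)) = tor"
proof (rule measure_eqI)
  have m: "(\<lambda>x. frac_part (x + a)) \<in> measurable tor tor"
    unfolding tor_def by (intro measurable_restrict_space3) (auto simp: measurable_restrict_space2_iff)
  fix A assume "A \<in> sets (distr tor tor (\<lambda>x. frac_part (x + a)))"
  then have A: "A \<in> sets tor" by simp
  then have A': "A \<in> sets borel" unfolding sets_tor
    by (subst (asm) sets_restrict_space_iff) auto
  have "emeasure (distr tor tor (\<lambda>x. frac_part (x + a))) A
      = (\<integral>\<^sup>+x. indicator A x \<partial>distr tor tor (\<lambda>x. frac_part (x + a)))" using A by simp
  also have "\<dots> = (\<integral>\<^sup>+x. indicator A (frac_part (x + a)) \<partial>tor)"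
    by (rule nn_integral_distr[OF m]) (use A in simp)
  also have "\<dots> = (\<integral>\<^sup>+x. indicator A x \<partial>tor)" by (rule nn_integral_tor_frac_part) (use A' in simp)
  also have "\<dots> = emeasure tor A" using A by simp
  finally show "emeasure (distr tor tor (\<lambda>x. frac_part (x + a))) A = emeasure tor A" .
qed simp

lemma shift_freq:
  assumes "\<And>x i. g (x + axis i 1) = g x"
  shows "g (x + freq \<xi>) = g (x :: real ^ 'n::finite)"
proof -
  have nat: "g (x + axis i (real k)) = g x" for x i k
  proof (induction k arbitrary: x)
    case (Suc k)
    have "x + axis i (real (Suc k)) = (x + axis i (real k)) + axis i 1"
      by (simp add: vec_eq_iff axis_def)
    then show ?case using Suc assms by metis
  qed (simp add: axis_def zero_vec_def[symmetric])
  have int: "g (x + axis i (of_int k)) = g x" for x i k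
  proof (cases "k \<ge> 0")
    case True then show ?thesis using nat[of x i "nat k"] by simp
  next
    case False
    have h: "x + axis i (of_int k) + axis i (real (nat (- k))) = x"
      using False by (simp add: vec_eq_iff axis_def)
    show ?thesis using nat[of "x + axis i (of_int k)" i "nat (- k)"] unfolding h by simp
  qed
  have "g (x + (\<Sum>i\<in>S. axis i (of_int (\<xi> $ i)))) = g x" if "finite S" for S
    using that
  proof (induction S)
    case (insert i S)
    have "x + (\<Sum>i\<in>insert i S. axis i (of_int (\<xi> $ i)))
       = (x + (\<Sum>i\<in>S. axis i (of_int (\<xi> $ i)))) + axis i (of_int (\<xi> $ i))"
      using insert by (simp add: algebra_simps)
    then show ?case using int insert.IH by metis
  qed simp
  from this[of UNIV] have "g (x + (\<Sum>i\<in>UNIV. axis i (of_int (\<xi> $ i)))) = g x" by simp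
  moreover have "(\<Sum>i\<in>UNIV. axis i (of_int (\<xi> $ i))) = freq \<xi>"
    by (simp add: vec_eq_iff axis_def sum.If_cases)
  ultimately show ?thesis by simp
qed

lemma shift_frac_part:
  assumes "\<And>x i. g (x + axis i 1) = g x"
  shows "g (frac_part x) = g (x :: real ^ 'n::finite)"
  using shift_freq[of g x "- floor_vec x"] assms by (simp add: frac_part_eq freq_uminus)

lemma translate_tor:
  fixes g :: "real ^ 'n::finite \<Rightarrow> 'b::{banach, second_countable_topology}"
  assumes g: "g \<in> borel_measurable borel" and p: "\<And>x i. g (x + axis i 1) = g x"
  shows integral_tor_translate: "(LINT x|tor. g (x + a)) = (LINT x|tor. g x)"
    and integrable_tor_translate: "integrable tor (\<lambda>x. g (x + a)) \<longleftrightarrow> integrable tor g"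
proof -
  have m: "(\<lambda>x. frac_part (x + a)) \<in> measurable tor tor"
    unfolding tor_def by (intro measurable_restrict_space3) (auto simp: measurable_restrict_space2_iff)
  have eq: "(\<lambda>x. g (frac_part (x + a))) = (\<lambda>x. g (x + a))" using shift_frac_part[of g] p by auto
  have g': "g \<in> borel_measurable tor" using g by (rule measurable_tor)
  show "(LINT x|tor. g (x + a)) = (LINT x|tor. g x)"
    using integral_distr[OF m g'] by (simp add: distr_tor_frac_part eq)
  show "integrable tor (\<lambda>x. g (x + a)) \<longleftrightarrow> integrable tor g"
    using integrable_distr_eq[OF m g'] by (simp add: distr_tor_frac_part eq)
qed

lemma nn_integral_tor_translate:
  fixes g :: "real ^ 'n::finite \<Rightarrow> ennreal"
  assumes g: "g \<in> borel_measurable borel" and p: "\<And>x i. g (x + axis i 1) = g x"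
  shows "(\<integral>\<^sup>+x. g (x + a) \<partial>tor) = (\<integral>\<^sup>+x. g x \<partial>tor)"
  using nn_integral_tor_frac_part[OF g, of a] shift_frac_part[of g] p by simp

section \<open>Characters\<close>

definition ee :: "int ^ 'n \<Rightarrow> real ^ 'n::finite \<Rightarrow> complex" where
  "ee \<xi> x = cis (2 * pi * (x \<bullet> freq \<xi>))"

lemma ee_0 [simp]: "ee 0 x = 1" "ee \<xi> 0 = 1" by (simp_all add: ee_def)
lemma ee_add: "ee (\<xi> + \<eta>) x = ee \<xi> x * ee \<eta> x"
  by (simp add: ee_def freq_add cis_mult inner_add_right algebra_simps)
lemma ee_uminus: "ee (- \<xi>) x = cnj (ee \<xi> x)"
  by (simp add: ee_def freq_uminus cis_cnj)
lemma ee_diff: "ee (\<xi> - \<eta>) x = ee \<xi> x * cnj (ee \<eta> x)"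
  using ee_add[of \<xi> "- \<eta>"] by (simp add: ee_uminus)
lemma ee_plus: "ee \<xi> (x + y) = ee \<xi> x * ee \<xi> y"
  by (simp add: ee_def cis_mult inner_add_left algebra_simps)
lemma norm_ee [simp]: "cmod (ee \<xi> x) = 1" by (simp add: ee_def)
lemma ee_minus_arg: "ee \<xi> (- x) = cnj (ee \<xi> x)" by (simp add: ee_def cis_cnj)
lemma ee_mult_cnj [simp]: "ee \<xi> x * cnj (ee \<xi> x) = 1" "cnj (ee \<xi> x) * ee \<xi> x = 1"
  by (simp_all add: complex_norm_square[symmetric] mult.commute)
lemma ee_axis: "ee \<xi> (axis j t) = cis (2 * pi * t * real_of_int (\<xi> $ j))"
  by (simp add: ee_def inner_axis' mult_ac)
lemma ee_periodic [simp]: "ee \<xi> (x + axis i 1) = ee \<xi> x"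
  by (simp add: ee_plus ee_axis cis_multiple_2pi)
lemma continuous_ee [continuous_intros]: "continuous_on S (ee \<xi>)"
  unfolding ee_def by (intro continuous_intros)
lemma measurable_ee [measurable]: "ee \<xi> \<in> borel_measurable borel"
  by (intro borel_measurable_continuous_onI continuous_ee)

lemma measurable_cnj [measurable (raw)]:
  "f \<in> borel_measurable M \<Longrightarrow> (\<lambda>x. cnj (f x)) \<in> borel_measurable M"
  by (rule borel_measurable_continuous_on[OF continuous_on_cnj[OF continuous_on_id]])

lemma integrable_tor_bounded:
  fixes f :: "real ^ 'n::finite \<Rightarrow> 'b::{banach, second_countable_topology}"
  assumes "f \<in> borel_measurable borel" "\<And>x. norm (f x) \<le> B"
  shows "integrable tor f"
  by (rule tor.integrable_const_bound[where B = B]) (use assms measurable_tor in auto)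

text \<open>Translation by half a period in a direction with \<open>\<xi> $ j \<noteq> 0\<close>
  changes the sign of the character, so the invariant integral equals its own negative.\<close>

lemma integral_ee:
  fixes \<xi> :: "int ^ 'n::finite"
  shows "(LINT x|tor. ee \<xi> x) = (if \<xi> = 0 then 1 else 0)"
proof (cases "\<xi> = 0")
  case True then show ?thesis by (simp add: tor.prob_space[simplified])
next
  case False
  then obtain j where j: "\<xi> $ j \<noteq> 0" by (auto simp: vec_eq_iff)
  define a where "a = (axis j (1 / (2 * real_of_int (\<xi> $ j))) :: real ^ 'n)"
  have a: "ee \<xi> a = -1" using j by (simp add: a_def ee_axis)
  have "(LINT x|tor. ee \<xi> x) = (LINT x|tor. ee \<xi> (x + a))"
    by (rule integral_tor_translate[symmetric]) auto
  also have "\<dots> = - (LINT x|tor. ee \<xi> x)" by (simp add: ee_plus a)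
  finally show ?thesis using False by simp
qed

definition fc :: "(real ^ 'n::finite \<Rightarrow> real) \<Rightarrow> int ^ 'n \<Rightarrow> complex" where
  "fc g \<xi> = (LINT x|tor. complex_of_real (g x) * cnj (ee \<xi> x))"

text \<open>Taking the real part makes every choice of coefficients admissible. Cosine and sine are
  the cases of one frequency with coefficient 1 and \<open>- \<i>\<close>.\<close>

definition rtp :: "(int ^ 'n) set \<Rightarrow> (int ^ 'n \<Rightarrow> complex) \<Rightarrow> real ^ 'n::finite \<Rightarrow> real" where
  "rtp A c x = Re (\<Sum>\<xi>\<in>A. c \<xi> * ee \<xi> x)"

lemma rtp_periodic: "rtp A c (x + axis i 1) = rtp A c x"
  by (simp add: rtp_def)

lemma continuous_rtp [continuous_intros]: "continuous_on S (rtp A c)"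
  unfolding rtp_def by (intro continuous_intros)

lemma measurable_rtp [measurable]: "rtp A c \<in> borel_measurable borel"
  by (intro borel_measurable_continuous_onI continuous_rtp)

lemma rtp_bound: "\<bar>rtp A c x\<bar> \<le> (\<Sum>\<xi>\<in>A. cmod (c \<xi>))"
proof -
  have "\<bar>rtp A c x\<bar> \<le> cmod (\<Sum>\<xi>\<in>A. c \<xi> * ee \<xi> x)" unfolding rtp_def by (rule abs_Re_le_cmod)
  also have "\<dots> \<le> (\<Sum>\<xi>\<in>A. cmod (c \<xi> * ee \<xi> x))" by (rule norm_sum)
  finally show ?thesis by (simp add: norm_mult)
qed

lemma integrable_fc:
  assumes "integrable tor g" "g \<in> borel_measurable borel"
  shows "integrable tor (\<lambda>x. complex_of_real (g x) * cnj (ee \<xi> x))"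
proof (rule Bochner_Integration.integrable_bound[OF assms(1)])
  have [measurable]: "g \<in> borel_measurable borel" by fact
  show "(\<lambda>x. complex_of_real (g x) * cnj (ee \<xi> x)) \<in> borel_measurable tor"
    by (rule measurable_tor) measurable
qed (auto simp: norm_mult)

lemma fc_add:
  assumes "integrable tor g" "g \<in> borel_measurable borel" "integrable tor h" "h \<in> borel_measurable borel"
  shows "fc (\<lambda>x. g x + h x) \<xi> = fc g \<xi> + fc h \<xi>"
  unfolding fc_def using integrable_fc[OF assms(1,2)] integrable_fc[OF assms(3,4)]
  by (simp add: ring_distribs)

lemma fc_cmult: "fc (\<lambda>x. r * g x) \<xi> = of_real r * fc g \<xi>"
  unfolding fc_def by (simp add: mult.assoc)

lemma fc_uminus: "fc g (- \<xi>) = cnj (fc g \<xi>)"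
  unfolding fc_def by (subst Bochner_Integration.integral_cnj[symmetric]) (simp add: ee_uminus)

lemma norm_fc_le: "cmod (fc g \<xi>) \<le> (LINT x|tor. \<bar>g x\<bar>)"
proof -
  have "cmod (fc g \<xi>) \<le> (LINT x|tor. norm (complex_of_real (g x) * cnj (ee \<xi> x)))"
    unfolding fc_def by (rule integral_norm_bound)
  then show ?thesis by (simp add: norm_mult)
qed

lemma fourier_distr_of:
  assumes g: "g \<in> borel_measurable borel" "integrable tor g"
  shows "fourier (distr_of g) \<xi> = fc g \<xi>"
proof (rule complex_eqI)
  have [measurable]: "g \<in> borel_measurable borel" by fact
  show "Re (fourier (distr_of g) \<xi>) = Re (fc g \<xi>)"
    unfolding fc_def integral_Re[OF integrable_fc[OF g(2,1)], symmetric]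
    by (simp add: fourier_def distr_of_def set_integral_torus ee_def)
  show "Im (fourier (distr_of g) \<xi>) = Im (fc g \<xi>)"
    unfolding fc_def integral_Im[OF integrable_fc[OF g(2,1)], symmetric]
    by (simp add: fourier_def distr_of_def set_integral_torus ee_def)
qed

text \<open>A function of the form \<open>rtp\<close> need not have conjugate symmetric coefficients.\<close>

lemma fc_rtp:
  assumes "finite A"
  shows "fc (rtp A c) \<xi> = ((if \<xi> \<in> A then c \<xi> else 0) + cnj (if - \<xi> \<in> A then c (- \<xi>) else 0)) / 2"
proof -
  have i: "integrable tor (\<lambda>x. c * ee \<eta> x)" for \<eta> :: "int ^ 'a" and c
    by (rule integrable_tor_bounded[where B = "cmod c"]) (auto simp: norm_mult)
  have of_Re: "complex_of_real (Re z) = (z + cnj z) / 2" for z by (simp add: complex_eq_iff)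
  have "complex_of_real (rtp A c x) * cnj (ee \<xi> x)
      = ((\<Sum>\<eta>\<in>A. c \<eta> * ee (\<eta> - \<xi>) x) + (\<Sum>\<eta>\<in>A. cnj (c \<eta>) * ee (- \<eta> - \<xi>) x)) / 2" for x
  proof -
    have "complex_of_real (rtp A c x) = ((\<Sum>\<eta>\<in>A. c \<eta> * ee \<eta> x) + cnj (\<Sum>\<eta>\<in>A. c \<eta> * ee \<eta> x)) / 2"
      unfolding rtp_def by (rule of_Re)
    then show ?thesis
      by (simp only:) (simp add: ee_diff ee_uminus sum_distrib_right distrib_right mult.assoc)
  qed
  then have "fc (rtp A c) \<xi> = (LINT x|tor. ((\<Sum>\<eta>\<in>A. c \<eta> * ee (\<eta> - \<xi>) x) + (\<Sum>\<eta>\<in>A. cnj (c \<eta>) * ee (- \<eta> - \<xi>) x)) / 2)"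
    unfolding fc_def by (simp only:)
  also have "\<dots> = ((\<Sum>\<eta>\<in>A. c \<eta> * (if \<eta> - \<xi> = 0 then 1 else 0)) +
       (\<Sum>\<eta>\<in>A. cnj (c \<eta>) * (if - \<eta> - \<xi> = 0 then 1 else 0))) / 2"
    by (simp add: Bochner_Integration.integral_sum i integral_ee)
  also have "(\<Sum>\<eta>\<in>A. c \<eta> * (if \<eta> - \<xi> = 0 then 1 else 0)) = (if \<xi> \<in> A then c \<xi> else 0)"
    using assms by (simp add: if_distrib cong: if_cong)
  also have "(\<Sum>\<eta>\<in>A. cnj (c \<eta>) * (if - \<eta> - \<xi> = 0 then 1 else 0)) = (\<Sum>\<eta>\<in>A. if \<eta> = - \<xi> then cnj (c \<eta>) else 0)"
  proof -
    have "- \<eta> - \<xi> = 0 \<longleftrightarrow> \<eta> = - \<xi>" for \<eta>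
      by (metis add.inverse_inverse eq_iff_diff_eq_0)
    then show ?thesis by (intro sum.cong) auto
  qed
  also have "\<dots> = cnj (if - \<xi> \<in> A then c (- \<xi>) else 0)"
    using assms by simp
  finally show ?thesis .
qed

section \<open>Lattice sums\<close>

text \<open>Cubes rather than balls: product majorants can be summed over them coordinate by
  coordinate (\<open>sum_lorentz\<close>), and they are symmetric under negation, which keeps
  partial sums of Hermitian coefficients real.\<close>

definition Lam :: "nat \<Rightarrow> (int ^ 'n::finite) set" where
  "Lam N = {\<xi>. \<forall>i. \<bar>\<xi> $ i\<bar> \<le> int N}"

lemma Lam_eq: "Lam N = vec_lambda ` (PiE UNIV (\<lambda>_. {- int N..int N}))"
proof -
  have "\<xi> \<in> vec_lambda ` (PiE UNIV (\<lambda>_. {- int N..int N}))" if "\<xi> \<in> Lam N" for \<xi> :: "int ^ 'a"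
    by (rule image_eqI[of _ _ "\<lambda>i. \<xi> $ i"]) (use that in \<open>auto simp: Lam_def abs_le_iff\<close>, (smt (verit))+)
  then show ?thesis by (auto simp: Lam_def abs_le_iff PiE_def Pi_def) (smt (verit))+
qed

lemma finite_Lam [simp]: "finite (Lam N)"
  unfolding Lam_eq by (intro finite_imageI finite_PiE) auto

lemma card_Lam: "card (Lam N :: (int ^ 'n::finite) set) \<le> (2 * N + 1) ^ CARD('n)"
proof -
  have "card (Lam N :: (int ^ 'n) set) \<le> card (PiE (UNIV :: 'n set) (\<lambda>_. {- int N..int N}))"
    unfolding Lam_eq by (intro card_image_le finite_PiE) auto
  also have "\<dots> = nat (2 * int N + 1) ^ CARD('n)" by (simp add: card_PiE)
  also have "nat (2 * int N + 1) = 2 * N + 1" by simp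
  finally show ?thesis .
qed

lemma Lam_mono: "M \<le> N \<Longrightarrow> Lam M \<subseteq> Lam N"
  by (auto simp: Lam_def intro: order_trans)

lemma Lam_uminus [simp]: "- \<xi> \<in> Lam N \<longleftrightarrow> \<xi> \<in> Lam N"
  by (simp add: Lam_def)

lemma ex_Lam: "\<exists>N. \<xi> \<in> Lam N"
proof
  have "\<bar>\<xi> $ i\<bar> \<le> (\<Sum>i\<in>UNIV. \<bar>\<xi> $ i\<bar>)" for i by (rule member_le_sum) auto
  then show "\<xi> \<in> Lam (nat (\<Sum>i\<in>UNIV. \<bar>\<xi> $ i\<bar>))" by (simp add: Lam_def sum_nonneg)
qed

lemma filterlim_Lam: "filterlim Lam (finite_subsets_at_top UNIV) sequentially"
  unfolding filterlim_finite_subsets_at_top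
proof (intro allI impI)
  fix X :: "(int ^ 'n::finite) set" assume X: "finite X \<and> X \<subseteq> UNIV"
  obtain n where n: "\<And>\<xi> :: int ^ 'n. \<xi> \<in> Lam (n \<xi>)" using ex_Lam by metis
  have "X \<subseteq> Lam N" if "N \<ge> (\<Sum>\<xi>\<in>X. n \<xi>)" for N
  proof
    fix \<xi> assume "\<xi> \<in> X"
    then have "n \<xi> \<le> (\<Sum>\<xi>\<in>X. n \<xi>)" using X by (intro member_le_sum) auto
    then show "\<xi> \<in> Lam N" using n Lam_mono[of "n \<xi>" N] that by auto
  qed
  then show "\<forall>\<^sub>F N in sequentially. finite (Lam N) \<and> X \<subseteq> Lam N \<and> Lam N \<subseteq> UNIV"
    by (auto simp: eventually_sequentially)
qed

lemma finite_subset_Lam: "finite X \<Longrightarrow> \<exists>N. X \<subseteq> Lam N"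
proof -
  assume "finite X"
  with filterlim_Lam[unfolded filterlim_finite_subsets_at_top, rule_format, of X]
  have "\<forall>\<^sub>F N in sequentially. finite (Lam N) \<and> X \<subseteq> Lam N \<and> Lam N \<subseteq> UNIV" by simp
  then show ?thesis by (auto simp: eventually_sequentially)
qed

lemma infsum_Lam:
  assumes "f summable_on UNIV"
  shows "(\<lambda>N. \<Sum>\<xi>\<in>Lam N. f \<xi>) \<longlonglongrightarrow> (\<Sum>\<^sub>\<infinity>\<xi>. f \<xi>)"
proof -
  have "(sum f \<longlongrightarrow> (\<Sum>\<^sub>\<infinity>\<xi>. f \<xi>)) (finite_subsets_at_top UNIV)"
    using assms by (simp add: has_sum_def[symmetric])
  then show ?thesis using filterlim_compose[OF _ filterlim_Lam] by blast
qed

lemma summable_Lam_bound: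
  fixes f :: "int ^ 'n::finite \<Rightarrow> real"
  assumes "\<And>\<xi>. f \<xi> \<ge> 0" "\<And>N. (\<Sum>\<xi>\<in>Lam N. f \<xi>) \<le> B"
  shows "f summable_on UNIV" "(\<Sum>\<^sub>\<infinity>\<xi>. f \<xi>) \<le> B"
proof -
  have b: "sum f X \<le> B" if fX: "finite X" for X
  proof -
    obtain N where "X \<subseteq> Lam N" using finite_subset_Lam[OF fX] by blast
    then have "sum f X \<le> sum f (Lam N)" by (intro sum_mono2) (auto simp: assms)
    then show ?thesis using assms(2)[of N] by simp
  qed
  show "f summable_on UNIV"
    by (rule nonneg_bdd_above_summable_on) (auto simp: assms intro!: bdd_aboveI2[where M = B] b)
  then show "(\<Sum>\<^sub>\<infinity>\<xi>. f \<xi>) \<le> B"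
    by (rule infsum_le_finite_sums) (use b in auto)
qed

text \<open>The integral comparison for the decreasing function \<open>1 / (1 + z^2)\<close>, in the
  form of the mean value theorem for arctan, so that the right-hand sides telescope.\<close>

lemma arctan_summand:
  fixes t :: real assumes "t > 0"
  shows "1 / (1 + (t * real (Suc k))\<^sup>2) \<le> (arctan (t * real (Suc k)) - arctan (t * real k)) / t"
proof -
  have "\<exists>z>t * real k. z < t * real (Suc k) \<and>
      arctan (t * real (Suc k)) - arctan (t * real k) = (t * real (Suc k) - t * real k) * inverse (1 + z\<^sup>2)"
    by (rule MVT2) (use assms in \<open>auto intro!: DERIV_arctan\<close>)
  then obtain z where z: "z > t * real k" "z < t * real (Suc k)"
    "arctan (t * real (Suc k)) - arctan (t * real k) = t * inverse (1 + z\<^sup>2)"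
    by (auto simp: algebra_simps)
  have "0 \<le> t * real k" using assms by simp
  then have "z\<^sup>2 \<le> (t * real (Suc k))\<^sup>2" using z by (intro power_mono) auto
  then have "inverse (1 + (t * real (Suc k))\<^sup>2) \<le> inverse (1 + z\<^sup>2)"
    by (intro le_imp_inverse_le add_left_mono) (auto intro: add_pos_nonneg)
  moreover have "(arctan (t * real (Suc k)) - arctan (t * real k)) / t = inverse (1 + z\<^sup>2)"
    unfolding z(3) using assms by simp
  ultimately show ?thesis by (simp only: inverse_eq_divide)
qed

text \<open>The term at 0 gives 1, and each half-line gives at most
  \<open>(pi / 2) / t\<close>.\<close>

lemma sum_lorentz_1d:
  fixes t :: real assumes t: "t > 0"
  shows "(\<Sum>k\<in>{- int N..int N}. 1 / (1 + (t * real_of_int k)\<^sup>2)) \<le> 1 + pi / t"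
proof -
  let ?f = "\<lambda>k::int. 1 / (1 + (t * real_of_int k)\<^sup>2)"
  have pos: "(\<Sum>k<N. 1 / (1 + (t * real (Suc k))\<^sup>2)) \<le> pi / (2 * t)"
  proof -
    have "(\<Sum>k<N. 1 / (1 + (t * real (Suc k))\<^sup>2)) \<le> (\<Sum>k<N. (arctan (t * real (Suc k)) - arctan (t * real k)) / t)"
      by (intro sum_mono arctan_summand t)
    also have "\<dots> = arctan (t * real N) / t"
      by (subst sum_divide_distrib[symmetric], subst sum_lessThan_telescope) simp
    also have "\<dots> \<le> (pi / 2) / t" using arctan_ubound[of "t * real N"] t by (intro divide_right_mono) auto
    finally show ?thesis by simp
  qed
  have "{- int N..int N} = {0} \<union> (\<lambda>k. int (Suc k)) ` {..<N} \<union> (\<lambda>k. - int (Suc k)) ` {..<N}"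
  proof (intro equalityI subsetI)
    fix k assume k: "k \<in> {- int N..int N}"
    consider "k = 0" | "k > 0" | "k < 0" by linarith
    then show "k \<in> {0} \<union> (\<lambda>k. int (Suc k)) ` {..<N} \<union> (\<lambda>k. - int (Suc k)) ` {..<N}"
    proof cases
      case 2 then have "k = int (Suc (nat k - 1))" "nat k - 1 < N" using k by auto
      then show ?thesis by blast
    next
      case 3 then have "k = - int (Suc (nat (-k) - 1))" "nat (-k) - 1 < N" using k by auto
      then show ?thesis by blast
    qed auto
  qed auto
  moreover have "({0} \<union> (\<lambda>k. int (Suc k)) ` {..<N}) \<inter> (\<lambda>k. - int (Suc k)) ` {..<N} = {}" by auto
  ultimately have "sum ?f {- int N..int N} = sum ?f ({0} \<union> (\<lambda>k. int (Suc k)) ` {..<N}) + sum ?f ((\<lambda>k. - int (Suc k)) ` {..<N})"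
    by (simp only: sum.union_disjoint finite_UnI finite_imageI finite_lessThan finite.intros)
  also have "sum ?f ({0} \<union> (\<lambda>k. int (Suc k)) ` {..<N}) = 1 + (\<Sum>k<N. 1 / (1 + (t * real (Suc k))\<^sup>2))"
    by (subst sum.union_disjoint) (auto simp: sum.reindex inj_on_def)
  also have "sum ?f ((\<lambda>k. - int (Suc k)) ` {..<N}) = (\<Sum>k<N. 1 / (1 + (t * real (Suc k))\<^sup>2))"
  proof (subst sum.reindex)
    show "inj_on (\<lambda>k. - int (Suc k)) {..<N}" by (simp add: inj_on_def)
    have "(t * real_of_int (- int (Suc k)))\<^sup>2 = (t * real (Suc k))\<^sup>2" for k
      by (simp add: power_mult_distrib power2_eq_square algebra_simps)
    then show "sum (?f \<circ> (\<lambda>k. - int (Suc k))) {..<N} = (\<Sum>k<N. 1 / (1 + (t * real (Suc k))\<^sup>2))"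
      by (simp only: o_def)
  qed
  also have "1 + (\<Sum>k<N. 1 / (1 + (t * real (Suc k))\<^sup>2)) + (\<Sum>k<N. 1 / (1 + (t * real (Suc k))\<^sup>2)) \<le> 1 + pi / t"
    using pos by simp
  finally show ?thesis .
qed

text \<open>For small t the bound is of order \<open>t^(-n)\<close>, the number of frequencies below
  \<open>1 / t\<close>. The same majorant serves for the decay of test functions and for the
  Gaussian multipliers.\<close>

lemma sum_lorentz:
  fixes t :: real assumes t: "t > 0"
  shows "(\<Sum>\<xi>\<in>(Lam N :: (int ^ 'n::finite) set). \<Prod>i\<in>UNIV. 1 / (1 + (t * real_of_int (\<xi> $ i))\<^sup>2)) \<le> (1 + pi / t) ^ CARD('n)"
proof -
  let ?P = "PiE (UNIV :: 'n set) (\<lambda>_. {- int N..int N})"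
  define g where "g k = 1 / (1 + (t * real_of_int k)\<^sup>2)" for k
  have g0: "g k \<ge> 0" for k by (simp add: g_def)
  have inj: "inj_on vec_lambda ?P" by (rule inj_onI) (metis vec_lambda_inverse UNIV_I)
  have "(\<Sum>\<xi>\<in>(Lam N :: (int ^ 'n) set). \<Prod>i\<in>UNIV. g (\<xi> $ i)) = (\<Sum>x\<in>?P. \<Prod>i\<in>UNIV. g (x i))"
    unfolding Lam_eq sum.reindex[OF inj] o_def vec_lambda_beta ..
  also have "\<dots> = (\<Prod>i\<in>(UNIV :: 'n set). \<Sum>k\<in>{- int N..int N}. g k)"
    by (rule prod_sum_PiE[symmetric]) auto
  also have "\<dots> = (\<Sum>k\<in>{- int N..int N}. g k) ^ CARD('n)" by (rule prod_constant)
  also have "\<dots> \<le> (1 + pi / t) ^ CARD('n)"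
    using sum_lorentz_1d[OF t, of N] unfolding g_def[symmetric] by (intro power_mono sum_nonneg g0)
  finally show ?thesis unfolding g_def .
qed

section \<open>Density of trigonometric polynomials\<close>

definition trig :: "(real ^ 'n::finite \<Rightarrow> real) \<Rightarrow> bool" where
  "trig P \<longleftrightarrow> (\<exists>A c. finite A \<and> P = rtp A c)"

lemma trig_rtp: "finite A \<Longrightarrow> trig (rtp A c)"
  by (auto simp: trig_def)

lemma trig_add:
  assumes "trig P" "trig Q" shows "trig (\<lambda>x. P x + Q x)"
proof -
  obtain A c B d where AB: "finite A" "finite B" "P = rtp A c" "Q = rtp B d"
    using assms by (auto simp: trig_def)
  have "P x + Q x = rtp (A \<union> B) (\<lambda>\<xi>. (if \<xi> \<in> A then c \<xi> else 0) + (if \<xi> \<in> B then d \<xi> else 0)) x" for x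
  proof -
    have "(\<Sum>\<xi>\<in>A. c \<xi> * ee \<xi> x) = (\<Sum>\<xi>\<in>A \<union> B. (if \<xi> \<in> A then c \<xi> else 0) * ee \<xi> x)"
      using AB by (intro sum.mono_neutral_cong_left) auto
    moreover have "(\<Sum>\<xi>\<in>B. d \<xi> * ee \<xi> x) = (\<Sum>\<xi>\<in>A \<union> B. (if \<xi> \<in> B then d \<xi> else 0) * ee \<xi> x)"
      using AB by (intro sum.mono_neutral_cong_left) auto
    ultimately show ?thesis
      unfolding AB rtp_def by (simp add: distrib_right sum.distrib)
  qed
  then have eq: "(\<lambda>x. P x + Q x) = rtp (A \<union> B) (\<lambda>\<xi>. (if \<xi> \<in> A then c \<xi> else 0) + (if \<xi> \<in> B then d \<xi> else 0))"
    by (rule ext)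
  show ?thesis unfolding eq by (rule trig_rtp) (simp add: AB)
qed

lemma trig_0: "trig (\<lambda>x. 0)"
  unfolding trig_def by (intro exI[of _ "{}"]) (auto simp: rtp_def fun_eq_iff)

lemma trig_sum: "finite I \<Longrightarrow> (\<And>i. i \<in> I \<Longrightarrow> trig (P i)) \<Longrightarrow> trig (\<lambda>x. \<Sum>i\<in>I. P i x)"
  by (induction I rule: finite_induct) (auto intro: trig_0 trig_add)

lemma trig_single: "trig (\<lambda>x. Re (a * ee \<xi> x))"
  unfolding trig_def by (intro exI[of _ "{\<xi>}"] exI[of _ "\<lambda>_. a"]) (auto simp: rtp_def fun_eq_iff)

lemma trig_const: "trig (\<lambda>x. r)"
  using trig_single[of "of_real r" 0] by simp

lemma trig_mult:
  assumes "trig P" "trig Q" shows "trig (\<lambda>x. P x * Q x)"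
proof -
  obtain A c B d where AB: "finite A" "finite B" "P = rtp A c" "Q = rtp B d"
    using assms by (auto simp: trig_def)
  have "P x * Q x = (\<Sum>\<xi>\<in>A. \<Sum>\<eta>\<in>B. Re ((c \<xi> * d \<eta> / 2) * ee (\<xi> + \<eta>) x) + Re ((c \<xi> * cnj (d \<eta>) / 2) * ee (\<xi> - \<eta>) x))" for x
  proof -
    have "Re u * Re v = Re (u * v / 2) + Re (u * cnj v / 2)" for u v by (simp add: field_simps)
    then have "P x * Q x = (\<Sum>\<xi>\<in>A. \<Sum>\<eta>\<in>B. Re ((c \<xi> * ee \<xi> x) * (d \<eta> * ee \<eta> x) / 2)
        + Re ((c \<xi> * ee \<xi> x) * cnj (d \<eta> * ee \<eta> x) / 2))"
      unfolding AB rtp_def Re_sum sum_product by presburger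
    also have "\<dots> = (\<Sum>\<xi>\<in>A. \<Sum>\<eta>\<in>B. Re ((c \<xi> * d \<eta> / 2) * ee (\<xi> + \<eta>) x) + Re ((c \<xi> * cnj (d \<eta>) / 2) * ee (\<xi> - \<eta>) x))"
      by (intro sum.cong refl arg_cong2[where f = "(+)"] arg_cong[where f = Re])
        (simp_all add: ee_add ee_diff)
    finally show ?thesis .
  qed
  then have "(\<lambda>x. P x * Q x) = (\<lambda>x. \<Sum>\<xi>\<in>A. \<Sum>\<eta>\<in>B. Re ((c \<xi> * d \<eta> / 2) * ee (\<xi> + \<eta>) x) + Re ((c \<xi> * cnj (d \<eta>) / 2) * ee (\<xi> - \<eta>) x))"
    by (rule ext)
  then show ?thesis using AB by (simp only:) (intro trig_sum trig_add trig_single)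
qed

text \<open>The torus is realized as the compact set \<open>S\<close> of points with coordinates
  \<open>exp (2 pi i x_j)\<close>, to which Stone-Weierstrass applies: a periodic function descends
  to \<open>S\<close>, and the real and imaginary parts of the coordinates, which separate points,
  pull back to trigonometric polynomials.\<close>

lemma trig_dense:
  fixes \<phi> :: "real ^ 'n::finite \<Rightarrow> real"
  assumes per: "\<And>x i. \<phi> (x + axis i 1) = \<phi> x" and cont: "continuous_on UNIV \<phi>" and e: "e > 0"
  obtains P where "trig P" "\<And>x. \<bar>\<phi> x - P x\<bar> < e"
proof -
  define E where "E x = (\<chi> i. cis (2 * pi * (x $ i)) :: complex ^ 'n)" for x :: "real ^ 'n"
  define C where "C = cbox 0 (\<chi> i. 1 :: real ^ 'n)"
  define S where "S = E ` C"
  have "continuous_on X E" for X unfolding E_def by (intro continuous_intros continuous_on_vec_lambda)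
  then have contE: "continuous_on X E" for X .
  have E_shift: "E (x + freq \<xi>) = E x" for x \<xi>
    by (simp add: E_def vec_eq_iff distrib_left cis_mult[symmetric] cis_multiple_2pi)
  have E_frac: "E (frac_part x) = E x" for x
    using E_shift[of x "- floor_vec x"] by (simp add: frac_part_eq freq_uminus)
  have frac_C: "frac_part x \<in> C" for x :: "real ^ 'n"
    unfolding C_def mem_box_cart by (simp add: frac_part_def frac_ge_0 less_imp_le[OF frac_lt_1])
  have ES: "E x \<in> S" for x unfolding S_def using frac_C E_frac by (metis image_eqI)
  have E_eq: "\<exists>\<xi>. y = x + freq \<xi>" if "E x = E y" for x y
  proof -
    have "\<exists>n::int. y $ i - x $ i = n" for i
    proof -
      have "cis (2 * pi * (x $ i)) = cis (2 * pi * (y $ i))"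
        using that by (simp add: E_def vec_eq_iff)
      then have "cis (2 * pi * (y $ i) - 2 * pi * (x $ i)) = 1" by (simp add: cis_divide[symmetric])
      then have "cos (2 * pi * (y $ i - x $ i)) = 1"
        by (simp add: complex_eq_iff algebra_simps)
      then obtain n :: int where "2 * pi * (y $ i - x $ i) = n * 2 * pi" by (auto simp: cos_one_2pi_int)
      then show ?thesis by (intro exI[of _ n]) simp
    qed
    then obtain n :: "'n \<Rightarrow> int" where "\<And>i. y $ i - x $ i = n i" by metis
    then have "y = x + freq (\<chi> i. n i)" by (simp add: vec_eq_iff algebra_simps)
    then show ?thesis ..
  qed
  have "compact S" unfolding S_def C_def by (intro compact_continuous_image contE compact_cbox)
  define \<Phi> where "\<Phi> w = \<phi> (SOME x. E x = w)" for w
  have \<Phi>: "\<Phi> (E x) = \<phi> x" for x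
  proof -
    have "E (SOME y. E y = E x) = E x" by (rule someI) simp
    then obtain \<xi> where "x = (SOME y. E y = E x) + freq \<xi>" using E_eq by blast
    then show ?thesis unfolding \<Phi>_def using shift_freq[of \<phi>] per by metis
  qed
  \<comment> \<open>\<open>E\<close> maps the compact cube \<open>C\<close> onto \<open>S\<close>
    and is therefore a quotient map, so continuity of \<open>\<Phi>\<close> can be tested on the
    composition with \<open>E\<close>, which is \<open>\<phi>\<close>.\<close>
  have cont\<Phi>: "continuous_on S \<Phi>"
    unfolding continuous_on_open
  proof (intro allI impI)
    fix U assume "openin (top_of_set (\<Phi> ` S)) U"
    then obtain V where V: "open V" "U = \<Phi> ` S \<inter> V" by (auto simp: openin_open)
    have eq: "C \<inter> E -` (S \<inter> \<Phi> -` U) = C \<inter> \<phi> -` V" using ES by (auto simp: V \<Phi>)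
    have "openin (top_of_set C) (C \<inter> \<phi> -` V)"
      using cont V(1) continuous_on_subset[OF cont, of C] by (simp add: continuous_openin_preimage_gen)
    moreover have "openin (top_of_set C) (C \<inter> E -` (S \<inter> \<Phi> -` U)) = openin (top_of_set S) (S \<inter> \<Phi> -` U)"
      by (rule Abstract_Topology_2.continuous_imp_quotient_map) (auto simp: contE S_def C_def)
    ultimately show "openin (top_of_set S) (S \<inter> \<Phi> -` U)" by (simp only: eq)
  qed
  define R where "R = {F. continuous_on S F \<and> trig (\<lambda>x. F (E x))}"
  interpret function_ring_on R S
  proof unfold_locales
    show "compact S" by fact
    fix f assume "f \<in> R" then show "continuous_on S f" by (simp add: R_def)
  next
    fix f g assume "f \<in> R" "g \<in> R"
    then show "(\<lambda>x. f x + g x) \<in> R" "(\<lambda>x. f x * g x) \<in> R"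
      by (auto simp: R_def intro: continuous_intros trig_add trig_mult)
  next
    fix c show "(\<lambda>_. c) \<in> R" by (simp add: R_def trig_const)
  next
    fix x y assume xy: "x \<in> S" "y \<in> S" "x \<noteq> y"
    then obtain i where i: "x $ i \<noteq> y $ i" by (auto simp: vec_eq_iff)
    define \<xi> where "\<xi> = (\<chi> j. if j = i then (1::int) else 0)"
    have eE: "E z $ i = ee \<xi> z" for z
    proof -
      have "z \<bullet> freq \<xi> = z $ i"
        by (simp add: inner_vec_def \<xi>_def if_distrib cong: if_cong)
      then show ?thesis by (simp add: E_def ee_def)
    qed
    have cRe: "(\<lambda>w. Re (w $ i)) \<in> R"
      using trig_single[of 1 \<xi>] by (auto simp: R_def eE intro!: continuous_intros)
    have cIm: "(\<lambda>w. Im (w $ i)) \<in> R"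
      using trig_single[of "-\<i>" \<xi>] by (auto simp: R_def eE intro!: continuous_intros)
    from i have "Re (x $ i) \<noteq> Re (y $ i) \<or> Im (x $ i) \<noteq> Im (y $ i)" by (auto simp: complex_eq_iff)
    then show "\<exists>f\<in>R. f x \<noteq> f y" by (elim disjE) (rule bexI[OF _ cRe] bexI[OF _ cIm], assumption)+
  qed
  obtain F where F: "F \<in> R" "\<And>w. w \<in> S \<Longrightarrow> \<bar>\<Phi> w - F w\<bar> < e"
    using Stone_Weierstrass_basic[OF cont\<Phi> e] by blast
  show ?thesis
  proof
    show "trig (\<lambda>x. F (E x))" using F by (simp add: R_def)
    show "\<bar>\<phi> x - F (E x)\<bar> < e" for x using F(2)[OF ES[of x]] by (simp add: \<Phi>)
  qed
qed

text \<open>The function stays within distance 1 of some trigonometric polynomial, and those are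
  bounded by the sum of their coefficients.\<close>

lemma periodic_bounded:
  fixes \<phi> :: "real ^ 'n::finite \<Rightarrow> real"
  assumes per: "\<And>x i. \<phi> (x + axis i 1) = \<phi> x" and cont: "continuous_on UNIV \<phi>"
  obtains B where "B > 0" "\<And>x. \<bar>\<phi> x\<bar> \<le> B"
proof -
  obtain P where P: "trig P" "\<And>x. \<bar>\<phi> x - P x\<bar> < 1" using trig_dense[OF assms, of 1] by auto
  then obtain A c where "P = rtp A c" by (auto simp: trig_def)
  then have PB: "\<bar>P x\<bar> \<le> (\<Sum>\<xi>\<in>A. cmod (c \<xi>))" for x using rtp_bound[of A c x] by simp
  have "\<bar>\<phi> x\<bar> \<le> 1 + (\<Sum>\<xi>\<in>A. cmod (c \<xi>))" for x
    using P(2)[of x] PB[of x] by linarith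
  moreover have "1 + (\<Sum>\<xi>\<in>A. cmod (c \<xi>)) > 0" by (intro add_pos_nonneg sum_nonneg) auto
  ultimately show ?thesis using that by blast
qed

lemma integrable_periodic_continuous:
  fixes \<phi> :: "real ^ 'n::finite \<Rightarrow> real"
  assumes per: "\<And>x i. \<phi> (x + axis i 1) = \<phi> x" and cont: "continuous_on UNIV \<phi>"
  shows "integrable tor \<phi>"
proof -
  obtain B where "\<And>x. \<bar>\<phi> x\<bar> \<le> B" using periodic_bounded[OF assms] by blast
  then show ?thesis
    by (intro integrable_tor_bounded[where B = B] borel_measurable_continuous_onI cont) auto
qed

lemma integral_mult_rtp:
  assumes g: "g \<in> borel_measurable borel" "integrable tor g" and A: "finite A"
  shows "integrable tor (\<lambda>x. g x * rtp A c x)"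
    "(LINT x|tor. g x * rtp A c x) = Re (\<Sum>\<xi>\<in>A. c \<xi> * cnj (fc g \<xi>))"
proof -
  have [measurable]: "g \<in> borel_measurable borel" by fact
  have i: "integrable tor (\<lambda>x. c \<xi> * (complex_of_real (g x) * cnj (ee (- \<xi>) x)))" for \<xi>
    by (intro integrable_mult_right integrable_fc g)
  have isum: "integrable tor (\<lambda>x. \<Sum>\<xi>\<in>A. c \<xi> * (complex_of_real (g x) * cnj (ee (- \<xi>) x)))"
    by (intro Bochner_Integration.integrable_sum i)
  have eq: "g x * rtp A c x = Re (\<Sum>\<xi>\<in>A. c \<xi> * (complex_of_real (g x) * cnj (ee (- \<xi>) x)))" for x
    unfolding rtp_def Re_sum sum_distrib_left by (intro sum.cong) (auto simp: ee_uminus algebra_simps)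
  show "integrable tor (\<lambda>x. g x * rtp A c x)" unfolding eq using isum by (rule integrable_Re)
  have "(LINT x|tor. g x * rtp A c x) = Re (\<Sum>\<xi>\<in>A. c \<xi> * fc g (- \<xi>))"
    unfolding eq integral_Re[OF isum] fc_def by (subst Bochner_Integration.integral_sum[OF i]) simp
  then show "(LINT x|tor. g x * rtp A c x) = Re (\<Sum>\<xi>\<in>A. c \<xi> * cnj (fc g \<xi>))"
    by (simp add: fc_uminus)
qed

lemma integral_trig_approx:
  fixes K \<phi> :: "real ^ 'n::finite \<Rightarrow> real"
  assumes K: "K \<in> borel_measurable borel" "integrable tor K"
    and per: "\<And>x i. \<phi> (x + axis i 1) = \<phi> x" and cont: "continuous_on UNIV \<phi>" and e: "e > 0"
  obtains P where "trig P" "\<And>x. \<bar>\<phi> x - P x\<bar> < e" "\<bar>(LINT x|tor. K x * \<phi> x) - (LINT x|tor. K x * P x)\<bar> \<le> e * (LINT x|tor. \<bar>K x\<bar>)"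
    "integrable tor (\<lambda>x. K x * \<phi> x)"
proof -
  obtain P where P: "trig P" "\<And>x. \<bar>\<phi> x - P x\<bar> < e" using trig_dense[OF per cont e] by blast
  have iP: "integrable tor (\<lambda>x. K x * P x)" using P(1) integral_mult_rtp(1)[OF K] by (auto simp: trig_def)
  obtain B where B: "\<And>x. \<bar>\<phi> x\<bar> \<le> B" using periodic_bounded[OF per cont] by blast
  have [measurable]: "\<phi> \<in> borel_measurable borel" "K \<in> borel_measurable borel"
    using cont K by (auto intro: borel_measurable_continuous_onI)
  have i\<phi>: "integrable tor (\<lambda>x. K x * \<phi> x)"
  proof (rule Bochner_Integration.integrable_bound)
    show "integrable tor (\<lambda>x. B * K x)" using K by simp
    show "(\<lambda>x. K x * \<phi> x) \<in> borel_measurable tor" by (rule measurable_tor) measurable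
    show "AE x in tor. norm (K x * \<phi> x) \<le> norm (B * K x)"
    proof (rule AE_I2)
      fix x
      have "\<bar>K x\<bar> * \<bar>\<phi> x\<bar> \<le> \<bar>K x\<bar> * \<bar>B\<bar>" using B[of x] by (intro mult_left_mono) auto
      then show "norm (K x * \<phi> x) \<le> norm (B * K x)" by (simp add: abs_mult mult.commute)
    qed
  qed
  have "\<bar>(LINT x|tor. K x * \<phi> x) - (LINT x|tor. K x * P x)\<bar> = \<bar>LINT x|tor. K x * \<phi> x - K x * P x\<bar>"
    using iP i\<phi> by simp
  also have "\<dots> \<le> (LINT x|tor. \<bar>K x * \<phi> x - K x * P x\<bar>)" by (rule integral_abs_bound)
  also have "\<dots> \<le> (LINT x|tor. e * \<bar>K x\<bar>)"
  proof (rule integral_mono)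
    fix x
    have "\<bar>K x * \<phi> x - K x * P x\<bar> = \<bar>K x\<bar> * \<bar>\<phi> x - P x\<bar>" by (simp add: abs_mult[symmetric] algebra_simps)
    also have "\<dots> \<le> \<bar>K x\<bar> * e" using P(2)[of x] by (intro mult_left_mono) auto
    finally show "\<bar>K x * \<phi> x - K x * P x\<bar> \<le> e * \<bar>K x\<bar>" by (simp add: mult.commute)
  qed (use iP i\<phi> K in auto)
  finally show ?thesis using that P i\<phi> by simp
qed

text \<open>The dual description of the norm of a continuous kernel in \<open>L\<^sub>1\<close>, tested only against
  trigonometric polynomials; the sign of \<open>K\<close> is smoothed to $K/(|K|+\varepsilon)$.\<close>

lemma L1_norm_dual:
  fixes K :: "real ^ 'n::finite \<Rightarrow> real"
  assumes per: "\<And>x i. K (x + axis i 1) = K x" and cont: "continuous_on UNIV K" and B: "B \<ge> 0"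
    and dual: "\<And>P M. trig P \<Longrightarrow> (\<And>x. \<bar>P x\<bar> \<le> M) \<Longrightarrow> \<bar>LINT x|tor. K x * P x\<bar> \<le> B * M"
  shows "(LINT x|tor. \<bar>K x\<bar>) \<le> B"
proof -
  have iK: "integrable tor K" by (rule integrable_periodic_continuous[OF per cont])
  have [measurable]: "K \<in> borel_measurable borel" using cont by (rule borel_measurable_continuous_onI)
  let ?N = "LINT x|tor. \<bar>K x\<bar>"
  have "?N \<le> B + (1 + B + ?N) * e" if e: "e > 0" for e
  proof -
    define \<phi> where "\<phi> x = K x / (\<bar>K x\<bar> + e)" for x
    have pos: "\<bar>K x\<bar> + e > 0" for x using e by linarith
    have c: "continuous_on UNIV \<phi>" unfolding \<phi>_def using pos
      by (intro continuous_intros cont) (auto simp: less_le)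
    obtain P where P: "trig P" "\<And>x. \<bar>\<phi> x - P x\<bar> < e"
      "\<bar>(LINT x|tor. K x * \<phi> x) - (LINT x|tor. K x * P x)\<bar> \<le> e * ?N" "integrable tor (\<lambda>x. K x * \<phi> x)"
      by (rule integral_trig_approx[of K \<phi> e]) (use iK c e per in \<open>auto simp: \<phi>_def\<close>)
    have "\<bar>\<phi> x\<bar> \<le> 1" for x unfolding \<phi>_def using pos[of x] e by (simp add: abs_divide divide_le_eq)
    then have "\<bar>P x\<bar> \<le> 1 + e" for x using P(2)[of x] by (smt (verit))
    then have "\<bar>LINT x|tor. K x * P x\<bar> \<le> B * (1 + e)" by (rule dual[OF P(1)])
    then have 1: "(LINT x|tor. K x * \<phi> x) \<le> B * (1 + e) + e * ?N" using P(3) by linarith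
    have "?N - e = (LINT x|tor. \<bar>K x\<bar> - e)" using iK by (simp add: tor.prob_space[simplified])
    also have "\<dots> \<le> (LINT x|tor. K x * \<phi> x)"
    proof (rule integral_mono)
      fix x
      have "(\<bar>K x\<bar> - e) * (\<bar>K x\<bar> + e) \<le> \<bar>K x\<bar> * \<bar>K x\<bar>" by (simp add: algebra_simps)
      then have "\<bar>K x\<bar> - e \<le> \<bar>K x\<bar> * \<bar>K x\<bar> / (\<bar>K x\<bar> + e)" using pos[of x] by (simp add: pos_le_divide_eq)
      then show "\<bar>K x\<bar> - e \<le> K x * \<phi> x" by (simp add: \<phi>_def)
    qed (use iK P in auto)
    finally show ?thesis using 1 by (simp add: algebra_simps)
  qed
  then have le: "?N \<le> B + (1 + B + ?N) * e" if "e > 0" for e using that by blast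
  have "?N \<ge> 0" by simp
  show ?thesis
  proof (rule field_le_epsilon)
    fix d :: real assume "d > 0"
    have p: "1 + B + ?N > 0" using B \<open>?N \<ge> 0\<close> by linarith
    from le[of "d / (1 + B + ?N)"] p \<open>d > 0\<close> show "?N \<le> B + d" by simp
  qed
qed

text \<open>A function orthogonal to all trigonometric polynomials has integral norm 0 by
  \<open>L1_norm_dual\<close> with bound 0. Continuity turns zero almost everywhere into zero on the
  open cube, then on its closure, then everywhere by periodicity.\<close>

lemma continuous_fc_zero:
  fixes \<phi> :: "real ^ 'n::finite \<Rightarrow> real"
  assumes per: "\<And>x i. \<phi> (x + axis i 1) = \<phi> x" and cont: "continuous_on UNIV \<phi>"
    and zero: "\<And>\<xi>. fc \<phi> \<xi> = 0"
  shows "\<phi> x = 0"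
proof -
  have i: "integrable tor \<phi>" by (rule integrable_periodic_continuous[OF per cont])
  have m [measurable]: "\<phi> \<in> borel_measurable borel" using cont by (rule borel_measurable_continuous_onI)
  have "(LINT x|tor. \<bar>\<phi> x\<bar>) \<le> 0"
  proof (rule L1_norm_dual[OF per cont])
    fix P :: "real ^ 'n \<Rightarrow> real" and M :: real assume "trig P"
    then obtain A c where "finite A" "P = rtp A c" by (auto simp: trig_def)
    then show "\<bar>LINT x|tor. \<phi> x * P x\<bar> \<le> 0 * M"
      using integral_mult_rtp(2)[OF m i] by (simp add: zero)
  qed auto
  moreover have "(LINT x|tor. \<bar>\<phi> x\<bar>) \<ge> 0" by simp
  ultimately have "(LINT x|tor. \<bar>\<phi> x\<bar>) = 0" by linarith
  then have "AE x in tor. \<phi> x = 0"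
    using integral_nonneg_eq_0_iff_AE[of tor "\<lambda>x. \<bar>\<phi> x\<bar>"] i by simp
  then have ae: "AE x in lborel. x \<in> torus \<longrightarrow> \<phi> x = 0"
    unfolding tor_def by (simp add: AE_restrict_space_iff)
  have box0: "\<phi> y = 0" if y: "y \<in> box 0 (\<chi> i. 1)" for y
  proof (rule ccontr)
    assume "\<phi> y \<noteq> 0"
    define U where "U = box 0 (\<chi> i. 1) \<inter> \<phi> -` (- {0})"
    have "open U" unfolding U_def by (intro open_Int open_box open_vimage cont) auto
    moreover have "U \<noteq> {}" using y \<open>\<phi> y \<noteq> 0\<close> by (auto simp: U_def)
    moreover have "AE x in lborel. x \<notin> U"
      using ae by eventually_elim (auto simp: U_def torus_def mem_box_cart less_imp_le)
    ultimately show False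
      using AE_iff_measurable[of U lborel "\<lambda>x. x \<notin> U"] open_not_negligible[of U]
      by (auto simp: negligible_iff_null_sets null_sets_def)
  qed
  have clos: "\<phi> y = 0" if "y \<in> torus" for y
  proof -
    have "y \<in> cbox 0 (\<chi> i. 1)" using that by (auto simp: torus_def mem_box_cart less_imp_le)
    also have "cbox 0 (\<chi> i. 1 :: real ^ 'n) = closure (box 0 (\<chi> i. 1))"
    proof (rule closure_box[symmetric])
      have "(\<chi> i. 1/2 :: real ^ 'n) \<in> box 0 (\<chi> i. 1)" by (simp add: mem_box_cart)
      then show "box 0 (\<chi> i. 1 :: real ^ 'n) \<noteq> {}" by blast
    qed
    finally have "y \<in> closure (box 0 (\<chi> i. 1))" .
    with box0 show ?thesis
      by (intro continuous_constant_on_closure[of "box 0 (\<chi> i. 1)" \<phi> 0 y] continuous_on_subset[OF cont]) auto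
  qed
  show ?thesis using clos[OF frac_part_torus[of x]] shift_frac_part[of \<phi>] per by metis
qed

section \<open>Test functions\<close>

lemma tf_periodic: "\<phi> \<in> test_fun \<Longrightarrow> \<phi> (x + axis i 1) = \<phi> x"
  by (simp add: test_fun_def periodic_def)

lemma partials_Nil [simp]: "partials [] \<phi> = \<phi>"
  and partials_Cons: "partials (j # js) \<phi> = partial j (partials js \<phi>)"
  and partials_snoc: "partials (js @ [j]) \<phi> = partials js (partial j \<phi>)"
  by (simp_all add: partials_def)

lemma tf_has_derivative:
  assumes "\<phi> \<in> test_fun"
  shows "(\<phi> has_derivative frechet_derivative \<phi> (at x)) (at x)"
proof -
  have "partials [] \<phi> differentiable_on UNIV" using assms by (simp add: test_fun_def del: partials_Nil)
  then show ?thesis by (simp add: differentiable_on_def frechet_derivative_works)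
qed

lemma tf_continuous: "\<phi> \<in> test_fun \<Longrightarrow> continuous_on S \<phi>"
  by (meson continuous_at_imp_continuous_on has_derivative_continuous tf_has_derivative)

lemma tf_measurable: "\<phi> \<in> test_fun \<Longrightarrow> \<phi> \<in> borel_measurable borel"
  by (intro borel_measurable_continuous_onI tf_continuous)

lemma tf_bounded:
  assumes "\<phi> \<in> test_fun" obtains B where "B > 0" "\<And>x. \<bar>\<phi> x\<bar> \<le> B"
  using periodic_bounded[of \<phi>] tf_periodic[OF assms] tf_continuous[OF assms] by blast

lemma tf_integrable: "\<phi> \<in> test_fun \<Longrightarrow> integrable tor \<phi>"
  by (rule integrable_periodic_continuous) (auto simp: tf_periodic tf_continuous)

lemma partial_eqI:
  assumes "(\<phi> has_derivative D) (at x)" shows "partial j \<phi> x = D (axis j 1)"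
  unfolding partial_def using frechet_derivative_at[OF assms] by simp

lemma periodic_partial:
  assumes \<phi>: "\<phi> \<in> test_fun" shows "periodic (partial j \<phi>)"
  unfolding periodic_def
proof (intro allI)
  fix x :: "real ^ 'a" and i
  let ?D = "frechet_derivative \<phi> (at (x + axis i 1))"
  have "((\<lambda>y. \<phi> (y + axis i 1)) has_derivative (\<lambda>h. ?D h)) (at x)"
    by (rule has_derivative_compose[of "\<lambda>y. y + axis i 1" "\<lambda>h. h" x UNIV \<phi> ?D, simplified])
       (auto intro!: derivative_eq_intros tf_has_derivative \<phi>)
  moreover have "(\<lambda>y. \<phi> (y + axis i 1)) = \<phi>" using tf_periodic[OF \<phi>] by auto
  ultimately have "(\<phi> has_derivative ?D) (at x)" by simp
  then show "partial j \<phi> (x + axis i 1) = partial j \<phi> x"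
    by (simp add: partial_eqI) (simp add: partial_def)
qed

lemma tf_partial: "\<phi> \<in> test_fun \<Longrightarrow> partial j \<phi> \<in> test_fun"
  using periodic_partial[of \<phi> j]
  by (auto simp: test_fun_def simp flip: partials_snoc)

lemma tf_partials: "\<phi> \<in> test_fun \<Longrightarrow> partials js \<phi> \<in> test_fun"
  by (induction js) (auto simp: partials_Cons intro: tf_partial)

lemma partial_lin:
  assumes "\<phi> \<in> test_fun" "\<psi> \<in> test_fun"
  shows "partial j (\<lambda>x. a * \<phi> x + b * \<psi> x) = (\<lambda>x. a * partial j \<phi> x + b * partial j \<psi> x)"
proof
  fix x
  have "((\<lambda>x. a * \<phi> x + b * \<psi> x) has_derivative
     (\<lambda>h. a * frechet_derivative \<phi> (at x) h + b * frechet_derivative \<psi> (at x) h)) (at x)"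
    by (intro derivative_intros tf_has_derivative assms)
  then show "partial j (\<lambda>x. a * \<phi> x + b * \<psi> x) x = a * partial j \<phi> x + b * partial j \<psi> x"
    by (subst partial_eqI) (auto simp: partial_def)
qed

lemma partials_lin:
  assumes "\<phi> \<in> test_fun" "\<psi> \<in> test_fun"
  shows "partials js (\<lambda>x. a * \<phi> x + b * \<psi> x) = (\<lambda>x. a * partials js \<phi> x + b * partials js \<psi> x)"
  by (induction js) (simp_all add: partials_Cons partial_lin tf_partials assms)

lemma tf_lin:
  assumes "\<phi> \<in> test_fun" "\<psi> \<in> test_fun" shows "(\<lambda>x. a * \<phi> x + b * \<psi> x) \<in> test_fun"
proof -
  have "partials js (\<lambda>x. a * \<phi> x + b * \<psi> x) differentiable_on UNIV" for js
    unfolding partials_lin[OF assms] using assms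
    by (intro differentiable_on_add differentiable_on_mult differentiable_on_const) (auto simp: test_fun_def)
  moreover have "periodic (\<lambda>x. a * \<phi> x + b * \<psi> x)" using assms by (simp add: periodic_def tf_periodic)
  ultimately show ?thesis by (simp add: test_fun_def)
qed

lemma ee_has_derivative:
  "(ee \<xi> has_derivative (\<lambda>h. of_real (2 * pi * (h \<bullet> freq \<xi>)) * (\<i> * ee \<xi> x))) (at x)"
proof -
  have "((\<lambda>x. 2 * pi * (x \<bullet> freq \<xi>)) has_derivative (\<lambda>h. 2 * pi * (h \<bullet> freq \<xi>))) (at x)"
    by (auto intro!: derivative_eq_intros)
  from has_derivative_cis[OF this] show ?thesis by (simp add: ee_def[abs_def] scaleR_conv_of_real)
qed

lemma rtp_has_derivative:
  "(rtp A c has_derivative (\<lambda>h. Re (\<Sum>\<xi>\<in>A. c \<xi> * (of_real (2 * pi * (h \<bullet> freq \<xi>)) * (\<i> * ee \<xi> x))))) (at x)"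
  unfolding rtp_def[abs_def]
  by (intro has_derivative_Re has_derivative_sum has_derivative_mult_right ee_has_derivative)

lemma partial_rtp:
  "partial j (rtp A c) = rtp A (\<lambda>\<xi>. 2 * pi * \<i> * of_int (\<xi> $ j) * c \<xi>)"
proof
  fix x show "partial j (rtp A c) x = rtp A (\<lambda>\<xi>. 2 * pi * \<i> * of_int (\<xi> $ j) * c \<xi>) x"
    by (subst partial_eqI[OF rtp_has_derivative])
       (simp add: rtp_def inner_axis' mult_ac)
qed

lemma partials_rtp: "\<exists>d. partials js (rtp A c) = rtp A d"
  by (induction js) (auto simp: partials_Cons partial_rtp)

lemma rtp_test_fun: "rtp A c \<in> test_fun"
proof -
  have "partials js (rtp A c) differentiable_on UNIV" for js
  proof -
    obtain d where "partials js (rtp A c) = rtp A d" using partials_rtp by blast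
    then show ?thesis
      using rtp_has_derivative by (auto simp: differentiable_on_def differentiable_def)
  qed
  then show ?thesis by (simp add: test_fun_def periodic_def rtp_periodic)
qed

text \<open>Integration by parts: differentiate $\int \phi(x+te_j)\overline{e_\xi(x)}\,dx = e_\xi(te_j)\hat\phi(\xi)$ at $t=0$.\<close>

lemma fc_translate:
  assumes g: "g \<in> borel_measurable borel" and per: "\<And>x i. g (x + axis i 1) = g x"
  shows "fc (\<lambda>x. g (x + a)) \<xi> = ee \<xi> a * fc g \<xi>"
proof -
  have [measurable]: "g \<in> borel_measurable borel" by fact
  have "fc (\<lambda>x. g (x + a)) \<xi> = (LINT x|tor. ee \<xi> a * (complex_of_real (g (x + a)) * cnj (ee \<xi> (x + a))))"
  proof -
    have "complex_of_real (g (x + a)) * cnj (ee \<xi> x)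
        = ee \<xi> a * (complex_of_real (g (x + a)) * cnj (ee \<xi> (x + a)))" for x
    proof -
      have "complex_of_real (g (x + a)) * cnj (ee \<xi> x)
          = (ee \<xi> a * cnj (ee \<xi> a)) * (complex_of_real (g (x + a)) * cnj (ee \<xi> x))"
        by (simp only: ee_mult_cnj mult_1)
      also have "\<dots> = ee \<xi> a * (complex_of_real (g (x + a)) * cnj (ee \<xi> (x + a)))"
        by (simp only: ee_plus complex_cnj_mult mult_ac)
      finally show ?thesis .
    qed
    then show ?thesis unfolding fc_def by (simp only:)
  qed
  also have "\<dots> = ee \<xi> a * (LINT x|tor. complex_of_real (g (x + a)) * cnj (ee \<xi> (x + a)))"
    by (rule integral_mult_right_zero)
  also have "(LINT x|tor. complex_of_real (g (x + a)) * cnj (ee \<xi> (x + a))) = fc g \<xi>"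
    unfolding fc_def by (rule integral_tor_translate) (auto simp: per)
  finally show ?thesis .
qed

lemma fc_partial:
  fixes \<phi> :: "real ^ 'n::finite \<Rightarrow> real"
  assumes \<phi>: "\<phi> \<in> test_fun"
  shows "fc (partial j \<phi>) \<xi> = 2 * pi * \<i> * of_int (\<xi> $ j) * fc \<phi> \<xi>"
proof -
  have [measurable]: "\<phi> \<in> borel_measurable borel" "partial j \<phi> \<in> borel_measurable borel"
    using \<phi> by (auto intro: tf_measurable tf_partial)
  define t where "t n = inverse (real (Suc n))" for n
  have t: "t n > 0" "t \<longlonglongrightarrow> 0" for n unfolding t_def using LIMSEQ_inverse_real_of_nat by simp_all
  define D where "D n x = (\<phi> (x + axis j (t n)) - \<phi> x) / t n" for n x
  have deriv: "((\<lambda>s. \<phi> (x + axis j s)) has_real_derivative partial j \<phi> (x + axis j s)) (at s)" for x s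
  proof -
    have ax: "axis j h = h *\<^sub>R (axis j 1 :: real ^ 'n)" for h by (simp add: vec_eq_iff axis_def)
    have lin: "linear (frechet_derivative \<phi> (at y))" for y
      using tf_has_derivative[OF \<phi>] has_derivative_linear by blast
    have "((\<lambda>s. x + axis j s) has_derivative (\<lambda>h. axis j h)) (at s)"
    proof -
      have "((\<lambda>s. x + s *\<^sub>R axis j 1) has_derivative (\<lambda>h. h *\<^sub>R axis j 1)) (at s)"
        by (auto intro!: derivative_eq_intros)
      then show ?thesis by (simp only: ax[symmetric])
    qed
    from has_derivative_compose[OF this tf_has_derivative[OF \<phi>]]
    have "((\<lambda>s. \<phi> (x + axis j s)) has_derivative (\<lambda>h. frechet_derivative \<phi> (at (x + axis j s)) (axis j h))) (at s)" .
    moreover have "frechet_derivative \<phi> (at y) (axis j h) = partial j \<phi> y * h" for y h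
      unfolding ax[of h] linear_cmul[OF lin] by (simp add: partial_def)
    ultimately show ?thesis by (simp add: has_field_derivative_def)
  qed
  obtain B where B: "\<And>x. \<bar>partial j \<phi> x\<bar> \<le> B" using tf_bounded[OF tf_partial[OF \<phi>]] by blast
  \<comment> \<open>The mean value theorem bounds the difference quotients by the supremum of the
    derivative; this is the dominating constant for the limit below.\<close>
  have Dle: "\<bar>D n x\<bar> \<le> B" for n x
  proof -
    have "\<exists>z>0. z < t n \<and> \<phi> (x + axis j (t n)) - \<phi> (x + axis j 0) = (t n - 0) * partial j \<phi> (x + axis j z)"
      by (rule MVT2) (use t deriv in auto)
    then obtain z where "\<phi> (x + axis j (t n)) - \<phi> x = t n * partial j \<phi> (x + axis j z)"
      by (auto simp: axis_def zero_vec_def[symmetric])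
    then have "D n x = partial j \<phi> (x + axis j z)" using t(1)[of n] by (simp add: D_def)
    then show ?thesis using B by simp
  qed
  have Dlim: "(\<lambda>n. D n x) \<longlonglongrightarrow> partial j \<phi> x" for x
  proof -
    have "((\<lambda>h. (\<phi> (x + axis j (0 + h)) - \<phi> (x + axis j 0)) / h) \<longlongrightarrow> partial j \<phi> (x + axis j 0)) (at 0)"
      using deriv[of x 0] unfolding DERIV_def .
    moreover have "filterlim t (at 0) sequentially"
      using t by (auto simp: filterlim_at less_imp_neq[symmetric] intro!: always_eventually)
    ultimately have "(\<lambda>n. (\<phi> (x + axis j (0 + t n)) - \<phi> (x + axis j 0)) / t n) \<longlonglongrightarrow> partial j \<phi> (x + axis j 0)"
      by (rule filterlim_compose)
    moreover have "axis j 0 = (0 :: real ^ 'n)" by (simp add: vec_eq_iff axis_def)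
    ultimately show ?thesis by (simp add: D_def)
  qed
  have DM [measurable]: "D n \<in> borel_measurable borel" for n unfolding D_def by measurable
  have "(\<lambda>n. fc (D n) \<xi>) \<longlonglongrightarrow> fc (partial j \<phi>) \<xi>"
    unfolding fc_def
  proof (rule integral_dominated_convergence[where w = "\<lambda>_. B"])
    show "(\<lambda>x. complex_of_real (partial j \<phi> x) * cnj (ee \<xi> x)) \<in> borel_measurable tor"
      "\<And>n. (\<lambda>x. complex_of_real (D n x) * cnj (ee \<xi> x)) \<in> borel_measurable tor"
      by (rule measurable_tor; measurable)+
    show "AE x in tor. (\<lambda>n. complex_of_real (D n x) * cnj (ee \<xi> x)) \<longlonglongrightarrow> complex_of_real (partial j \<phi> x) * cnj (ee \<xi> x)"
      by (intro AE_I2 tendsto_intros Dlim)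
    show "\<And>n. AE x in tor. norm (complex_of_real (D n x) * cnj (ee \<xi> x)) \<le> B"
      using Dle by (intro AE_I2) (simp add: norm_mult)
  qed simp
  moreover have "fc (D n) \<xi> = (ee \<xi> (axis j (t n)) - 1) / t n * fc \<phi> \<xi>" for n
  proof -
    have int: "integrable tor (\<lambda>x. \<phi> (x + axis j (t n)))"
      by (subst integrable_tor_translate) (auto simp: tf_periodic \<phi> tf_integrable)
    have "fc (D n) \<xi> = fc (\<lambda>x. inverse (t n) * (\<phi> (x + axis j (t n)) + (-1) * \<phi> x)) \<xi>"
      unfolding D_def by (simp add: field_simps)
    also have "\<dots> = inverse (t n) * (fc (\<lambda>x. \<phi> (x + axis j (t n))) \<xi> + (-1) * fc \<phi> \<xi>)"
      unfolding fc_cmult[of "inverse (t n)"]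
      by (subst fc_add) (use int \<phi> in \<open>auto simp: fc_cmult[of "-1", simplified] tf_integrable intro: tf_integrable\<close>)
    also have "fc (\<lambda>x. \<phi> (x + axis j (t n))) \<xi> = ee \<xi> (axis j (t n)) * fc \<phi> \<xi>"
      by (rule fc_translate) (auto simp: tf_periodic \<phi>)
    finally show ?thesis by (simp add: field_simps)
  qed
  moreover have "(\<lambda>n. (ee \<xi> (axis j (t n)) - 1) / t n * fc \<phi> \<xi>) \<longlonglongrightarrow> 2 * pi * \<i> * of_int (\<xi> $ j) * fc \<phi> \<xi>"
  proof (intro tendsto_mult_right)
    let ?w = "2 * pi * \<i> * of_int (\<xi> $ j)"
    have e: "ee \<xi> (axis j s) = exp (of_real s * ?w)" for s
      by (simp add: ee_axis cis_conv_exp mult_ac)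
    have "((\<lambda>s::complex. exp (s * ?w)) has_field_derivative ?w) (at 0)"
      by (auto intro!: derivative_eq_intros)
    then have "((\<lambda>h. (exp ((0 + h) * ?w) - exp (0 * ?w)) / h) \<longlongrightarrow> ?w) (at 0)" unfolding DERIV_def .
    moreover have "filterlim (\<lambda>n. complex_of_real (t n)) (at 0) sequentially"
      using t tendsto_of_real[OF t(2), where 'a = complex]
      by (auto simp: filterlim_at less_imp_neq[symmetric] intro!: always_eventually)
    ultimately have "(\<lambda>n. (exp ((0 + of_real (t n)) * ?w) - exp (0 * ?w)) / of_real (t n)) \<longlonglongrightarrow> ?w"
      by (rule filterlim_compose)
    then show "(\<lambda>n. (ee \<xi> (axis j (t n)) - 1) / t n) \<longlonglongrightarrow> ?w" by (simp add: e)
  qed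
  ultimately show ?thesis using LIMSEQ_unique by (simp only:)
qed

section \<open>Fourier series of test functions\<close>

lemma fc_lin:
  assumes "integrable tor g" "g \<in> borel_measurable borel" "integrable tor h" "h \<in> borel_measurable borel"
  shows "fc (\<lambda>x. a * g x + b * h x) \<xi> = of_real a * fc g \<xi> + of_real b * fc h \<xi>"
  using assms by (subst fc_add) (auto simp: fc_cmult)

text \<open>The operator \<open>1 - \<partial>_i^2 / (4 pi^2)\<close> keeps test functions and
  multiplies the coefficients by \<open>1 + \<xi>_i^2\<close>. Applying it to one coordinate after
  another gives the product, which is why \<open>\<phi>\<close> varies in the induction.\<close>

lemma tf_decay_aux:
  assumes "finite S"
  shows "\<phi> \<in> test_fun \<Longrightarrow> \<exists>C. \<forall>\<xi>. cmod (fc \<phi> \<xi>) * (\<Prod>i\<in>S. 1 + (real_of_int (\<xi> $ i))\<^sup>2) \<le> C"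
  using assms
proof (induction S arbitrary: \<phi> rule: finite_induct)
  case empty
  then show ?case using norm_fc_le by auto
next
  case (insert i S)
  define \<psi> where "\<psi> = (\<lambda>x. 1 * \<phi> x + (- 1 / (4 * pi\<^sup>2)) * partial i (partial i \<phi>) x)"
  have pp: "partial i (partial i \<phi>) \<in> test_fun" by (intro tf_partial insert.prems)
  have "\<psi> \<in> test_fun" unfolding \<psi>_def by (intro tf_lin insert.prems pp)
  then obtain C where C: "\<And>\<xi>. cmod (fc \<psi> \<xi>) * (\<Prod>i\<in>S. 1 + (real_of_int (\<xi> $ i))\<^sup>2) \<le> C"
    using insert.IH by blast
  have "fc \<psi> \<xi> = of_real (1 + (real_of_int (\<xi> $ i))\<^sup>2) * fc \<phi> \<xi>" for \<xi>
  proof -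
    have "fc \<psi> \<xi> = fc \<phi> \<xi> + of_real (- 1 / (4 * pi\<^sup>2)) * fc (partial i (partial i \<phi>)) \<xi>"
      unfolding \<psi>_def
      by (subst fc_lin) (use insert.prems pp in \<open>auto intro: tf_integrable tf_measurable\<close>)
    also have "fc (partial i (partial i \<phi>)) \<xi> = (2 * pi * \<i> * of_int (\<xi> $ i)) * ((2 * pi * \<i> * of_int (\<xi> $ i)) * fc \<phi> \<xi>)"
      by (simp only: fc_partial tf_partial insert.prems)
    also have "\<dots> = - of_real (4 * pi\<^sup>2 * (real_of_int (\<xi> $ i))\<^sup>2) * fc \<phi> \<xi>"
      by (simp add: power2_eq_square algebra_simps)
    finally show ?thesis by (simp add: algebra_simps)
  qed
  then have "cmod (fc \<psi> \<xi>) = (1 + (real_of_int (\<xi> $ i))\<^sup>2) * cmod (fc \<phi> \<xi>)" for \<xi>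
    by (simp only: norm_mult norm_of_real) (simp add: add_nonneg_nonneg)
  with C have "cmod (fc \<phi> \<xi>) * (\<Prod>i\<in>insert i S. 1 + (real_of_int (\<xi> $ i))\<^sup>2) \<le> C" for \<xi>
    using insert.hyps by (simp add: mult_ac)
  then show ?case by blast
qed

lemma tf_summable:
  fixes \<phi> :: "real ^ 'n::finite \<Rightarrow> real"
  assumes "\<phi> \<in> test_fun"
  shows "(\<lambda>\<xi>. cmod (fc \<phi> \<xi>)) summable_on UNIV"
proof -
  obtain C where C: "\<And>\<xi>. cmod (fc \<phi> \<xi>) * (\<Prod>i\<in>UNIV. 1 + (real_of_int (\<xi> $ i))\<^sup>2) \<le> C"
    using tf_decay_aux[OF finite_class.finite_UNIV assms] by blast
  have C0: "C \<ge> 0" by (rule order_trans[OF _ C[of 0]]) simp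
  have pt: "cmod (fc \<phi> \<xi>) \<le> C * (\<Prod>i\<in>UNIV. 1 / (1 + (1 * real_of_int (\<xi> $ i))\<^sup>2))" for \<xi>
  proof -
    have "(\<Prod>i\<in>(UNIV :: 'n set). 1 + (real_of_int (\<xi> $ i))\<^sup>2) > 0" by (intro prod_pos) (auto intro: add_pos_nonneg)
    then show ?thesis using C[of \<xi>] by (simp add: prod_dividef divide_simps)
  qed
  show ?thesis
  proof (rule summable_Lam_bound)
    fix N
    have "(\<Sum>\<xi>\<in>Lam N. cmod (fc \<phi> \<xi>)) \<le> C * (\<Sum>\<xi>\<in>(Lam N :: (int ^ 'n) set). \<Prod>i\<in>UNIV. 1 / (1 + (1 * real_of_int (\<xi> $ i))\<^sup>2))"
      unfolding sum_distrib_left by (intro sum_mono pt)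
    also have "\<dots> \<le> C * (1 + pi / 1) ^ CARD('n)" using C0 by (intro mult_left_mono sum_lorentz) auto
    finally show "(\<Sum>\<xi>\<in>Lam N. cmod (fc \<phi> \<xi>)) \<le> C * (1 + pi / 1) ^ CARD('n)" .
  qed simp
qed

definition tail :: "(int ^ 'n::finite \<Rightarrow> real) \<Rightarrow> nat \<Rightarrow> real" where
  "tail w N = (\<Sum>\<^sub>\<infinity>\<xi>\<in>- Lam N. w \<xi>)"

lemma tail_eq:
  assumes "w summable_on UNIV"
  shows "tail w N = (\<Sum>\<^sub>\<infinity>\<xi>. w \<xi>) - (\<Sum>\<xi>\<in>Lam N. w \<xi>)"
proof -
  have "(\<Sum>\<^sub>\<infinity>\<xi>\<in>Lam N \<union> - Lam N. w \<xi>) = infsum w (Lam N) + infsum w (- Lam N)"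
    by (rule infsum_Un_disjoint) (auto intro: summable_on_subset_banach[OF assms])
  then show ?thesis by (simp add: tail_def)
qed

lemma tail_tendsto:
  assumes "w summable_on UNIV" shows "tail w \<longlonglongrightarrow> 0"
proof -
  have "tail w = (\<lambda>N. (\<Sum>\<^sub>\<infinity>\<xi>. w \<xi>) - (\<Sum>\<xi>\<in>Lam N. w \<xi>))"
    using tail_eq[OF assms] by (rule ext)
  then show ?thesis
    using tendsto_diff[OF tendsto_const[of "\<Sum>\<^sub>\<infinity>\<xi>. w \<xi>"] infsum_Lam[OF assms]] by simp
qed

lemma tail_nonneg: "(\<And>\<xi>. w \<xi> \<ge> 0) \<Longrightarrow> tail w N \<ge> 0"
  unfolding tail_def by (rule infsum_nonneg) simp

definition fseries :: "(int ^ 'n::finite \<Rightarrow> complex) \<Rightarrow> real ^ 'n \<Rightarrow> real" where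
  "fseries c x = Re (\<Sum>\<^sub>\<infinity>\<xi>. c \<xi> * ee \<xi> x)"

lemma fseries_rtp:
  assumes c: "(\<lambda>\<xi>. cmod (c \<xi>)) summable_on UNIV"
  shows "\<bar>fseries c x - rtp (Lam N) c x\<bar> \<le> tail (\<lambda>\<xi>. cmod (c \<xi>)) N"
proof -
  let ?f = "\<lambda>\<xi>. c \<xi> * ee \<xi> x"
  have ab: "(\<lambda>\<xi>. norm (?f \<xi>)) summable_on A" for A
    using summable_on_subset_banach[OF c, of A] by (simp add: norm_mult)
  have s: "?f summable_on A" for A by (rule abs_summable_summable[OF ab])
  have "infsum ?f (Lam N \<union> - Lam N) = infsum ?f (Lam N) + infsum ?f (- Lam N)"
    by (rule infsum_Un_disjoint) (auto intro: s)
  then have "fseries c x - rtp (Lam N) c x = Re (infsum ?f (- Lam N))"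
    by (simp add: fseries_def rtp_def)
  also have "\<bar>\<dots>\<bar> \<le> cmod (infsum ?f (- Lam N))" by (rule abs_Re_le_cmod)
  also have "\<dots> \<le> infsum (\<lambda>\<xi>. norm (?f \<xi>)) (- Lam N)" by (rule norm_infsum_bound[OF ab])
  finally show ?thesis by (simp add: tail_def norm_mult)
qed

lemma fseries_bound:
  assumes c: "(\<lambda>\<xi>. cmod (c \<xi>)) summable_on UNIV"
  shows "\<bar>fseries c x\<bar> \<le> (\<Sum>\<^sub>\<infinity>\<xi>. cmod (c \<xi>))"
proof -
  have "\<bar>fseries c x\<bar> \<le> tail (\<lambda>\<xi>. cmod (c \<xi>)) 0 + (\<Sum>\<xi>\<in>Lam 0. cmod (c \<xi>))"
    using fseries_rtp[OF c, of x 0] rtp_bound[of "Lam 0" c x] by linarith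
  then show ?thesis by (simp add: tail_eq[OF c])
qed

lemma fseries_periodic: "fseries c (x + axis i 1) = fseries c x"
  by (simp add: fseries_def)

lemma fseries_continuous:
  assumes c: "(\<lambda>\<xi>. cmod (c \<xi>)) summable_on UNIV"
  shows "continuous_on S (fseries c)"
proof -
  have ul: "uniform_limit S (\<lambda>N. rtp (Lam N) c) (fseries c) sequentially"
  proof (rule uniform_limitI)
    fix e :: real assume "e > 0"
    then have "\<forall>\<^sub>F N in sequentially. tail (\<lambda>\<xi>. cmod (c \<xi>)) N < e"
      using tail_tendsto[OF c] by (rule order_tendstoD(2)[rotated])
    then show "\<forall>\<^sub>F N in sequentially. \<forall>x\<in>S. dist (rtp (Lam N) c x) (fseries c x) < e"
      by eventually_elim (metis abs_minus_commute dist_real_def fseries_rtp[OF c] le_less_trans)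
  qed
  show ?thesis
    by (rule uniform_limit_theorem[OF _ ul]) (simp_all add: continuous_rtp)
qed

lemma fc_fseries:
  assumes c: "(\<lambda>\<xi>. cmod (c \<xi>)) summable_on UNIV"
  shows "fc (fseries c) \<xi> = (c \<xi> + cnj (c (- \<xi>))) / 2"
proof -
  have i: "integrable tor (fseries c)"
    by (rule integrable_periodic_continuous[OF fseries_periodic fseries_continuous[OF c]])
  have m: "fseries c \<in> borel_measurable borel"
    by (rule borel_measurable_continuous_onI[OF fseries_continuous[OF c]])
  have ir: "integrable tor (rtp (Lam N) c)" for N
    by (rule integrable_periodic_continuous[OF rtp_periodic continuous_rtp])
  have "(\<lambda>N. fc (rtp (Lam N) c) \<xi>) \<longlonglongrightarrow> fc (fseries c) \<xi>"
  proof (rule LIM_zero_cancel, rule Lim_null_comparison[OF _ tail_tendsto[OF c]], rule always_eventually, rule allI)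
    fix N
    have "fc (rtp (Lam N) c) \<xi> - fc (fseries c) \<xi> = fc (\<lambda>x. 1 * rtp (Lam N) c x + (-1) * fseries c x) \<xi>"
      by (subst fc_lin[OF ir _ i m]) simp_all
    also have "cmod \<dots> \<le> (LINT x|tor. \<bar>1 * rtp (Lam N) c x + (-1) * fseries c x\<bar>)" by (rule norm_fc_le)
    also have "\<dots> \<le> (LINT x|(tor :: (real ^ 'a) measure). tail (\<lambda>\<xi>. cmod (c \<xi>)) N)"
      using fseries_rtp[OF c, of _ N] ir[of N] i
      by (intro integral_mono) (auto simp: abs_minus_commute)
    finally show "cmod (fc (rtp (Lam N) c) \<xi> - fc (fseries c) \<xi>) \<le> tail (\<lambda>\<xi>. cmod (c \<xi>)) N"
      by (simp add: tor.prob_space[simplified])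
  qed
  moreover have "(\<lambda>N. fc (rtp (Lam N) c) \<xi>) \<longlonglongrightarrow> (c \<xi> + cnj (c (- \<xi>))) / 2"
  proof (rule tendsto_eventually)
    obtain M where M: "\<xi> \<in> Lam M" using ex_Lam by blast
    have "fc (rtp (Lam N) c) \<xi> = (c \<xi> + cnj (c (- \<xi>))) / 2" if "N \<ge> M" for N
      using M Lam_mono[OF that] by (subst fc_rtp) auto
    then show "\<forall>\<^sub>F N in sequentially. fc (rtp (Lam N) c) \<xi> = (c \<xi> + cnj (c (- \<xi>))) / 2"
      by (auto simp: eventually_sequentially)
  qed
  ultimately show ?thesis using LIMSEQ_unique by blast
qed

text \<open>By \<open>continuous_fc_zero\<close> a test function equals the sum of its absolutely
  convergent Fourier series. The explicit tail allows the error to be added up over all derivatives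
  in \<open>distribution_eq_0\<close>.\<close>

lemma tf_series:
  assumes \<phi>: "\<phi> \<in> test_fun"
  shows "\<bar>\<phi> x - rtp (Lam N) (fc \<phi>) x\<bar> \<le> tail (\<lambda>\<xi>. cmod (fc \<phi> \<xi>)) N"
proof -
  note s = tf_summable[OF \<phi>]
  have i: "integrable tor (fseries (fc \<phi>))"
    by (rule integrable_periodic_continuous[OF fseries_periodic fseries_continuous[OF s]])
  have m: "fseries (fc \<phi>) \<in> borel_measurable borel"
    by (rule borel_measurable_continuous_onI[OF fseries_continuous[OF s]])
  have "1 * \<phi> x + (-1) * fseries (fc \<phi>) x = 0"
  proof (rule continuous_fc_zero)
    show "continuous_on UNIV (\<lambda>x. 1 * \<phi> x + (-1) * fseries (fc \<phi>) x)"
      by (intro continuous_intros tf_continuous[OF \<phi>] fseries_continuous[OF s])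
    show "fc (\<lambda>x. 1 * \<phi> x + (-1) * fseries (fc \<phi>) x) \<xi> = 0" for \<xi>
      by (subst fc_lin[OF tf_integrable[OF \<phi>] tf_measurable[OF \<phi>] i m]) (simp add: fc_fseries[OF s] fc_uminus)
  qed (simp add: tf_periodic[OF \<phi>] fseries_periodic)
  then show ?thesis using fseries_rtp[OF s, of x N] by simp
qed

section \<open>Distributions are determined by their Fourier coefficients\<close>

lemma Ck_norm_le:
  assumes "\<And>js x. length js \<le> m \<Longrightarrow> \<bar>partials js \<phi> x\<bar> \<le> B"
  shows "Ck_norm m \<phi> \<le> B"
  unfolding Ck_norm_def
proof (rule cSUP_least)
  have "([], 0) \<in> {js. length js \<le> m} \<times> UNIV" by simp
  then show "{js. length js \<le> m} \<times> UNIV \<noteq> {}" by blast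
qed (use assms in auto)

text \<open>The supremum in \<open>Ck_norm\<close> is taken in the reals, so an upper bound must be
  produced first: there are finitely many lists of length at most m, and each iterated derivative is
  bounded.\<close>

lemma Ck_norm_ge:
  assumes \<phi>: "\<phi> \<in> test_fun" and js: "length js \<le> m"
  shows "\<bar>partials js \<phi> x\<bar> \<le> Ck_norm m \<phi>"
proof -
  have "\<exists>B. \<forall>x. \<bar>partials js \<phi> x\<bar> \<le> B" for js
    using tf_bounded[OF tf_partials[OF \<phi>]] by metis
  then obtain B where B: "\<And>js x. \<bar>partials js \<phi> x\<bar> \<le> B js" by metis
  let ?J = "{js :: 'a list. length js \<le> m}"
  have fin: "finite ?J" using finite_lists_length_le[of "UNIV :: 'a set" m] by simp
  have "\<bar>partials js \<phi> x\<bar> \<le> (\<Sum>js\<in>?J. B js)" if "js \<in> ?J" for js x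
  proof -
    have "B js \<ge> 0" for js using B[of js 0] by linarith
    then have "B js \<le> (\<Sum>js\<in>?J. B js)" using that fin by (intro member_le_sum) auto
    then show ?thesis using B[of js x] by linarith
  qed
  then have "bdd_above ((\<lambda>(js, x). \<bar>partials js \<phi> x\<bar>) ` (?J \<times> UNIV))"
    by (intro bdd_aboveI2[where M = "\<Sum>js\<in>?J. B js"]) auto
  from cSUP_upper[OF _ this, of "(js, x)"] js show ?thesis by (simp add: Ck_norm_def)
qed

lemma Ck_norm_nonneg: "\<phi> \<in> test_fun \<Longrightarrow> Ck_norm m \<phi> \<ge> 0"
  using Ck_norm_ge[of \<phi> "[]" m 0] by simp

lemma Ck_norm_mono: "\<phi> \<in> test_fun \<Longrightarrow> k \<le> m \<Longrightarrow> Ck_norm k \<phi> \<le> Ck_norm m \<phi>"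
  by (rule Ck_norm_le) (auto intro: Ck_norm_ge)

lemma Ck_norm_partial: "\<phi> \<in> test_fun \<Longrightarrow> Ck_norm m (partial j \<phi>) \<le> Ck_norm (Suc m) \<phi>"
  by (rule Ck_norm_le) (auto simp flip: partials_snoc intro: Ck_norm_ge)

lemma distribution_bound:
  assumes "distribution T"
  shows "\<exists>C m. C \<ge> 0 \<and> (\<forall>\<phi>\<in>test_fun. \<bar>T \<phi>\<bar> \<le> C * Ck_norm m \<phi>)"
proof -
  have "\<exists>C m. \<forall>\<phi>\<in>test_fun. \<bar>T \<phi>\<bar> \<le> C * Ck_norm m \<phi>"
    using assms unfolding distribution_def by blast
  then obtain C m where C: "\<forall>\<phi>\<in>test_fun. \<bar>T \<phi>\<bar> \<le> C * Ck_norm m \<phi>" by blast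
  have "\<bar>T \<phi>\<bar> \<le> \<bar>C\<bar> * Ck_norm m \<phi>" if "\<phi> \<in> test_fun" for \<phi>
    using C that mult_right_mono[OF abs_ge_self[of C] Ck_norm_nonneg[OF that, of m]] by fastforce
  then show ?thesis by (intro exI[of _ "\<bar>C\<bar>"] exI[of _ m]) auto
qed

lemma distribution_lin_apply:
  assumes "distribution T" "\<phi> \<in> test_fun" "\<psi> \<in> test_fun"
  shows "T (\<lambda>x. a * \<phi> x + b * \<psi> x) = a * T \<phi> + b * T \<psi>"
proof -
  have "(\<lambda>x. c * \<phi> x) \<in> test_fun" if "\<phi> \<in> test_fun" for c and \<phi> :: "real ^ 'a \<Rightarrow> real"
    using tf_lin[OF that that, of c 0] by simp
  then show ?thesis using assms by (simp add: distribution_def)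
qed

lemma distributionI:
  assumes lin: "\<And>a b \<phi> \<psi>. \<phi> \<in> test_fun \<Longrightarrow> \<psi> \<in> test_fun \<Longrightarrow> T (\<lambda>x. a * \<phi> x + b * \<psi> x) = a * T \<phi> + b * T \<psi>"
    and bd: "\<And>\<phi>. \<phi> \<in> test_fun \<Longrightarrow> \<bar>T \<phi>\<bar> \<le> C * Ck_norm m \<phi>"
  shows "distribution T"
  unfolding distribution_def
proof (intro conjI ballI allI)
  fix \<phi> \<psi> :: "real ^ 'a \<Rightarrow> real" and c assume "\<phi> \<in> test_fun"
  then show "T (\<lambda>x. c * \<phi> x) = c * T \<phi>" using lin[of \<phi> \<phi> c 0] by simp
  assume "\<psi> \<in> test_fun"
  then show "T (\<lambda>x. \<phi> x + \<psi> x) = T \<phi> + T \<psi>" using lin[OF \<open>\<phi> \<in> test_fun\<close>, of \<psi> 1 1] by simp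
qed (use bd in blast)

lemma distribution_lin:
  assumes S: "distribution S" and T: "distribution T"
  shows "distribution (\<lambda>\<phi>. a * S \<phi> + b * T \<phi>)"
proof -
  obtain C m where C: "C \<ge> 0" "\<And>\<phi>. \<phi> \<in> test_fun \<Longrightarrow> \<bar>S \<phi>\<bar> \<le> C * Ck_norm m \<phi>" using distribution_bound[OF S] by blast
  obtain D k where D: "D \<ge> 0" "\<And>\<phi>. \<phi> \<in> test_fun \<Longrightarrow> \<bar>T \<phi>\<bar> \<le> D * Ck_norm k \<phi>" using distribution_bound[OF T] by blast
  show ?thesis
  proof (rule distributionI)
    fix \<phi> :: "real ^ 'a \<Rightarrow> real" assume \<phi>: "\<phi> \<in> test_fun"
    let ?N = "Ck_norm (max m k) \<phi>"
    have "\<bar>S \<phi>\<bar> \<le> C * ?N" "\<bar>T \<phi>\<bar> \<le> D * ?N"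
      using C(2)[OF \<phi>] D(2)[OF \<phi>] mult_left_mono[OF Ck_norm_mono[OF \<phi>] C(1), of m "max m k"]
        mult_left_mono[OF Ck_norm_mono[OF \<phi>] D(1), of k "max m k"] by auto
    then have "\<bar>a\<bar> * \<bar>S \<phi>\<bar> \<le> \<bar>a\<bar> * (C * ?N)" "\<bar>b\<bar> * \<bar>T \<phi>\<bar> \<le> \<bar>b\<bar> * (D * ?N)" by (auto intro: mult_left_mono)
    moreover have "\<bar>a * S \<phi> + b * T \<phi>\<bar> \<le> \<bar>a\<bar> * \<bar>S \<phi>\<bar> + \<bar>b\<bar> * \<bar>T \<phi>\<bar>"
      unfolding abs_mult[symmetric] by (rule abs_triangle_ineq)
    ultimately show "\<bar>a * S \<phi> + b * T \<phi>\<bar> \<le> (\<bar>a\<bar> * C + \<bar>b\<bar> * D) * ?N" by (simp add: algebra_simps)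
  qed (simp add: distribution_lin_apply[OF S] distribution_lin_apply[OF T] algebra_simps)
qed

lemma distribution_zero: "distribution (\<lambda>\<phi>. 0)"
  by (rule distributionI[where C = 0 and m = 0]) auto

lemma distribution_sum:
  assumes "finite I" "\<And>i. i \<in> I \<Longrightarrow> distribution (T i)"
  shows "distribution (\<lambda>\<phi>. \<Sum>i\<in>I. r i * T i \<phi>)"
  using assms
proof (induction I rule: finite_induct)
  case (insert i I)
  then show ?case using distribution_lin[of "T i" "\<lambda>\<phi>. \<Sum>i\<in>I. r i * T i \<phi>" "r i" 1] by simp
qed (simp add: distribution_zero)

lemma distribution_dpartial:
  assumes T: "distribution T" shows "distribution (dpartial j T)"
proof -
  obtain C m where C: "C \<ge> 0" "\<And>\<phi>. \<phi> \<in> test_fun \<Longrightarrow> \<bar>T \<phi>\<bar> \<le> C * Ck_norm m \<phi>" using distribution_bound[OF T] by blast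
  show ?thesis
  proof (rule distributionI)
    fix \<phi> :: "real ^ 'a \<Rightarrow> real" assume \<phi>: "\<phi> \<in> test_fun"
    have "\<bar>dpartial j T \<phi>\<bar> \<le> C * Ck_norm m (partial j \<phi>)" using C(2)[OF tf_partial[OF \<phi>]] by (simp add: dpartial_def)
    also have "\<dots> \<le> C * Ck_norm (Suc m) \<phi>" by (intro mult_left_mono Ck_norm_partial \<phi> C)
    finally show "\<bar>dpartial j T \<phi>\<bar> \<le> C * Ck_norm (Suc m) \<phi>" .
  qed (simp add: dpartial_def partial_lin distribution_lin_apply[OF T] tf_partial)
qed

lemma integrable_mult_tf:
  assumes g: "g \<in> borel_measurable borel" "integrable tor g" and \<phi>: "\<phi> \<in> test_fun"
  shows "integrable tor (\<lambda>x. g x * \<phi> x)"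
  by (rule integral_trig_approx[OF g tf_periodic[OF \<phi>] tf_continuous[OF \<phi>], of 1]) auto

lemma distr_of_eq:
  assumes g: "g \<in> borel_measurable borel" and \<phi>: "\<phi> \<in> test_fun"
  shows "distr_of g \<phi> = (LINT x|tor. g x * \<phi> x)"
  unfolding distr_of_def using g tf_measurable[OF \<phi>] by (intro set_integral_torus) measurable

lemma distribution_distr_of:
  assumes g: "g \<in> borel_measurable borel" "integrable tor g"
  shows "distribution (distr_of g)"
proof (rule distributionI[where m = 0 and C = "LINT x|tor. \<bar>g x\<bar>"])
  fix a b and \<phi> \<psi> :: "real ^ 'a \<Rightarrow> real" assume t: "\<phi> \<in> test_fun" "\<psi> \<in> test_fun"
  have "(LINT x|tor. g x * (a * \<phi> x + b * \<psi> x)) = (LINT x|tor. a * (g x * \<phi> x) + b * (g x * \<psi> x))"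
    by (simp add: algebra_simps)
  also have "\<dots> = a * (LINT x|tor. g x * \<phi> x) + b * (LINT x|tor. g x * \<psi> x)"
    using integrable_mult_tf[OF g t(1)] integrable_mult_tf[OF g t(2)] by simp
  finally show "distr_of g (\<lambda>x. a * \<phi> x + b * \<psi> x) = a * distr_of g \<phi> + b * distr_of g \<psi>"
    by (simp add: distr_of_eq g(1) t tf_lin)
next
  fix \<phi> :: "real ^ 'a \<Rightarrow> real" assume \<phi>: "\<phi> \<in> test_fun"
  have "\<bar>LINT x|tor. g x * \<phi> x\<bar> \<le> (LINT x|tor. \<bar>g x * \<phi> x\<bar>)" by (rule integral_abs_bound)
  also have "\<dots> \<le> (LINT x|tor. \<bar>g x\<bar> * Ck_norm 0 \<phi>)"
    using integrable_abs[OF integrable_mult_tf[OF g \<phi>]] g Ck_norm_ge[OF \<phi>, of "[]" 0]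
    by (intro integral_mono) (simp_all add: abs_mult mult_left_mono)
  finally show "\<bar>distr_of g \<phi>\<bar> \<le> (LINT x|tor. \<bar>g x\<bar>) * Ck_norm 0 \<phi>" by (simp add: distr_of_eq[OF g(1) \<phi>])
qed

lemma cos_rtp: "(\<lambda>x. cos (2 * pi * (x \<bullet> freq \<xi>))) = rtp {\<xi>} (\<lambda>_. 1)"
  and sin_rtp: "(\<lambda>x. sin (2 * pi * (x \<bullet> freq \<xi>))) = rtp {\<xi>} (\<lambda>_. - \<i>)"
  by (simp_all add: rtp_def ee_def fun_eq_iff)

lemma fourier_eq: "fourier T \<xi> = Complex (T (rtp {\<xi>} (\<lambda>_. 1))) (- T (rtp {\<xi>} (\<lambda>_. - \<i>)))"
  by (simp add: fourier_def cos_rtp sin_rtp)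

lemma distribution_rtp:
  assumes T: "distribution T" and A: "finite A"
  shows "T (rtp A c) = Re (\<Sum>\<xi>\<in>A. c \<xi> * cnj (fourier T \<xi>))"
  using A
proof (induction A rule: finite_induct)
  case empty
  have "rtp {} c = (\<lambda>x. 0 * rtp {} c x + 0 * rtp {} c x)" by (simp add: rtp_def fun_eq_iff)
  then have "T (rtp {} c) = 0" using distribution_lin_apply[OF T rtp_test_fun rtp_test_fun, of 0 "{}" c 0 "{}" c] by simp
  then show ?case by simp
next
  case (insert \<xi> A)
  have single: "rtp {\<xi>} c = (\<lambda>x. Re (c \<xi>) * rtp {\<xi>} (\<lambda>_. 1) x + (- Im (c \<xi>)) * rtp {\<xi>} (\<lambda>_. -\<i>) x)"
    by (simp add: rtp_def fun_eq_iff)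
  have "rtp (insert \<xi> A) c = (\<lambda>x. 1 * rtp {\<xi>} c x + 1 * rtp A c x)"
    using insert.hyps by (simp add: rtp_def fun_eq_iff)
  then have "T (rtp (insert \<xi> A) c) = T (rtp {\<xi>} c) + T (rtp A c)"
    using distribution_lin_apply[OF T rtp_test_fun rtp_test_fun, of 1 "{\<xi>}" c 1 A c] by simp
  also have "T (rtp {\<xi>} c) = Re (c \<xi> * cnj (fourier T \<xi>))"
    unfolding single distribution_lin_apply[OF T rtp_test_fun rtp_test_fun] by (simp add: fourier_eq)
  finally show ?case using insert by simp
qed

lemma fourier_dpartial:
  assumes T: "distribution T"
  shows "fourier (dpartial j T) \<xi> = 2 * pi * \<i> * of_int (\<xi> $ j) * fourier T \<xi>"
  unfolding fourier_eq[of "dpartial j T"]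
  by (simp add: dpartial_def partial_rtp distribution_rtp[OF T] complex_eq_iff)

lemma fourier_lin: "fourier (\<lambda>\<phi>. a * S \<phi> + b * T \<phi>) \<xi> = of_real a * fourier S \<xi> + of_real b * fourier T \<xi>"
  by (simp add: fourier_def complex_eq_iff)

lemma fourier_sum: "fourier (\<lambda>\<phi>. \<Sum>i\<in>I. r i * T i \<phi>) \<xi> = (\<Sum>i\<in>I. of_real (r i) * fourier (T i) \<xi>)"
  by (simp add: fourier_def complex_eq_iff sum_negf[symmetric])

lemma fourier_uminus:
  assumes T: "distribution T" shows "fourier T (- \<xi>) = cnj (fourier T \<xi>)"
proof -
  have "rtp {- \<xi>} (\<lambda>_. 1) = rtp {\<xi>} (\<lambda>_. 1)" "rtp {- \<xi>} (\<lambda>_. - \<i>) = rtp {\<xi>} (\<lambda>_. \<i>)"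
    by (simp_all add: rtp_def fun_eq_iff ee_uminus)
  then show ?thesis
    by (simp add: fourier_eq[of T "- \<xi>"] distribution_rtp[OF T] complex_eq_iff)
qed

lemma partials_rtp_fc:
  assumes "\<phi> \<in> test_fun" shows "partials js (rtp A (fc \<phi>)) = rtp A (fc (partials js \<phi>))"
proof (induction js)
  case (Cons j js)
  then show ?case by (simp add: partials_Cons partial_rtp fc_partial[OF tf_partials[OF assms]])
qed simp

text \<open>The Fourier series of a test function converges in every \<open>Ck_norm\<close>.\<close>

lemma distribution_eq_0:
  fixes T :: "'n::finite distr"
  assumes T: "distribution T" and zero: "\<And>\<xi>. fourier T \<xi> = 0" and \<phi>: "\<phi> \<in> test_fun"
  shows "T \<phi> = 0"
proof -
  obtain C m where C: "C \<ge> 0" "\<And>\<phi>. \<phi> \<in> test_fun \<Longrightarrow> \<bar>T \<phi>\<bar> \<le> C * Ck_norm m \<phi>" using distribution_bound[OF T] by blast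
  let ?J = "{js :: 'n list. length js \<le> m}"
  have fin: "finite ?J" using finite_lists_length_le[of "UNIV :: 'n set" m] by simp
  define r where "r N = (\<Sum>js\<in>?J. tail (\<lambda>\<xi>. cmod (fc (partials js \<phi>) \<xi>)) N)" for N
  have "r \<longlonglongrightarrow> (\<Sum>js\<in>?J. 0)" unfolding r_def
    by (intro tendsto_sum tail_tendsto tf_summable tf_partials \<phi>)
  then have r: "(\<lambda>N. C * r N) \<longlonglongrightarrow> 0" using tendsto_mult_left[of r 0 sequentially C] by simp
  have "\<bar>T \<phi>\<bar> \<le> C * r N" for N
  proof -
    define \<psi> where "\<psi> = (\<lambda>x. 1 * \<phi> x + (-1) * rtp (Lam N) (fc \<phi>) x)"
    have \<psi>: "\<psi> \<in> test_fun" unfolding \<psi>_def by (intro tf_lin \<phi> rtp_test_fun)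
    have "Ck_norm m \<psi> \<le> r N"
    proof (rule Ck_norm_le)
      fix js :: "'n list" and x assume js: "length js \<le> m"
      have "\<bar>partials js \<psi> x\<bar> = \<bar>partials js \<phi> x - rtp (Lam N) (fc (partials js \<phi>)) x\<bar>"
        unfolding \<psi>_def by (simp only: partials_lin[OF \<phi> rtp_test_fun] partials_rtp_fc[OF \<phi>])
      also have "\<dots> \<le> tail (\<lambda>\<xi>. cmod (fc (partials js \<phi>) \<xi>)) N" by (intro tf_series tf_partials \<phi>)
      also have "\<dots> \<le> r N" unfolding r_def using js fin by (intro member_le_sum tail_nonneg) auto
      finally show "\<bar>partials js \<psi> x\<bar> \<le> r N" .
    qed
    moreover have "T \<psi> = T \<phi>"
      unfolding \<psi>_def by (subst distribution_lin_apply[OF T \<phi> rtp_test_fun]) (simp add: distribution_rtp[OF T] zero)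
    ultimately show ?thesis using C(2)[OF \<psi>] mult_left_mono[of "Ck_norm m \<psi>" "r N" C] C(1) by simp
  qed
  then have "\<bar>T \<phi>\<bar> \<le> 0" by (intro LIMSEQ_le_const[OF r]) blast
  then show ?thesis by simp
qed

section \<open>Square integrable functions on the torus\<close>

text \<open>The second claim is the nonnegativity of the variance of \<open>\<bar>h\<bar>\<close> on
  a probability space.\<close>

lemma L2_L1:
  fixes h :: "real ^ 'n::finite \<Rightarrow> real"
  assumes h: "h \<in> borel_measurable borel" "integrable tor (\<lambda>x. (h x)\<^sup>2)"
  shows "integrable tor h" "(LINT x|tor. \<bar>h x\<bar>)\<^sup>2 \<le> (LINT x|tor. (h x)\<^sup>2)"
proof -
  have m: "h \<in> borel_measurable tor" using h(1) by (rule measurable_tor)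
  show i: "integrable tor h"
  proof (rule Bochner_Integration.integrable_bound)
    show "integrable tor (\<lambda>x. 1 + (h x)\<^sup>2)" using h(2) by simp
    have "\<bar>t\<bar> \<le> \<bar>1 + t\<^sup>2\<bar>" for t :: real
      using sum_power2_ge_zero[of "\<bar>t\<bar> - 1" 0] abs_ge_zero[of t] by (simp add: power2_eq_square algebra_simps abs_if split: if_splits)
    then show "AE x in tor. norm (h x) \<le> norm (1 + (h x)\<^sup>2)" by simp
  qed (rule m)
  let ?m = "LINT x|tor. \<bar>h x\<bar>"
  have "0 \<le> (LINT x|tor. (\<bar>h x\<bar> - ?m)\<^sup>2)" by simp
  also have "\<dots> = (LINT x|tor. (h x)\<^sup>2 - 2 * ?m * \<bar>h x\<bar> + ?m\<^sup>2)"
    by (intro Bochner_Integration.integral_cong refl) (simp add: power2_eq_square algebra_simps)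
  also have "\<dots> = (LINT x|tor. (h x)\<^sup>2) - 2 * ?m * ?m + ?m\<^sup>2"
    using i h(2) by (simp add: tor.prob_space[simplified])
  finally show "?m\<^sup>2 \<le> (LINT x|tor. (h x)\<^sup>2)" by (simp add: power2_eq_square)
qed

lemma L2_mult:
  fixes g h :: "real ^ 'n::finite \<Rightarrow> real"
  assumes g: "g \<in> borel_measurable borel" "integrable tor (\<lambda>x. (g x)\<^sup>2)"
    and h: "h \<in> borel_measurable borel" "integrable tor (\<lambda>x. (h x)\<^sup>2)"
  shows "integrable tor (\<lambda>x. g x * h x)"
    "(LINT x|tor. \<bar>g x * h x\<bar>) \<le> sqrt (LINT x|tor. (g x)\<^sup>2) * sqrt (LINT x|tor. (h x)\<^sup>2)"
proof -
  have [measurable]: "g \<in> borel_measurable tor" "h \<in> borel_measurable tor" using g(1) h(1) by (auto intro: measurable_tor)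
  show i: "integrable tor (\<lambda>x. g x * h x)"
  proof (rule Bochner_Integration.integrable_bound)
    show "integrable tor (\<lambda>x. (g x)\<^sup>2 + (h x)\<^sup>2)" using g(2) h(2) by simp
    have "\<bar>a * b\<bar> \<le> a\<^sup>2 + b\<^sup>2" for a b :: real
    proof -
      have "2 * \<bar>a\<bar> * \<bar>b\<bar> \<le> \<bar>a\<bar>\<^sup>2 + \<bar>b\<bar>\<^sup>2" by (rule sum_squares_bound)
      moreover have "0 \<le> \<bar>a\<bar> * \<bar>b\<bar>" by simp
      ultimately show ?thesis unfolding abs_mult power2_abs mult.assoc by linarith
    qed
    then show "AE x in tor. norm (g x * h x) \<le> norm ((g x)\<^sup>2 + (h x)\<^sup>2)" by simp
  qed measurable
  let ?A = "LINT x|tor. (g x)\<^sup>2" and ?B = "LINT x|tor. (h x)\<^sup>2" and ?I = "LINT x|tor. \<bar>g x * h x\<bar>"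
  have "(\<integral>\<^sup>+x. ennreal \<bar>g x\<bar> * ennreal \<bar>h x\<bar> \<partial>tor)\<^sup>2
      \<le> (\<integral>\<^sup>+x. (ennreal \<bar>g x\<bar>)\<^sup>2 \<partial>tor) * (\<integral>\<^sup>+x. (ennreal \<bar>h x\<bar>)\<^sup>2 \<partial>tor)"
    by (rule Cauchy_Schwarz_nn_integral) measurable
  also have "(\<integral>\<^sup>+x. ennreal \<bar>g x\<bar> * ennreal \<bar>h x\<bar> \<partial>tor) = ennreal ?I"
    using integrable_abs[OF i] by (subst nn_integral_eq_integral[symmetric]) (auto simp: abs_mult ennreal_mult')
  also have "(\<integral>\<^sup>+x. (ennreal \<bar>g x\<bar>)\<^sup>2 \<partial>tor) = ennreal ?A"
    using g(2) by (subst nn_integral_eq_integral[symmetric]) (auto simp: ennreal_power)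
  also have "(\<integral>\<^sup>+x. (ennreal \<bar>h x\<bar>)\<^sup>2 \<partial>tor) = ennreal ?B"
    using h(2) by (subst nn_integral_eq_integral[symmetric]) (auto simp: ennreal_power)
  finally have "?I\<^sup>2 \<le> ?A * ?B" by (simp add: ennreal_power ennreal_mult'[symmetric])
  then have "?I \<le> sqrt (?A * ?B)" by (rule real_le_rsqrt)
  then show "?I \<le> sqrt ?A * sqrt ?B" by (simp add: real_sqrt_mult)
qed

lemma AE_summable_L1:
  fixes f :: "nat \<Rightarrow> 'a \<Rightarrow> real"
  assumes i: "\<And>k. integrable M (f k)" and s: "summable (\<lambda>k. LINT x|M. \<bar>f k x\<bar>)"
  shows "AE x in M. summable (\<lambda>k. \<bar>f k x\<bar>)"
proof -
  have [measurable]: "f k \<in> borel_measurable M" for k using i by auto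
  have "(\<integral>\<^sup>+x. (\<Sum>k. ennreal \<bar>f k x\<bar>) \<partial>M) = (\<Sum>k. \<integral>\<^sup>+x. ennreal \<bar>f k x\<bar> \<partial>M)"
    by (rule nn_integral_suminf) measurable
  also have "\<dots> = (\<Sum>k. ennreal (LINT x|M. \<bar>f k x\<bar>))"
    using i by (subst nn_integral_eq_integral) auto
  also have "\<dots> \<noteq> \<infinity>" using s by (simp add: ennreal_suminf_neq_top)
  finally have "AE x in M. (\<Sum>k. ennreal \<bar>f k x\<bar>) \<noteq> \<infinity>"
    by (intro nn_integral_PInf_AE) auto
  then show ?thesis by eventually_elim (auto intro: summable_suminf_not_top)
qed

text \<open>The coefficients of real-valued functions and of real distributions.\<close>

definition hermitian :: "(int ^ 'n \<Rightarrow> complex) \<Rightarrow> bool" where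
  "hermitian c \<longleftrightarrow> (\<forall>\<xi>. c (- \<xi>) = cnj (c \<xi>))"

lemma fc_rtp_hermitian:
  assumes "hermitian c" "finite A" "\<And>\<xi>. \<xi> \<in> A \<Longrightarrow> - \<xi> \<in> A"
  shows "fc (rtp A c) \<xi> = (if \<xi> \<in> A then c \<xi> else 0)"
proof -
  have "- \<xi> \<in> A \<longleftrightarrow> \<xi> \<in> A" using assms(3)[of \<xi>] assms(3)[of "- \<xi>"] by auto
  then show ?thesis using assms by (subst fc_rtp) (auto simp: hermitian_def)
qed

lemma of_real_rtp:
  assumes "hermitian c" "\<And>\<xi>. \<xi> \<in> A \<Longrightarrow> - \<xi> \<in> A"
  shows "complex_of_real (rtp A c x) = (\<Sum>\<xi>\<in>A. c \<xi> * ee \<xi> x)"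
proof -
  have "cnj (\<Sum>\<xi>\<in>A. c \<xi> * ee \<xi> x) = (\<Sum>\<xi>\<in>A. c (- \<xi>) * ee (- \<xi>) x)"
    using assms(1) by (simp add: hermitian_def ee_uminus)
  also have "\<dots> = (\<Sum>\<xi>\<in>A. c \<xi> * ee \<xi> x)"
    by (rule sum.reindex_bij_witness[of _ uminus uminus]) (auto simp: assms(2))
  finally have "(\<Sum>\<xi>\<in>A. c \<xi> * ee \<xi> x) \<in> \<real>" by (simp only: Reals_cnj_iff)
  then show ?thesis unfolding rtp_def by (rule of_real_Re)
qed

lemma integral_rtp_square:
  assumes "hermitian c" "finite A" "\<And>\<xi>. \<xi> \<in> A \<Longrightarrow> - \<xi> \<in> A"
  shows "integrable tor (\<lambda>x. (rtp A c x)\<^sup>2)" "(LINT x|tor. (rtp A c x)\<^sup>2) = (\<Sum>\<xi>\<in>A. (cmod (c \<xi>))\<^sup>2)"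
proof -
  have i: "integrable tor (rtp A c)"
    by (rule integrable_periodic_continuous[OF rtp_periodic continuous_rtp])
  note * = integral_mult_rtp[OF measurable_rtp i assms(2), of c]
  show "integrable tor (\<lambda>x. (rtp A c x)\<^sup>2)" using *(1) by (simp add: power2_eq_square)
  have "(LINT x|tor. (rtp A c x)\<^sup>2) = Re (\<Sum>\<xi>\<in>A. c \<xi> * cnj (fc (rtp A c) \<xi>))" using *(2) by (simp add: power2_eq_square)
  also have "\<dots> = (\<Sum>\<xi>\<in>A. (cmod (c \<xi>))\<^sup>2)"
  proof -
    have "Re (z * cnj z) = (cmod z)\<^sup>2" for z
      unfolding complex_norm_square[symmetric] by simp
    then show ?thesis
      unfolding Re_sum by (intro sum.cong) (simp_all only: fc_rtp_hermitian[OF assms] if_True)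
  qed
  finally show "(LINT x|tor. (rtp A c x)\<^sup>2) = (\<Sum>\<xi>\<in>A. (cmod (c \<xi>))\<^sup>2)" .
qed

lemma rtp_diff:
  assumes "finite B" "A \<subseteq> B" shows "rtp B c x - rtp A c x = rtp (B - A) c x"
  using sum_diff[OF assms, of "\<lambda>\<xi>. c \<xi> * ee \<xi> x"] by (simp add: rtp_def)

lemma tail_bound:
  assumes "w summable_on UNIV" "\<And>\<xi>. w \<xi> \<ge> 0" "M \<le> N"
  shows "(\<Sum>\<xi>\<in>Lam N - Lam M. w \<xi>) \<le> tail w M"
proof -
  have "(\<Sum>\<xi>\<in>Lam N - Lam M. w \<xi>) = (\<Sum>\<xi>\<in>Lam N. w \<xi>) - (\<Sum>\<xi>\<in>Lam M. w \<xi>)"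
    by (rule sum_diff) (use Lam_mono[OF assms(3)] in auto)
  also have "\<dots> = tail w M - tail w N" by (simp add: tail_eq assms)
  also have "\<dots> \<le> tail w M" using tail_nonneg[of w N] assms by simp
  finally show ?thesis .
qed

text \<open>Along a subsequence of cubes with tails at most \<open>(1/4)^k\<close>, consecutive
  differences have integral norm at most \<open>(1/2)^k\<close>, so the partial sums converge almost
  everywhere. Fatou's lemma along this subsequence then bounds the distance of the limit to the
  partial sum over every cube.\<close>

lemma riesz_fischer:
  fixes c :: "int ^ 'n::finite \<Rightarrow> complex"
  assumes c: "hermitian c" and s: "(\<lambda>\<xi>. (cmod (c \<xi>))\<^sup>2) summable_on UNIV"
  shows "\<exists>U. U \<in> borel_measurable borel \<and> (\<forall>x i. U (x + axis i 1) = U x) \<and> integrable tor (\<lambda>x. (U x)\<^sup>2)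
    \<and> (\<forall>N. integrable tor (\<lambda>x. (U x - rtp (Lam N) c x)\<^sup>2) \<and>
           (LINT x|tor. (U x - rtp (Lam N) c x)\<^sup>2) \<le> tail (\<lambda>\<xi>. (cmod (c \<xi>))\<^sup>2) N)"
proof -
  define w where "w = (\<lambda>\<xi>. (cmod (c \<xi>))\<^sup>2)"
  have w: "w summable_on UNIV" "\<And>\<xi>. w \<xi> \<ge> 0" using s by (auto simp: w_def)
  have L2: "integrable tor (\<lambda>x. (rtp (Lam N) c x - rtp (Lam M) c x)\<^sup>2)"
    "(LINT x|tor. (rtp (Lam N) c x - rtp (Lam M) c x)\<^sup>2) \<le> tail w M" if "M \<le> N" for M N
  proof -
    have eq: "rtp (Lam N) c x - rtp (Lam M) c x = rtp (Lam N - Lam M) c x" for x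
      by (rule rtp_diff) (use Lam_mono[OF that] in auto)
    show "integrable tor (\<lambda>x. (rtp (Lam N) c x - rtp (Lam M) c x)\<^sup>2)"
      unfolding eq by (rule integral_rtp_square[OF c]) auto
    have "(LINT x|tor. (rtp (Lam N) c x - rtp (Lam M) c x)\<^sup>2) = (\<Sum>\<xi>\<in>Lam N - Lam M. w \<xi>)"
      unfolding eq w_def by (rule integral_rtp_square[OF c]) auto
    then show "(LINT x|tor. (rtp (Lam N) c x - rtp (Lam M) c x)\<^sup>2) \<le> tail w M"
      using tail_bound[OF w that] by simp
  qed
  have "\<forall>k. \<exists>n. \<forall>N\<ge>n. tail w N < (1/4) ^ k"
  proof
    fix k :: nat
    show "\<exists>n. \<forall>N\<ge>n. tail w N < (1/4) ^ k"
      using order_tendstoD(2)[OF tail_tendsto[OF w(1)], of "(1/4) ^ k"] by (simp add: eventually_sequentially)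
  qed
  then obtain n where n: "\<And>k N. N \<ge> n k \<Longrightarrow> tail w N < (1/4) ^ k" by metis
  \<comment> \<open>The partial sums of \<open>n\<close> make the indices monotone and large enough
    for the tail bound; the summand k makes them unbounded.\<close>
  define \<sigma> where "\<sigma> k = k + (\<Sum>j\<le>k. n j)" for k
  have \<sigma>_mono: "\<sigma> k \<le> \<sigma> (Suc k)" and \<sigma>_ge: "\<sigma> k \<ge> k" for k by (auto simp: \<sigma>_def)
  have "n k \<le> \<sigma> k" for k
    using member_le_sum[of k "{..k}" n] by (auto simp: \<sigma>_def)
  then have tl: "tail w (\<sigma> k) \<le> (1/4) ^ k" for k using n less_imp_le by blast
  define f where "f k = (case k of 0 \<Rightarrow> rtp (Lam (\<sigma> 0)) c | Suc j \<Rightarrow> (\<lambda>x. rtp (Lam (\<sigma> (Suc j))) c x - rtp (Lam (\<sigma> j)) c x))" for k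
  have fsum: "(\<Sum>k<Suc K. f k x) = rtp (Lam (\<sigma> K)) c x" for K x
    by (induction K) (simp_all add: f_def)
  have fper: "f k (x + axis i 1) = f k x" for k x i by (simp add: f_def rtp_periodic split: nat.split)
  have fm: "f k \<in> borel_measurable borel" for k by (cases k) (auto simp: f_def)
  have fm': "f k \<in> borel_measurable tor" for k using fm by (rule measurable_tor)
  have irt: "integrable tor (rtp (Lam N) c)" for N
    by (rule integrable_periodic_continuous[OF rtp_periodic continuous_rtp])
  have fi: "integrable tor (f k)" for k using irt by (auto simp: f_def split: nat.split)
  have fb: "(LINT x|tor. \<bar>f (Suc k) x\<bar>) \<le> (1/2) ^ k" for k
  proof -
    have "(LINT x|tor. \<bar>f (Suc k) x\<bar>)\<^sup>2 \<le> (LINT x|tor. (f (Suc k) x)\<^sup>2)"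
      by (rule L2_L1(2)[OF fm]) (use L2(1)[OF \<sigma>_mono[of k]] in \<open>simp add: f_def\<close>)
    also have "\<dots> \<le> tail w (\<sigma> k)" using L2(2)[OF \<sigma>_mono[of k]] by (simp add: f_def)
    also have "\<dots> \<le> ((1/2) ^ k)\<^sup>2" using tl[of k] by (simp add: power2_eq_square flip: power_mult_distrib)
    finally show ?thesis by (rule power2_le_imp_le) simp
  qed
  have fs: "summable (\<lambda>k. LINT x|tor. \<bar>f k x\<bar>)"
  proof -
    have "summable (\<lambda>k. LINT x|tor. \<bar>f (Suc k) x\<bar>)"
      by (rule summable_comparison_test'[of "\<lambda>k. (1/2::real) ^ k" 0]) (use fb in auto)
    then show ?thesis by (subst (asm) summable_Suc_iff)
  qed
  have ae: "AE x in tor. summable (\<lambda>k. \<bar>f k x\<bar>)" by (rule AE_summable_L1[OF fi fs])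
  \<comment> \<open>Defined at every point, also where the series diverges: its value depends only
    on the sequence \<open>f k x\<close>, so periodicity holds everywhere and not just almost
    everywhere.\<close>
  define U where "U x = (\<Sum>k. f k x)" for x
  have Um: "U \<in> borel_measurable borel" unfolding U_def using fm by measurable
  have Um': "U \<in> borel_measurable tor" using Um by (rule measurable_tor)
  have conv: "AE x in tor. (\<lambda>k. rtp (Lam (\<sigma> k)) c x) \<longlonglongrightarrow> U x"
    using ae
  proof eventually_elim
    case (elim x)
    then have "summable (\<lambda>k. f k x)" by (rule summable_rabs_cancel)
    then have "(\<lambda>K. \<Sum>k<K. f k x) \<longlonglongrightarrow> U x" unfolding U_def by (rule summable_LIMSEQ)
    then have "(\<lambda>K. \<Sum>k<Suc K. f k x) \<longlonglongrightarrow> U x" by (rule LIMSEQ_Suc)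
    then show ?case by (simp only: fsum)
  qed
  have fatou: "(\<integral>\<^sup>+x. ennreal ((U x - rtp (Lam N) c x)\<^sup>2) \<partial>tor) \<le> ennreal (tail w N)" for N
  proof -
    let ?g = "\<lambda>k x. ennreal ((rtp (Lam (\<sigma> k)) c x - rtp (Lam N) c x)\<^sup>2)"
    have gm: "?g k \<in> borel_measurable tor" for k by (rule measurable_tor) measurable
    have "(\<integral>\<^sup>+x. ennreal ((U x - rtp (Lam N) c x)\<^sup>2) \<partial>tor) = (\<integral>\<^sup>+x. liminf (\<lambda>k. ?g k x) \<partial>tor)"
    proof (rule nn_integral_cong_AE)
      show "AE x in tor. ennreal ((U x - rtp (Lam N) c x)\<^sup>2) = liminf (\<lambda>k. ?g k x)"
        using conv
      proof eventually_elim
        case (elim x)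
        then have "(\<lambda>k. ?g k x) \<longlonglongrightarrow> ennreal ((U x - rtp (Lam N) c x)\<^sup>2)"
          by (intro tendsto_ennrealI tendsto_intros)
        then show ?case using lim_imp_Liminf[OF sequentially_bot] by metis
      qed
    qed
    also have "\<dots> \<le> liminf (\<lambda>k. \<integral>\<^sup>+x. ?g k x \<partial>tor)" by (rule nn_integral_liminf[OF gm])
    also have "\<dots> \<le> ennreal (tail w N)"
    proof (rule Liminf_le)
      have "(\<integral>\<^sup>+x. ?g k x \<partial>tor) \<le> ennreal (tail w N)" if "k \<ge> N" for k
      proof -
        have le: "N \<le> \<sigma> k" using \<sigma>_ge[of k] that by simp
        show ?thesis by (subst nn_integral_eq_integral) (use L2[OF le] in \<open>auto intro: ennreal_leI\<close>)
      qed
      then show "\<forall>\<^sub>F k in sequentially. (\<integral>\<^sup>+x. ?g k x \<partial>tor) \<le> ennreal (tail w N)"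
        by (auto simp: eventually_sequentially)
    qed simp
    finally show ?thesis .
  qed
  have int: "integrable tor (\<lambda>x. (U x - rtp (Lam N) c x)\<^sup>2)" for N
  proof (rule integrableI_bounded)
    show "(\<lambda>x. (U x - rtp (Lam N) c x)\<^sup>2) \<in> borel_measurable tor"
      by (intro measurable_tor borel_measurable_power borel_measurable_diff Um measurable_rtp)
    show "(\<integral>\<^sup>+x. ennreal (norm ((U x - rtp (Lam N) c x)\<^sup>2)) \<partial>tor) < \<infinity>"
      using fatou[of N] by (simp add: le_less_trans)
  qed
  have le: "(LINT x|tor. (U x - rtp (Lam N) c x)\<^sup>2) \<le> tail w N" for N
    using fatou[of N] int[of N] tail_nonneg[of w N] w(2)
    by (subst (asm) nn_integral_eq_integral) auto
  have "integrable tor (\<lambda>x. (U x)\<^sup>2)"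
  proof (rule Bochner_Integration.integrable_bound)
    show "integrable tor (\<lambda>x. 2 * (U x - rtp (Lam 0) c x)\<^sup>2 + 2 * (rtp (Lam 0) c x)\<^sup>2)"
      using int[of 0] integral_rtp_square(1)[OF c, of "Lam 0"] by simp
    have "a\<^sup>2 \<le> \<bar>2 * (a - b)\<^sup>2 + 2 * b\<^sup>2\<bar>" for a b :: real
      using sum_power2_ge_zero[of "a - 2 * b" 0] by (simp add: power2_eq_square algebra_simps abs_if)
    then show "AE x in tor. norm ((U x)\<^sup>2) \<le> norm (2 * (U x - rtp (Lam 0) c x)\<^sup>2 + 2 * (rtp (Lam 0) c x)\<^sup>2)"
      by simp
  qed (use Um' in measurable)
  then show ?thesis using Um int le fper by (intro exI[of _ U]) (auto simp: U_def w_def)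
qed

text \<open>A fixed representative, chosen because coefficients determine a square integrable
  function only up to null sets.\<close>

definition l2_fun :: "(int ^ 'n::finite \<Rightarrow> complex) \<Rightarrow> real ^ 'n \<Rightarrow> real" where
  "l2_fun c = (SOME U. U \<in> borel_measurable borel \<and> (\<forall>x i. U (x + axis i 1) = U x) \<and> integrable tor (\<lambda>x. (U x)\<^sup>2)
    \<and> (\<forall>N. integrable tor (\<lambda>x. (U x - rtp (Lam N) c x)\<^sup>2) \<and>
           (LINT x|tor. (U x - rtp (Lam N) c x)\<^sup>2) \<le> tail (\<lambda>\<xi>. (cmod (c \<xi>))\<^sup>2) N))"

context
  fixes c :: "int ^ 'n::finite \<Rightarrow> complex"
  assumes c: "hermitian c" and s: "(\<lambda>\<xi>. (cmod (c \<xi>))\<^sup>2) summable_on UNIV"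
begin

lemma l2_fun:
  shows l2_fun_measurable: "l2_fun c \<in> borel_measurable borel"
    and l2_fun_periodic: "l2_fun c (x + axis i 1) = l2_fun c x"
    and l2_fun_square: "integrable tor (\<lambda>x. (l2_fun c x)\<^sup>2)"
    and l2_fun_approx: "integrable tor (\<lambda>x. (l2_fun c x - rtp (Lam N) c x)\<^sup>2)"
      "(LINT x|tor. (l2_fun c x - rtp (Lam N) c x)\<^sup>2) \<le> tail (\<lambda>\<xi>. (cmod (c \<xi>))\<^sup>2) N"
  using someI_ex[OF riesz_fischer[OF c s]] unfolding l2_fun_def[symmetric] by blast+

lemma l2_fun_integrable: "integrable tor (l2_fun c)"
  by (rule L2_L1(1)[OF l2_fun_measurable l2_fun_square])

text \<open>Multiplication by a square integrable function turns the \<open>L\<^sub>2\<close> convergence of the Fourier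
  series of the other factor into convergence of the Fourier coefficients of the product.\<close>

lemma fc_l2_fun_mult:
  fixes V :: "real ^ 'n \<Rightarrow> real"
  assumes V: "V \<in> borel_measurable borel" "integrable tor (\<lambda>x. (V x)\<^sup>2)"
  shows "(\<lambda>N. \<Sum>\<eta>\<in>Lam N. c \<eta> * fc V (\<xi> - \<eta>)) \<longlonglongrightarrow> fc (\<lambda>x. l2_fun c x * V x) \<xi>"
proof -
  let ?U = "l2_fun c" and ?w = "\<lambda>\<xi>. (cmod (c \<xi>))\<^sup>2"
  have [measurable]: "?U \<in> borel_measurable borel" "V \<in> borel_measurable borel" by (fact l2_fun_measurable V)+
  have iV: "integrable tor V" by (rule L2_L1(1)[OF V])
  have iUV: "integrable tor (\<lambda>x. ?U x * V x)" by (rule L2_mult(1)[OF l2_fun_measurable l2_fun_square V])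
  have iRV: "integrable tor (\<lambda>x. rtp (Lam N) c x * V x)" for N
    by (rule L2_mult(1)[OF measurable_rtp integral_rtp_square(1)[OF c] V]) auto
  have eq: "fc (\<lambda>x. rtp (Lam N) c x * V x) \<xi> = (\<Sum>\<eta>\<in>Lam N. c \<eta> * fc V (\<xi> - \<eta>))" for N
  proof -
    have "complex_of_real (rtp (Lam N) c x * V x) * cnj (ee \<xi> x)
        = (\<Sum>\<eta>\<in>Lam N. c \<eta> * (complex_of_real (V x) * cnj (ee (\<xi> - \<eta>) x)))" for x
    proof -
      have r: "complex_of_real (rtp (Lam N) c x) = (\<Sum>\<xi>\<in>Lam N. c \<xi> * ee \<xi> x)"
        by (rule of_real_rtp[OF c]) simp
      show ?thesis unfolding of_real_mult r sum_distrib_right ee_diff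
        by (intro sum.cong refl) (simp add: mult_ac)
    qed
    then have "fc (\<lambda>x. rtp (Lam N) c x * V x) \<xi> = (LINT x|tor. (\<Sum>\<eta>\<in>Lam N. c \<eta> * (complex_of_real (V x) * cnj (ee (\<xi> - \<eta>) x))))"
      unfolding fc_def by (simp only:)
    also have "\<dots> = (\<Sum>\<eta>\<in>Lam N. LINT x|tor. c \<eta> * (complex_of_real (V x) * cnj (ee (\<xi> - \<eta>) x)))"
      by (intro Bochner_Integration.integral_sum integrable_mult_right integrable_fc iV) measurable
    finally show ?thesis by (simp add: fc_def)
  qed
  have "(\<lambda>N. fc (\<lambda>x. rtp (Lam N) c x * V x) \<xi>) \<longlonglongrightarrow> fc (\<lambda>x. ?U x * V x) \<xi>"
  proof (rule LIM_zero_cancel, rule Lim_null_comparison, rule always_eventually, rule allI)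
    fix N
    have "fc (\<lambda>x. rtp (Lam N) c x * V x) \<xi> - fc (\<lambda>x. ?U x * V x) \<xi>
        = fc (\<lambda>x. 1 * (rtp (Lam N) c x * V x) + (-1) * (?U x * V x)) \<xi>"
      by (subst fc_lin[OF iRV _ iUV]) simp_all
    also have "cmod \<dots> \<le> (LINT x|tor. \<bar>1 * (rtp (Lam N) c x * V x) + (-1) * (?U x * V x)\<bar>)" by (rule norm_fc_le)
    also have "\<dots> = (LINT x|tor. \<bar>(?U x - rtp (Lam N) c x) * V x\<bar>)"
      by (intro Bochner_Integration.integral_cong refl) (simp add: abs_minus_commute algebra_simps)
    also have "\<dots> \<le> sqrt (LINT x|tor. (?U x - rtp (Lam N) c x)\<^sup>2) * sqrt (LINT x|tor. (V x)\<^sup>2)"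
      by (rule L2_mult(2)[OF _ l2_fun_approx(1) V]) measurable
    also have "\<dots> \<le> sqrt (tail ?w N) * sqrt (LINT x|tor. (V x)\<^sup>2)"
      by (intro mult_right_mono real_sqrt_le_mono l2_fun_approx) auto
    finally show "cmod (fc (\<lambda>x. rtp (Lam N) c x * V x) \<xi> - fc (\<lambda>x. ?U x * V x) \<xi>)
        \<le> sqrt (tail ?w N) * sqrt (LINT x|tor. (V x)\<^sup>2)" .
  next
    have "(\<lambda>N. sqrt (tail ?w N)) \<longlonglongrightarrow> sqrt 0" by (intro tendsto_real_sqrt tail_tendsto s)
    then have "(\<lambda>N. sqrt (tail ?w N) * sqrt (LINT x|tor. (V x)\<^sup>2)) \<longlonglongrightarrow> sqrt 0 * sqrt (LINT x|tor. (V x)\<^sup>2)"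
      by (rule tendsto_mult_right)
    then show "(\<lambda>N. sqrt (tail ?w N) * sqrt (LINT x|tor. (V x)\<^sup>2)) \<longlonglongrightarrow> 0" by simp
  qed
  then show ?thesis by (simp only: eq)
qed

text \<open>The product formula above with \<open>V = 1\<close>, whose only nonzero coefficient is
  the one at frequency 0.\<close>

lemma fc_l2_fun: "fc (l2_fun c) \<xi> = c \<xi>"
proof -
  have one: "fc (\<lambda>x. 1 :: real) \<eta> = (if \<eta> = 0 then 1 else 0)" for \<eta> :: "int ^ 'n"
    unfolding fc_def using integral_ee[of "- \<eta>"] by (simp add: ee_uminus)
  have "(\<lambda>N. \<Sum>\<eta>\<in>Lam N. c \<eta> * fc (\<lambda>x. 1) (\<xi> - \<eta>)) \<longlonglongrightarrow> fc (\<lambda>x. l2_fun c x * 1) \<xi>"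
    by (rule fc_l2_fun_mult) simp_all
  moreover have "(\<Sum>\<eta>\<in>Lam N. c \<eta> * fc (\<lambda>x. 1) (\<xi> - \<eta>)) = (if \<xi> \<in> Lam N then c \<xi> else 0)" for N
    by (simp add: one if_distrib cong: if_cong)
  moreover have "(\<lambda>N. if \<xi> \<in> Lam N then c \<xi> else 0) \<longlonglongrightarrow> c \<xi>"
  proof (rule tendsto_eventually)
    obtain M where "\<xi> \<in> Lam M" using ex_Lam by blast
    then show "\<forall>\<^sub>F N in sequentially. (if \<xi> \<in> Lam N then c \<xi> else 0) = c \<xi>"
      using Lam_mono by (auto simp: eventually_sequentially intro!: exI[of _ M])
  qed
  ultimately show ?thesis by (simp add: LIMSEQ_unique)
qed

end

section \<open>Interpolation and the Sobolev inequality\<close>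

text \<open>If \<open>v\<close> splits at every dyadic level \<open>A\<close> into a part of size at most $D 2^{sA}$ and a part of
  size \<open>w A\<close>, choose \<open>A\<close> so that the first part is at most half of \<open>v\<close>.\<close>

lemma dyadic_split:
  fixes v D s \<theta> :: real and w :: "nat \<Rightarrow> real"
  assumes D: "D > 0" and s: "s > 0" and \<theta>: "\<theta> > 0"
    and split: "\<And>A. v \<le> D * 2 powr (s * real A) + w A"
  shows "v \<le> 2 * D \<or> (\<exists>A. v powr (\<theta> + 2 / s) \<le> (2 * D * 2 powr s) powr (2 / s) * 2 powr \<theta> * 4 ^ A * w A powr \<theta>)"
proof (rule disjCI)
  assume "\<not> (\<exists>A. v powr (\<theta> + 2 / s) \<le> (2 * D * 2 powr s) powr (2 / s) * 2 powr \<theta> * 4 ^ A * w A powr \<theta>)"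
  moreover have "\<exists>A. v powr (\<theta> + 2 / s) \<le> (2 * D * 2 powr s) powr (2 / s) * 2 powr \<theta> * 4 ^ A * w A powr \<theta>"
    if v: "v > 2 * D"
  proof -
    \<comment> \<open>The real level at which \<open>D * 2 powr (s * y)\<close> is exactly half of
      \<open>v\<close>; \<open>A\<close> is its integer part. The height is then comparable to
      \<open>2 powr (s * A)\<close>, and the exponent \<open>2 / s\<close> turns it into
      \<open>4 ^ A\<close>.\<close>
    define y where "y = log 2 (v / (2 * D)) / s"
    have v0: "v > 0" using v D by linarith
    have "v / (2 * D) > 1" using v D by (simp add: field_simps)
    then have y0: "y > 0" using s by (simp add: y_def)
    have yv: "2 powr (s * y) = v / (2 * D)" using s v0 D by (simp add: y_def)
    define A where "A = nat \<lfloor>y\<rfloor>"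
    have A: "real A \<le> y" "y < real A + 1" using y0 unfolding A_def by linarith+
    have "2 powr (s * real A) \<le> v / (2 * D)" unfolding yv[symmetric] using A s by (intro powr_mono) auto
    then have "D * 2 powr (s * real A) \<le> v / 2" using D by (simp add: field_simps)
    then have w: "v \<le> 2 * w A" using split[of A] by linarith
    then have w0: "w A > 0" using v0 by linarith
    have "v / (2 * D) \<le> 2 powr (s * (real A + 1))" unfolding yv[symmetric] using A s by (intro powr_mono mult_left_mono) auto
    then have "v \<le> 2 * D * 2 powr s * 2 powr (s * real A)"
      using D by (simp add: field_simps powr_add)
    then have "v powr (2 / s) \<le> (2 * D * 2 powr s * 2 powr (s * real A)) powr (2 / s)"
      using v0 s by (intro powr_mono2) auto
    also have "\<dots> = (2 * D * 2 powr s) powr (2 / s) * (2 powr (s * real A)) powr (2 / s)"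
      by (rule powr_mult)
    also have "(2 powr (s * real A)) powr (2 / s) = 4 ^ A"
    proof -
      have "(2 powr (s * real A)) powr (2 / s) = (2::real) powr (2 * real A)" using s by (simp add: powr_powr mult.commute)
      also have "\<dots> = (2 powr 2) powr real A" by (simp only: powr_powr)
      also have "\<dots> = 4 ^ A" by (simp add: powr_realpow)
      finally show ?thesis .
    qed
    finally have 1: "v powr (2 / s) \<le> (2 * D * 2 powr s) powr (2 / s) * 4 ^ A" .
    have "v powr \<theta> \<le> (2 * w A) powr \<theta>" using v0 w \<theta> by (intro powr_mono2) auto
    also have "\<dots> = 2 powr \<theta> * w A powr \<theta>" by (rule powr_mult)
    finally have 2: "v powr \<theta> \<le> 2 powr \<theta> * w A powr \<theta>" .
    have "v powr (\<theta> + 2 / s) = v powr (2 / s) * v powr \<theta>" by (simp add: powr_add)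
    also have "\<dots> \<le> ((2 * D * 2 powr s) powr (2 / s) * 4 ^ A) * (2 powr \<theta> * w A powr \<theta>)"
      by (intro mult_mono 1 2) auto
    finally show ?thesis by (intro exI[of _ A]) (simp add: mult_ac)
  qed
  ultimately show "v \<le> 2 * D" by fastforce
qed

text \<open>The level chosen by \<open>dyadic_split\<close> depends on the point, so its term is
  replaced by the sum over all levels, which can be integrated termwise. The Sobolev inequality is
  the case \<open>\<theta> = 2\<close>, fractional integration the case
  \<open>\<theta> = 1\<close>.\<close>

lemma dyadic_split_integrable:
  fixes v :: "real ^ 'n::finite \<Rightarrow> real" and w :: "nat \<Rightarrow> real ^ 'n \<Rightarrow> real"
  assumes D: "D > 0" and s: "s > 0" and \<theta>: "\<theta> > 0"
    and m: "v \<in> borel_measurable borel" "\<And>A. w A \<in> borel_measurable borel"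
    and split: "\<And>A. AE x in tor. \<bar>v x\<bar> \<le> D * 2 powr (s * real A) + w A x"
    and fin: "(\<Sum>A. 4 ^ A * (\<integral>\<^sup>+x. ennreal (w A x powr \<theta>) \<partial>tor)) < \<infinity>"
  shows "integrable tor (\<lambda>x. \<bar>v x\<bar> powr (\<theta> + 2 / s))"
proof (rule integrableI_bounded)
  have [measurable]: "v \<in> borel_measurable tor" "\<And>A. w A \<in> borel_measurable tor"
    using m measurable_tor by blast+
  show "(\<lambda>x. \<bar>v x\<bar> powr (\<theta> + 2 / s)) \<in> borel_measurable tor" by measurable
  let ?q = "\<theta> + 2 / s"
  define K where "K = (2 * D * 2 powr s) powr (2 / s) * 2 powr \<theta>"
  have K: "K \<ge> 0" by (simp add: K_def)
  have "AE x in tor. \<forall>A. \<bar>v x\<bar> \<le> D * 2 powr (s * real A) + w A x"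
    using split by (simp add: AE_all_countable)
  then have "AE x in tor. ennreal (\<bar>v x\<bar> powr ?q)
      \<le> ennreal ((2 * D) powr ?q) + ennreal K * (\<Sum>A. 4 ^ A * ennreal (w A x powr \<theta>))"
  proof eventually_elim
    case (elim x)
    then consider "\<bar>v x\<bar> \<le> 2 * D" | A where "\<bar>v x\<bar> powr ?q \<le> K * 4 ^ A * w A x powr \<theta>"
      using dyadic_split[OF D s \<theta>, of "\<bar>v x\<bar>" "\<lambda>A. w A x"] unfolding K_def by blast
    then show ?case
    proof cases
      case 1
      then have "\<bar>v x\<bar> powr ?q \<le> (2 * D) powr ?q" using s \<theta> by (intro powr_mono2) auto
      then have "ennreal (\<bar>v x\<bar> powr ?q) \<le> ennreal ((2 * D) powr ?q) + 0" by (simp add: ennreal_leI)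
      also have "\<dots> \<le> ennreal ((2 * D) powr ?q) + ennreal K * (\<Sum>A. 4 ^ A * ennreal (w A x powr \<theta>))"
        by (intro add_left_mono) simp
      finally show ?thesis .
    next
      case 2
      then have "ennreal (\<bar>v x\<bar> powr ?q) \<le> ennreal (K * 4 ^ A * w A x powr \<theta>)" by (rule ennreal_leI)
      also have "\<dots> = ennreal K * (4 ^ A * ennreal (w A x powr \<theta>))"
        using K by (simp add: ennreal_mult' mult.assoc ennreal_power[symmetric])
      also have "\<dots> \<le> ennreal K * (\<Sum>A. 4 ^ A * ennreal (w A x powr \<theta>))"
        by (intro mult_left_mono sum_le_suminf[of _ "{A}", simplified]) auto
      also have "\<dots> \<le> ennreal ((2 * D) powr ?q) + ennreal K * (\<Sum>A. 4 ^ A * ennreal (w A x powr \<theta>))" by simp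
      finally show ?thesis .
    qed
  qed
  then have "(\<integral>\<^sup>+x. ennreal (\<bar>v x\<bar> powr ?q) \<partial>tor)
      \<le> (\<integral>\<^sup>+x. ennreal ((2 * D) powr ?q) + ennreal K * (\<Sum>A. 4 ^ A * ennreal (w A x powr \<theta>)) \<partial>tor)"
    by (rule nn_integral_mono_AE)
  also have "\<dots> = ennreal ((2 * D) powr ?q) + ennreal K * (\<Sum>A. 4 ^ A * (\<integral>\<^sup>+x. ennreal (w A x powr \<theta>) \<partial>tor))"
    by (simp add: nn_integral_add nn_integral_cmult nn_integral_suminf tor.emeasure_space_1[simplified])
  also have "\<dots> < \<infinity>" using fin by (simp add: ennreal_mult_less_top)
  finally show "(\<integral>\<^sup>+x. ennreal (norm (\<bar>v x\<bar> powr ?q)) \<partial>tor) < \<infinity>" by simp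
qed

lemma sum_geometric_le:
  fixes y :: real
  assumes b: "b \<ge> 2" and "\<And>A. A \<in> X \<Longrightarrow> b ^ A \<le> y" "finite X" "y \<ge> 0"
  shows "(\<Sum>A\<in>X. b ^ A) \<le> 2 * y"
proof (cases "X = {}")
  case False
  define M where "M = Max X"
  have M: "M \<in> X" "X \<subseteq> {..M}" using False assms(3) by (auto simp: M_def)
  have "(\<Sum>A\<in>X. b ^ A) \<le> (\<Sum>A\<le>M. b ^ A)" using M b by (intro sum_mono2) auto
  also have "\<dots> \<le> 2 * b ^ M"
  proof (induction M)
    case (Suc M)
    have "2 * b ^ M \<le> b * b ^ M" using b by (intro mult_right_mono) auto
    then show ?case using Suc by simp
  qed simp
  also have "\<dots> \<le> 2 * y" using assms(2)[OF M(1)] by simp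
  finally show ?thesis .
qed (use assms in simp)

lemma has_sum_finite_sum:
  fixes f :: "'i \<Rightarrow> 'a \<Rightarrow> 'b::topological_comm_monoid_add"
  assumes "finite I" "\<And>i. i \<in> I \<Longrightarrow> (f i has_sum s i) A"
  shows "((\<lambda>x. \<Sum>i\<in>I. f i x) has_sum (\<Sum>i\<in>I. s i)) A"
  using assms by (induction I rule: finite_induct) (auto intro: has_sum_add)

text \<open>After exchanging the sums, a frequency is counted with those \<open>4 ^ A\<close> for
  which it lies outside the cube of half-width \<open>2 ^ A\<close>. This forces
  \<open>4 ^ A <= |\<xi>|^2\<close>, and a geometric sum is at most twice its largest term.\<close>

lemma sum_tail_le:
  fixes w :: "int ^ 'n::finite \<Rightarrow> real"
  assumes w: "\<And>\<xi>. w \<xi> \<ge> 0" and s: "(\<lambda>\<xi>. (1 + (norm (freq \<xi>))\<^sup>2) * w \<xi>) summable_on UNIV"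
  shows "(\<Sum>A\<le>K. 4 ^ A * tail w (2 ^ A)) \<le> 2 * (\<Sum>\<^sub>\<infinity>\<xi>. (1 + (norm (freq \<xi>))\<^sup>2) * w \<xi>)"
proof -
  let ?W = "\<lambda>\<xi>. (1 + (norm (freq \<xi>))\<^sup>2) * w \<xi>"
  have ws: "w summable_on X" for X
    by (rule summable_on_comparison_test[OF summable_on_subset_banach[OF s, of X]])
       (auto simp: w algebra_simps)
  have W0: "?W \<xi> \<ge> 0" for \<xi> using w by simp
  have t: "tail w N = (\<Sum>\<^sub>\<infinity>\<xi>. if \<xi> \<in> Lam N then 0 else w \<xi>)" for N
    unfolding tail_def by (rule infsum_cong_neutral) auto
  have ts: "(\<lambda>\<xi>. if \<xi> \<in> Lam N then 0 else w \<xi>) summable_on UNIV" for N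
    by (rule summable_on_comparison_test[OF ws]) (auto simp: w)
  have "((\<lambda>\<xi>. 4 ^ A * (if \<xi> \<in> Lam (2 ^ A) then 0 else w \<xi>)) has_sum
      (\<Sum>\<^sub>\<infinity>\<xi>. 4 ^ A * (if \<xi> \<in> Lam (2 ^ A) then 0 else w \<xi>))) UNIV" for A
    by (intro has_sum_infsum summable_on_cmult_right ts)
  note hsum = has_sum_finite_sum[OF finite_atMost[of K] this]
  have "(\<Sum>A\<le>K. 4 ^ A * tail w (2 ^ A)) = (\<Sum>A\<le>K. \<Sum>\<^sub>\<infinity>\<xi>. 4 ^ A * (if \<xi> \<in> Lam (2 ^ A) then 0 else w \<xi>))"
    unfolding t by (intro sum.cong refl infsum_cmult_right[symmetric] ts)
  also have "\<dots> = (\<Sum>\<^sub>\<infinity>\<xi>. \<Sum>A\<le>K. 4 ^ A * (if \<xi> \<in> Lam (2 ^ A) then 0 else w \<xi>))"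
    by (rule infsumI[OF hsum, symmetric])
  also have "\<dots> \<le> (\<Sum>\<^sub>\<infinity>\<xi>. 2 * ?W \<xi>)"
  proof (rule infsum_mono)
    show "(\<lambda>\<xi>. \<Sum>A\<le>K. 4 ^ A * (if \<xi> \<in> Lam (2 ^ A) then 0 else w \<xi>)) summable_on UNIV"
      by (rule has_sum_imp_summable[OF hsum])
    show "(\<lambda>\<xi>. 2 * ?W \<xi>) summable_on UNIV" by (intro summable_on_cmult_right s)
    fix \<xi>
    have "(\<Sum>A\<le>K. 4 ^ A * (if \<xi> \<in> Lam (2 ^ A) then 0 else w \<xi>)) = (\<Sum>A\<in>{A. A \<le> K \<and> \<xi> \<notin> Lam (2 ^ A)}. 4 ^ A) * w \<xi>"
      unfolding sum_distrib_right by (rule sum.mono_neutral_cong_right) auto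
    also have "\<dots> \<le> (2 * (1 + (norm (freq \<xi>))\<^sup>2)) * w \<xi>"
    proof (intro mult_right_mono w sum_geometric_le)
      fix A assume "A \<in> {A. A \<le> K \<and> \<xi> \<notin> Lam (2 ^ A)}"
      then obtain i where "\<bar>\<xi> $ i\<bar> > 2 ^ A" by (auto simp: Lam_def not_le)
      then have "(2::real) ^ A < real_of_int \<bar>\<xi> $ i\<bar>" by (metis of_int_less_iff of_int_numeral of_int_power)
      also have "\<dots> = \<bar>freq \<xi> $ i\<bar>" by simp
      also have "\<dots> \<le> norm (freq \<xi>)" by (rule component_le_norm_cart)
      finally have "((2::real) ^ A)\<^sup>2 \<le> (norm (freq \<xi>))\<^sup>2" by (intro power_mono) auto
      then show "(4::real) ^ A \<le> 1 + (norm (freq \<xi>))\<^sup>2" by (simp add: power2_eq_square flip: power_mult_distrib)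
    qed auto
    finally show "(\<Sum>A\<le>K. 4 ^ A * (if \<xi> \<in> Lam (2 ^ A) then 0 else w \<xi>)) \<le> 2 * ?W \<xi>" by (simp only: mult.assoc)
  qed
  also have "\<dots> = 2 * (\<Sum>\<^sub>\<infinity>\<xi>. ?W \<xi>)" by (rule infsum_cmult_right) (use s in simp)
  finally show ?thesis .
qed

text \<open>A dyadic shell has at most \<open>(5 * 2 ^ A) ^ m\<close> points, each of weight at most
  \<open>1 / 4 ^ A\<close>, hence contributes \<open>5 ^ m * 2 ^ (A * (m - 2))\<close>. Since m is
  at least 3 these contributions at least double from shell to shell, so the last one
  dominates.\<close>

lemma sum_inverse_weight:
  assumes m: "m \<ge> CARD('n::finite)" "m \<ge> 3"
  shows "(\<Sum>\<xi>\<in>(Lam (2 ^ A) :: (int ^ 'n) set). 1 / (1 + (norm (freq \<xi>))\<^sup>2)) \<le> (3 ^ m + 5 ^ m) * 2 ^ (A * (m - 2))"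
proof (induction A)
  case 0
  have "(\<Sum>\<xi>\<in>(Lam (2 ^ 0) :: (int ^ 'n) set). 1 / (1 + (norm (freq \<xi>))\<^sup>2)) \<le> (\<Sum>\<xi>\<in>(Lam (2 ^ 0) :: (int ^ 'n) set). 1)"
    by (intro sum_mono) (simp add: divide_le_eq_1_pos add_pos_nonneg)
  also have "\<dots> \<le> real (3 ^ CARD('n))" using card_Lam[where N = 1 and 'n = 'n] by (simp flip: of_nat_power)
  also have "\<dots> \<le> 3 ^ m" using m by (simp add: power_increasing)
  finally have "(\<Sum>\<xi>\<in>(Lam (2 ^ 0) :: (int ^ 'n) set). 1 / (1 + (norm (freq \<xi>))\<^sup>2)) \<le> 3 ^ m" .
  from add_increasing2[OF _ this, of "5 ^ m"] show ?case by simp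
next
  case (Suc A)
  let ?L = "\<lambda>A. Lam (2 ^ A) :: (int ^ 'n) set" and ?f = "\<lambda>\<xi> :: int ^ 'n. 1 / (1 + (norm (freq \<xi>))\<^sup>2)"
  have sub: "?L A \<subseteq> ?L (Suc A)" by (rule Lam_mono) simp
  have "sum ?f (?L (Suc A)) = sum ?f (?L A) + sum ?f (?L (Suc A) - ?L A)"
    using sum.subset_diff[OF sub, of ?f] by simp
  also have "sum ?f (?L (Suc A) - ?L A) \<le> (\<Sum>\<xi>\<in>?L (Suc A) - ?L A. 1 / 4 ^ A)"
  proof (rule sum_mono)
    fix \<xi> assume "\<xi> \<in> ?L (Suc A) - ?L A"
    then obtain i where "\<bar>\<xi> $ i\<bar> > 2 ^ A" by (auto simp: Lam_def not_le)
    then have "(2::real) ^ A < real_of_int \<bar>\<xi> $ i\<bar>" by (metis of_int_less_iff of_int_numeral of_int_power)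
    also have "\<dots> = \<bar>freq \<xi> $ i\<bar>" by simp
    also have "\<dots> \<le> norm (freq \<xi>)" by (rule component_le_norm_cart)
    finally have "((2::real) ^ A)\<^sup>2 \<le> (norm (freq \<xi>))\<^sup>2" by (intro power_mono) auto
    then have "(4::real) ^ A \<le> 1 + (norm (freq \<xi>))\<^sup>2" by (simp add: power2_eq_square flip: power_mult_distrib)
    then show "?f \<xi> \<le> 1 / 4 ^ A" by (intro divide_left_mono mult_pos_pos add_pos_nonneg) auto
  qed
  also have "\<dots> \<le> real (card (?L (Suc A))) / 4 ^ A"
  proof -
    have "card (?L (Suc A) - ?L A) \<le> card (?L (Suc A))" by (intro card_mono) auto
    then show ?thesis by (simp add: divide_right_mono)
  qed
  also have "real (card (?L (Suc A))) \<le> (5 * 2 ^ A) ^ m"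
  proof -
    have "card (?L (Suc A)) \<le> (2 * 2 ^ Suc A + 1) ^ CARD('n)" by (rule card_Lam)
    also have "\<dots> \<le> (5 * 2 ^ A) ^ CARD('n)" by (intro power_mono) auto
    also have "\<dots> \<le> (5 * 2 ^ A) ^ m" using m by (intro power_increasing) auto
    finally show ?thesis by (simp flip: of_nat_power) (metis (mono_tags) of_nat_le_iff of_nat_mult of_nat_numeral of_nat_power)
  qed
  also have "(5 * 2 ^ A) ^ m / 4 ^ A = (5 ^ m * 2 ^ (A * (m - 2)) :: real)"
  proof -
    have "(2::real) ^ (A * m) = 2 ^ (A * (m - 2)) * 4 ^ A"
    proof -
      have "A * m = A * (m - 2) + 2 * A" using m by (cases m) (auto simp: algebra_simps diff_mult_distrib2)
      then show ?thesis by (simp add: power_add power_mult)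
    qed
    then show ?thesis by (simp add: power_mult_distrib power_mult[symmetric])
  qed
  finally have "sum ?f (?L (Suc A)) \<le> (3 ^ m + 5 ^ m) * 2 ^ (A * (m - 2)) + 5 ^ m * 2 ^ (A * (m - 2))"
    using Suc by (simp add: divide_right_mono)
  also have "\<dots> \<le> (3 ^ m + 5 ^ m) * (2 * 2 ^ (A * (m - 2)))"
    by (simp add: algebra_simps)
  also have "\<dots> \<le> (3 ^ m + 5 ^ m) * 2 ^ (Suc A * (m - 2))"
  proof (intro mult_left_mono)
    have "(2::real) * 2 ^ (A * (m - 2)) = 2 ^ Suc (A * (m - 2))" by simp
    also have "\<dots> \<le> 2 ^ (Suc A * (m - 2))" using m by (intro power_increasing) auto
    finally show "(2::real) * 2 ^ (A * (m - 2)) \<le> 2 ^ (Suc A * (m - 2))" .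
  qed simp
  finally show ?case .
qed

text \<open>The low frequencies are bounded pointwise by Cauchy-Schwarz against the weight, with
  growth \<open>2 powr (t * A)\<close> for \<open>t = (m - 2) / 2\<close>; the high ones are
  measured in \<open>L_2\<close> by the tails. With \<open>\<theta> = 2\<close> the interpolation
  gives the exponent \<open>2 + 2 / t = 2 m / (m - 2)\<close>.\<close>

lemma sobolev:
  fixes c :: "int ^ 'n::finite \<Rightarrow> complex"
  assumes c: "hermitian c" and s: "(\<lambda>\<xi>. (1 + (norm (freq \<xi>))\<^sup>2) * (cmod (c \<xi>))\<^sup>2) summable_on UNIV"
    and m: "m \<ge> CARD('n)" "m \<ge> 3"
  shows "integrable tor (\<lambda>x. \<bar>l2_fun c x\<bar> powr (2 * real m / (real m - 2)))"
proof -
  define w where "w \<xi> = (cmod (c \<xi>))\<^sup>2" for \<xi>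
  define W where "W = (\<Sum>\<^sub>\<infinity>\<xi>. (1 + (norm (freq \<xi>))\<^sup>2) * w \<xi>)"
  have s': "(\<lambda>\<xi>. (1 + (norm (freq \<xi>))\<^sup>2) * w \<xi>) summable_on UNIV" using s by (simp add: w_def)
  have W0: "W \<ge> 0" unfolding W_def by (rule infsum_nonneg) (simp add: w_def)
  have ws: "(\<lambda>\<xi>. (cmod (c \<xi>))\<^sup>2) summable_on UNIV"
    by (rule summable_on_comparison_test[OF s]) (auto simp: algebra_simps)
  \<comment> \<open>The summand 1 keeps \<open>D\<close> positive when all coefficients
    vanish.\<close>
  define D where "D = sqrt ((3 ^ m + 5 ^ m) * (W + 1))"
  have D: "D > 0" using W0 by (simp add: D_def add_pos_pos)
  define t where "t = (real m - 2) / 2"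
  have t: "t > 0" using m by (simp add: t_def)
  have low: "\<bar>rtp (Lam (2 ^ A)) c x\<bar> \<le> D * 2 powr (t * real A)" for A x
  proof -
    let ?L = "Lam (2 ^ A) :: (int ^ 'n) set"
    have "(\<Sum>\<xi>\<in>?L. cmod (c \<xi>))\<^sup>2
        = (\<Sum>\<xi>\<in>?L. (1 / sqrt (1 + (norm (freq \<xi>))\<^sup>2)) * (sqrt (1 + (norm (freq \<xi>))\<^sup>2) * cmod (c \<xi>)))\<^sup>2"
      by (intro arg_cong[where f = "\<lambda>x. x\<^sup>2"] sum.cong refl) (simp add: add_pos_nonneg less_imp_neq[symmetric])
    also have "\<dots> \<le> (\<Sum>\<xi>\<in>?L. (1 / sqrt (1 + (norm (freq \<xi>))\<^sup>2))\<^sup>2) * (\<Sum>\<xi>\<in>?L. (sqrt (1 + (norm (freq \<xi>))\<^sup>2) * cmod (c \<xi>))\<^sup>2)"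
      using Convex.Cauchy_Schwarz_ineq_sum[of "\<lambda>\<xi>. 1 / sqrt (1 + (norm (freq \<xi>))\<^sup>2)" "\<lambda>\<xi>. sqrt (1 + (norm (freq \<xi>))\<^sup>2) * cmod (c \<xi>)" "?L"] .
    also have "\<dots> = (\<Sum>\<xi>\<in>?L. 1 / (1 + (norm (freq \<xi>))\<^sup>2)) * (\<Sum>\<xi>\<in>?L. (1 + (norm (freq \<xi>))\<^sup>2) * w \<xi>)"
      by (simp add: power_divide power_mult_distrib w_def)
    also have "\<dots> \<le> ((3 ^ m + 5 ^ m) * 2 ^ (A * (m - 2))) * (W + 1)"
    proof (intro mult_mono sum_inverse_weight m sum_nonneg)
      have "(\<Sum>\<xi>\<in>?L. (1 + (norm (freq \<xi>))\<^sup>2) * w \<xi>) \<le> W"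
        unfolding W_def by (rule finite_sum_le_infsum[OF s']) (auto simp: w_def)
      then show "(\<Sum>\<xi>\<in>?L. (1 + (norm (freq \<xi>))\<^sup>2) * w \<xi>) \<le> W + 1" by simp
    qed (auto simp: w_def)
    also have "\<dots> = (D * 2 powr (t * real A))\<^sup>2"
    proof -
      have "(2 powr (t * real A))\<^sup>2 = (2::real) powr (2 * (t * real A))"
        by (simp add: power2_eq_square powr_add[symmetric])
      also have "2 * (t * real A) = real (A * (m - 2))" using m by (simp add: t_def of_nat_diff)
      also have "(2::real) powr real (A * (m - 2)) = 2 ^ (A * (m - 2))" by (rule powr_realpow) simp
      finally show ?thesis using W0 by (simp add: D_def power_mult_distrib)
    qed
    finally have "(\<Sum>\<xi>\<in>Lam (2 ^ A). cmod (c \<xi>)) \<le> D * 2 powr (t * real A)"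
      by (rule power2_le_imp_le) (use D in simp)
    then show ?thesis using rtp_bound[of "Lam (2 ^ A)" c x] by linarith
  qed
  have "integrable tor (\<lambda>x. \<bar>l2_fun c x\<bar> powr (2 + 2 / t))"
  proof (rule dyadic_split_integrable[OF D t, of 2 "l2_fun c" "\<lambda>A x. \<bar>l2_fun c x - rtp (Lam (2 ^ A)) c x\<bar>"])
    show "l2_fun c \<in> borel_measurable borel" by (rule l2_fun_measurable[OF c ws])
    then show "(\<lambda>x. \<bar>l2_fun c x - rtp (Lam (2 ^ A)) c x\<bar>) \<in> borel_measurable borel" for A
      by (intro borel_measurable_abs borel_measurable_diff measurable_rtp)
    show "AE x in tor. \<bar>l2_fun c x\<bar> \<le> D * 2 powr (t * real A) + \<bar>l2_fun c x - rtp (Lam (2 ^ A)) c x\<bar>" for A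
    proof (rule AE_I2)
      fix x show "\<bar>l2_fun c x\<bar> \<le> D * 2 powr (t * real A) + \<bar>l2_fun c x - rtp (Lam (2 ^ A)) c x\<bar>"
        using low[of A x] by linarith
    qed
    have int: "(\<integral>\<^sup>+x. ennreal (\<bar>l2_fun c x - rtp (Lam (2 ^ A)) c x\<bar> powr 2) \<partial>tor) \<le> ennreal (tail w (2 ^ A))" for A
    proof -
      have "(\<integral>\<^sup>+x. ennreal (\<bar>l2_fun c x - rtp (Lam (2 ^ A)) c x\<bar> powr 2) \<partial>tor)
          = (\<integral>\<^sup>+x. ennreal ((l2_fun c x - rtp (Lam (2 ^ A)) c x)\<^sup>2) \<partial>tor)" by simp
      also have "\<dots> = ennreal (LINT x|tor. (l2_fun c x - rtp (Lam (2 ^ A)) c x)\<^sup>2)"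
        by (rule nn_integral_eq_integral[OF l2_fun_approx(1)[OF c ws]]) simp
      also have "\<dots> \<le> ennreal (tail w (2 ^ A))"
        using l2_fun_approx(2)[OF c ws, of "2 ^ A"] by (simp add: w_def[abs_def] ennreal_leI)
      finally show ?thesis .
    qed
    have "(\<Sum>A. 4 ^ A * (\<integral>\<^sup>+x. ennreal (\<bar>l2_fun c x - rtp (Lam (2 ^ A)) c x\<bar> powr 2) \<partial>tor)) \<le> ennreal (2 * W)"
    proof (rule suminf_le_const[OF summableI])
      fix K
      have "(\<Sum>A<K. 4 ^ A * (\<integral>\<^sup>+x. ennreal (\<bar>l2_fun c x - rtp (Lam (2 ^ A)) c x\<bar> powr 2) \<partial>tor))
         \<le> (\<Sum>A\<le>K. 4 ^ A * (\<integral>\<^sup>+x. ennreal (\<bar>l2_fun c x - rtp (Lam (2 ^ A)) c x\<bar> powr 2) \<partial>tor))"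
        by (rule sum_mono2) auto
      also have "\<dots> \<le> (\<Sum>A\<le>K. 4 ^ A * ennreal (tail w (2 ^ A)))"
        by (intro sum_mono mult_left_mono int) auto
      also have "\<dots> = ennreal (\<Sum>A\<le>K. 4 ^ A * tail w (2 ^ A))"
        by (simp add: sum_ennreal[symmetric] tail_nonneg w_def ennreal_mult' ennreal_power[symmetric])
      also have "\<dots> \<le> ennreal (2 * W)"
        unfolding W_def by (intro ennreal_leI sum_tail_le s') (simp add: w_def)
      finally show "(\<Sum>A<K. 4 ^ A * (\<integral>\<^sup>+x. ennreal (\<bar>l2_fun c x - rtp (Lam (2 ^ A)) c x\<bar> powr 2) \<partial>tor)) \<le> ennreal (2 * W)" .
    qed
    also have "\<dots> < \<infinity>" by simp
    finally show "(\<Sum>A. 4 ^ A * (\<integral>\<^sup>+x. ennreal (\<bar>l2_fun c x - rtp (Lam (2 ^ A)) c x\<bar> powr 2) \<partial>tor)) < \<infinity>" .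
  qed simp
  moreover have "2 + 2 / t = 2 * real m / (real m - 2)" using m by (simp add: t_def field_simps)
  ultimately show ?thesis by simp
qed

section \<open>Gaussian averages of trigonometric polynomials\<close>

lemma integrable_gauss_bounded:
  fixes f :: "real \<Rightarrow> 'b::{banach, second_countable_topology}"
  assumes f: "f \<in> borel_measurable borel" "\<And>z. norm (f z) \<le> B"
  shows "integrable lborel (\<lambda>z. std_normal_density z *\<^sub>R f z)"
    "integrable lborel (\<lambda>z. (std_normal_density z * z) *\<^sub>R f z)"
proof -
  have [measurable]: "f \<in> borel_measurable borel" by fact
  have B: "B \<ge> 0" by (rule order_trans[OF norm_ge_zero f(2)[of 0]])
  show "integrable lborel (\<lambda>z. std_normal_density z *\<^sub>R f z)"
  proof (rule Bochner_Integration.integrable_bound)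
    show "integrable lborel (\<lambda>z. std_normal_density z * B)" by simp
    show "AE z in lborel. norm (std_normal_density z *\<^sub>R f z) \<le> norm (std_normal_density z * B)"
      using f(2) B by (intro AE_I2) (simp add: abs_mult mult_left_mono)
  qed measurable
  show "integrable lborel (\<lambda>z. (std_normal_density z * z) *\<^sub>R f z)"
  proof (rule Bochner_Integration.integrable_bound)
    show "integrable lborel (\<lambda>z. std_normal_density z * \<bar>z\<bar> * B)"
      using integrable_std_normal_moment_abs[of 1] by simp
    show "AE z in lborel. norm ((std_normal_density z * z) *\<^sub>R f z) \<le> norm (std_normal_density z * \<bar>z\<bar> * B)"
      using f(2) B by (intro AE_I2) (simp add: abs_mult mult_left_mono)
  qed measurable
qed

lemma measurable_cis [measurable]: "(\<lambda>z. cis (s * z)) \<in> borel_measurable borel"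
  by (intro borel_measurable_continuous_onI continuous_intros)

lemma isCont_cis: "isCont (\<lambda>z. cis (s * z)) z"
proof -
  have "continuous_on UNIV (\<lambda>z. cis (s * z))" by (intro continuous_intros)
  then show ?thesis by (simp add: continuous_on_eq_continuous_at)
qed

lemma integrable_gauss_cis:
  "integrable lborel (\<lambda>z. std_normal_density z *\<^sub>R cis (s * z))"
  "integrable lborel (\<lambda>z. (std_normal_density z * z) *\<^sub>R cis (s * z))"
  by (intro integrable_gauss_bounded[where B = 1]; simp)+

lemma gauss_cis:
  "(LINT z|lborel. std_normal_density z *\<^sub>R cis (s * z)) = of_real (exp (- s\<^sup>2 / 2))"
proof -
  have "char std_normal_distribution s = (LINT z|std_normal_distribution. cis (s * z))"
    by (simp add: char_def cis_conv_exp mult_ac)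
  also have "\<dots> = (LINT z|lborel. std_normal_density z *\<^sub>R cis (s * z))"
    by (rule integral_density) auto
  finally show ?thesis by (simp add: char_std_normal_distribution)
qed

lemma std_normal_density_tendsto:
  "(std_normal_density \<longlongrightarrow> 0) at_top" "(std_normal_density \<longlongrightarrow> 0) at_bot"
  unfolding std_normal_density_def by real_asymp+

text \<open>The derivative of \<open>F\<close> is \<open>\<i> s\<close> times the integrand of
  \<open>gauss_cis\<close> minus the present integrand. \<open>F\<close> vanishes at both ends of
  the line, so the two integrals agree up to the factor \<open>\<i> s\<close>.\<close>

lemma gauss_mult_cis:
  "(LINT z|lborel. (std_normal_density z * z) *\<^sub>R cis (s * z)) = \<i> * of_real (s * exp (- s\<^sup>2 / 2))"
proof -
  let ?\<phi> = std_normal_density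
  define F where "F z = ?\<phi> z *\<^sub>R cis (s * z)" for z
  define f where "f z = (\<i> * of_real s) * (?\<phi> z *\<^sub>R cis (s * z)) - (?\<phi> z * z) *\<^sub>R cis (s * z)" for z
  have d\<phi>: "(?\<phi> has_real_derivative - z * ?\<phi> z) (at z)" for z
    unfolding std_normal_density_def[abs_def]
    by (auto intro!: derivative_eq_intros simp: field_simps)
  have dF: "(F has_vector_derivative f z) (at z)" for z
  proof -
    have "((\<lambda>z. cis (s * z)) has_derivative (\<lambda>t. (s * t) *\<^sub>R (\<i> * cis (s * z)))) (at z)"
      by (rule has_derivative_cis) (auto intro!: derivative_eq_intros)
    then have "((\<lambda>z. cis (s * z)) has_vector_derivative s *\<^sub>R (\<i> * cis (s * z))) (at z)"
      by (simp add: has_vector_derivative_def mult.commute)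
    from has_vector_derivative_scaleR[OF d\<phi> this] show ?thesis
      by (simp add: F_def[abs_def] f_def scaleR_conv_of_real algebra_simps)
  qed
  have i1: "integrable lborel (\<lambda>z. ?\<phi> z *\<^sub>R cis (s * z))" and i2: "integrable lborel (\<lambda>z. (?\<phi> z * z) *\<^sub>R cis (s * z))"
    by (rule integrable_gauss_cis)+
  have fi: "integrable lborel f" unfolding f_def by (intro Bochner_Integration.integrable_diff integrable_mult_right i1 i2)
  have normF: "norm (F z) = ?\<phi> z" for z by (simp add: F_def)
  have "(LBINT z=-\<infinity>..\<infinity>. f z) = 0 - 0"
  proof (rule interval_integral_FTC_integrable)
    have c\<phi>: "isCont ?\<phi> z" for z by (rule DERIV_isCont[OF d\<phi>])
    show "isCont f z" for z unfolding f_def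
      by (intro continuous_diff continuous_mult continuous_scaleR continuous_const c\<phi> continuous_ident isCont_cis)
    show "set_integrable lborel (einterval (- \<infinity>) \<infinity>) f" using fi by (simp add: set_integrable_def)
    have "(F \<longlongrightarrow> 0) at_bot"
      by (rule tendsto_norm_zero_cancel) (simp only: normF std_normal_density_tendsto(2))
    then show "((F \<circ> real_of_ereal) \<longlongrightarrow> 0) (at_right (- \<infinity>))"
      unfolding ereal_tendsto_simps .
    have "(F \<longlongrightarrow> 0) at_top"
      by (rule tendsto_norm_zero_cancel) (simp only: normF std_normal_density_tendsto(1))
    then show "((F \<circ> real_of_ereal) \<longlongrightarrow> 0) (at_left \<infinity>)"
      unfolding ereal_tendsto_simps .
  qed (use dF in auto)
  then have "(LINT z|lborel. f z) = 0"
    by (simp add: interval_lebesgue_integral_def set_lebesgue_integral_def)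
  moreover have "(LINT z|lborel. f z) = (\<i> * of_real s) * (LINT z|lborel. ?\<phi> z *\<^sub>R cis (s * z)) - (LINT z|lborel. (?\<phi> z * z) *\<^sub>R cis (s * z))"
    unfolding f_def by (simp only: Bochner_Integration.integral_diff[OF integrable_mult_right[OF i1] i2] integral_mult_right_zero)
  ultimately show ?thesis by (simp add: gauss_cis mult.assoc)
qed

text \<open>Averaging translates in direction i against the Gaussian density multiplies the
  coefficients by a Gaussian and cannot enlarge the supremum. Averaging against z times the density
  also produces the factor of a derivative; the first absolute moment \<open>sqrt (2 / pi)\<close>
  is below 1, so the bound stays \<open>M\<close>. The second claim is the value at the origin,
  which is all that the pairing in \<open>piece_L1\<close> needs.\<close>

lemma gauss_rtp_step:
  fixes A :: "(int ^ 'n::finite) set"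
  assumes A: "finite A" and M: "\<And>x. \<bar>rtp A c x\<bar> \<le> M"
  shows "\<bar>rtp A (\<lambda>\<xi>. c \<xi> * of_real (exp (- 2 * pi\<^sup>2 * \<sigma>\<^sup>2 * (real_of_int (\<xi> $ i))\<^sup>2))) x\<bar> \<le> M"
    and "\<bar>Re (\<Sum>\<xi>\<in>A. c \<xi> * (2 * pi * \<i> * of_real \<sigma> * of_int (\<xi> $ i)) * of_real (exp (- 2 * pi\<^sup>2 * \<sigma>\<^sup>2 * (real_of_int (\<xi> $ i))\<^sup>2)))\<bar> \<le> M"
proof -
  have M0: "M \<ge> 0" using M[of 0] by linarith
  let ?\<phi> = std_normal_density
  define s where "s \<xi> = 2 * pi * \<sigma> * real_of_int (\<xi> $ i)" for \<xi> :: "int ^ 'n"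
  have s2: "- (s \<xi>)\<^sup>2 / 2 = - 2 * pi\<^sup>2 * \<sigma>\<^sup>2 * (real_of_int (\<xi> $ i))\<^sup>2" for \<xi>
    by (simp add: s_def power_mult_distrib)
  have ee: "ee \<xi> (axis i (\<sigma> * z)) = cis (s \<xi> * z)" for \<xi> z
    by (simp add: ee_axis s_def mult_ac)
  have eq: "rtp A c (x + axis i (\<sigma> * z)) = Re (\<Sum>\<xi>\<in>A. (c \<xi> * ee \<xi> x) * cis (s \<xi> * z))" for x z
    unfolding rtp_def by (simp add: ee_plus ee mult.assoc)
  have i1: "integrable lborel (\<lambda>z. ?\<phi> z *\<^sub>R cis (s \<xi> * z))" and i2: "integrable lborel (\<lambda>z. (?\<phi> z * z) *\<^sub>R cis (s \<xi> * z))" for \<xi>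
    by (rule integrable_gauss_cis)+
  have pull: "Re (\<Sum>\<xi>\<in>A. d \<xi> * (r *\<^sub>R X \<xi>)) = r *\<^sub>R Re (\<Sum>\<xi>\<in>A. d \<xi> * X \<xi>)"
    for d X :: "int ^ 'n \<Rightarrow> complex" and r
    by (simp only: mult_scaleR_right scaleR_sum_right[symmetric] scaleR_complex.sel real_scaleR_def)
  have avg: "(LINT z|lborel. Re (\<Sum>\<xi>\<in>A. d \<xi> * (r z *\<^sub>R cis (s \<xi> * z)))) = Re (\<Sum>\<xi>\<in>A. d \<xi> * (LINT z|lborel. r z *\<^sub>R cis (s \<xi> * z)))"
    if "\<And>\<xi>. integrable lborel (\<lambda>z. r z *\<^sub>R cis (s \<xi> * z))" for d r
  proof -
    have "integrable lborel (\<lambda>z. \<Sum>\<xi>\<in>A. d \<xi> * (r z *\<^sub>R cis (s \<xi> * z)))"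
      by (intro Bochner_Integration.integrable_sum integrable_mult_right that)
    then have "(LINT z|lborel. Re (\<Sum>\<xi>\<in>A. d \<xi> * (r z *\<^sub>R cis (s \<xi> * z)))) = Re (LINT z|lborel. (\<Sum>\<xi>\<in>A. d \<xi> * (r z *\<^sub>R cis (s \<xi> * z))))"
      by (rule integral_Re)
    also have "(LINT z|lborel. (\<Sum>\<xi>\<in>A. d \<xi> * (r z *\<^sub>R cis (s \<xi> * z)))) = (\<Sum>\<xi>\<in>A. d \<xi> * (LINT z|lborel. r z *\<^sub>R cis (s \<xi> * z)))"
      by (simp only: Bochner_Integration.integral_sum[OF integrable_mult_right[OF that]] integral_mult_right_zero)
    finally show ?thesis .
  qed
  have mr: "(\<lambda>z. rtp A c (x + axis i (\<sigma> * z))) \<in> borel_measurable borel" for x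
    unfolding eq by measurable
  have "rtp A (\<lambda>\<xi>. c \<xi> * of_real (exp (- 2 * pi\<^sup>2 * \<sigma>\<^sup>2 * (real_of_int (\<xi> $ i))\<^sup>2))) x
      = Re (\<Sum>\<xi>\<in>A. (c \<xi> * ee \<xi> x) * (LINT z|lborel. ?\<phi> z *\<^sub>R cis (s \<xi> * z)))"
    unfolding rtp_def gauss_cis s2 by (simp add: mult_ac)
  also have "\<dots> = (LINT z|lborel. Re (\<Sum>\<xi>\<in>A. (c \<xi> * ee \<xi> x) * (?\<phi> z *\<^sub>R cis (s \<xi> * z))))"
    by (rule avg[OF i1, symmetric])
  also have "\<dots> = (LINT z|lborel. ?\<phi> z *\<^sub>R rtp A c (x + axis i (\<sigma> * z)))"
    unfolding eq pull ..
  also have "\<bar>\<dots>\<bar> \<le> (LINT z|lborel. \<bar>?\<phi> z *\<^sub>R rtp A c (x + axis i (\<sigma> * z))\<bar>)" by (rule integral_abs_bound)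
  also have "\<dots> \<le> (LINT z|lborel. ?\<phi> z * M)"
    using integrable_abs[OF integrable_gauss_bounded(1)[OF mr, of x M]] M
    by (intro integral_mono) (auto simp: abs_mult intro!: mult_left_mono)
  also have "\<dots> = M" by simp
  finally show "\<bar>rtp A (\<lambda>\<xi>. c \<xi> * of_real (exp (- 2 * pi\<^sup>2 * \<sigma>\<^sup>2 * (real_of_int (\<xi> $ i))\<^sup>2))) x\<bar> \<le> M" .
  have "Re (\<Sum>\<xi>\<in>A. c \<xi> * (2 * pi * \<i> * of_real \<sigma> * of_int (\<xi> $ i)) * of_real (exp (- 2 * pi\<^sup>2 * \<sigma>\<^sup>2 * (real_of_int (\<xi> $ i))\<^sup>2)))
      = Re (\<Sum>\<xi>\<in>A. (c \<xi> * ee \<xi> 0) * (LINT z|lborel. (?\<phi> z * z) *\<^sub>R cis (s \<xi> * z)))"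
    unfolding gauss_mult_cis s2 by (simp add: s_def mult_ac)
  also have "\<dots> = (LINT z|lborel. Re (\<Sum>\<xi>\<in>A. (c \<xi> * ee \<xi> 0) * ((?\<phi> z * z) *\<^sub>R cis (s \<xi> * z))))"
    by (rule avg[OF i2, symmetric])
  also have "\<dots> = (LINT z|lborel. (?\<phi> z * z) *\<^sub>R rtp A c (0 + axis i (\<sigma> * z)))"
    unfolding eq pull ..
  also have "\<bar>\<dots>\<bar> \<le> (LINT z|lborel. \<bar>(?\<phi> z * z) *\<^sub>R rtp A c (0 + axis i (\<sigma> * z))\<bar>)" by (rule integral_abs_bound)
  also have "\<dots> \<le> (LINT z|lborel. ?\<phi> z * \<bar>z\<bar> ^ (2 * 0 + 1) * M)"
    using integrable_abs[OF integrable_gauss_bounded(2)[OF mr, of 0 M]] M integrable_std_normal_moment_abs[of 1]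
    by (intro integral_mono integrable_mult_left) (auto simp: abs_mult intro!: mult_left_mono)
  also have "\<dots> = sqrt (2 / pi) * M"
    unfolding integral_mult_left_zero integral_std_normal_moment_abs_odd by simp
  also have "\<dots> \<le> 1 * M" using M0 pi_gt3 by (intro mult_right_mono) (auto simp: real_sqrt_le_1_iff)
  finally show "\<bar>Re (\<Sum>\<xi>\<in>A. c \<xi> * (2 * pi * \<i> * of_real \<sigma> * of_int (\<xi> $ i)) * of_real (exp (- 2 * pi\<^sup>2 * \<sigma>\<^sup>2 * (real_of_int (\<xi> $ i))\<^sup>2)))\<bar> \<le> M"
    by simp
qed

text \<open>The characteristic function of a centred Gaussian displacement of standard deviation
  \<open>\<sigma>\<close> in every coordinate, taken at \<open>2 pi \<xi>\<close>. The width, not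
  the time, is the parameter, because the kernel bounds are linear in it.\<close>

definition heat :: "real \<Rightarrow> int ^ 'n::finite \<Rightarrow> real" where
  "heat \<sigma> \<xi> = exp (- 2 * pi\<^sup>2 * \<sigma>\<^sup>2 * (norm (freq \<xi>))\<^sup>2)"

lemma norm_freq_sq: "(norm (freq \<xi>))\<^sup>2 = (\<Sum>i\<in>UNIV. (real_of_int (\<xi> $ i))\<^sup>2)"
  by (simp add: norm_vec_def L2_set_def sum_nonneg)

text \<open>The multiplier factorizes over the coordinates: plain averaging in all directions other
  than j, then the first-moment average in direction j. No constant depending on the dimension
  appears.\<close>

lemma gauss_rtp:
  fixes A :: "(int ^ 'n::finite) set"
  assumes A: "finite A" and M: "\<And>x. \<bar>rtp A c x\<bar> \<le> M"
  shows "\<bar>Re (\<Sum>\<xi>\<in>A. c \<xi> * (2 * pi * \<i> * of_real \<sigma> * of_int (\<xi> $ j)) * of_real (heat \<sigma> \<xi>))\<bar> \<le> M"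
proof -
  let ?e = "\<lambda>i \<xi>. exp (- 2 * pi\<^sup>2 * \<sigma>\<^sup>2 * (real_of_int (\<xi> $ i))\<^sup>2) :: real"
  have *: "\<bar>rtp A (\<lambda>\<xi>. c \<xi> * of_real (\<Prod>i\<in>S. ?e i \<xi>)) x\<bar> \<le> M" if "finite S" for S :: "'n set" and x
    using that
  proof (induction S arbitrary: x rule: finite_induct)
    case empty
    then show ?case using M by simp
  next
    case (insert i S)
    from gauss_rtp_step(1)[OF A insert.IH, of \<sigma> i x] show ?case
      using insert.hyps by (simp add: mult_ac)
  qed
  have "heat \<sigma> \<xi> = (\<Prod>i\<in>UNIV - {j}. ?e i \<xi>) * ?e j \<xi>" for \<xi>
  proof -
    have "heat \<sigma> \<xi> = (\<Prod>i\<in>UNIV. ?e i \<xi>)"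
      unfolding heat_def norm_freq_sq by (simp add: sum_distrib_left exp_sum)
    also have "\<dots> = ?e j \<xi> * (\<Prod>i\<in>UNIV - {j}. ?e i \<xi>)" by (rule prod.remove) auto
    finally show ?thesis by simp
  qed
  then have "(\<Sum>\<xi>\<in>A. c \<xi> * (2 * pi * \<i> * of_real \<sigma> * of_int (\<xi> $ j)) * of_real (heat \<sigma> \<xi>))
     = (\<Sum>\<xi>\<in>A. (c \<xi> * of_real (\<Prod>i\<in>UNIV - {j}. ?e i \<xi>)) * (2 * pi * \<i> * of_real \<sigma> * of_int (\<xi> $ j)) * of_real (?e j \<xi>))"
    by (intro sum.cong refl) (simp only: of_real_mult mult_ac)
  then show ?thesis using gauss_rtp_step(2)[OF A *, of "UNIV - {j}" \<sigma> j] by simp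
qed

section \<open>The dyadic pieces of the kernel of $-\nabla\Delta^{-1}$\<close>

text \<open>The symbol \<open>2 pi \<i> \<xi>_j / (4 pi^2 |\<xi>|^2)\<close> in lowest terms. At
  frequency 0 the quotient is 0, which later gives the pressure mean value zero.\<close>

definition riesz :: "'n::finite \<Rightarrow> int ^ 'n \<Rightarrow> complex" where
  "riesz j \<xi> = \<i> * of_real (real_of_int (\<xi> $ j) / (2 * pi * (norm (freq \<xi>))\<^sup>2))"

text \<open>Differences of Gaussian multipliers: summed over \<open>k\<close> they telescope to \<open>riesz\<close> up to a rapidly
  decaying remainder.\<close>

definition piece :: "'n::finite \<Rightarrow> nat \<Rightarrow> int ^ 'n \<Rightarrow> complex" where
  "piece j k \<xi> = riesz j \<xi> * of_real (heat ((1/2) ^ Suc k) \<xi> - heat ((1/2) ^ k) \<xi>)"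

lemma riesz_uminus: "riesz j (- \<xi>) = - riesz j \<xi>" "cnj (riesz j \<xi>) = - riesz j \<xi>"
  by (simp_all add: riesz_def freq_uminus)

lemma heat_uminus: "heat \<sigma> (- \<xi>) = heat \<sigma> \<xi>"
  by (simp add: heat_def freq_uminus)

lemma heat_bounds: "heat \<sigma> \<xi> > 0" "heat \<sigma> \<xi> \<le> 1"
  by (simp_all add: heat_def)

lemma piece_uminus: "piece j k (- \<xi>) = - piece j k \<xi>" "cnj (piece j k \<xi>) = - piece j k \<xi>"
  by (simp_all add: piece_def riesz_uminus heat_uminus)

lemma hermitian_piece: "hermitian (piece j k)"
  by (simp add: hermitian_def piece_uminus)

lemma norm_riesz: "cmod (riesz j \<xi>) = \<bar>real_of_int (\<xi> $ j)\<bar> / (2 * pi * (norm (freq \<xi>))\<^sup>2)"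
  unfolding riesz_def norm_mult norm_of_real by (simp add: abs_divide abs_mult)

lemma norm_riesz_le: "cmod (riesz j \<xi>) \<le> 1"
proof (cases "\<xi> = 0")
  case False
  define y where "y = norm (freq \<xi>)"
  have y: "y \<ge> 1" using norm_freq_ge_1[OF False] by (simp add: y_def)
  have "\<bar>real_of_int (\<xi> $ j)\<bar> \<le> y" using component_le_norm_cart[of "freq \<xi>" j] by (simp add: y_def)
  also have "y \<le> 2 * pi * y\<^sup>2"
  proof -
    have "1 * y \<le> y * y" using y by (intro mult_right_mono) auto
    moreover have "1 * (y * y) \<le> (2 * pi) * (y * y)" using pi_gt3 y by (intro mult_right_mono) auto
    ultimately show ?thesis by (simp add: power2_eq_square)
  qed
  finally show ?thesis using y by (simp add: norm_riesz y_def[symmetric] divide_le_eq)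
qed (simp add: riesz_def)

lemma exp_lorentz:
  fixes t :: real
  shows "exp (- ((t * norm (freq \<xi>))\<^sup>2)) \<le> (\<Prod>i\<in>UNIV. 1 / (1 + (t * real_of_int (\<xi> $ i))\<^sup>2))"
proof -
  have "exp (- ((t * norm (freq \<xi>))\<^sup>2)) = (\<Prod>i\<in>UNIV. exp (- ((t * real_of_int (\<xi> $ i))\<^sup>2)))"
    by (simp add: power_mult_distrib norm_freq_sq sum_distrib_left exp_sum[symmetric] sum_negf)
  also have "\<dots> \<le> (\<Prod>i\<in>UNIV. 1 / (1 + (t * real_of_int (\<xi> $ i))\<^sup>2))"
  proof (intro prod_mono conjI)
    fix i
    have "1 + (t * real_of_int (\<xi> $ i))\<^sup>2 \<le> exp ((t * real_of_int (\<xi> $ i))\<^sup>2)" by (rule exp_ge_add_one_self)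
    then have "1 / exp ((t * real_of_int (\<xi> $ i))\<^sup>2) \<le> 1 / (1 + (t * real_of_int (\<xi> $ i))\<^sup>2)"
      by (intro divide_left_mono mult_pos_pos add_pos_nonneg) auto
    then show "exp (- ((t * real_of_int (\<xi> $ i))\<^sup>2)) \<le> 1 / (1 + (t * real_of_int (\<xi> $ i))\<^sup>2)"
      by (simp add: exp_minus inverse_eq_divide)
  qed simp
  finally show ?thesis .
qed

text \<open>The difference of Gaussians vanishes to second order at low frequencies, which
  compensates the singularity of \<open>riesz\<close>:
  \<open>exp (-a) - exp (-b) <= b * exp (-a)\<close> with b quadratic in the frequency. What remains
  is \<open>t = (1/2) ^ k\<close> times a rapidly decaying function of \<open>t * r\<close>.\<close>

lemma norm_piece_le:
  "cmod (piece j k \<xi>) \<le> pi * (1/2) ^ k * (\<Prod>i\<in>UNIV. 1 / (1 + ((1/2) ^ k * real_of_int (\<xi> $ i))\<^sup>2))"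
proof (cases "\<xi> = 0")
  case True
  then show ?thesis by (simp add: piece_def riesz_def)
next
  case False
  define t :: real where "t = (1/2) ^ k"
  define r where "r = norm (freq \<xi>)"
  have t: "t > 0" by (simp add: t_def)
  have r: "r \<ge> 1" using norm_freq_ge_1[OF False] by (simp add: r_def)
  define a where "a = 2 * pi\<^sup>2 * (t / 2)\<^sup>2 * r\<^sup>2"
  define b where "b = 2 * pi\<^sup>2 * t\<^sup>2 * r\<^sup>2"
  have ab: "a \<le> b" using r t by (simp add: a_def b_def power_divide mult_right_mono)
  have "exp (- a) - exp (- b) \<le> (b - a) * exp (- a)"
  proof -
    have "1 + (a - b) \<le> exp (a - b)" by (rule exp_ge_add_one_self)
    then have "exp (-a) * (1 + (a - b)) \<le> exp (-a) * exp (a - b)" by (intro mult_left_mono) auto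
    also have "exp (-a) * exp (a - b) = exp (- b)" by (simp add: exp_add[symmetric])
    finally show ?thesis by (simp add: algebra_simps)
  qed
  also have "\<dots> \<le> b * exp (- a)" using t by (intro mult_right_mono) (auto simp: a_def)
  finally have 1: "exp (- a) - exp (- b) \<le> b * exp (- a)" .
  have "\<bar>real_of_int (\<xi> $ j)\<bar> \<le> r" using component_le_norm_cart[of "freq \<xi>" j] by (simp add: r_def)
  then have "cmod (riesz j \<xi>) \<le> r / (2 * pi * r\<^sup>2)"
    using r by (simp add: norm_riesz r_def[symmetric] divide_right_mono)
  then have 2: "cmod (riesz j \<xi>) * b \<le> pi * t\<^sup>2 * r"
  proof -
    have "cmod (riesz j \<xi>) * b \<le> r / (2 * pi * r\<^sup>2) * b"
      by (intro mult_right_mono) (use \<open>cmod (riesz j \<xi>) \<le> r / (2 * pi * r\<^sup>2)\<close> in \<open>auto simp: b_def\<close>)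
    also have "\<dots> = pi * t\<^sup>2 * r" using r by (simp add: b_def power2_eq_square field_simps)
    finally show ?thesis .
  qed
  have heats: "heat ((1/2) ^ Suc k) \<xi> = exp (- a)" "heat ((1/2) ^ k) \<xi> = exp (- b)"
    by (simp_all add: heat_def a_def b_def t_def r_def)
  have "cmod (piece j k \<xi>) = cmod (riesz j \<xi>) * (exp (- a) - exp (- b))"
    unfolding piece_def norm_mult norm_of_real heats using ab by simp
  also have "\<dots> \<le> cmod (riesz j \<xi>) * (b * exp (- a))" by (intro mult_left_mono 1) auto
  also have "\<dots> \<le> (pi * t\<^sup>2 * r) * exp (- a)" using 2 by (simp add: mult.assoc[symmetric] mult_right_mono)
  \<comment> \<open>Here \<open>a = (pi^2 / 2) (t r)^2\<close> and \<open>pi^2 >= 8\<close>. Three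
    of the four units in the exponent absorb the factor \<open>t * r\<close>; the last one is
    compared with the product majorant.\<close>
  also have "\<dots> \<le> (pi * t\<^sup>2 * r) * exp (- 4 * (t * r)\<^sup>2)"
  proof -
    have "3 * 3 \<le> pi * pi" using pi_gt3 by (intro mult_mono) auto
    then have "8 * (t * r)\<^sup>2 \<le> pi\<^sup>2 * (t * r)\<^sup>2" by (intro mult_right_mono) (auto simp: power2_eq_square)
    then have "4 * (t * r)\<^sup>2 \<le> a" by (simp add: a_def power_mult_distrib power_divide)
    then show ?thesis using r t by (intro mult_left_mono) auto
  qed
  also have "\<dots> = pi * t * ((t * r) * exp (- 3 * (t * r)\<^sup>2)) * exp (- ((t * r)\<^sup>2))"
    by (simp add: exp_add[symmetric] power2_eq_square algebra_simps)
  also have "\<dots> \<le> pi * t * 1 * exp (- ((t * r)\<^sup>2))"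
  proof (intro mult_right_mono mult_left_mono)
    define y where "y = t * r"
    have "y \<le> 1 + 3 * y\<^sup>2"
    proof -
      have "0 \<le> (y - 1)\<^sup>2" "0 \<le> y\<^sup>2" by simp_all
      moreover have "(y - 1)\<^sup>2 = y\<^sup>2 - 2 * y + 1" by (simp add: power2_diff)
      ultimately show ?thesis by linarith
    qed
    also have "\<dots> \<le> exp (3 * y\<^sup>2)" by (rule exp_ge_add_one_self)
    finally show "(t * r) * exp (- 3 * (t * r)\<^sup>2) \<le> 1" unfolding y_def[symmetric] by (simp add: exp_minus inverse_eq_divide)
  qed (use t in auto)
  also have "\<dots> \<le> pi * t * 1 * (\<Prod>i\<in>UNIV. 1 / (1 + (t * real_of_int (\<xi> $ i))\<^sup>2))"
    using t by (intro mult_left_mono) (auto simp: r_def intro: exp_lorentz)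
  finally show ?thesis by (simp add: t_def)
qed

lemma piece_summable:
  fixes j :: "'n::finite"
  shows "(\<lambda>\<xi>. cmod (piece j k \<xi>)) summable_on UNIV"
    "(\<Sum>\<^sub>\<infinity>\<xi>. cmod (piece j k \<xi>)) \<le> pi * (1/2) ^ k * (1 + pi / (1/2) ^ k) ^ CARD('n)"
proof -
  have *: "(\<Sum>\<xi>\<in>Lam N. cmod (piece j k \<xi>)) \<le> pi * (1/2) ^ k * (1 + pi / (1/2) ^ k) ^ CARD('n)" for N
  proof -
    have "(\<Sum>\<xi>\<in>Lam N. cmod (piece j k \<xi>)) \<le> pi * (1/2) ^ k * (\<Sum>\<xi>\<in>(Lam N :: (int ^ 'n) set). (\<Prod>i\<in>UNIV. 1 / (1 + ((1/2) ^ k * real_of_int (\<xi> $ i))\<^sup>2)))"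
      unfolding sum_distrib_left by (intro sum_mono norm_piece_le)
    also have "\<dots> \<le> pi * (1/2) ^ k * (1 + pi / (1/2) ^ k) ^ CARD('n)"
      by (intro mult_left_mono sum_lorentz) auto
    finally show ?thesis .
  qed
  show "(\<lambda>\<xi>. cmod (piece j k \<xi>)) summable_on UNIV"
    by (rule summable_Lam_bound(1)[OF _ *]) simp
  show "(\<Sum>\<^sub>\<infinity>\<xi>. cmod (piece j k \<xi>)) \<le> pi * (1/2) ^ k * (1 + pi / (1/2) ^ k) ^ CARD('n)"
    by (rule summable_Lam_bound(2)[OF _ *]) simp
qed

lemma fc_piece: "fc (fseries (piece j k)) \<xi> = piece j k \<xi>"
  using hermitian_piece[of j k] by (simp add: fc_fseries[OF piece_summable(1)] hermitian_def piece_uminus)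

text \<open>Frequencies up to about \<open>2 ^ k\<close> contribute, at most of the order
  \<open>2 ^ (k * m)\<close> many, each of size at most of the order
  \<open>(1/2) ^ k\<close>.\<close>

lemma piece_sup:
  assumes m: "m \<ge> CARD('n::finite)"
  shows "\<bar>fseries (piece (j :: 'n) k) x\<bar> \<le> pi * (1 + pi) ^ m * 2 ^ (k * (m - 1))"
proof -
  have "\<bar>fseries (piece j k) x\<bar> \<le> pi * (1/2) ^ k * (1 + pi / (1/2) ^ k) ^ CARD('n)"
    using fseries_bound[OF piece_summable(1), of j k x] piece_summable(2)[of j k] by linarith
  also have "\<dots> \<le> pi * (1/2) ^ k * (1 + pi / (1/2) ^ k) ^ m"
    using m by (intro mult_left_mono power_increasing) auto
  also have "\<dots> \<le> pi * (1/2) ^ k * ((1 + pi) * 2 ^ k) ^ m"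
    by (intro mult_left_mono power_mono) (auto simp: power_divide algebra_simps)
  also have "\<dots> = pi * (1 + pi) ^ m * 2 ^ (k * (m - 1))"
  proof -
    have "0 < m" using m by (metis finite_UNIV_card_ge_0 finite_class.finite_UNIV less_le_trans)
    then obtain l where "m = Suc l" by (cases m) auto
    then show ?thesis by (simp add: power_mult_distrib power_mult[symmetric] power_divide power_add)
  qed
  finally show ?thesis .
qed

text \<open>The pairing with \<open>P\<close> is \<open>F\<close> at width
  \<open>(1/2) ^ Suc k\<close> minus \<open>F\<close> at width \<open>(1/2) ^ k\<close>.
  Differentiating \<open>heat\<close> in the width brings down
  \<open>- 4 pi^2 \<sigma> |\<xi>|^2\<close>, which cancels the denominator of \<open>riesz\<close>
  and leaves the expression bounded in \<open>gauss_rtp\<close>. So \<open>F\<close> has Lipschitz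
  constant \<open>M\<close>, and the bound is the difference of the widths.\<close>

lemma piece_L1:
  fixes j :: "'n::finite"
  shows "(LINT x|tor. \<bar>fseries (piece j k) x\<bar>) \<le> (1/2) ^ k"
proof (rule L1_norm_dual[OF fseries_periodic fseries_continuous[OF piece_summable(1)]])
  fix P :: "real ^ 'n \<Rightarrow> real" and M assume P: "trig P" "\<And>x. \<bar>P x\<bar> \<le> M"
  then obtain A c where A: "finite A" "P = rtp A c" by (auto simp: trig_def)
  have M0: "M \<ge> 0" using P(2)[of 0] by linarith
  define F where "F \<sigma> = Re (\<Sum>\<xi>\<in>A. c \<xi> * (- riesz j \<xi>) * of_real (heat \<sigma> \<xi>))" for \<sigma>
  define F' where "F' \<sigma> = Re (\<Sum>\<xi>\<in>A. c \<xi> * (2 * pi * \<i> * of_real \<sigma> * of_int (\<xi> $ j)) * of_real (heat \<sigma> \<xi>))" for \<sigma>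
  have dF: "(F has_real_derivative F' \<sigma>) (at \<sigma>)" for \<sigma>
  proof -
    have dh: "((\<lambda>\<sigma>. heat \<sigma> \<xi>) has_real_derivative - 4 * pi\<^sup>2 * \<sigma> * (norm (freq \<xi>))\<^sup>2 * heat \<sigma> \<xi>) (at \<sigma>)" for \<xi> :: "int ^ 'n"
      unfolding heat_def by (auto intro!: derivative_eq_intros simp: algebra_simps)
    have FR: "F = (\<lambda>\<sigma>. \<Sum>\<xi>\<in>A. Re (c \<xi> * (- riesz j \<xi>)) * heat \<sigma> \<xi>)"
      unfolding F_def Re_sum by (intro ext sum.cong refl) (simp add: algebra_simps)
    have "(F has_real_derivative (\<Sum>\<xi>\<in>A. Re (c \<xi> * (- riesz j \<xi>)) * (- 4 * pi\<^sup>2 * \<sigma> * (norm (freq \<xi>))\<^sup>2 * heat \<sigma> \<xi>))) (at \<sigma>)"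
      unfolding FR by (intro DERIV_sum DERIV_cmult dh)
    also have "(\<Sum>\<xi>\<in>A. Re (c \<xi> * (- riesz j \<xi>)) * (- 4 * pi\<^sup>2 * \<sigma> * (norm (freq \<xi>))\<^sup>2 * heat \<sigma> \<xi>)) = F' \<sigma>"
      unfolding F'_def Re_sum
    proof (intro sum.cong refl)
      fix \<xi> :: "int ^ 'n"
      show "Re (c \<xi> * (- riesz j \<xi>)) * (- 4 * pi\<^sup>2 * \<sigma> * (norm (freq \<xi>))\<^sup>2 * heat \<sigma> \<xi>)
          = Re (c \<xi> * (2 * pi * \<i> * of_real \<sigma> * of_int (\<xi> $ j)) * of_real (heat \<sigma> \<xi>))"
        by (cases "\<xi> = 0") (auto simp: riesz_def power2_eq_square field_simps)
    qed
    finally show ?thesis .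
  qed
  have F'M: "\<bar>F' \<sigma>\<bar> \<le> M" for \<sigma>
    unfolding F'_def by (rule gauss_rtp[OF A(1)]) (use P(2) A(2) in auto)
  have "(LINT x|tor. fseries (piece j k) x * P x) = Re (\<Sum>\<xi>\<in>A. c \<xi> * cnj (piece j k \<xi>))"
    unfolding A(2)
    by (subst integral_mult_rtp(2)) (auto simp: A(1) fc_piece
        intro: borel_measurable_continuous_onI integrable_periodic_continuous fseries_periodic fseries_continuous piece_summable)
  also have "\<dots> = F ((1/2) ^ Suc k) - F ((1/2) ^ k)"
    unfolding F_def minus_complex.sel[symmetric] sum_subtractf[symmetric] piece_uminus
    by (intro arg_cong[where f = Re] sum.cong refl) (simp add: piece_def algebra_simps)
  also have "\<bar>\<dots>\<bar> \<le> M * \<bar>(1/2) ^ Suc k - (1/2) ^ k\<bar>"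
    using field_differentiable_bound[of UNIV F F' M "(1/2) ^ Suc k" "(1/2) ^ k"] dF F'M by simp
  also have "\<dots> \<le> M * (1/2) ^ k" using M0 by (intro mult_left_mono) auto
  finally show "\<bar>LINT x|tor. fseries (piece j k) x * P x\<bar> \<le> (1/2) ^ k * M" by (simp add: mult.commute)
qed simp

text \<open>Lets the absolute value of the kernel at \<open>x - y\<close> be read as a translate in
  y, so that invariance under translations suffices and reflections never have to be
  treated.\<close>

lemma piece_odd: "fseries (piece j k) (- x) = - fseries (piece j k) x"
proof -
  have "(\<Sum>\<^sub>\<infinity>\<xi>. piece j k \<xi> * ee \<xi> (- x)) = (\<Sum>\<^sub>\<infinity>\<xi>. piece j k (- \<xi>) * ee (- \<xi>) (- x))"
    by (rule infsum_reindex_bij_witness[of _ uminus uminus]) auto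
  also have "\<dots> = - (\<Sum>\<^sub>\<infinity>\<xi>. piece j k \<xi> * ee \<xi> x)"
    by (simp add: piece_uminus ee_uminus ee_minus_arg infsum_uminus)
  finally show ?thesis by (simp add: fseries_def)
qed

section \<open>Fractional integration\<close>

text \<open>The convolution theorem for an absolutely summable kernel and an integrable
  \<open>g\<close>: an identity for the partial sums over cubes, passed to the limit with the
  uniform tail of the kernel.\<close>

lemma fseries_mult_fc:
  fixes c :: "int ^ 'n::finite \<Rightarrow> complex"
  assumes c: "(\<lambda>\<xi>. cmod (c \<xi>)) summable_on UNIV" and g: "g \<in> borel_measurable borel" "integrable tor g"
  shows "(\<lambda>\<xi>. cmod (c \<xi> * fc g \<xi>)) summable_on UNIV"
    "integrable tor (\<lambda>y. fseries c (x - y) * g y)"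
    "fseries (\<lambda>\<xi>. c \<xi> * fc g \<xi>) x = (LINT y|tor. fseries c (x - y) * g y)"
proof -
  have [measurable]: "g \<in> borel_measurable borel" "fseries c \<in> borel_measurable borel"
    using g(1) fseries_continuous[OF c] by (auto intro: borel_measurable_continuous_onI)
  let ?G = "LINT x|tor. \<bar>g x\<bar>"
  show s: "(\<lambda>\<xi>. cmod (c \<xi> * fc g \<xi>)) summable_on UNIV"
  proof (rule summable_on_comparison_test)
    show "(\<lambda>\<xi>. cmod (c \<xi>) * ?G) summable_on UNIV" by (rule summable_on_cmult_left[OF c])
    show "cmod (c \<xi> * fc g \<xi>) \<le> cmod (c \<xi>) * ?G" for \<xi>
      unfolding norm_mult by (intro mult_left_mono norm_fc_le) simp
  qed simp
  have bd: "integrable tor (\<lambda>y. F y * g y)" if "F \<in> borel_measurable borel" "\<And>y. \<bar>F y\<bar> \<le> B" for F B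
  proof (rule Bochner_Integration.integrable_bound)
    have [measurable]: "F \<in> borel_measurable borel" by fact
    show "integrable tor (\<lambda>y. B * g y)" using g(2) by simp
    show "(\<lambda>y. F y * g y) \<in> borel_measurable tor" by (rule measurable_tor) measurable
    show "AE y in tor. norm (F y * g y) \<le> norm (B * g y)"
    proof (rule AE_I2)
      fix y
      have "\<bar>F y\<bar> \<le> \<bar>B\<bar>" using that(2)[of y] by linarith
      then show "norm (F y * g y) \<le> norm (B * g y)" by (simp add: abs_mult mult_right_mono)
    qed
  qed
  show i: "integrable tor (\<lambda>y. fseries c (x - y) * g y)"
    by (rule bd[where B = "\<Sum>\<^sub>\<infinity>\<xi>. cmod (c \<xi>)"]) (auto intro: fseries_bound[OF c])
  have iN: "integrable tor (\<lambda>y. rtp (Lam N) c (x - y) * g y)" for N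
    by (rule bd[where B = "\<Sum>\<xi>\<in>Lam N. cmod (c \<xi>)"]) (auto intro: rtp_bound)
  have eqN: "(LINT y|tor. rtp (Lam N) c (x - y) * g y) = rtp (Lam N) (\<lambda>\<xi>. c \<xi> * fc g \<xi>) x" for N
  proof -
    have e: "rtp (Lam N) c (x - y) * g y = Re (\<Sum>\<xi>\<in>Lam N. (c \<xi> * ee \<xi> x) * (complex_of_real (g y) * cnj (ee \<xi> y)))" for y
    proof -
      have "ee \<xi> (x - y) = ee \<xi> x * cnj (ee \<xi> y)" for \<xi> :: "int ^ 'n"
        using ee_plus[of \<xi> x "- y"] by (simp add: ee_minus_arg)
      then have "(\<Sum>\<xi>\<in>Lam N. (c \<xi> * ee \<xi> x) * (complex_of_real (g y) * cnj (ee \<xi> y)))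
          = of_real (g y) * (\<Sum>\<xi>\<in>Lam N. c \<xi> * ee \<xi> (x - y))"
        unfolding sum_distrib_left by (intro sum.cong refl) (simp add: mult_ac)
      then show ?thesis by (simp add: rtp_def)
    qed
    have ii: "integrable tor (\<lambda>y. (c \<xi> * ee \<xi> x) * (complex_of_real (g y) * cnj (ee \<xi> y)))" for \<xi>
      by (intro integrable_mult_right integrable_fc g)
    have "(LINT y|tor. rtp (Lam N) c (x - y) * g y)
      = Re (LINT y|tor. (\<Sum>\<xi>\<in>Lam N. (c \<xi> * ee \<xi> x) * (complex_of_real (g y) * cnj (ee \<xi> y))))"
      unfolding e by (rule integral_Re) (intro Bochner_Integration.integrable_sum ii)
    also have "\<dots> = rtp (Lam N) (\<lambda>\<xi>. c \<xi> * fc g \<xi>) x"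
      unfolding Bochner_Integration.integral_sum[OF ii] integral_mult_right_zero fc_def[symmetric] rtp_def
      by (simp add: mult_ac)
    finally show ?thesis .
  qed
  have "(\<lambda>N. rtp (Lam N) (\<lambda>\<xi>. c \<xi> * fc g \<xi>) x) \<longlonglongrightarrow> (LINT y|tor. fseries c (x - y) * g y)"
  proof (rule LIM_zero_cancel, rule Lim_null_comparison, rule always_eventually, rule allI)
    fix N
    have "norm (rtp (Lam N) (\<lambda>\<xi>. c \<xi> * fc g \<xi>) x - (LINT y|tor. fseries c (x - y) * g y))
        = \<bar>LINT y|tor. rtp (Lam N) c (x - y) * g y - fseries c (x - y) * g y\<bar>"
      unfolding eqN[symmetric] using iN i by simp
    also have "\<dots> \<le> (LINT y|tor. \<bar>rtp (Lam N) c (x - y) * g y - fseries c (x - y) * g y\<bar>)" by (rule integral_abs_bound)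
    also have "\<dots> \<le> (LINT y|tor. tail (\<lambda>\<xi>. cmod (c \<xi>)) N * \<bar>g y\<bar>)"
    proof (rule integral_mono)
      show "integrable tor (\<lambda>y. \<bar>rtp (Lam N) c (x - y) * g y - fseries c (x - y) * g y\<bar>)"
        by (intro integrable_abs Bochner_Integration.integrable_diff iN i)
      show "integrable tor (\<lambda>y. tail (\<lambda>\<xi>. cmod (c \<xi>)) N * \<bar>g y\<bar>)" using g(2) by simp
      fix y
      have "\<bar>rtp (Lam N) c (x - y) * g y - fseries c (x - y) * g y\<bar> = \<bar>fseries c (x - y) - rtp (Lam N) c (x - y)\<bar> * \<bar>g y\<bar>"
        unfolding abs_mult[symmetric] by (simp add: abs_minus_commute algebra_simps)
      also have "\<dots> \<le> tail (\<lambda>\<xi>. cmod (c \<xi>)) N * \<bar>g y\<bar>" by (intro mult_right_mono fseries_rtp[OF c]) simp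
      finally show "\<bar>rtp (Lam N) c (x - y) * g y - fseries c (x - y) * g y\<bar> \<le> tail (\<lambda>\<xi>. cmod (c \<xi>)) N * \<bar>g y\<bar>" .
    qed
    also have "\<dots> = tail (\<lambda>\<xi>. cmod (c \<xi>)) N * ?G" by simp
    finally show "norm (rtp (Lam N) (\<lambda>\<xi>. c \<xi> * fc g \<xi>) x - (LINT y|tor. fseries c (x - y) * g y))
        \<le> tail (\<lambda>\<xi>. cmod (c \<xi>)) N * ?G" .
  next
    show "(\<lambda>N. tail (\<lambda>\<xi>. cmod (c \<xi>)) N * ?G) \<longlonglongrightarrow> 0"
      using tendsto_mult_right[OF tail_tendsto[OF c], of ?G] by simp
  qed
  moreover have "(\<lambda>N. rtp (Lam N) (\<lambda>\<xi>. c \<xi> * fc g \<xi>) x) \<longlonglongrightarrow> fseries (\<lambda>\<xi>. c \<xi> * fc g \<xi>) x"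
  proof (rule LIM_zero_cancel, rule Lim_null_comparison[OF _ tail_tendsto[OF s]], rule always_eventually, rule allI)
    fix N show "norm (rtp (Lam N) (\<lambda>\<xi>. c \<xi> * fc g \<xi>) x - fseries (\<lambda>\<xi>. c \<xi> * fc g \<xi>) x) \<le> tail (\<lambda>\<xi>. cmod (c \<xi> * fc g \<xi>)) N"
      using fseries_rtp[OF s, of x N] by (simp add: abs_minus_commute)
  qed
  ultimately show "fseries (\<lambda>\<xi>. c \<xi> * fc g \<xi>) x = (LINT y|tor. fseries c (x - y) * g y)"
    using LIMSEQ_unique by blast
qed

text \<open>The absolute kernel and values in \<open>ennreal\<close> make it additive, monotone and
  summable over k without integrability conditions, as needed when \<open>g\<close> is cut at
  varying heights.\<close>

definition pconv :: "'n::finite \<Rightarrow> nat \<Rightarrow> (real ^ 'n \<Rightarrow> ennreal) \<Rightarrow> real ^ 'n \<Rightarrow> ennreal" where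
  "pconv j k h x = (\<integral>\<^sup>+y. ennreal \<bar>fseries (piece j k) (x - y)\<bar> * h y \<partial>tor)"

lemma piece_measurable [measurable]: "fseries (piece j k) \<in> borel_measurable borel"
  by (intro borel_measurable_continuous_onI fseries_continuous piece_summable)

lemma id_tor [measurable]: "(\<lambda>x. x) \<in> borel_measurable tor"
  by (rule measurable_tor) simp

lemma pconv_measurable [measurable]:
  assumes [measurable]: "h \<in> borel_measurable borel"
  shows "pconv j k h \<in> borel_measurable borel"
proof -
  have [measurable]: "snd \<in> borel_measurable (borel \<Otimes>\<^sub>M tor)"
    using measurable_compose[OF measurable_snd id_tor] by simp
  show ?thesis unfolding pconv_def by (intro tor.borel_measurable_nn_integral) measurable
qed

lemma pconv_add:
  assumes [measurable]: "h \<in> borel_measurable borel" "h' \<in> borel_measurable borel"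
  shows "pconv j k (\<lambda>y. h y + h' y) x = pconv j k h x + pconv j k h' x"
proof -
  have [measurable]: "h \<in> borel_measurable tor" "h' \<in> borel_measurable tor"
    "(\<lambda>y. fseries (piece j k) (x - y)) \<in> borel_measurable tor" by (rule measurable_tor; measurable)+
  show ?thesis unfolding pconv_def by (simp add: distrib_left nn_integral_add)
qed

lemma piece_nn_L1: "(\<integral>\<^sup>+x. ennreal \<bar>fseries (piece j k) x\<bar> \<partial>tor) \<le> ennreal ((1/2) ^ k)"
proof -
  have "integrable tor (fseries (piece j k))"
    by (intro integrable_periodic_continuous fseries_periodic fseries_continuous piece_summable)
  then have "(\<integral>\<^sup>+x. ennreal \<bar>fseries (piece j k) x\<bar> \<partial>tor) = ennreal (LINT x|tor. \<bar>fseries (piece j k) x\<bar>)"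
    by (intro nn_integral_eq_integral) auto
  then show ?thesis using piece_L1[of j k] by (simp add: ennreal_leI)
qed

text \<open>One of three endpoint bounds: integral to integral and supremum to supremum
  (\<open>pconv_sup\<close>), both with factor \<open>(1/2) ^ k\<close>, and integral to supremum
  (\<open>pconv_L1_sup\<close>) with a factor of order \<open>2 ^ (k * (m - 1))\<close>.\<close>

lemma pconv_L1:
  fixes j :: "'n::finite"
  assumes [measurable]: "h \<in> borel_measurable borel"
  shows "(\<integral>\<^sup>+x. pconv j k h x \<partial>tor) \<le> ennreal ((1/2) ^ k) * (\<integral>\<^sup>+x. h x \<partial>tor)"
proof -
  interpret ps: pair_sigma_finite "tor :: (real ^ 'n) measure" "tor :: (real ^ 'n) measure" ..
  have [measurable]: "fst \<in> borel_measurable (tor \<Otimes>\<^sub>M (tor :: (real ^ 'n) measure))" "snd \<in> borel_measurable (tor \<Otimes>\<^sub>M (tor :: (real ^ 'n) measure))"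
    using measurable_compose[OF measurable_snd id_tor] measurable_compose[OF measurable_fst id_tor] by simp_all
  have [measurable]: "h \<in> borel_measurable tor" by (rule measurable_tor) measurable
  have "(\<integral>\<^sup>+x. pconv j k h x \<partial>tor) = (\<integral>\<^sup>+y. \<integral>\<^sup>+x. ennreal \<bar>fseries (piece j k) (x - y)\<bar> * h y \<partial>tor \<partial>tor)"
    unfolding pconv_def by (rule ps.Fubini'[symmetric]) (simp add: case_prod_beta, measurable)
  also have "\<dots> = (\<integral>\<^sup>+y. (\<integral>\<^sup>+x. ennreal \<bar>fseries (piece j k) (x - y)\<bar> \<partial>tor) * h y \<partial>tor)"
    by (intro nn_integral_cong nn_integral_multc measurable_tor) measurable
  also have "\<dots> \<le> (\<integral>\<^sup>+y. ennreal ((1/2) ^ k) * h y \<partial>tor)"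
  proof (intro nn_integral_mono mult_right_mono)
    fix y
    have "(\<integral>\<^sup>+x. ennreal \<bar>fseries (piece j k) (x + (- y))\<bar> \<partial>tor) = (\<integral>\<^sup>+x. ennreal \<bar>fseries (piece j k) x\<bar> \<partial>tor)"
      by (rule nn_integral_tor_translate) (auto simp: fseries_periodic)
    then show "(\<integral>\<^sup>+x. ennreal \<bar>fseries (piece j k) (x - y)\<bar> \<partial>tor) \<le> ennreal ((1/2) ^ k)"
      using piece_nn_L1[of j k] by simp
  qed simp
  also have "\<dots> = ennreal ((1/2) ^ k) * (\<integral>\<^sup>+x. h x \<partial>tor)" by (rule nn_integral_cmult) measurable
  finally show ?thesis .
qed

lemma pconv_sup:
  assumes "\<And>y. h y \<le> s"
  shows "pconv j k h x \<le> ennreal ((1/2) ^ k) * s"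
proof -
  have "pconv j k h x \<le> (\<integral>\<^sup>+y. ennreal \<bar>fseries (piece j k) (y + (- x))\<bar> * s \<partial>tor)"
    unfolding pconv_def
  proof (intro nn_integral_mono mult_mono assms)
    fix y show "ennreal \<bar>fseries (piece j k) (x - y)\<bar> \<le> ennreal \<bar>fseries (piece j k) (y + (- x))\<bar>"
      using piece_odd[of j k "y - x"] by simp
  qed auto
  also have "\<dots> = (\<integral>\<^sup>+y. ennreal \<bar>fseries (piece j k) (y + (- x))\<bar> \<partial>tor) * s"
    by (intro nn_integral_multc measurable_tor) measurable
  also have "(\<integral>\<^sup>+y. ennreal \<bar>fseries (piece j k) (y + (- x))\<bar> \<partial>tor) = (\<integral>\<^sup>+y. ennreal \<bar>fseries (piece j k) y\<bar> \<partial>tor)"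
    by (rule nn_integral_tor_translate) (auto simp: fseries_periodic)
  also have "\<dots> * s \<le> ennreal ((1/2) ^ k) * s" by (intro mult_right_mono piece_nn_L1) simp
  finally show ?thesis .
qed

lemma pconv_L1_sup:
  fixes j :: "'n::finite"
  assumes m: "m \<ge> CARD('n)" and [measurable]: "h \<in> borel_measurable borel"
  shows "pconv j k h x \<le> ennreal (pi * (1 + pi) ^ m * 2 ^ (k * (m - 1))) * (\<integral>\<^sup>+y. h y \<partial>tor)"
proof -
  have "pconv j k h x \<le> (\<integral>\<^sup>+y. ennreal (pi * (1 + pi) ^ m * 2 ^ (k * (m - 1))) * h y \<partial>tor)"
    unfolding pconv_def by (intro nn_integral_mono mult_right_mono ennreal_leI piece_sup m) simp
  also have "\<dots> = ennreal (pi * (1 + pi) ^ m * 2 ^ (k * (m - 1))) * (\<integral>\<^sup>+y. h y \<partial>tor)"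
    by (intro nn_integral_cmult measurable_tor) measurable
  finally show ?thesis .
qed

lemma heat_1_summable: "(\<lambda>\<xi>::int ^ 'n::finite. heat 1 \<xi>) summable_on UNIV"
proof (rule summable_Lam_bound(1))
  fix N
  have hb: "heat 1 \<xi> \<le> (\<Prod>i\<in>UNIV. 1 / (1 + (1 * real_of_int (\<xi> $ i))\<^sup>2))" for \<xi> :: "int ^ 'n"
  proof -
    have "3 * 3 \<le> pi * pi" using pi_gt3 by (intro mult_mono) auto
    then have "1 * (norm (freq \<xi>))\<^sup>2 \<le> 2 * pi\<^sup>2 * (norm (freq \<xi>))\<^sup>2" by (intro mult_right_mono) (auto simp: power2_eq_square)
    then have "heat 1 \<xi> \<le> exp (- ((1 * norm (freq \<xi>))\<^sup>2))" by (simp add: heat_def)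
    also have "\<dots> \<le> (\<Prod>i\<in>UNIV. 1 / (1 + (1 * real_of_int (\<xi> $ i))\<^sup>2))" by (rule exp_lorentz)
    finally show ?thesis .
  qed
  have "(\<Sum>\<xi>\<in>(Lam N :: (int ^ 'n) set). heat 1 \<xi>) \<le> (\<Sum>\<xi>\<in>(Lam N :: (int ^ 'n) set). \<Prod>i\<in>UNIV. 1 / (1 + (1 * real_of_int (\<xi> $ i))\<^sup>2))"
    by (rule sum_mono) (rule hb)
  also have "\<dots> \<le> (1 + pi / 1) ^ CARD('n)" by (rule sum_lorentz) simp
  finally show "(\<Sum>\<xi>\<in>(Lam N :: (int ^ 'n) set). heat 1 \<xi>) \<le> (1 + pi / 1) ^ CARD('n)" .
qed (simp add: heat_bounds less_imp_le)

lemma piece_sums: "(\<lambda>k. piece j k \<xi>) sums (riesz j \<xi> * of_real (1 - heat 1 \<xi>))"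
proof -
  have "(\<lambda>n. heat ((1/2) ^ n) \<xi>) \<longlonglongrightarrow> exp (- 2 * pi\<^sup>2 * 0\<^sup>2 * (norm (freq \<xi>))\<^sup>2)"
    unfolding heat_def by (intro tendsto_intros LIMSEQ_realpow_zero) auto
  then have "(\<lambda>n. heat ((1/2) ^ n) \<xi> - heat ((1/2) ^ 0) \<xi>) \<longlonglongrightarrow> 1 - heat 1 \<xi>"
    by (intro tendsto_diff) auto
  then have "(\<lambda>k. heat ((1/2) ^ Suc k) \<xi> - heat ((1/2) ^ k) \<xi>) sums (1 - heat 1 \<xi>)"
    unfolding sums_def by (subst sum_lessThan_telescope)
  then have "(\<lambda>k. complex_of_real (heat ((1/2) ^ Suc k) \<xi> - heat ((1/2) ^ k) \<xi>)) sums of_real (1 - heat 1 \<xi>)"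
    by (rule sums_of_real)
  then show ?thesis unfolding piece_def by (rule sums_mult)
qed

lemma suminf_half: "(\<Sum>k. ennreal ((1/2) ^ (k + A))) = ennreal (2 * (1/2) ^ A)"
proof -
  have "(\<lambda>k. (1/2 :: real) ^ k * (1/2) ^ A) sums (2 * (1/2) ^ A)"
    using geometric_sums[of "1/2 :: real"] by (intro sums_mult2) simp
  then have "(\<lambda>k. (1/2 :: real) ^ (k + A)) sums (2 * (1/2) ^ A)" by (simp add: power_add)
  then show ?thesis by (intro suminf_ennreal_eq) auto
qed

lemma two_powr_mult: "(2::real) powr (real l * real A) = 2 ^ (l * A)"
  by (metis of_nat_mult powr_realpow zero_less_numeral)

text \<open>The proof of the Hardy-Littlewood-Sobolev inequality by real interpolation: at level \<open>A\<close>, the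
  pieces with \<open>k < A\<close> are bounded, and the remaining ones are applied to \<open>g\<close> cut at height $2^{A(m-1)}$.\<close>

lemma fractional_integral:
  fixes g :: "real ^ 'n::finite \<Rightarrow> real" and j :: 'n
  assumes m: "m \<ge> CARD('n)" "m \<ge> 3"
    and g: "g \<in> borel_measurable borel" "integrable tor g"
    and gr: "integrable tor (\<lambda>x. \<bar>g x\<bar> powr (1 + 1 / (real m - 1)))"
  shows "\<exists>v. v \<in> borel_measurable borel \<and> (\<forall>x i. v (x + axis i 1) = v x) \<and> integrable tor v
    \<and> integrable tor (\<lambda>x. \<bar>v x\<bar> powr (real m / (real m - 2))) \<and> (\<forall>\<xi>. fc v \<xi> = riesz j \<xi> * fc g \<xi>)"
proof -
  have gm [measurable]: "g \<in> borel_measurable borel" by (fact g(1))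
  have gm' [measurable]: "g \<in> borel_measurable tor" by (rule measurable_tor) measurable
  let ?r = "1 + 1 / (real m - 1)"
  define G where "G = (LINT x|tor. \<bar>g x\<bar> powr ?r)"
  have G0: "G \<ge> 0" by (simp add: G_def)
  have Gnn: "(\<integral>\<^sup>+x. ennreal (\<bar>g x\<bar> powr ?r) \<partial>tor) = ennreal G"
    unfolding G_def by (rule nn_integral_eq_integral[OF gr]) simp
  define gn where "gn = (\<lambda>y. ennreal \<bar>g y\<bar>)"
  define lo where "lo A = (\<lambda>y. if \<bar>g y\<bar> \<le> 2 ^ (A * (m - 1)) then gn y else 0)" for A :: nat
  define hi where "hi A = (\<lambda>y. if \<bar>g y\<bar> \<le> 2 ^ (A * (m - 1)) then 0 else gn y)" for A :: nat
  have [measurable]: "gn \<in> borel_measurable borel" "lo A \<in> borel_measurable borel" "hi A \<in> borel_measurable borel" for A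
    unfolding gn_def lo_def hi_def by measurable
  have [measurable]: "gn \<in> borel_measurable tor" "hi A \<in> borel_measurable tor" for A
    by (rule measurable_tor; measurable)+
  have lohi: "gn = (\<lambda>y. lo A y + hi A y)" for A by (auto simp: lo_def hi_def)
  have lo_le: "lo A y \<le> ennreal (2 ^ (A * (m - 1)))" for A y
    by (auto simp: lo_def gn_def intro: ennreal_leI)
  \<comment> \<open>The exponent \<open>?r\<close> splits into 1 and \<open>1 / (m - 1)\<close>;
    above the cut the second part is worth at least \<open>2 ^ A\<close>.\<close>
  have root: "2 ^ A \<le> \<bar>g y\<bar> powr (1 / (real m - 1))" if "\<not> \<bar>g y\<bar> \<le> 2 ^ (A * (m - 1))" for A y
  proof -
    have "(2::real) ^ A = (2 powr (real (m - 1) * real A)) powr (1 / (real m - 1))"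
      using m by (simp add: powr_powr powr_realpow of_nat_diff)
    also have "2 powr (real (m - 1) * real A) = (2::real) ^ (A * (m - 1))" by (simp add: two_powr_mult mult.commute)
    also have "\<dots> powr (1 / (real m - 1)) \<le> \<bar>g y\<bar> powr (1 / (real m - 1))"
      using that m by (intro powr_mono2) auto
    finally show ?thesis .
  qed
  have split: "\<bar>g y\<bar> powr ?r = \<bar>g y\<bar> * \<bar>g y\<bar> powr (1 / (real m - 1))" for y
    by (cases "g y = 0") (simp_all add: powr_add)
  \<comment> \<open>Chebyshev's argument: above the height of level k, \<open>\<bar>g\<bar>\<close>
    is at most \<open>(1/2) ^ k\<close> times its power \<open>?r\<close>.\<close>
  have hi_int: "(\<integral>\<^sup>+y. hi k y \<partial>tor) \<le> ennreal ((1/2) ^ k * G)" for k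
  proof -
    have "(\<integral>\<^sup>+y. hi k y \<partial>tor) \<le> (\<integral>\<^sup>+y. ennreal ((1/2) ^ k) * ennreal (\<bar>g y\<bar> powr ?r) \<partial>tor)"
    proof (rule nn_integral_mono)
      fix y
      show "hi k y \<le> ennreal ((1/2) ^ k) * ennreal (\<bar>g y\<bar> powr ?r)"
      proof (cases "\<bar>g y\<bar> \<le> 2 ^ (k * (m - 1))")
        case False
        have "\<bar>g y\<bar> * 2 ^ k \<le> \<bar>g y\<bar> powr ?r" unfolding split using root[OF False] by (intro mult_left_mono) auto
        then have "(1/2) ^ k * (\<bar>g y\<bar> * 2 ^ k) \<le> (1/2) ^ k * \<bar>g y\<bar> powr ?r" by (intro mult_left_mono) auto
        then have "\<bar>g y\<bar> \<le> (1/2) ^ k * \<bar>g y\<bar> powr ?r" by (simp add: power_divide)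
        then show ?thesis using False by (simp add: hi_def gn_def ennreal_mult'[symmetric] ennreal_leI)
      qed (simp add: hi_def)
    qed
    also have "\<dots> = ennreal ((1/2) ^ k) * ennreal G" unfolding Gnn[symmetric] by (rule nn_integral_cmult) measurable
    finally show ?thesis by (simp add: ennreal_mult')
  qed
  \<comment> \<open>For fixed y only the levels whose height lies below
    \<open>\<bar>g y\<bar>\<close> contribute, and the geometric sum of \<open>2 ^ A\<close> over
    them is at most twice the root of \<open>\<bar>g y\<bar>\<close>.\<close>
  have hi_sum: "(\<Sum>A. ennreal (2 ^ A) * hi A y) \<le> ennreal (2 * \<bar>g y\<bar> powr ?r)" for y
  proof (rule suminf_le_const[OF summableI])
    fix K
    let ?X = "{A. A < K \<and> \<not> \<bar>g y\<bar> \<le> 2 ^ (A * (m - 1))}"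
    have "(\<Sum>A<K. ennreal (2 ^ A) * hi A y) = (\<Sum>A<K. ennreal (if A \<in> ?X then 2 ^ A * \<bar>g y\<bar> else 0))"
      by (intro sum.cong refl) (auto simp: hi_def gn_def ennreal_mult')
    also have "\<dots> = ennreal (\<Sum>A<K. if A \<in> ?X then 2 ^ A * \<bar>g y\<bar> else 0)" by (rule sum_ennreal) auto
    also have "(\<Sum>A<K. if A \<in> ?X then 2 ^ A * \<bar>g y\<bar> else 0) = (\<Sum>A\<in>?X. 2 ^ A) * \<bar>g y\<bar>"
      unfolding sum_distrib_right by (rule sum.mono_neutral_cong_right) auto
    also have "ennreal ((\<Sum>A\<in>?X. 2 ^ A) * \<bar>g y\<bar>) \<le> ennreal ((2 * \<bar>g y\<bar> powr (1 / (real m - 1))) * \<bar>g y\<bar>)"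
      by (intro ennreal_leI mult_right_mono sum_geometric_le) (auto intro: root)
    finally show "(\<Sum>A<K. ennreal (2 ^ A) * hi A y) \<le> ennreal (2 * \<bar>g y\<bar> powr ?r)" by (simp add: split mult_ac)
  qed
  \<comment> \<open>The convolution of \<open>g\<close> with the k-th kernel piece. The integral
    norms decay like \<open>(1/2) ^ k\<close>, so the series defining \<open>v\<close> below
    converges almost everywhere and may be integrated termwise.\<close>
  define T where "T k = fseries (\<lambda>\<xi>. piece j k \<xi> * fc g \<xi>)" for k
  note Tsum = fseries_mult_fc(1)[OF piece_summable(1) g]
  have Tcont: "continuous_on S (T k)" for S k unfolding T_def by (rule fseries_continuous[OF Tsum])
  have Tper: "T k (x + axis i 1) = T k x" for k x i by (simp add: T_def fseries_periodic)
  have Tm [measurable]: "T k \<in> borel_measurable borel" for k by (intro borel_measurable_continuous_onI Tcont)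
  have Ti: "integrable tor (T k)" for k by (intro integrable_periodic_continuous Tper Tcont)
  have Tle: "ennreal \<bar>T k x\<bar> \<le> pconv j k gn x" for k x
  proof -
    have "ennreal (norm (LINT y|tor. fseries (piece j k) (x - y) * g y))
        \<le> (\<integral>\<^sup>+y. ennreal (norm (fseries (piece j k) (x - y) * g y)) \<partial>tor)"
      by (rule integral_norm_bound_ennreal[OF fseries_mult_fc(2)[OF piece_summable(1) g]])
    then show ?thesis
      unfolding T_def fseries_mult_fc(3)[OF piece_summable(1) g] pconv_def gn_def by (simp add: abs_mult ennreal_mult')
  qed
  have TL1: "(LINT x|tor. \<bar>T k x\<bar>) \<le> (1/2) ^ k * (LINT x|tor. \<bar>g x\<bar>)" for k
  proof -
    have "ennreal (LINT x|tor. \<bar>T k x\<bar>) = (\<integral>\<^sup>+x. ennreal \<bar>T k x\<bar> \<partial>tor)"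
      using Ti[of k] by (intro nn_integral_eq_integral[symmetric]) auto
    also have "\<dots> \<le> (\<integral>\<^sup>+x. pconv j k gn x \<partial>tor)" by (intro nn_integral_mono Tle)
    also have "\<dots> \<le> ennreal ((1/2) ^ k) * (\<integral>\<^sup>+x. gn x \<partial>tor)" by (rule pconv_L1) measurable
    also have "(\<integral>\<^sup>+x. gn x \<partial>tor) = ennreal (LINT x|tor. \<bar>g x\<bar>)"
      unfolding gn_def using g(2) by (intro nn_integral_eq_integral) auto
    finally show ?thesis by (simp add: ennreal_mult'[symmetric])
  qed
  have TL1s: "summable (\<lambda>k. LINT x|tor. \<bar>T k x\<bar>)"
    by (rule summable_comparison_test'[of "\<lambda>k. (1/2::real) ^ k * (LINT x|tor. \<bar>g x\<bar>)" 0]) (use TL1 in \<open>auto intro!: summable_mult2\<close>)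
  have Tae: "AE x in tor. summable (\<lambda>k. \<bar>T k x\<bar>)" by (rule AE_summable_L1[OF Ti TL1s])
  define v where "v x = (\<Sum>k. T k x)" for x
  \<comment> \<open>The remainder that the pieces do not reach. Its multiplier is absolutely
    summable because of \<open>heat 1\<close>, so \<open>e\<close> is continuous and bounded and
    does not affect integrability.\<close>
  define e where "e = fseries (\<lambda>\<xi>. (riesz j \<xi> * of_real (heat 1 \<xi>)) * fc g \<xi>)"
  have esum0: "(\<lambda>\<xi>. cmod (riesz j \<xi> * of_real (heat 1 \<xi>))) summable_on UNIV"
  proof (rule summable_on_comparison_test[OF heat_1_summable])
    show "cmod (riesz j \<xi> * of_real (heat 1 \<xi>)) \<le> heat 1 \<xi>" for \<xi>
      using mult_right_mono[OF norm_riesz_le[of j \<xi>], of "heat 1 \<xi>"] heat_bounds(1)[of 1 \<xi>]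
      by (simp add: norm_mult)
  qed simp
  note esum = fseries_mult_fc(1)[OF esum0 g]
  have ecc: "continuous_on S e" for S unfolding e_def by (rule fseries_continuous[OF esum])
  have eper: "e (x + axis i 1) = e x" for x i by (simp add: e_def fseries_periodic)
  have em [measurable]: "e \<in> borel_measurable borel" by (intro borel_measurable_continuous_onI ecc)
  have ei: "integrable tor e" by (intro integrable_periodic_continuous eper ecc)
  have "\<exists>B>0. \<forall>x. \<bar>e x\<bar> \<le> B" by (rule periodic_bounded[OF eper ecc]) auto
  then obtain eB where eB: "eB > 0" "\<And>x. \<bar>e x\<bar> \<le> eB" by auto
  have vm [measurable]: "v \<in> borel_measurable borel" unfolding v_def by measurable
  have vper: "v (x + axis i 1) = v x" for x i by (simp add: v_def Tper)
  have vi: "integrable tor v" unfolding v_def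
    by (rule integrable_suminf[OF Ti]) (use Tae TL1s in simp_all)
  have fcT: "fc (T k) \<xi> = piece j k \<xi> * fc g \<xi>" for k \<xi>
    unfolding T_def by (subst fc_fseries[OF Tsum]) (simp add: piece_uminus fc_uminus)
  have fce: "fc e \<xi> = riesz j \<xi> * of_real (heat 1 \<xi>) * fc g \<xi>" for \<xi>
    unfolding e_def by (subst fc_fseries[OF esum]) (simp add: riesz_uminus fc_uminus heat_uminus)
  have fcv: "fc v \<xi> = riesz j \<xi> * of_real (1 - heat 1 \<xi>) * fc g \<xi>" for \<xi>
  proof -
    let ?f = "\<lambda>k x. complex_of_real (T k x) * cnj (ee \<xi> x)"
    have nf: "norm (?f k x) = \<bar>T k x\<bar>" for k x by (simp add: norm_mult)
    have "(\<lambda>k. LINT x|tor. ?f k x) sums (LINT x|tor. (\<Sum>k. ?f k x))"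
      by (rule sums_integral) (use Tae TL1s integrable_fc[OF Ti Tm] in \<open>simp_all add: nf\<close>)
    moreover have "(LINT x|tor. (\<Sum>k. ?f k x)) = fc v \<xi>"
      unfolding fc_def
    proof (rule integral_cong_AE)
      show "(\<lambda>x. \<Sum>k. ?f k x) \<in> borel_measurable tor" "(\<lambda>x. complex_of_real (v x) * cnj (ee \<xi> x)) \<in> borel_measurable tor"
        by (rule measurable_tor; measurable)+
      show "AE x in tor. (\<Sum>k. ?f k x) = complex_of_real (v x) * cnj (ee \<xi> x)"
        using Tae
      proof eventually_elim
        case (elim x)
        then have s: "summable (\<lambda>k. T k x)" by (rule summable_rabs_cancel)
        then have "summable (\<lambda>k. complex_of_real (T k x))" by (rule summable_of_real)
        then show ?case unfolding v_def suminf_of_real[OF s] by (rule suminf_mult2[symmetric])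
      qed
    qed
    ultimately have "(\<lambda>k. piece j k \<xi> * fc g \<xi>) sums fc v \<xi>" by (simp add: fc_def[symmetric] fcT)
    moreover have "(\<lambda>k. piece j k \<xi> * fc g \<xi>) sums (riesz j \<xi> * of_real (1 - heat 1 \<xi>) * fc g \<xi>)"
      by (intro sums_mult2 piece_sums)
    ultimately show ?thesis by (rule sums_unique2)
  qed
  define B where "B = pi * (1 + pi) ^ m"
  have B0: "B \<ge> 0" by (simp add: B_def)
  have pw: "(1/2) ^ k * 2 ^ (k * (m - 1)) = (2::real) ^ (k * (m - 2))" for k
  proof -
    have "k * (m - 1) = k + k * (m - 2)" using m by (cases m) (auto simp: algebra_simps diff_mult_distrib2)
    then show ?thesis by (simp add: power_add power_divide)
  qed
  \<comment> \<open>Cutting \<open>g\<close> at the height of the same level k balances the two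
    bounds: \<open>(1/2) ^ k\<close> times the height \<open>2 ^ (k * (m - 1))\<close> for the lower
    part, and \<open>B * 2 ^ (k * (m - 1))\<close> times the mass \<open>(1/2) ^ k * G\<close> for
    the upper one.\<close>
  have low: "pconv j k gn x \<le> ennreal ((1 + B * G) * 2 ^ (k * (m - 2)))" for k x
  proof -
    have "pconv j k gn x = pconv j k (lo k) x + pconv j k (hi k) x"
      by (subst lohi[of k]) (rule pconv_add; measurable)
    also have "\<dots> \<le> ennreal ((1/2) ^ k) * ennreal (2 ^ (k * (m - 1))) + ennreal (B * 2 ^ (k * (m - 1))) * ennreal ((1/2) ^ k * G)"
    proof (rule add_mono)
      show "pconv j k (lo k) x \<le> ennreal ((1/2) ^ k) * ennreal (2 ^ (k * (m - 1)))"
        by (rule pconv_sup[OF lo_le])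
      have "pconv j k (hi k) x \<le> ennreal (B * 2 ^ (k * (m - 1))) * (\<integral>\<^sup>+y. hi k y \<partial>tor)"
        unfolding B_def by (rule pconv_L1_sup[OF m(1)]) measurable
      also have "\<dots> \<le> ennreal (B * 2 ^ (k * (m - 1))) * ennreal ((1/2) ^ k * G)"
        by (intro mult_left_mono hi_int) simp
      finally show "pconv j k (hi k) x \<le> ennreal (B * 2 ^ (k * (m - 1))) * ennreal ((1/2) ^ k * G)" .
    qed
    also have "\<dots> = ennreal ((1/2) ^ k * 2 ^ (k * (m - 1)) + (B * 2 ^ (k * (m - 1))) * ((1/2) ^ k * G))"
      using B0 G0 by (subst ennreal_plus) (auto simp: ennreal_mult')
    also have "(1/2) ^ k * 2 ^ (k * (m - 1)) + (B * 2 ^ (k * (m - 1))) * ((1/2) ^ k * G)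
        = (1 + B * G) * ((1/2) ^ k * 2 ^ (k * (m - 1)))" by (simp add: algebra_simps)
    finally show ?thesis unfolding pw .
  qed
  \<comment> \<open>The first two summands come from the pieces with \<open>k < A\<close>, the last
    one from the geometric series of the pieces with \<open>k >= A\<close> applied to the lower part
    of \<open>g\<close>.\<close>
  define D where "D = 1 + B * G + 2"
  have D: "D > 0" using mult_nonneg_nonneg[OF B0 G0] by (simp add: D_def)
  define W where "W A x = (\<Sum>k. pconv j (k + A) (hi A) x)" for A x
  have Wm [measurable]: "W A \<in> borel_measurable borel" for A unfolding W_def by measurable
  have Wint: "(\<integral>\<^sup>+x. W A x \<partial>tor) \<le> ennreal (2 * (1/2) ^ A) * (\<integral>\<^sup>+y. hi A y \<partial>tor)" for A
  proof -
    have "(\<integral>\<^sup>+x. W A x \<partial>tor) = (\<Sum>k. \<integral>\<^sup>+x. pconv j (k + A) (hi A) x \<partial>tor)"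
      unfolding W_def by (intro nn_integral_suminf measurable_tor) measurable
    also have "\<dots> \<le> (\<Sum>k. ennreal ((1/2) ^ (k + A)) * (\<integral>\<^sup>+y. hi A y \<partial>tor))"
      by (intro suminf_le pconv_L1) auto
    also have "\<dots> = ennreal (2 * (1/2) ^ A) * (\<integral>\<^sup>+y. hi A y \<partial>tor)"
      by (simp only: ennreal_suminf_multc suminf_half)
    finally show ?thesis .
  qed
  have Wfin: "AE x in tor. W A x \<noteq> \<infinity>" for A
  proof (rule nn_integral_PInf_AE)
    have "(\<integral>\<^sup>+y. hi A y \<partial>tor) < \<infinity>" using hi_int[of A] by (rule le_less_trans) simp
    then have "ennreal (2 * (1/2) ^ A) * (\<integral>\<^sup>+y. hi A y \<partial>tor) < \<infinity>" by (simp add: ennreal_mult_less_top)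
    then show "(\<integral>\<^sup>+x. W A x \<partial>tor) \<noteq> \<infinity>" using Wint[of A] by (metis leD)
  qed (rule measurable_tor, measurable)
  have geo: "(\<Sum>k<A. (2::real) ^ (k * (m - 2))) \<le> 2 ^ (A * (m - 2))" for A
  proof (induction A)
    case (Suc A)
    have "(\<Sum>k<Suc A. (2::real) ^ (k * (m - 2))) \<le> 2 * 2 ^ (A * (m - 2))" using Suc by simp
    also have "\<dots> = 2 ^ (Suc (A * (m - 2)))" by simp
    also have "\<dots> \<le> 2 ^ (Suc A * (m - 2))" using m by (intro power_increasing) auto
    finally show ?case .
  qed simp
  have total: "(\<Sum>k. pconv j k gn x) \<le> ennreal (D * 2 ^ (A * (m - 2))) + W A x" for A x
  proof -
    have "(\<Sum>k. pconv j k gn x) = (\<Sum>k. pconv j (k + A) gn x) + (\<Sum>k<A. pconv j k gn x)"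
      by (rule suminf_offset) (rule summableI)
    also have "(\<Sum>k<A. pconv j k gn x) \<le> (\<Sum>k<A. ennreal ((1 + B * G) * 2 ^ (k * (m - 2))))" by (intro sum_mono low)
    also have "\<dots> = ennreal (\<Sum>k<A. (1 + B * G) * 2 ^ (k * (m - 2)))" using B0 G0 by (intro sum_ennreal) auto
    also have "\<dots> \<le> ennreal ((1 + B * G) * 2 ^ (A * (m - 2)))"
      unfolding sum_distrib_left[symmetric] using B0 G0 by (intro ennreal_leI mult_left_mono geo) auto
    also have "(\<Sum>k. pconv j (k + A) gn x) = (\<Sum>k. pconv j (k + A) (lo A) x + pconv j (k + A) (hi A) x)"
      by (subst lohi[of A]) (subst pconv_add; measurable)
    also have "\<dots> = (\<Sum>k. pconv j (k + A) (lo A) x) + W A x"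
      unfolding W_def by (rule suminf_add[symmetric]) (rule summableI)+
    also have "(\<Sum>k. pconv j (k + A) (lo A) x) \<le> (\<Sum>k. ennreal ((1/2) ^ (k + A)) * ennreal (2 ^ (A * (m - 1))))"
      by (intro suminf_le pconv_sup lo_le) auto
    also have "\<dots> = ennreal (2 * (1/2) ^ A) * ennreal (2 ^ (A * (m - 1)))"
      by (simp only: ennreal_suminf_multc suminf_half)
    also have "\<dots> = ennreal (2 * 2 ^ (A * (m - 2)))"
      unfolding pw[symmetric] by (simp add: ennreal_mult'[symmetric] mult.assoc)
    finally have "(\<Sum>k. pconv j k gn x) \<le> ennreal (2 * 2 ^ (A * (m - 2))) + W A x + ennreal ((1 + B * G) * 2 ^ (A * (m - 2)))"
      by (simp add: add_mono)
    also have "\<dots> = (ennreal (2 * 2 ^ (A * (m - 2))) + ennreal ((1 + B * G) * 2 ^ (A * (m - 2)))) + W A x"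
      by (simp only: ac_simps)
    also have "ennreal (2 * 2 ^ (A * (m - 2))) + ennreal ((1 + B * G) * 2 ^ (A * (m - 2))) = ennreal (D * 2 ^ (A * (m - 2)))"
      using B0 G0 by (subst ennreal_plus[symmetric]) (auto simp: D_def algebra_simps)
    finally show ?thesis .
  qed
  have bound: "AE x in tor. \<bar>v x\<bar> \<le> D * 2 powr (real (m - 2) * real A) + enn2real (W A x)" for A
    using Tae Wfin[of A]
  proof eventually_elim
    case (elim x)
    have "\<bar>v x\<bar> \<le> (\<Sum>k. \<bar>T k x\<bar>)" unfolding v_def by (rule summable_rabs[OF elim(1)])
    then have "ennreal \<bar>v x\<bar> \<le> ennreal (\<Sum>k. \<bar>T k x\<bar>)" by (rule ennreal_leI)
    also have "\<dots> = (\<Sum>k. ennreal \<bar>T k x\<bar>)" using elim(1) by (intro suminf_ennreal2[symmetric]) auto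
    also have "\<dots> \<le> (\<Sum>k. pconv j k gn x)" by (intro suminf_le Tle) auto
    also have "\<dots> \<le> ennreal (D * 2 ^ (A * (m - 2))) + W A x" by (rule total)
    also have "W A x = ennreal (enn2real (W A x))" using elim(2) by (simp add: top.not_eq_extremum)
    also have "ennreal (D * 2 ^ (A * (m - 2))) + ennreal (enn2real (W A x)) = ennreal (D * 2 ^ (A * (m - 2)) + enn2real (W A x))"
      using D by (intro ennreal_plus[symmetric]) auto
    finally have "\<bar>v x\<bar> \<le> D * 2 ^ (A * (m - 2)) + enn2real (W A x)"
      using D by (subst (asm) ennreal_le_iff) auto
    then show ?case by (simp only: two_powr_mult mult.commute[of A])
  qed
  \<comment> \<open>With growth rate \<open>m - 2\<close> and \<open>\<theta> = 1\<close> the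
    exponent is \<open>1 + 2 / (m - 2) = m / (m - 2)\<close>. The factor \<open>4 ^ A\<close> meets
    the bound \<open>2 * (1/2) ^ A\<close> for the mass of \<open>W A\<close>, and the remaining
    \<open>2 ^ A\<close> is summed in \<open>hi_sum\<close>.\<close>
  have vq: "integrable tor (\<lambda>x. \<bar>v x\<bar> powr (1 + 2 / real (m - 2)))"
  proof (rule dyadic_split_integrable[OF D, of "real (m - 2)" 1 v "\<lambda>A x. enn2real (W A x)"])
    have "(\<Sum>A. 4 ^ A * (\<integral>\<^sup>+x. ennreal (enn2real (W A x) powr 1) \<partial>tor))
        \<le> (\<Sum>A. 2 * (ennreal (2 ^ A) * (\<integral>\<^sup>+y. hi A y \<partial>tor)))"
    proof (intro suminf_le)
      fix A
      have "(\<integral>\<^sup>+x. ennreal (enn2real (W A x) powr 1) \<partial>tor) \<le> (\<integral>\<^sup>+x. W A x \<partial>tor)"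
        by (intro nn_integral_mono) (simp add: ennreal_enn2real_if)
      also have "\<dots> \<le> ennreal (2 * (1/2) ^ A) * (\<integral>\<^sup>+y. hi A y \<partial>tor)" by (rule Wint)
      finally have "4 ^ A * (\<integral>\<^sup>+x. ennreal (enn2real (W A x) powr 1) \<partial>tor)
        \<le> 4 ^ A * (ennreal (2 * (1/2) ^ A) * (\<integral>\<^sup>+y. hi A y \<partial>tor))" by (intro mult_left_mono) auto
      also have "\<dots> = (ennreal (4 ^ A) * ennreal (2 * (1/2) ^ A)) * (\<integral>\<^sup>+y. hi A y \<partial>tor)"
        by (simp add: mult.assoc ennreal_power[symmetric])
      also have "ennreal (4 ^ A) * ennreal (2 * (1/2) ^ A) = ennreal (2 * 2 ^ A)"
      proof -
        have "(4::real) ^ A * (2 * (1/2) ^ A) = 2 * (4 * (1/2)) ^ A" by (simp only: power_mult_distrib mult_ac)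
        then show ?thesis by (simp add: ennreal_mult'[symmetric])
      qed
      also have "ennreal (2 * 2 ^ A) = 2 * ennreal (2 ^ A)" by (simp add: ennreal_mult')
      finally show "4 ^ A * (\<integral>\<^sup>+x. ennreal (enn2real (W A x) powr 1) \<partial>tor) \<le> 2 * (ennreal (2 ^ A) * (\<integral>\<^sup>+y. hi A y \<partial>tor))"
        by (simp only: mult.assoc)
    qed auto
    also have "\<dots> = 2 * (\<Sum>A. ennreal (2 ^ A) * (\<integral>\<^sup>+y. hi A y \<partial>tor))" by (rule ennreal_suminf_cmult)
    also have "(\<Sum>A. ennreal (2 ^ A) * (\<integral>\<^sup>+y. hi A y \<partial>tor)) = (\<integral>\<^sup>+y. (\<Sum>A. ennreal (2 ^ A) * hi A y) \<partial>tor)"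
      by (subst nn_integral_suminf) (auto intro!: suminf_cong nn_integral_cmult[symmetric])
    also have "\<dots> \<le> (\<integral>\<^sup>+y. 2 * ennreal (\<bar>g y\<bar> powr ?r) \<partial>tor)"
      using hi_sum by (intro nn_integral_mono) (simp add: ennreal_mult')
    also have "\<dots> = 2 * ennreal G" unfolding Gnn[symmetric] by (rule nn_integral_cmult) measurable
    finally have "(\<Sum>A. 4 ^ A * (\<integral>\<^sup>+x. ennreal (enn2real (W A x) powr 1) \<partial>tor)) \<le> 2 * (2 * ennreal G)"
      by (simp add: mult_left_mono)
    also have "\<dots> < \<infinity>" by (simp add: ennreal_mult_less_top)
    finally show "(\<Sum>A. 4 ^ A * (\<integral>\<^sup>+x. ennreal (enn2real (W A x) powr 1) \<partial>tor)) < \<infinity>" .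
  qed (use m bound in auto)
  define q where "q = real m / (real m - 2)"
  have q: "1 + 2 / real (m - 2) = q" "q \<ge> 0" using m by (auto simp: q_def of_nat_diff field_simps)
  have "integrable tor (\<lambda>x. \<bar>v x + e x\<bar> powr q)"
  proof (rule Bochner_Integration.integrable_bound)
    show "integrable tor (\<lambda>x. 2 powr q * (\<bar>v x\<bar> powr q + eB powr q))" using vq q by simp
    show "(\<lambda>x. \<bar>v x + e x\<bar> powr q) \<in> borel_measurable tor" by (rule measurable_tor) measurable
    show "AE x in tor. norm (\<bar>v x + e x\<bar> powr q) \<le> norm (2 powr q * (\<bar>v x\<bar> powr q + eB powr q))"
    proof (rule AE_I2)
      fix x
      have "\<bar>v x + e x\<bar> powr q \<le> (2 * max \<bar>v x\<bar> eB) powr q"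
        using eB(2)[of x] q by (intro powr_mono2) auto
      also have "\<dots> = 2 powr q * (max \<bar>v x\<bar> eB) powr q" by (rule powr_mult)
      also have "\<dots> \<le> 2 powr q * (\<bar>v x\<bar> powr q + eB powr q)"
        by (intro mult_left_mono) (auto simp: max_def)
      finally show "norm (\<bar>v x + e x\<bar> powr q) \<le> norm (2 powr q * (\<bar>v x\<bar> powr q + eB powr q))" by simp
    qed
  qed
  moreover have "fc (\<lambda>x. v x + e x) \<xi> = riesz j \<xi> * fc g \<xi>" for \<xi>
    by (subst fc_add[OF vi vm ei em]) (simp add: fcv fce algebra_simps)
  ultimately show ?thesis
    using vi ei by (intro exI[of _ "\<lambda>x. v x + e x"]) (auto simp: q_def vper eper)
qed

section \<open>The Galerkin system in Fourier space\<close>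

text \<open>Bilinear, without conjugation: up to \<open>2 pi \<i>\<close> it is the Fourier
  coefficient of the divergence.\<close>

definition sdot :: "int ^ 'n \<Rightarrow> ('n::finite \<Rightarrow> complex) \<Rightarrow> complex" where
  "sdot \<xi> u = (\<Sum>k\<in>UNIV. of_int (\<xi> $ k) * u k)"

text \<open>The orthogonal projection onto the complement of \<open>\<xi>\<close>; at
  \<open>\<xi> = 0\<close> division by zero makes it the identity.\<close>

definition leray :: "int ^ 'n \<Rightarrow> ('n::finite \<Rightarrow> complex) \<Rightarrow> 'n \<Rightarrow> complex" where
  "leray \<xi> u k = u k - of_int (\<xi> $ k) * sdot \<xi> u / of_real ((norm (freq \<xi>))\<^sup>2)"

definition symb :: "'n::finite tensor \<Rightarrow> int ^ 'n \<Rightarrow> ('n \<Rightarrow> complex) \<Rightarrow> 'n \<Rightarrow> complex" where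
  "symb a \<xi> u k = (\<Sum>j\<in>UNIV. of_real (\<Sum>\<alpha>\<in>UNIV. \<Sum>\<beta>\<in>UNIV. a k j \<alpha> \<beta> * real_of_int (\<xi> $ \<alpha>) * real_of_int (\<xi> $ \<beta>)) * u j)"

text \<open>The divergence form $\partial_j(w_jw_k)$ of the convection term, which agrees with $w_j\partial_jw_k$
  only for solenoidal \<open>w\<close>.\<close>

definition conv :: "(int ^ 'n) set \<Rightarrow> ('n::finite \<Rightarrow> int ^ 'n \<Rightarrow> complex) \<Rightarrow> 'n \<Rightarrow> int ^ 'n \<Rightarrow> complex" where
  "conv X w k \<xi> = 2 * pi * \<i> * (\<Sum>\<zeta>\<in>X. sdot \<xi> (\<lambda>j. w j (\<xi> - \<zeta>)) * w k \<zeta>)"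

lemma sdot_lin: "sdot \<xi> (\<lambda>k. r * u k + s * v k) = r * sdot \<xi> u + s * sdot \<xi> v"
  by (simp add: sdot_def sum.distrib sum_distrib_left algebra_simps)

lemma sdot_add_freq: "sdot (\<xi> + \<eta>) u = sdot \<xi> u + sdot \<eta> u"
  and sdot_uminus_freq: "sdot (- \<xi>) u = - sdot \<xi> u"
  by (simp_all add: sdot_def sum.distrib algebra_simps sum_negf)

lemma sdot_cnj: "sdot \<xi> (\<lambda>k. cnj (u k)) = cnj (sdot \<xi> u)"
  by (simp add: sdot_def)

lemma sdot_freq: "sdot \<xi> (\<lambda>k. of_int (\<xi> $ k)) = of_real ((norm (freq \<xi>))\<^sup>2)"
  unfolding sdot_def norm_freq_sq by (simp add: power2_eq_square)

lemma leray_sdot: "\<xi> \<noteq> 0 \<Longrightarrow> sdot \<xi> (leray \<xi> u) = 0"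
proof -
  assume "\<xi> \<noteq> 0"
  let ?q = "sdot \<xi> u / of_real ((norm (freq \<xi>))\<^sup>2)"
  have "leray \<xi> u = (\<lambda>k. 1 * u k + (- ?q) * of_int (\<xi> $ k))" by (simp add: leray_def fun_eq_iff)
  then have "sdot \<xi> (leray \<xi> u) = 1 * sdot \<xi> u + (- ?q) * of_real ((norm (freq \<xi>))\<^sup>2)"
    by (simp only: sdot_lin sdot_freq)
  then show ?thesis using \<open>\<xi> \<noteq> 0\<close> by simp
qed

lemma leray_id: "sdot \<xi> u = 0 \<Longrightarrow> leray \<xi> u = u"
  by (simp add: leray_def fun_eq_iff)

lemma leray_lin: "leray \<xi> (\<lambda>k. r * u k + s * v k) k = r * leray \<xi> u k + s * leray \<xi> v k"
  unfolding leray_def sdot_lin by (simp add: right_diff_distrib distrib_left add_divide_distrib mult_ac)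

lemma leray_uminus: "leray (- \<xi>) u = leray \<xi> u"
  by (simp add: leray_def sdot_uminus_freq freq_uminus fun_eq_iff)

lemma leray_cnj: "leray \<xi> (\<lambda>k. cnj (u k)) k = cnj (leray \<xi> u k)"
  by (simp add: leray_def sdot_cnj)

lemma leray_selfadjoint: "(\<Sum>k\<in>UNIV. cnj (u k) * leray \<xi> v k) = (\<Sum>k\<in>UNIV. cnj (leray \<xi> u k) * v k)"
proof -
  let ?r = "complex_of_real ((norm (freq \<xi>))\<^sup>2)"
  have c: "(\<Sum>k\<in>UNIV. of_int (\<xi> $ k) * cnj (u k)) = cnj (sdot \<xi> u)" by (simp add: sdot_def)
  have d: "(\<Sum>k\<in>UNIV. of_int (\<xi> $ k) * v k) = sdot \<xi> v" by (simp add: sdot_def)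
  have "(\<Sum>k\<in>UNIV. cnj (u k) * leray \<xi> v k)
      = (\<Sum>k\<in>UNIV. cnj (u k) * v k - (of_int (\<xi> $ k) * cnj (u k)) * (sdot \<xi> v / ?r))"
    by (intro sum.cong refl) (simp add: leray_def algebra_simps)
  also have "\<dots> = (\<Sum>k\<in>UNIV. cnj (u k) * v k) - cnj (sdot \<xi> u) * (sdot \<xi> v / ?r)"
    by (simp only: sum_subtractf sum_distrib_right[symmetric] c)
  also have "\<dots> = (\<Sum>k\<in>UNIV. cnj (u k) * v k) - sdot \<xi> v * (cnj (sdot \<xi> u) / ?r)" by simp
  also have "\<dots> = (\<Sum>k\<in>UNIV. cnj (u k) * v k - (of_int (\<xi> $ k) * v k) * (cnj (sdot \<xi> u) / ?r))"
    by (simp only: sum_subtractf sum_distrib_right[symmetric] d)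
  also have "\<dots> = (\<Sum>k\<in>UNIV. cnj (leray \<xi> u k) * v k)"
    by (intro sum.cong refl) (simp add: leray_def algebra_simps)
  finally show ?thesis .
qed

lemma sum3_swap:
  "(\<Sum>k\<in>UNIV. \<Sum>j\<in>UNIV. \<Sum>\<alpha>\<in>UNIV. H k j \<alpha>) = (\<Sum>k\<in>UNIV. \<Sum>j\<in>UNIV. \<Sum>\<alpha>\<in>UNIV. H \<alpha> j (k :: 'n::finite) :: real)"
proof -
  have "(\<Sum>k\<in>UNIV. \<Sum>j\<in>UNIV. \<Sum>\<alpha>\<in>UNIV. H k j \<alpha>) = (\<Sum>j\<in>UNIV. \<Sum>k\<in>UNIV. \<Sum>\<alpha>\<in>UNIV. H k j \<alpha>)" by (rule sum.swap)
  also have "\<dots> = (\<Sum>j\<in>UNIV. \<Sum>\<alpha>\<in>UNIV. \<Sum>k\<in>UNIV. H k j \<alpha>)" by (intro sum.cong refl sum.swap)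
  also have "\<dots> = (\<Sum>\<alpha>\<in>UNIV. \<Sum>j\<in>UNIV. \<Sum>k\<in>UNIV. H k j \<alpha>)" by (rule sum.swap)
  finally show ?thesis .
qed

text \<open>The test matrix is the symmetric part of \<open>x k * z \<alpha>\<close>; its trace is
  the vanishing product of x and z. The two symmetries of \<open>a\<close> allow either factor of
  the quadratic form to be replaced by the unsymmetrized matrix.\<close>

lemma elliptic_real:
  fixes a :: "'n::finite tensor" and x z :: "'n \<Rightarrow> real"
  assumes a: "tensor_symmetric a" "relaxed_elliptic a C" and div: "(\<Sum>k\<in>UNIV. z k * x k) = 0"
  shows "(\<Sum>k\<in>UNIV. (z k)\<^sup>2) * (\<Sum>k\<in>UNIV. (x k)\<^sup>2) / 2
    \<le> C * (\<Sum>k\<in>UNIV. \<Sum>j\<in>UNIV. \<Sum>\<alpha>\<in>UNIV. \<Sum>\<beta>\<in>UNIV. a k j \<alpha> \<beta> * (x k * z \<alpha>) * (x j * z \<beta>))"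
proof -
  have sa: "a k j \<alpha> \<beta> = a \<alpha> j k \<beta>" "a k j \<alpha> \<beta> = a k \<beta> \<alpha> j" for k j \<alpha> \<beta>
    using a(1) unfolding tensor_symmetric_def by blast+
  define p where "p k \<alpha> = x k * z \<alpha>" for k \<alpha>
  define s where "s k \<alpha> = (p k \<alpha> + p \<alpha> k) / 2" for k \<alpha>
  define Z where "Z = (\<chi> k \<alpha>. s k \<alpha>)"
  have "transpose Z = Z" by (simp add: transpose_def Z_def s_def add.commute vec_eq_iff)
  moreover have "(\<Sum>k\<in>UNIV. Z $ k $ k) = 0" using div by (simp add: Z_def s_def p_def mult.commute)
  ultimately have ell: "(\<Sum>k\<in>UNIV. \<Sum>\<alpha>\<in>UNIV. s k \<alpha> * s k \<alpha>)
      \<le> C * (\<Sum>k\<in>UNIV. \<Sum>j\<in>UNIV. \<Sum>\<alpha>\<in>UNIV. \<Sum>\<beta>\<in>UNIV. a k j \<alpha> \<beta> * s k \<alpha> * s j \<beta>)"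
    using a(2) unfolding relaxed_elliptic_def by (fastforce simp: Z_def)
  have half1: "(\<Sum>k\<in>UNIV. \<Sum>j\<in>UNIV. \<Sum>\<alpha>\<in>UNIV. \<Sum>\<beta>\<in>UNIV. a k j \<alpha> \<beta> * s k \<alpha> * Y j \<beta>)
      = (\<Sum>k\<in>UNIV. \<Sum>j\<in>UNIV. \<Sum>\<alpha>\<in>UNIV. \<Sum>\<beta>\<in>UNIV. a k j \<alpha> \<beta> * p k \<alpha> * Y j \<beta>)" for Y
  proof -
    have "(\<Sum>k\<in>UNIV. \<Sum>j\<in>UNIV. \<Sum>\<alpha>\<in>UNIV. \<Sum>\<beta>\<in>UNIV. a k j \<alpha> \<beta> * p \<alpha> k * Y j \<beta>)
        = (\<Sum>k\<in>UNIV. \<Sum>j\<in>UNIV. \<Sum>\<alpha>\<in>UNIV. \<Sum>\<beta>\<in>UNIV. a \<alpha> j k \<beta> * p k \<alpha> * Y j \<beta>)"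
      by (rule sum3_swap)
    also have "\<dots> = (\<Sum>k\<in>UNIV. \<Sum>j\<in>UNIV. \<Sum>\<alpha>\<in>UNIV. \<Sum>\<beta>\<in>UNIV. a k j \<alpha> \<beta> * p k \<alpha> * Y j \<beta>)"
      by (simp only: sa(1)[symmetric])
    moreover have "(\<Sum>k\<in>UNIV. \<Sum>j\<in>UNIV. \<Sum>\<alpha>\<in>UNIV. \<Sum>\<beta>\<in>UNIV. a k j \<alpha> \<beta> * s k \<alpha> * Y j \<beta>)
      = ((\<Sum>k\<in>UNIV. \<Sum>j\<in>UNIV. \<Sum>\<alpha>\<in>UNIV. \<Sum>\<beta>\<in>UNIV. a k j \<alpha> \<beta> * p k \<alpha> * Y j \<beta>)
        + (\<Sum>k\<in>UNIV. \<Sum>j\<in>UNIV. \<Sum>\<alpha>\<in>UNIV. \<Sum>\<beta>\<in>UNIV. a k j \<alpha> \<beta> * p \<alpha> k * Y j \<beta>)) / 2"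
      unfolding sum.distrib[symmetric] sum_divide_distrib
      by (intro sum.cong refl) (simp add: s_def field_simps)
    ultimately show ?thesis by simp
  qed
  have half2: "(\<Sum>k\<in>UNIV. \<Sum>j\<in>UNIV. \<Sum>\<alpha>\<in>UNIV. \<Sum>\<beta>\<in>UNIV. a k j \<alpha> \<beta> * p k \<alpha> * s j \<beta>)
      = (\<Sum>k\<in>UNIV. \<Sum>j\<in>UNIV. \<Sum>\<alpha>\<in>UNIV. \<Sum>\<beta>\<in>UNIV. a k j \<alpha> \<beta> * p k \<alpha> * p j \<beta>)"
  proof -
    have "(\<Sum>k\<in>UNIV. \<Sum>j\<in>UNIV. \<Sum>\<alpha>\<in>UNIV. \<Sum>\<beta>\<in>UNIV. a k j \<alpha> \<beta> * p k \<alpha> * p \<beta> j)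
        = (\<Sum>k\<in>UNIV. \<Sum>j\<in>UNIV. \<Sum>\<alpha>\<in>UNIV. \<Sum>\<beta>\<in>UNIV. a k \<beta> \<alpha> j * p k \<alpha> * p j \<beta>)"
      by (intro sum.cong refl sum3_swap)
    also have "\<dots> = (\<Sum>k\<in>UNIV. \<Sum>j\<in>UNIV. \<Sum>\<alpha>\<in>UNIV. \<Sum>\<beta>\<in>UNIV. a k j \<alpha> \<beta> * p k \<alpha> * p j \<beta>)"
      by (simp only: sa(2)[symmetric])
    moreover have "(\<Sum>k\<in>UNIV. \<Sum>j\<in>UNIV. \<Sum>\<alpha>\<in>UNIV. \<Sum>\<beta>\<in>UNIV. a k j \<alpha> \<beta> * p k \<alpha> * s j \<beta>)
      = ((\<Sum>k\<in>UNIV. \<Sum>j\<in>UNIV. \<Sum>\<alpha>\<in>UNIV. \<Sum>\<beta>\<in>UNIV. a k j \<alpha> \<beta> * p k \<alpha> * p j \<beta>)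
        + (\<Sum>k\<in>UNIV. \<Sum>j\<in>UNIV. \<Sum>\<alpha>\<in>UNIV. \<Sum>\<beta>\<in>UNIV. a k j \<alpha> \<beta> * p k \<alpha> * p \<beta> j)) / 2"
      unfolding sum.distrib[symmetric] sum_divide_distrib
      by (intro sum.cong refl) (simp add: s_def field_simps)
    ultimately show ?thesis by simp
  qed
  \<comment> \<open>The squared norm of the symmetric part is
    \<open>(|x|^2 |z|^2 + (x \<bullet> z)^2) / 2\<close>, and the second term is zero. This is the
    origin of the factor 1/2.\<close>
  have "(\<Sum>k\<in>UNIV. \<Sum>\<alpha>\<in>UNIV. s k \<alpha> * s k \<alpha>) = (\<Sum>k\<in>UNIV. (z k)\<^sup>2) * (\<Sum>k\<in>UNIV. (x k)\<^sup>2) / 2"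
  proof -
    have "(\<Sum>k\<in>UNIV. \<Sum>\<alpha>\<in>UNIV. s k \<alpha> * s k \<alpha>)
        = (\<Sum>k\<in>UNIV. \<Sum>\<alpha>\<in>UNIV. (x k)\<^sup>2 * (z \<alpha>)\<^sup>2) / 4 + (\<Sum>k\<in>UNIV. \<Sum>\<alpha>\<in>UNIV. (z k)\<^sup>2 * (x \<alpha>)\<^sup>2) / 4
          + (\<Sum>k\<in>UNIV. \<Sum>\<alpha>\<in>UNIV. (z k * x k) * (z \<alpha> * x \<alpha>)) / 2"
      unfolding sum.distrib[symmetric] sum_divide_distrib
      by (intro sum.cong refl) (simp add: s_def p_def power2_eq_square field_simps)
    also have "\<dots> = (\<Sum>k\<in>UNIV. (z k)\<^sup>2) * (\<Sum>k\<in>UNIV. (x k)\<^sup>2) / 2"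
      unfolding sum_product[symmetric] div by (simp add: mult.commute)
    finally show ?thesis .
  qed
  with ell half1[of s] half2 show ?thesis by (simp add: p_def)
qed

text \<open>The tensor and the frequency are real, so real and imaginary parts of u decouple and
  each satisfies the divergence condition.\<close>

lemma elliptic_symb:
  fixes a :: "'n::finite tensor"
  assumes a: "tensor_symmetric a" "relaxed_elliptic a C" and div: "sdot \<xi> u = 0"
  shows "(norm (freq \<xi>))\<^sup>2 * (\<Sum>k\<in>UNIV. (cmod (u k))\<^sup>2) / 2 \<le> C * Re (\<Sum>k\<in>UNIV. cnj (u k) * symb a \<xi> u k)"
proof -
  define z where "z k = real_of_int (\<xi> $ k)" for k
  define Q where "Q x = (\<Sum>k\<in>UNIV. \<Sum>j\<in>UNIV. \<Sum>\<alpha>\<in>UNIV. \<Sum>\<beta>\<in>UNIV. a k j \<alpha> \<beta> * (x k * z \<alpha>) * (x j * z \<beta>))" for x :: "'n \<Rightarrow> real"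
  have "Re (sdot \<xi> u) = 0" "Im (sdot \<xi> u) = 0" using div by simp_all
  then have d: "(\<Sum>k\<in>UNIV. z k * Re (u k)) = 0" "(\<Sum>k\<in>UNIV. z k * Im (u k)) = 0"
    by (simp_all add: sdot_def z_def)
  have "Re (\<Sum>k\<in>UNIV. cnj (u k) * symb a \<xi> u k) = Q (\<lambda>k. Re (u k)) + Q (\<lambda>k. Im (u k))"
    unfolding Q_def symb_def Re_sum sum.distrib[symmetric] sum_distrib_left
  proof (intro sum.cong refl)
    fix k j
    let ?S = "\<Sum>\<alpha>\<in>UNIV. \<Sum>\<beta>\<in>UNIV. a k j \<alpha> \<beta> * z \<alpha> * z \<beta>"
    have "Re (cnj (u k) * (of_real ?S * u j)) = ?S * (Re (u k) * Re (u j) + Im (u k) * Im (u j))"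
      by (simp add: algebra_simps)
    also have "\<dots> = (\<Sum>\<alpha>\<in>UNIV. \<Sum>\<beta>\<in>UNIV. a k j \<alpha> \<beta> * (Re (u k) * z \<alpha>) * (Re (u j) * z \<beta>) + a k j \<alpha> \<beta> * (Im (u k) * z \<alpha>) * (Im (u j) * z \<beta>))"
      unfolding sum_distrib_right by (intro sum.cong refl) (simp add: algebra_simps)
    finally show "Re (cnj (u k) * (of_real (\<Sum>\<alpha>\<in>UNIV. \<Sum>\<beta>\<in>UNIV. a k j \<alpha> \<beta> * real_of_int (\<xi> $ \<alpha>) * real_of_int (\<xi> $ \<beta>)) * u j))
      = (\<Sum>\<alpha>\<in>UNIV. \<Sum>\<beta>\<in>UNIV. a k j \<alpha> \<beta> * (Re (u k) * z \<alpha>) * (Re (u j) * z \<beta>) + a k j \<alpha> \<beta> * (Im (u k) * z \<alpha>) * (Im (u j) * z \<beta>))"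
      by (simp only: z_def)
  qed
  moreover have "(\<Sum>k\<in>UNIV. (z k)\<^sup>2) * (\<Sum>k\<in>UNIV. (Re (u k))\<^sup>2) / 2 \<le> C * Q (\<lambda>k. Re (u k))"
    unfolding Q_def by (rule elliptic_real[OF a d(1)])
  moreover have "(\<Sum>k\<in>UNIV. (z k)\<^sup>2) * (\<Sum>k\<in>UNIV. (Im (u k))\<^sup>2) / 2 \<le> C * Q (\<lambda>k. Im (u k))"
    unfolding Q_def by (rule elliptic_real[OF a d(2)])
  ultimately show ?thesis
    by (simp add: norm_freq_sq cmod_power2 sum.distrib z_def[symmetric] distrib_left add_divide_distrib)
qed

definition solenoidal :: "(int ^ 'n::finite) set \<Rightarrow> ('n \<Rightarrow> int ^ 'n \<Rightarrow> complex) \<Rightarrow> bool" where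
  "solenoidal X w \<longleftrightarrow> (\<forall>k. hermitian (w k)) \<and> (\<forall>\<xi>. sdot \<xi> (\<lambda>k. w k \<xi>) = 0) \<and> (\<forall>k \<xi>. \<xi> \<notin> X \<longrightarrow> w k \<xi> = 0)"

text \<open>The convection term does no work: substituting $\xi\mapsto-\xi$ and symmetrizing in
  \<open>\<xi>\<close> and \<open>\<zeta>\<close> produces the divergence of \<open>w\<close> at $-(\xi+\zeta)$.\<close>

lemma conv_orthogonal:
  assumes w: "solenoidal X w" and X: "finite X" "\<And>\<xi>. \<xi> \<in> X \<Longrightarrow> - \<xi> \<in> X"
  shows "(\<Sum>\<xi>\<in>X. \<Sum>k\<in>UNIV. cnj (w k \<xi>) * conv X w k \<xi>) = 0"
proof -
  have herm: "cnj (w k \<xi>) = w k (- \<xi>)" and div: "sdot \<xi> (\<lambda>k. w k \<xi>) = 0" for k \<xi>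
    using w by (simp_all add: solenoidal_def hermitian_def)
  define S where "S k = (\<Sum>\<xi>\<in>X. \<Sum>\<zeta>\<in>X. w k \<xi> * w k \<zeta> * sdot \<xi> (\<lambda>j. w j (- \<xi> - \<zeta>)))" for k
  have S0: "S k = 0" for k
  proof -
    have "S k = (\<Sum>\<zeta>\<in>X. \<Sum>\<xi>\<in>X. w k \<xi> * w k \<zeta> * sdot \<xi> (\<lambda>j. w j (- \<xi> - \<zeta>)))"
      unfolding S_def by (rule sum.swap)
    then have "S k + S k = (\<Sum>\<xi>\<in>X. \<Sum>\<zeta>\<in>X. w k \<xi> * w k \<zeta> * sdot \<xi> (\<lambda>j. w j (- \<xi> - \<zeta>)))
      + (\<Sum>\<zeta>\<in>X. \<Sum>\<xi>\<in>X. w k \<xi> * w k \<zeta> * sdot \<xi> (\<lambda>j. w j (- \<xi> - \<zeta>)))"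
      by (simp only: S_def)
    also have "\<dots> = (\<Sum>\<xi>\<in>X. \<Sum>\<zeta>\<in>X. w k \<xi> * w k \<zeta> * (- sdot (- \<xi> - \<zeta>) (\<lambda>j. w j (- \<xi> - \<zeta>))))"
    proof -
      have h: "- sdot (- \<xi> - \<zeta>) u = sdot \<xi> u + sdot \<zeta> u" for \<xi> \<zeta> :: "int ^ 'a" and u
        using sdot_uminus_freq[of "\<xi> + \<zeta>" u] by (simp add: sdot_add_freq)
      have e: "w k \<zeta> * w k \<xi> * sdot \<zeta> (\<lambda>j. w j (- \<zeta> - \<xi>)) = w k \<xi> * w k \<zeta> * sdot \<zeta> (\<lambda>j. w j (- \<xi> - \<zeta>))" for \<xi> \<zeta>
      proof -
        have "- \<zeta> - \<xi> = - \<xi> - \<zeta>" by simp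
        then show ?thesis by (simp only: mult.commute)
      qed
      show ?thesis
        unfolding sum.distrib[symmetric] e h distrib_left ..
    qed
    also have "\<dots> = 0" by (simp add: div)
    finally show ?thesis by simp
  qed
  have "(\<Sum>\<xi>\<in>X. cnj (w k \<xi>) * conv X w k \<xi>) = - (2 * pi * \<i>) * S k" for k
  proof -
    have "(\<Sum>\<xi>\<in>X. cnj (w k \<xi>) * conv X w k \<xi>) = (\<Sum>\<xi>\<in>X. cnj (w k (- \<xi>)) * conv X w k (- \<xi>))"
      by (rule sum.reindex_bij_witness[of _ uminus uminus]) (auto intro: X)
    also have "\<dots> = (\<Sum>\<xi>\<in>X. - (2 * pi * \<i>) * (\<Sum>\<zeta>\<in>X. w k \<xi> * w k \<zeta> * sdot \<xi> (\<lambda>j. w j (- \<xi> - \<zeta>))))"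
      unfolding conv_def herm sdot_uminus_freq
      by (intro sum.cong refl) (simp add: sum_distrib_left sum_negf mult_ac)
    finally show ?thesis by (simp add: S_def sum_distrib_left)
  qed
  then have "(\<Sum>k\<in>UNIV. \<Sum>\<xi>\<in>X. cnj (w k \<xi>) * conv X w k \<xi>) = 0" by (simp add: S0)
  then show ?thesis by (subst sum.swap)
qed

definition resid :: "'n::finite tensor \<Rightarrow> ('n \<Rightarrow> int ^ 'n \<Rightarrow> complex) \<Rightarrow> (int ^ 'n) set
    \<Rightarrow> ('n \<Rightarrow> int ^ 'n \<Rightarrow> complex) \<Rightarrow> int ^ 'n \<Rightarrow> 'n \<Rightarrow> complex" where
  "resid a F X w \<xi> k = of_real (4 * pi\<^sup>2) * symb a \<xi> (\<lambda>k. w k \<xi>) k + conv X w k \<xi> - F k \<xi>"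

lemma symb_uminus: "symb a (- \<xi>) u k = symb a \<xi> u k"
  by (simp add: symb_def)

lemma symb_cnj: "symb a \<xi> (\<lambda>k. cnj (u k)) k = cnj (symb a \<xi> u k)"
  by (simp add: symb_def)

lemma resid_hermitian:
  assumes w: "solenoidal X w" and X: "\<And>\<xi>. \<xi> \<in> X \<Longrightarrow> - \<xi> \<in> X" and F: "\<And>k. hermitian (F k)"
  shows "resid a F X w (- \<xi>) k = cnj (resid a F X w \<xi> k)"
proof -
  have herm: "w k (- \<xi>) = cnj (w k \<xi>)" for k \<xi> using w by (simp add: solenoidal_def hermitian_def)
  have "(\<Sum>\<zeta>\<in>X. sdot (- \<xi>) (\<lambda>j. w j (- \<xi> - \<zeta>)) * w k \<zeta>) = (\<Sum>\<zeta>\<in>X. sdot (- \<xi>) (\<lambda>j. w j (- \<xi> - - \<zeta>)) * w k (- \<zeta>))"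
    by (rule sum.reindex_bij_witness[of _ uminus uminus]) (auto intro: X)
  also have "\<dots> = - cnj (\<Sum>\<zeta>\<in>X. sdot \<xi> (\<lambda>j. w j (\<xi> - \<zeta>)) * w k \<zeta>)"
  proof -
    have "w j (- \<xi> - - \<zeta>) = cnj (w j (\<xi> - \<zeta>))" for j \<zeta> using herm[of j "\<xi> - \<zeta>"] by simp
    then show ?thesis by (simp add: sdot_uminus_freq herm sdot_cnj sum_negf)
  qed
  finally have "conv X w k (- \<xi>) = cnj (conv X w k \<xi>)" by (simp add: conv_def)
  moreover have "F k (- \<xi>) = cnj (F k \<xi>)" using F by (simp add: hermitian_def)
  ultimately show ?thesis by (simp add: resid_def symb_uminus herm symb_cnj)
qed

text \<open>The orthogonal projection onto the coefficients of real solenoidal trigonometric fields.\<close>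

definition hproj :: "(int ^ 'n::finite) set \<Rightarrow> ('n \<Rightarrow> int ^ 'n \<Rightarrow> complex) \<Rightarrow> 'n \<Rightarrow> int ^ 'n \<Rightarrow> complex" where
  "hproj X v k \<xi> = (if \<xi> \<in> X then leray \<xi> (\<lambda>k. (v k \<xi> + cnj (v k (- \<xi>))) / 2) k else 0)"

text \<open>Only a real inner product: averaging with the reflected conjugate is real-linear but not
  complex-linear, so self-adjointness of \<open>hproj\<close> makes sense only for the real
  part.\<close>

definition hip :: "(int ^ 'n::finite) set \<Rightarrow> ('n \<Rightarrow> int ^ 'n \<Rightarrow> complex) \<Rightarrow> ('n \<Rightarrow> int ^ 'n \<Rightarrow> complex) \<Rightarrow> real" where
  "hip X v w = Re (\<Sum>\<xi>\<in>X. \<Sum>k\<in>UNIV. cnj (v k \<xi>) * w k \<xi>)"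

lemma solenoidal_hproj:
  assumes X: "\<And>\<xi>. \<xi> \<in> X \<Longrightarrow> - \<xi> \<in> X" "0 \<notin> X"
  shows "solenoidal X (hproj X v)"
proof -
  have mem: "- \<xi> \<in> X \<longleftrightarrow> \<xi> \<in> X" for \<xi> using X(1)[of \<xi>] X(1)[of "- \<xi>"] by auto
  have "hproj X v k (- \<xi>) = cnj (hproj X v k \<xi>)" for k \<xi>
    unfolding hproj_def by (simp add: mem leray_uminus leray_cnj[symmetric] add.commute)
  moreover have "sdot \<xi> (\<lambda>k. hproj X v k \<xi>) = 0" for \<xi>
  proof (cases "\<xi> \<in> X")
    case True
    then have "\<xi> \<noteq> 0" using X by auto
    have "(\<lambda>k. hproj X v k \<xi>) = leray \<xi> (\<lambda>k. (v k \<xi> + cnj (v k (- \<xi>))) / 2)" using True by (simp add: hproj_def fun_eq_iff)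
    then show ?thesis using leray_sdot[OF \<open>\<xi> \<noteq> 0\<close>] by simp
  qed (simp add: hproj_def sdot_def)
  ultimately show ?thesis by (simp add: solenoidal_def hermitian_def hproj_def)
qed

lemma hproj_id:
  assumes "solenoidal X w" shows "hproj X w = w"
proof (intro ext)
  fix k \<xi>
  have "(\<lambda>k. (w k \<xi> + cnj (w k (- \<xi>))) / 2) = (\<lambda>k. w k \<xi>)" using assms by (simp add: solenoidal_def hermitian_def fun_eq_iff)
  moreover have "leray \<xi> (\<lambda>k. w k \<xi>) = (\<lambda>k. w k \<xi>)" using assms by (intro leray_id) (simp add: solenoidal_def)
  ultimately show "hproj X w k \<xi> = w k \<xi>" using assms by (simp add: hproj_def solenoidal_def)
qed

lemma hip_hproj:
  assumes X: "\<And>\<xi>. \<xi> \<in> X \<Longrightarrow> - \<xi> \<in> X"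
  shows "hip X v (hproj X u) = hip X (hproj X v) u"
proof -
  have "hip X v (hproj X u) = Re (\<Sum>\<xi>\<in>X. \<Sum>k\<in>UNIV. cnj (leray \<xi> (\<lambda>k. v k \<xi>) k) * ((u k \<xi> + cnj (u k (- \<xi>))) / 2))"
    unfolding hip_def leray_selfadjoint[symmetric] hproj_def by (intro arg_cong[where f = Re] sum.cong refl) simp
  also have "\<dots> = Re (\<Sum>\<xi>\<in>X. \<Sum>k\<in>UNIV. cnj (leray \<xi> (\<lambda>k. v k \<xi>) k) * u k \<xi>) / 2
      + Re (\<Sum>\<xi>\<in>X. \<Sum>k\<in>UNIV. cnj (leray \<xi> (\<lambda>k. v k \<xi>) k) * cnj (u k (- \<xi>))) / 2"
    unfolding Re_sum sum_divide_distrib sum.distrib[symmetric] by (intro sum.cong refl) (simp add: field_simps)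
  also have "Re (\<Sum>\<xi>\<in>X. \<Sum>k\<in>UNIV. cnj (leray \<xi> (\<lambda>k. v k \<xi>) k) * cnj (u k (- \<xi>)))
      = Re (\<Sum>\<xi>\<in>X. \<Sum>k\<in>UNIV. cnj (leray \<xi> (\<lambda>k. v k (- \<xi>)) k) * cnj (u k \<xi>))"
    by (intro arg_cong[where f = Re] sum.reindex_bij_witness[of _ uminus uminus]) (auto intro: X simp: leray_uminus)
  also have "\<dots> = Re (\<Sum>\<xi>\<in>X. \<Sum>k\<in>UNIV. cnj (leray \<xi> (\<lambda>k. cnj (v k (- \<xi>))) k) * u k \<xi>)"
    unfolding Re_sum by (intro sum.cong refl) (simp add: leray_cnj)
  also have "Re (\<Sum>\<xi>\<in>X. \<Sum>k\<in>UNIV. cnj (leray \<xi> (\<lambda>k. v k \<xi>) k) * u k \<xi>) / 2 + \<dots> / 2 = hip X (hproj X v) u"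
    unfolding hip_def Re_sum sum_divide_distrib sum.distrib[symmetric]
  proof (intro sum.cong refl)
    fix \<xi> k assume "\<xi> \<in> X"
    let ?A = "leray \<xi> (\<lambda>k. v k \<xi>) k" and ?B = "leray \<xi> (\<lambda>k. cnj (v k (- \<xi>))) k"
    have "hproj X v k \<xi> = leray \<xi> (\<lambda>k. (1/2) * v k \<xi> + (1/2) * cnj (v k (- \<xi>))) k"
      using \<open>\<xi> \<in> X\<close> by (simp add: hproj_def add_divide_distrib)
    also have "\<dots> = (1/2) * ?A + (1/2) * ?B" by (rule leray_lin)
    finally have "cnj (hproj X v k \<xi>) * u k \<xi> = (cnj ?A * u k \<xi> + cnj ?B * u k \<xi>) / 2"
      by (simp add: distrib_right add_divide_distrib)
    then show "Re (cnj ?A * u k \<xi>) / 2 + Re (cnj ?B * u k \<xi>) / 2 = Re (cnj (hproj X v k \<xi>) * u k \<xi>)"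
      by (simp only:) (simp only: Re_divide_numeral plus_complex.sel add_divide_distrib)
  qed
  finally show ?thesis .
qed

definition energy :: "(int ^ 'n::finite) set \<Rightarrow> ('n \<Rightarrow> int ^ 'n \<Rightarrow> complex) \<Rightarrow> real" where
  "energy X w = (\<Sum>\<xi>\<in>X. \<Sum>k\<in>UNIV. (1 + (norm (freq \<xi>))\<^sup>2) * (cmod (w k \<xi>))\<^sup>2)"

lemma energy_nonneg: "energy X w \<ge> 0"
  unfolding energy_def by (intro sum_nonneg mult_nonneg_nonneg) auto

lemma hip_self: "hip X v v = (\<Sum>\<xi>\<in>X. \<Sum>k\<in>UNIV. (cmod (v k \<xi>))\<^sup>2)"
proof -
  have "Re (cnj z * z) = (cmod z)\<^sup>2" for z
    by (simp add: cmod_power2 power2_eq_square[of "Re z"] power2_eq_square[of "Im z"])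
  then show ?thesis unfolding hip_def Re_sum by simp
qed

lemma hip_lin: "hip X v (\<lambda>k \<xi>. u k \<xi> + w k \<xi> - z k \<xi>) = hip X v u + hip X v w - hip X v z"
  unfolding hip_def Re_sum sum.distrib[symmetric] sum_subtractf[symmetric]
  by (intro sum.cong refl) (simp add: algebra_simps)

text \<open>The duality between the Sobolev norms of order 1 and -1: Cauchy-Schwarz after inserting
  the weight and its inverse.\<close>

lemma hip_bound:
  assumes X: "finite X" and M: "M \<ge> 0" "(\<Sum>\<xi>\<in>X. \<Sum>k\<in>UNIV. (cmod (F k \<xi>))\<^sup>2 / (1 + (norm (freq \<xi>))\<^sup>2)) \<le> M\<^sup>2"
  shows "hip X w F \<le> sqrt (energy X w) * M"
proof -
  let ?I = "X \<times> (UNIV :: 'a set)"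
  let ?s = "\<lambda>\<xi> :: int ^ 'a. sqrt (1 + (norm (freq \<xi>))\<^sup>2)"
  have sp: "?s \<xi> > 0" for \<xi> :: "int ^ 'a" by (simp add: add_pos_nonneg)
  have "hip X w F = (\<Sum>(\<xi>, k)\<in>?I. Re (cnj (w k \<xi>) * F k \<xi>))"
    unfolding hip_def Re_sum by (simp add: sum.cartesian_product)
  also have "\<dots> \<le> (\<Sum>(\<xi>, k)\<in>?I. (?s \<xi> * cmod (w k \<xi>)) * (cmod (F k \<xi>) / ?s \<xi>))"
  proof (intro sum_mono, clarify)
    fix \<xi> k
    have "Re (cnj (w k \<xi>) * F k \<xi>) \<le> cmod (cnj (w k \<xi>) * F k \<xi>)" by (rule complex_Re_le_cmod)
    also have "\<dots> = (?s \<xi> * cmod (w k \<xi>)) * (cmod (F k \<xi>) / ?s \<xi>)" using sp[of \<xi>] by (simp add: norm_mult)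
    finally show "Re (cnj (w k \<xi>) * F k \<xi>) \<le> (?s \<xi> * cmod (w k \<xi>)) * (cmod (F k \<xi>) / ?s \<xi>)" .
  qed
  also have "\<dots> \<le> sqrt ((\<Sum>(\<xi>, k)\<in>?I. (?s \<xi> * cmod (w k \<xi>))\<^sup>2) * (\<Sum>(\<xi>, k)\<in>?I. (cmod (F k \<xi>) / ?s \<xi>)\<^sup>2))"
    using Cauchy_Schwarz_ineq_sum[of "\<lambda>(\<xi>, k). ?s \<xi> * cmod (w k \<xi>)" "\<lambda>(\<xi>, k). cmod (F k \<xi>) / ?s \<xi>" ?I]
    by (intro real_le_rsqrt) (simp add: case_prod_beta)
  also have "(\<Sum>(\<xi>, k)\<in>?I. (?s \<xi> * cmod (w k \<xi>))\<^sup>2) = energy X w"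
    unfolding energy_def by (simp add: sum.cartesian_product power_mult_distrib)
  also have "(\<Sum>(\<xi>, k)\<in>?I. (cmod (F k \<xi>) / ?s \<xi>)\<^sup>2) = (\<Sum>\<xi>\<in>X. \<Sum>k\<in>UNIV. (cmod (F k \<xi>))\<^sup>2 / (1 + (norm (freq \<xi>))\<^sup>2))"
    by (simp add: sum.cartesian_product power_divide)
  also have "sqrt (energy X w * (\<Sum>\<xi>\<in>X. \<Sum>k\<in>UNIV. (cmod (F k \<xi>))\<^sup>2 / (1 + (norm (freq \<xi>))\<^sup>2))) \<le> sqrt (energy X w * M\<^sup>2)"
    by (intro real_sqrt_le_mono mult_left_mono M energy_nonneg)
  also have "\<dots> = sqrt (energy X w) * M" using M(1) by (simp add: real_sqrt_mult)
  finally show ?thesis .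
qed

context
  fixes a :: "'n::finite tensor" and C :: real and F :: "'n \<Rightarrow> int ^ 'n \<Rightarrow> complex"
  assumes a: "tensor_symmetric a" "relaxed_elliptic a C" and C: "C > 0" and F: "\<And>k. hermitian (F k)"
begin

text \<open>The convection term drops out by \<open>conv_orthogonal\<close>. Two derivatives give
  \<open>4 pi^2\<close>, ellipticity gives \<open>|\<xi>|^2 / (2 C)\<close>, and
  \<open>1 + |\<xi>|^2 <= 2 |\<xi>|^2\<close> away from frequency 0 turns this into
  \<open>pi\<^sup>2 / C\<close> times the full weight.\<close>

lemma energy_estimate:
  assumes X: "finite X" "\<And>\<xi>. \<xi> \<in> X \<Longrightarrow> - \<xi> \<in> X" "0 \<notin> X" and w: "solenoidal X w"
    and M: "M \<ge> 0" "(\<Sum>\<xi>\<in>X. \<Sum>k\<in>UNIV. (cmod (F k \<xi>))\<^sup>2 / (1 + (norm (freq \<xi>))\<^sup>2)) \<le> M\<^sup>2"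
  shows "pi\<^sup>2 / C * energy X w - sqrt (energy X w) * M \<le> hip X w (\<lambda>k \<xi>. resid a F X w \<xi> k)"
proof -
  have "hip X w (\<lambda>k \<xi>. resid a F X w \<xi> k)
      = hip X w (\<lambda>k \<xi>. of_real (4 * pi\<^sup>2) * symb a \<xi> (\<lambda>k. w k \<xi>) k) + hip X w (conv X w) - hip X w F"
    unfolding resid_def by (rule hip_lin)
  also have "hip X w (conv X w) = 0" using conv_orthogonal[OF w X(1,2)] by (simp add: hip_def)
  finally have 1: "hip X w (\<lambda>k \<xi>. resid a F X w \<xi> k)
      = hip X w (\<lambda>k \<xi>. of_real (4 * pi\<^sup>2) * symb a \<xi> (\<lambda>k. w k \<xi>) k) - hip X w F" by simp
  have "pi\<^sup>2 / C * energy X w = (\<Sum>\<xi>\<in>X. pi\<^sup>2 / C * ((1 + (norm (freq \<xi>))\<^sup>2) * (\<Sum>k\<in>UNIV. (cmod (w k \<xi>))\<^sup>2)))"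
    by (simp add: energy_def sum_distrib_left)
  also have "\<dots> \<le> (\<Sum>\<xi>\<in>X. 4 * pi\<^sup>2 * Re (\<Sum>k\<in>UNIV. cnj (w k \<xi>) * symb a \<xi> (\<lambda>k. w k \<xi>) k))"
  proof (rule sum_mono)
    fix \<xi> assume "\<xi> \<in> X"
    then have "\<xi> \<noteq> 0" using X(3) by auto
    let ?n = "(norm (freq \<xi>))\<^sup>2" and ?W = "\<Sum>k\<in>UNIV. (cmod (w k \<xi>))\<^sup>2"
    have "1\<^sup>2 \<le> ?n" using norm_freq_ge_1[OF \<open>\<xi> \<noteq> 0\<close>] by (intro power_mono) auto
    then have "(1 + ?n) * ?W \<le> 4 * (?n * ?W / 2)"
      by (simp add: mult_right_mono sum_nonneg algebra_simps) (simp add: mult_right_mono[of 1 ?n ?W, simplified] sum_nonneg)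
    also have "\<dots> \<le> 4 * (C * Re (\<Sum>k\<in>UNIV. cnj (w k \<xi>) * symb a \<xi> (\<lambda>k. w k \<xi>) k))"
      using elliptic_symb[OF a, of \<xi> "\<lambda>k. w k \<xi>"] w by (simp add: solenoidal_def)
    finally have "pi\<^sup>2 / C * ((1 + ?n) * ?W) \<le> pi\<^sup>2 / C * (4 * (C * Re (\<Sum>k\<in>UNIV. cnj (w k \<xi>) * symb a \<xi> (\<lambda>k. w k \<xi>) k)))"
      using C by (intro mult_left_mono) auto
    also have "\<dots> = 4 * pi\<^sup>2 * Re (\<Sum>k\<in>UNIV. cnj (w k \<xi>) * symb a \<xi> (\<lambda>k. w k \<xi>) k)" using C by simp
    finally show "pi\<^sup>2 / C * ((1 + ?n) * ?W) \<le> 4 * pi\<^sup>2 * Re (\<Sum>k\<in>UNIV. cnj (w k \<xi>) * symb a \<xi> (\<lambda>k. w k \<xi>) k)" .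
  qed
  also have "\<dots> = hip X w (\<lambda>k \<xi>. of_real (4 * pi\<^sup>2) * symb a \<xi> (\<lambda>k. w k \<xi>) k)"
    unfolding hip_def Re_sum sum_distrib_left by (intro sum.cong refl) (simp add: algebra_simps)
  finally show ?thesis using 1 hip_bound[OF X(1) M, of w] by linarith
qed

lemma continuous_hproj:
  assumes "\<And>k \<xi>. continuous_on UNIV (\<lambda>v. V v k \<xi>)"
  shows "continuous_on UNIV (\<lambda>v. hproj X (V v) k \<xi>)"
  unfolding hproj_def leray_def sdot_def divide_inverse
  by (cases "\<xi> \<in> X"; simp only: if_True if_False simp_thms; intro continuous_intros assms)

lemma continuous_resid:
  assumes "\<And>k \<xi>. continuous_on UNIV (\<lambda>v. V v k \<xi>)"
  shows "continuous_on UNIV (\<lambda>v. resid a F X (V v) \<xi> k)"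
  unfolding resid_def symb_def conv_def sdot_def by (intro continuous_intros assms)

text \<open>The zero of a coercive field on all coefficients over \<open>X\<close> is shown to lie
  in the real solenoidal subspace. Testing the projected equation with the solution itself then
  gives the energy bound.\<close>

lemma galerkin:
  assumes X: "finite X" "\<And>\<xi>. \<xi> \<in> X \<Longrightarrow> - \<xi> \<in> X" "0 \<notin> X"
    and M: "M \<ge> 0" "(\<Sum>\<xi>\<in>X. \<Sum>k\<in>UNIV. (cmod (F k \<xi>))\<^sup>2 / (1 + (norm (freq \<xi>))\<^sup>2)) \<le> M\<^sup>2"
  shows "\<exists>w. solenoidal X w \<and> (\<forall>\<xi>\<in>X. \<forall>k. leray \<xi> (resid a F X w \<xi>) k = 0) \<and> energy X w \<le> (C * M / pi\<^sup>2)\<^sup>2"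
proof -
  define cu where "cu v = (\<lambda>k \<xi>. v (k, \<xi>))" for v :: "'n \<times> (int ^ 'n) \<Rightarrow> complex"
  define W where "W v = hproj X (cu v)" for v
  define Z where "Z v = hproj X (\<lambda>k \<xi>. resid a F X (W v) \<xi> k)" for v
  \<comment> \<open>\<open>Z v\<close> is the projected residual at the projection
    \<open>W v\<close>. The added defect \<open>v - W v\<close> is orthogonal to the subspace and
    makes the field coercive in the remaining directions as well.\<close>
  define P where "P v = (\<lambda>(k, \<xi>). Z v k \<xi> + v (k, \<xi>) - W v k \<xi>)" for v
  have solW: "solenoidal X (W v)" and solZ: "solenoidal X (Z v)" for v
    unfolding W_def Z_def using solenoidal_hproj[OF X(2,3)] by blast+
  \<comment> \<open>The coercivity constant: \<open>pi\<^sup>2 / C\<close> along the subspace, 1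
    across it. The radius exceeds \<open>M / c\<close>, where the forcing is dominated, and the
    summand 1 keeps it positive for \<open>M = 0\<close>.\<close>
  define c where "c = min (pi\<^sup>2 / C) 1"
  have c: "c > 0" "c \<le> pi\<^sup>2 / C" "c \<le> 1" using C by (auto simp: c_def)
  define R where "R = M / c + 1"
  have R: "R > 0" using M(1) c by (simp add: R_def add_nonneg_pos)
  have ccu: "continuous_on UNIV (\<lambda>v. cu v k \<xi>)" for k \<xi>
    unfolding cu_def by (rule continuous_on_product_coordinates)
  have cW: "continuous_on UNIV (\<lambda>v. W v k \<xi>)" for k \<xi> unfolding W_def by (rule continuous_hproj[OF ccu])
  have cZ: "continuous_on UNIV (\<lambda>v. Z v k \<xi>)" for k \<xi> unfolding Z_def by (rule continuous_hproj[OF continuous_resid[OF cW]])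
  have sumI: "(\<Sum>i\<in>UNIV \<times> X. G (snd i) (fst i)) = (\<Sum>\<xi>\<in>X. \<Sum>k\<in>UNIV. G \<xi> k)" for G :: "int ^ 'n \<Rightarrow> 'n \<Rightarrow> real"
    by (subst sum.swap) (simp add: sum.cartesian_product case_prod_beta)
  have "\<exists>v. \<forall>i\<in>UNIV \<times> X. P v i = 0"
  proof (rule coercive_zero_complex[OF _ R])
    show "finite ((UNIV :: 'n set) \<times> X)" using X(1) by simp
    show "continuous_on UNIV (\<lambda>v. P v i)" for i
      unfolding P_def case_prod_beta
      by (intro continuous_intros cZ cW continuous_on_product_coordinates)
  next
    fix v :: "'n \<times> (int ^ 'n) \<Rightarrow> complex" assume v: "(\<Sum>i\<in>UNIV \<times> X. (cmod (v i))\<^sup>2) = R\<^sup>2"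
    let ?t = "sqrt (energy X (W v))"
    have vv: "hip X (cu v) (cu v) = R\<^sup>2"
      unfolding hip_self v[symmetric] cu_def using sumI[of "\<lambda>\<xi> k. (cmod (v (k, \<xi>)))\<^sup>2"] by simp
    have wv: "hip X (cu v) (W v) = hip X (W v) (W v)"
    proof -
      have "hip X (cu v) (W v) = hip X (cu v) (hproj X (W v))" by (simp add: hproj_id[OF solW])
      then show ?thesis by (simp add: hip_hproj[OF X(2)] W_def[symmetric])
    qed
    have "(\<Sum>i\<in>UNIV \<times> X. Re (cnj (v i) * P v i)) = hip X (cu v) (\<lambda>k \<xi>. Z v k \<xi> + cu v k \<xi> - W v k \<xi>)"
      unfolding hip_def Re_sum using sumI[of "\<lambda>\<xi> k. Re (cnj (v (k, \<xi>)) * (Z v k \<xi> + v (k, \<xi>) - W v k \<xi>))"]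
      by (simp add: P_def cu_def case_prod_beta)
    also have "\<dots> = hip X (cu v) (Z v) + R\<^sup>2 - hip X (W v) (W v)" by (simp only: hip_lin vv wv)
    also have "hip X (cu v) (Z v) = hip X (W v) (\<lambda>k \<xi>. resid a F X (W v) \<xi> k)"
      unfolding Z_def by (simp only: hip_hproj[OF X(2)] W_def)
    finally have eq: "(\<Sum>i\<in>UNIV \<times> X. Re (cnj (v i) * P v i))
       = hip X (W v) (\<lambda>k \<xi>. resid a F X (W v) \<xi> k) + R\<^sup>2 - hip X (W v) (W v)" .
    have t2: "?t\<^sup>2 = energy X (W v)" by (simp add: energy_nonneg)
    have w_le: "hip X (W v) (W v) \<le> ?t\<^sup>2"
      unfolding t2 unfolding hip_self energy_def by (intro sum_mono) (simp add: algebra_simps)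
    have w_R: "hip X (W v) (W v) \<le> R\<^sup>2"
    proof -
      have "0 \<le> hip X (\<lambda>k \<xi>. cu v k \<xi> - W v k \<xi>) (\<lambda>k \<xi>. cu v k \<xi> - W v k \<xi>)" unfolding hip_self by (intro sum_nonneg) auto
      also have "\<dots> = hip X (cu v) (cu v) - hip X (cu v) (W v) - hip X (W v) (cu v) + hip X (W v) (W v)"
        unfolding hip_def Re_sum sum.distrib[symmetric] sum_subtractf[symmetric] by (intro sum.cong refl) (simp add: algebra_simps)
      also have "hip X (W v) (cu v) = hip X (cu v) (W v)"
        unfolding hip_def Re_sum by (intro sum.cong refl) (simp add: algebra_simps)
      finally show ?thesis using vv wv by simp
    qed
    \<comment> \<open>Completing the square gives
      \<open>?t * M <= (c * ?E + c * R\<^sup>2) / 2\<close>. The rest is nonnegative because the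
      squared norm of \<open>W v\<close> is at most both \<open>?E\<close> and
      \<open>R\<^sup>2\<close>.\<close>
    let ?E = "energy X (W v)"
    have sq: "(c * s - M)\<^sup>2 / c = c * s\<^sup>2 - 2 * (s * M) + M\<^sup>2 / c" for s
      using c by (simp add: power2_eq_square field_simps)
    have "c * ?E \<le> pi\<^sup>2 / C * ?E" using c energy_nonneg by (intro mult_right_mono) auto
    moreover have "c * (hip X (W v) (W v)) \<le> c * ?E" using w_le c t2 by (intro mult_left_mono) auto
    moreover have "c * (R\<^sup>2 - hip X (W v) (W v)) \<le> 1 * (R\<^sup>2 - hip X (W v) (W v))" using c w_R by (intro mult_right_mono) auto
    moreover have "0 \<le> (c * ?t - M)\<^sup>2 / c" using c by simp
    moreover note sq[of ?t, unfolded t2]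
    moreover have "M\<^sup>2 / c \<le> c * R\<^sup>2"
    proof -
      have "M / c \<le> R" by (simp add: R_def)
      then have "(M / c)\<^sup>2 \<le> R\<^sup>2" using M(1) c by (intro power_mono) auto
      then have "c * (M / c)\<^sup>2 \<le> c * R\<^sup>2" using c by (intro mult_left_mono) auto
      then show ?thesis using c by (simp add: power2_eq_square)
    qed
    moreover have "0 \<le> c * R\<^sup>2" using c by simp
    moreover have "0 \<le> c * (R\<^sup>2 - hip X (W v) (W v))" using c w_R by simp
    moreover have "pi\<^sup>2 / C * ?E - ?t * M \<le> hip X (W v) (\<lambda>k \<xi>. resid a F X (W v) \<xi> k)"
      by (rule energy_estimate[OF X(1) _ X(3) solW M]) (rule X(2))
    ultimately show "0 \<le> (\<Sum>i\<in>UNIV \<times> X. Re (cnj (v i) * P v i))"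
      unfolding eq right_diff_distrib by linarith
  qed
  then obtain v where v: "\<And>k \<xi>. \<xi> \<in> X \<Longrightarrow> P v (k, \<xi>) = 0" by blast
  define w where "w = W v"
  have sol: "solenoidal X w" unfolding w_def by (rule solW)
  \<comment> \<open>A zero of \<open>P\<close> means \<open>v = W v - Z v\<close> on
    \<open>X\<close>. The right-hand side is already real and solenoidal, so projecting it changes
    nothing; comparing with \<open>W v\<close> gives \<open>Z v = 0\<close>.\<close>
  define w' where "w' = (\<lambda>k \<xi>. w k \<xi> - Z v k \<xi>)"
  have "solenoidal X w'"
    unfolding solenoidal_def
  proof (intro conjI allI impI)
    fix k \<xi>
    show "hermitian (w' k)" using sol solZ[of v] by (simp add: solenoidal_def hermitian_def w'_def)
    show "sdot \<xi> (\<lambda>k. w' k \<xi>) = 0"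
      using sdot_lin[of \<xi> 1 "\<lambda>k. w k \<xi>" "-1" "\<lambda>k. Z v k \<xi>"] sol solZ[of v] by (simp add: solenoidal_def w'_def)
    assume "\<xi> \<notin> X" then show "w' k \<xi> = 0" using sol solZ[of v] by (simp add: solenoidal_def w'_def)
  qed
  moreover have "hproj X (cu v) = hproj X w'"
  proof (intro ext)
    fix k \<xi>
    have "cu v k \<xi> = w' k \<xi>" if "\<xi> \<in> X" for k \<xi>
      using v[OF that, of k] by (simp add: P_def cu_def w'_def w_def algebra_simps eq_diff_eq)
    then show "hproj X (cu v) k \<xi> = hproj X w' k \<xi>" using X(2) by (simp add: hproj_def)
  qed
  ultimately have "w = w'" using hproj_id[of X w'] by (simp add: w_def W_def)
  then have Z0: "Z v k \<xi> = 0" for k \<xi> unfolding w'_def by (metis diff_eq_eq add_cancel_left_right)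
  have le0: "leray \<xi> (resid a F X w \<xi>) k = 0" if "\<xi> \<in> X" for \<xi> k
  proof -
    have "resid a F X w (- \<xi>) k = cnj (resid a F X w \<xi> k)" for \<xi> k
      by (rule resid_hermitian[OF sol]) (auto intro: X F)
    then show ?thesis using Z0[of k \<xi>] that by (simp add: Z_def hproj_def w_def[symmetric])
  qed
  \<comment> \<open>The projection is moved from \<open>w\<close> to the residual, where it produces
    \<open>Z v = 0\<close>.\<close>
  have "hip X w (\<lambda>k \<xi>. resid a F X w \<xi> k) = hip X (hproj X w) (\<lambda>k \<xi>. resid a F X w \<xi> k)" by (simp add: hproj_id[OF sol])
  also have "\<dots> = hip X w (Z v)" by (simp add: hip_hproj[OF X(2), symmetric] Z_def w_def)
  also have "\<dots> = 0" by (simp add: hip_def Z0)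
  finally have "pi\<^sup>2 / C * energy X w \<le> sqrt (energy X w) * M" using energy_estimate[OF X sol M] by simp
  then have e: "pi\<^sup>2 / C * (sqrt (energy X w))\<^sup>2 \<le> sqrt (energy X w) * M" by (simp add: energy_nonneg)
  have "sqrt (energy X w) \<le> C * M / pi\<^sup>2"
  proof (cases "energy X w = 0")
    case False
    then have p: "sqrt (energy X w) > 0" using energy_nonneg[of X w] by simp
    from e have "(pi\<^sup>2 / C * sqrt (energy X w)) * sqrt (energy X w) \<le> M * sqrt (energy X w)" by (simp only: power2_eq_square mult_ac)
    then have "pi\<^sup>2 / C * sqrt (energy X w) \<le> M" by (rule mult_right_le_imp_le[OF _ p])
    then show ?thesis using C by (simp add: field_simps)
  qed (use M C in simp)
  then have "(sqrt (energy X w))\<^sup>2 \<le> (C * M / pi\<^sup>2)\<^sup>2" by (intro power_mono) (simp_all add: energy_nonneg)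
  then show ?thesis using sol le0 by (intro exI[of _ w]) (simp add: energy_nonneg)
qed

end

text \<open>The error \<open>e K\<close> does not depend on n; this uniformity allows the limits in
  K and n to be exchanged.\<close>

lemma double_limit:
  fixes x :: "nat \<Rightarrow> 'a::real_normed_vector"
  assumes xy: "\<And>K n. norm (x n - y K n) \<le> e K" and e: "e \<longlonglongrightarrow> 0"
    and y: "\<And>K. (\<lambda>n. y K n) \<longlonglongrightarrow> b K" and b: "b \<longlonglongrightarrow> \<beta>"
  shows "x \<longlonglongrightarrow> \<beta>"
proof (rule LIMSEQ_I)
  fix r :: real assume r: "r > 0"
  have "\<forall>\<^sub>F K in sequentially. e K < r / 3 \<and> norm (b K - \<beta>) < r / 3"
    using order_tendstoD(2)[OF e, of "r / 3"] tendstoD[OF b, of "r / 3"] r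
    by (auto simp: eventually_conj_iff dist_norm)
  then obtain K where K: "e K < r / 3" "norm (b K - \<beta>) < r / 3" using eventually_happens' sequentially_bot by blast
  obtain n0 where n0: "\<And>n. n \<ge> n0 \<Longrightarrow> norm (y K n - b K) < r / 3"
    using LIMSEQ_D[OF y[of K], of "r / 3"] r by auto
  have "norm (x n - \<beta>) < r" if "n \<ge> n0" for n
  proof -
    have "x n - \<beta> = (x n - y K n) + (y K n - b K) + (b K - \<beta>)" by simp
    then have "norm (x n - \<beta>) \<le> norm (x n - y K n) + norm (y K n - b K) + norm (b K - \<beta>)"
      by (metis norm_triangle_ineq norm_triangle_mono order_refl)
    then show ?thesis using xy[of n K] K n0[OF that] by linarith
  qed
  then show "\<exists>n0. \<forall>n\<ge>n0. norm (x n - \<beta>) < r" by blast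
qed

lemma energy_mono_any:
  assumes "solenoidal X w" "finite X" "finite Y"
  shows "energy Y w \<le> energy X w"
proof -
  have "energy Y w = energy (Y \<inter> X) w" unfolding energy_def
    using assms by (intro sum.mono_neutral_right) (auto simp: solenoidal_def)
  also have "\<dots> \<le> energy X w" unfolding energy_def
    using assms by (intro sum_mono2 sum_nonneg) auto
  finally show ?thesis .
qed

lemma cmod_sdot_le: "(cmod (sdot \<xi> u))\<^sup>2 \<le> (norm (freq \<xi>))\<^sup>2 * (\<Sum>k\<in>UNIV. (cmod (u k))\<^sup>2)"
proof -
  have "cmod (sdot \<xi> u) \<le> (\<Sum>k\<in>UNIV. \<bar>real_of_int (\<xi> $ k)\<bar> * cmod (u k))"
    unfolding sdot_def by (rule sum_norm_le) (simp add: norm_mult)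
  then have "(cmod (sdot \<xi> u))\<^sup>2 \<le> (\<Sum>k\<in>UNIV. \<bar>real_of_int (\<xi> $ k)\<bar> * cmod (u k))\<^sup>2" by (intro power_mono) auto
  also have "\<dots> \<le> (\<Sum>k\<in>UNIV. \<bar>real_of_int (\<xi> $ k)\<bar>\<^sup>2) * (\<Sum>k\<in>UNIV. (cmod (u k))\<^sup>2)" by (rule Cauchy_Schwarz_ineq_sum)
  finally show ?thesis by (simp add: norm_freq_sq)
qed

text \<open>Since \<open>w\<close> is solenoidal the derivative in the convection term falls on the fixed frequency
  \<open>\<xi>\<close>, so the tail of the convolution is controlled by the energy alone.\<close>

lemma conv_tail:
  fixes w :: "'n::finite \<Rightarrow> int ^ 'n \<Rightarrow> complex"
  assumes w: "solenoidal X w" "finite X" and R: "R \<ge> 0" "energy X w \<le> R\<^sup>2"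
  shows "cmod (conv X w k \<xi> - conv (Lam K) w k \<xi>) \<le> 2 * pi * (norm (freq \<xi>) * R * R) * inverse (real (Suc K))"
proof -
  have E: "energy Y w \<le> R\<^sup>2" if "finite Y" for Y using energy_mono_any[OF w that] R(2) by linarith
  define t where "t \<zeta> = sdot \<xi> (\<lambda>j. w j (\<xi> - \<zeta>)) * w k \<zeta>" for \<zeta>
  have t0: "t \<zeta> = 0" if "\<zeta> \<notin> X" for \<zeta> using w(1) that by (simp add: t_def solenoidal_def)
  define Y where "Y = X - Lam K"
  have Y: "finite Y" using w(2) by (simp add: Y_def)
  have "sum t X - sum t (Lam K) = sum t Y"
  proof -
    have "sum t (Lam K) = sum t (Lam K \<inter> X)" by (intro sum.mono_neutral_right) (auto simp: t0)
    moreover have "sum t X = sum t (X - (Lam K \<inter> X)) + sum t (Lam K \<inter> X)" by (rule sum.subset_diff) (auto simp: w(2))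
    moreover have "X - (Lam K \<inter> X) = Y" by (auto simp: Y_def)
    ultimately show ?thesis by simp
  qed
  then have "conv X w k \<xi> - conv (Lam K) w k \<xi> = 2 * pi * \<i> * sum t Y"
    unfolding conv_def t_def[symmetric] right_diff_distrib[symmetric] by simp
  then have "cmod (conv X w k \<xi> - conv (Lam K) w k \<xi>) = 2 * pi * cmod (sum t Y)" by (simp add: norm_mult)
  also have "cmod (sum t Y) \<le> norm (freq \<xi>) * R * (R * inverse (real (Suc K)))"
  proof -
    have "cmod (sum t Y) \<le> (\<Sum>\<zeta>\<in>Y. cmod (sdot \<xi> (\<lambda>j. w j (\<xi> - \<zeta>))) * cmod (w k \<zeta>))"
      by (rule sum_norm_le) (simp add: t_def norm_mult)
    also have "\<dots> \<le> sqrt ((\<Sum>\<zeta>\<in>Y. (cmod (sdot \<xi> (\<lambda>j. w j (\<xi> - \<zeta>))))\<^sup>2) * (\<Sum>\<zeta>\<in>Y. (cmod (w k \<zeta>))\<^sup>2))"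
      by (intro real_le_rsqrt Cauchy_Schwarz_ineq_sum)
    also have "\<dots> \<le> sqrt ((norm (freq \<xi>) * R)\<^sup>2 * (R * inverse (real (Suc K)))\<^sup>2)"
    proof (intro real_sqrt_le_mono mult_mono)
      have "(\<Sum>\<zeta>\<in>Y. (cmod (sdot \<xi> (\<lambda>j. w j (\<xi> - \<zeta>))))\<^sup>2) \<le> (\<Sum>\<zeta>\<in>Y. (norm (freq \<xi>))\<^sup>2 * (\<Sum>j\<in>UNIV. (cmod (w j (\<xi> - \<zeta>)))\<^sup>2))"
        by (intro sum_mono cmod_sdot_le)
      also have "\<dots> = (norm (freq \<xi>))\<^sup>2 * (\<Sum>\<eta>\<in>(\<lambda>\<zeta>. \<xi> - \<zeta>) ` Y. \<Sum>j\<in>UNIV. (cmod (w j \<eta>))\<^sup>2)"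
        by (subst sum.reindex) (auto simp: inj_on_def sum_distrib_left)
      also have "(\<Sum>\<eta>\<in>(\<lambda>\<zeta>. \<xi> - \<zeta>) ` Y. \<Sum>j\<in>UNIV. (cmod (w j \<eta>))\<^sup>2) \<le> energy ((\<lambda>\<zeta>. \<xi> - \<zeta>) ` Y) w"
        unfolding energy_def by (intro sum_mono) (simp add: algebra_simps)
      also have "\<dots> \<le> R\<^sup>2" using Y by (intro E) simp
      finally show "(\<Sum>\<zeta>\<in>Y. (cmod (sdot \<xi> (\<lambda>j. w j (\<xi> - \<zeta>))))\<^sup>2) \<le> (norm (freq \<xi>) * R)\<^sup>2"
        by (simp add: power_mult_distrib mult_left_mono)
      have "(real (Suc K))\<^sup>2 * (\<Sum>\<zeta>\<in>Y. (cmod (w k \<zeta>))\<^sup>2) \<le> (\<Sum>\<zeta>\<in>Y. \<Sum>j\<in>UNIV. (1 + (norm (freq \<zeta>))\<^sup>2) * (cmod (w j \<zeta>))\<^sup>2)"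
        unfolding sum_distrib_left
      proof (rule sum_mono)
        fix \<zeta> assume "\<zeta> \<in> Y"
        then obtain i where "\<bar>\<zeta> $ i\<bar> > int K" by (auto simp: Y_def Lam_def not_le)
        then have "real (Suc K) \<le> \<bar>freq \<zeta> $ i\<bar>" by simp
        also have "\<dots> \<le> norm (freq \<zeta>)" by (rule component_le_norm_cart)
        finally have "(real (Suc K))\<^sup>2 \<le> (norm (freq \<zeta>))\<^sup>2" by (intro power_mono) auto
        then have "(real (Suc K))\<^sup>2 \<le> 1 + (norm (freq \<zeta>))\<^sup>2" by linarith
        then have "(real (Suc K))\<^sup>2 * (cmod (w k \<zeta>))\<^sup>2 \<le> (1 + (norm (freq \<zeta>))\<^sup>2) * (cmod (w k \<zeta>))\<^sup>2"
          by (rule mult_right_mono) simp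
        also have "\<dots> \<le> (\<Sum>j\<in>UNIV. (1 + (norm (freq \<zeta>))\<^sup>2) * (cmod (w j \<zeta>))\<^sup>2)"
          by (rule member_le_sum) auto
        finally show "(real (Suc K))\<^sup>2 * (cmod (w k \<zeta>))\<^sup>2 \<le> (\<Sum>j\<in>UNIV. (1 + (norm (freq \<zeta>))\<^sup>2) * (cmod (w j \<zeta>))\<^sup>2)" .
      qed
      also have "\<dots> \<le> R\<^sup>2" using E[OF Y] by (simp add: energy_def)
      finally show "(\<Sum>\<zeta>\<in>Y. (cmod (w k \<zeta>))\<^sup>2) \<le> (R * inverse (real (Suc K)))\<^sup>2"
        by (simp add: power_mult_distrib power_inverse divide_simps mult.commute del: of_nat_Suc)
    qed (auto intro: sum_nonneg)
    also have "\<dots> = norm (freq \<xi>) * R * (R * inverse (real (Suc K)))" using R(1) by (simp add: real_sqrt_mult)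
    finally show ?thesis .
  qed
  finally show ?thesis by (simp add: mult_ac)
qed

text \<open>The infinite convolution of the limit enters through any limit \<open>\<beta>\<close> of
  its partial sums. That these converge is established only later, once the coefficients are
  realized as functions and \<open>\<beta>\<close> as the coefficient of a product.\<close>

lemma weak_solution:
  fixes a :: "'n::finite tensor" and F :: "'n \<Rightarrow> int ^ 'n \<Rightarrow> complex"
  assumes a: "tensor_symmetric a" "relaxed_elliptic a C" and C: "C > 0" and F: "\<And>k. hermitian (F k)"
    and s: "\<And>k. (\<lambda>\<xi>. (cmod (F k \<xi>))\<^sup>2 / (1 + (norm (freq \<xi>))\<^sup>2)) summable_on UNIV"
  defines "M \<equiv> sqrt (\<Sum>k\<in>UNIV. \<Sum>\<^sub>\<infinity>\<xi>. (cmod (F k \<xi>))\<^sup>2 / (1 + (norm (freq \<xi>))\<^sup>2))"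
  shows "\<exists>w. solenoidal (- {0}) w
    \<and> (\<forall>k. (\<lambda>\<xi>. (1 + (norm (freq \<xi>))\<^sup>2) * (cmod (w k \<xi>))\<^sup>2) summable_on UNIV)
    \<and> (\<Sum>k\<in>UNIV. \<Sum>\<^sub>\<infinity>\<xi>. (1 + (norm (freq \<xi>))\<^sup>2) * (cmod (w k \<xi>))\<^sup>2) \<le> (C * M / pi\<^sup>2)\<^sup>2
    \<and> (\<forall>\<xi> \<beta>. \<xi> \<noteq> 0 \<longrightarrow> (\<forall>k. (\<lambda>K. conv (Lam K) w k \<xi>) \<longlonglongrightarrow> \<beta> k) \<longrightarrow>
        (\<forall>k. leray \<xi> (\<lambda>k. of_real (4 * pi\<^sup>2) * symb a \<xi> (\<lambda>k. w k \<xi>) k + \<beta> k - F k \<xi>) k = 0))"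
proof -
  define X where "X N = Lam N - {0 :: int ^ 'n}" for N
  have X: "finite (X N)" "\<And>\<xi>. \<xi> \<in> X N \<Longrightarrow> - \<xi> \<in> X N" "0 \<notin> X N" for N by (auto simp: X_def)
  have sum0: "(\<Sum>k\<in>UNIV. \<Sum>\<^sub>\<infinity>\<xi>. (cmod (F k \<xi>))\<^sup>2 / (1 + (norm (freq \<xi>))\<^sup>2)) \<ge> 0"
    by (intro sum_nonneg infsum_nonneg) (auto intro: divide_nonneg_nonneg)
  have M0: "M \<ge> 0" using sum0 by (simp add: M_def)
  have M2: "(\<Sum>\<xi>\<in>X N. \<Sum>k\<in>UNIV. (cmod (F k \<xi>))\<^sup>2 / (1 + (norm (freq \<xi>))\<^sup>2)) \<le> M\<^sup>2" for N
  proof -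
    have "(\<Sum>\<xi>\<in>X N. \<Sum>k\<in>UNIV. (cmod (F k \<xi>))\<^sup>2 / (1 + (norm (freq \<xi>))\<^sup>2))
        = (\<Sum>k\<in>UNIV. \<Sum>\<xi>\<in>X N. (cmod (F k \<xi>))\<^sup>2 / (1 + (norm (freq \<xi>))\<^sup>2))" by (rule sum.swap)
    also have "\<dots> \<le> (\<Sum>k\<in>UNIV. \<Sum>\<^sub>\<infinity>\<xi>. (cmod (F k \<xi>))\<^sup>2 / (1 + (norm (freq \<xi>))\<^sup>2))"
      by (intro sum_mono finite_sum_le_infsum s X) auto
    also have "\<dots> = M\<^sup>2" using sum0 by (simp add: M_def)
    finally show ?thesis .
  qed
  define R where "R = C * M / pi\<^sup>2"
  have R: "R \<ge> 0" using C M0 by (simp add: R_def)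
  have "\<exists>w. solenoidal (X N) w \<and> (\<forall>\<xi>\<in>X N. \<forall>k. leray \<xi> (resid a F (X N) w \<xi>) k = 0) \<and> energy (X N) w \<le> R\<^sup>2" for N
    unfolding R_def by (rule galerkin[OF a C F X(1) _ X(3) M0 M2]) (rule X(2))
  then obtain W where W: "\<And>N. solenoidal (X N) (W N)" "\<And>N \<xi> k. \<xi> \<in> X N \<Longrightarrow> leray \<xi> (resid a F (X N) (W N) \<xi>) k = 0"
    "\<And>N. energy (X N) (W N) \<le> R\<^sup>2" by metis
  have EW: "energy Y (W N) \<le> R\<^sup>2" if "finite Y" for Y N
    using energy_mono_any[OF W(1) X(1) that] W(3) by (rule order_trans)
  \<comment> \<open>The energy bounds every coefficient by \<open>R\<close>, so the approximations
    lie in a product of discs over a countable index set, which is sequentially compact. Convergence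
    there is convergence of each coefficient.\<close>
  define V where "V N = (\<lambda>(k, \<xi>). W N k \<xi>)" for N
  have Vb: "V N i \<in> cball 0 R" for N i
  proof -
    obtain k \<xi> where i: "i = (k, \<xi>)" by (cases i)
    have "(cmod (W N k \<xi>))\<^sup>2 \<le> (1 + (norm (freq \<xi>))\<^sup>2) * (cmod (W N k \<xi>))\<^sup>2" by (simp add: algebra_simps)
    also have "\<dots> \<le> (\<Sum>k\<in>UNIV. (1 + (norm (freq \<xi>))\<^sup>2) * (cmod (W N k \<xi>))\<^sup>2)"
      by (rule member_le_sum[where f = "\<lambda>k. (1 + (norm (freq \<xi>))\<^sup>2) * (cmod (W N k \<xi>))\<^sup>2"]) auto
    also have "\<dots> = energy {\<xi>} (W N)" by (simp add: energy_def)
    also have "\<dots> \<le> R\<^sup>2" by (rule EW) simp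
    finally have "cmod (W N k \<xi>) \<le> R" by (rule power2_le_imp_le[OF _ R])
    then show ?thesis by (simp add: V_def i)
  qed
  have "compact {x :: 'n \<times> (int ^ 'n) \<Rightarrow> complex. \<forall>i. x i \<in> cball 0 R}" by (rule compact_fun_box) simp
  then have "seq_compact {x :: 'n \<times> (int ^ 'n) \<Rightarrow> complex. \<forall>i. x i \<in> cball 0 R}" by (rule compact_imp_seq_compact)
  moreover have "\<forall>N. V N \<in> {x. \<forall>i. x i \<in> cball 0 R}" using Vb by blast
  ultimately obtain v r where r: "strict_mono (r :: nat \<Rightarrow> nat)" "(V \<circ> r) \<longlonglongrightarrow> v" by (rule seq_compactE)
  define w where "w = (\<lambda>k \<xi>. v (k, \<xi>))"
  have lim: "(\<lambda>n. W (r n) k \<xi>) \<longlonglongrightarrow> w k \<xi>" for k \<xi>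
    using r(2) unfolding tendsto_fun_iff by (auto simp: V_def w_def o_def dest: spec[of _ "(k, \<xi>)"])
  have herm: "hermitian (w k)" for k
    unfolding hermitian_def
  proof
    fix \<xi>
    have "(\<lambda>n. W (r n) k (- \<xi>)) \<longlonglongrightarrow> cnj (w k \<xi>)"
      using tendsto_cnj[OF lim[of k \<xi>]] W(1) by (simp add: solenoidal_def hermitian_def)
    then show "w k (- \<xi>) = cnj (w k \<xi>)" by (rule LIMSEQ_unique[OF lim])
  qed
  have div: "sdot \<xi> (\<lambda>k. w k \<xi>) = 0" for \<xi>
  proof -
    have "(\<lambda>n. sdot \<xi> (\<lambda>k. W (r n) k \<xi>)) \<longlonglongrightarrow> sdot \<xi> (\<lambda>k. w k \<xi>)"
      unfolding sdot_def by (intro tendsto_intros lim)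
    moreover have "sdot \<xi> (\<lambda>k. W (r n) k \<xi>) = 0" for n using W(1) by (simp add: solenoidal_def)
    ultimately show ?thesis by (simp add: LIMSEQ_const_iff)
  qed
  have "w k 0 = 0" for k
  proof -
    have "W (r n) k 0 = 0" for n using W(1)[of "r n"] X(3)[of "r n"] by (simp add: solenoidal_def)
    then show ?thesis using lim[of k 0] by (simp add: LIMSEQ_const_iff)
  qed
  then have sol: "solenoidal (- {0}) w" using herm div by (simp add: solenoidal_def)
  have Ew: "energy Y w \<le> R\<^sup>2" if "finite Y" for Y
  proof (rule LIMSEQ_le_const2)
    show "(\<lambda>n. energy Y (W (r n))) \<longlonglongrightarrow> energy Y w" unfolding energy_def by (intro tendsto_intros lim)
    show "\<exists>n0. \<forall>n\<ge>n0. energy Y (W (r n)) \<le> R\<^sup>2" using EW[OF that] by blast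
  qed
  let ?e = "\<lambda>k \<xi>. (1 + (norm (freq \<xi>))\<^sup>2) * (cmod (w k \<xi>))\<^sup>2"
  have le: "(\<Sum>\<xi>\<in>Lam N. ?e k \<xi>) \<le> R\<^sup>2" for N k
  proof -
    have "(\<Sum>\<xi>\<in>Lam N. ?e k \<xi>) \<le> energy (Lam N) w"
      unfolding energy_def by (intro sum_mono member_le_sum[where f = "\<lambda>k. ?e k _"]) auto
    then show ?thesis using Ew[of "Lam N"] by simp
  qed
  have summ: "?e k summable_on UNIV" for k by (rule summable_Lam_bound(1)[OF _ le]) simp
  have "(\<Sum>k\<in>UNIV. \<Sum>\<^sub>\<infinity>\<xi>. ?e k \<xi>) \<le> R\<^sup>2"
  proof (rule LIMSEQ_le_const2)
    show "(\<lambda>N. \<Sum>k\<in>UNIV. \<Sum>\<xi>\<in>Lam N. ?e k \<xi>) \<longlonglongrightarrow> (\<Sum>k\<in>UNIV. \<Sum>\<^sub>\<infinity>\<xi>. ?e k \<xi>)"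
      by (intro tendsto_sum infsum_Lam summ)
    have "(\<Sum>k\<in>UNIV. \<Sum>\<xi>\<in>Lam N. ?e k \<xi>) \<le> R\<^sup>2" for N
      using Ew[of "Lam N"] unfolding energy_def by (subst sum.swap) simp
    then show "\<exists>n0. \<forall>n\<ge>n0. (\<Sum>k\<in>UNIV. \<Sum>\<xi>\<in>Lam n. ?e k \<xi>) \<le> R\<^sup>2" by blast
  qed
  moreover have "leray \<xi> (\<lambda>k. of_real (4 * pi\<^sup>2) * symb a \<xi> (\<lambda>k. w k \<xi>) k + \<beta> k - F k \<xi>) k = 0"
    if \<xi>: "\<xi> \<noteq> 0" and \<beta>: "\<And>k. (\<lambda>K. conv (Lam K) w k \<xi>) \<longlonglongrightarrow> \<beta> k" for \<xi> \<beta> k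
  proof -
    have cl: "(\<lambda>n. conv (X (r n)) (W (r n)) k \<xi>) \<longlonglongrightarrow> \<beta> k" for k
    proof (rule double_limit)
      show "norm (conv (X (r n)) (W (r n)) k \<xi> - conv (Lam K) (W (r n)) k \<xi>)
          \<le> 2 * pi * (norm (freq \<xi>) * R * R) * inverse (real (Suc K))" for K n
        by (rule conv_tail[OF W(1) X(1) R W(3)])
      show "(\<lambda>K. 2 * pi * (norm (freq \<xi>) * R * R) * inverse (real (Suc K))) \<longlonglongrightarrow> 0"
        using tendsto_mult_left[OF LIMSEQ_inverse_real_of_nat] by fastforce
      show "(\<lambda>n. conv (Lam K) (W (r n)) k \<xi>) \<longlonglongrightarrow> conv (Lam K) w k \<xi>" for K
        unfolding conv_def sdot_def by (intro tendsto_intros lim)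
    qed (rule \<beta>)
    have rl: "(\<lambda>n. resid a F (X (r n)) (W (r n)) \<xi> k) \<longlonglongrightarrow> of_real (4 * pi\<^sup>2) * symb a \<xi> (\<lambda>k. w k \<xi>) k + \<beta> k - F k \<xi>" for k
      unfolding resid_def by (intro tendsto_intros cl) (unfold symb_def, intro tendsto_intros lim)
    have "(\<lambda>n. leray \<xi> (resid a F (X (r n)) (W (r n)) \<xi>) k)
        \<longlonglongrightarrow> leray \<xi> (\<lambda>k. of_real (4 * pi\<^sup>2) * symb a \<xi> (\<lambda>k. w k \<xi>) k + \<beta> k - F k \<xi>) k"
      unfolding leray_def sdot_def divide_inverse by (intro tendsto_intros rl)
    moreover have "(\<lambda>n. leray \<xi> (resid a F (X (r n)) (W (r n)) \<xi>) k) \<longlonglongrightarrow> 0"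
    proof (rule tendsto_eventually)
      obtain N where "\<xi> \<in> Lam N" using ex_Lam by blast
      have mem: "\<xi> \<in> X (r n)" if "n \<ge> N" for n
        using \<open>\<xi> \<in> Lam N\<close> Lam_mono[of N "r n"] that seq_suble[OF r(1), of n] \<xi> by (auto simp: X_def)
      then show "\<forall>\<^sub>F n in sequentially. leray \<xi> (resid a F (X (r n)) (W (r n)) \<xi>) k = 0"
        unfolding eventually_sequentially by (intro exI[of _ N] allI impI W(2) mem)
    qed
    ultimately show ?thesis by (rule LIMSEQ_unique)
  qed
  ultimately show ?thesis using sol summ unfolding R_def by blast
qed

section \<open>Integrability of the convection term and of the pressure\<close>

lemma powr_le_one_plus: "0 \<le> q \<Longrightarrow> q \<le> e \<Longrightarrow> \<bar>x\<bar> powr q \<le> 1 + \<bar>x :: real\<bar> powr e"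
proof (cases "\<bar>x\<bar> \<le> 1")
  case True
  assume "0 \<le> q"
  then have "\<bar>x\<bar> powr q \<le> 1 powr q" using True by (intro powr_mono2) auto
  then show ?thesis by (simp add: add_increasing2)
next
  case False
  assume "q \<le> e"
  then have "\<bar>x\<bar> powr q \<le> \<bar>x\<bar> powr e" using False by (intro powr_mono) auto
  then show ?thesis by simp
qed

lemma integrable_powr_le:
  fixes f :: "real ^ 'n::finite \<Rightarrow> real"
  assumes "f \<in> borel_measurable borel" "integrable tor (\<lambda>x. \<bar>f x\<bar> powr e)" "0 \<le> q" "q \<le> e"
  shows "integrable tor (\<lambda>x. \<bar>f x\<bar> powr q)"
proof (rule Bochner_Integration.integrable_bound)
  have [measurable]: "f \<in> borel_measurable borel" by fact
  show "integrable tor (\<lambda>x. 1 + \<bar>f x\<bar> powr e)" using assms(2) by simp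
  show "(\<lambda>x. \<bar>f x\<bar> powr q) \<in> borel_measurable tor" by (rule measurable_tor) measurable
  show "AE x in tor. norm (\<bar>f x\<bar> powr q) \<le> norm (1 + \<bar>f x\<bar> powr e)"
    using powr_le_one_plus[OF assms(3,4)] by (simp add: abs_of_nonneg add_nonneg_nonneg)
qed

lemma integrable_powr_add:
  fixes f g :: "real ^ 'n::finite \<Rightarrow> real"
  assumes "f \<in> borel_measurable borel" "g \<in> borel_measurable borel" "q \<ge> 0"
    and i: "integrable tor (\<lambda>x. \<bar>f x\<bar> powr q)" "integrable tor (\<lambda>x. \<bar>g x\<bar> powr q)"
  shows "integrable tor (\<lambda>x. \<bar>f x + g x\<bar> powr q)"
proof (rule Bochner_Integration.integrable_bound)
  have [measurable]: "f \<in> borel_measurable borel" "g \<in> borel_measurable borel" by fact+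
  show "integrable tor (\<lambda>x. 2 powr q * (\<bar>f x\<bar> powr q + \<bar>g x\<bar> powr q))" using i by simp
  show "(\<lambda>x. \<bar>f x + g x\<bar> powr q) \<in> borel_measurable tor" by (rule measurable_tor) measurable
  show "AE x in tor. norm (\<bar>f x + g x\<bar> powr q) \<le> norm (2 powr q * (\<bar>f x\<bar> powr q + \<bar>g x\<bar> powr q))"
  proof (rule AE_I2)
    fix x
    have "\<bar>f x + g x\<bar> powr q \<le> (2 * max \<bar>f x\<bar> \<bar>g x\<bar>) powr q" using assms(3) by (intro powr_mono2) auto
    also have "\<dots> = 2 powr q * (max \<bar>f x\<bar> \<bar>g x\<bar>) powr q" by (rule powr_mult)
    also have "\<dots> \<le> 2 powr q * (\<bar>f x\<bar> powr q + \<bar>g x\<bar> powr q)" by (intro mult_left_mono) (auto simp: max_def)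
    finally show "norm (\<bar>f x + g x\<bar> powr q) \<le> norm (2 powr q * (\<bar>f x\<bar> powr q + \<bar>g x\<bar> powr q))" by simp
  qed
qed

lemma integrable_powr_sum:
  fixes f :: "'i \<Rightarrow> real ^ 'n::finite \<Rightarrow> real"
  assumes "finite I" "q \<ge> 0" "\<And>i. i \<in> I \<Longrightarrow> f i \<in> borel_measurable borel"
    "\<And>i. i \<in> I \<Longrightarrow> integrable tor (\<lambda>x. \<bar>f i x\<bar> powr q)"
  shows "integrable tor (\<lambda>x. \<bar>\<Sum>i\<in>I. f i x\<bar> powr q)"
  using assms
proof (induction I rule: finite_induct)
  case (insert i I)
  have m: "(\<lambda>x. \<Sum>i\<in>I. f i x) \<in> borel_measurable borel" using insert.prems by (intro borel_measurable_sum) auto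
  have "integrable tor (\<lambda>x. \<bar>f i x + (\<Sum>i\<in>I. f i x)\<bar> powr q)"
    by (rule integrable_powr_add[OF _ m]) (use insert in auto)
  then show ?case using insert.hyps by simp
qed simp

text \<open>Young's inequality for the exponents of
  \<open>(m - 1) / m = (m - 2) / (2 m) + 1 / 2\<close>. The threshold
  \<open>y powr ((m - 2) / m)\<close> is the value of x at which both terms on the right coincide;
  on either side one of them suffices.\<close>

lemma young_powr:
  fixes x y m :: real
  assumes m: "m > 2" and x: "x \<ge> 0" and y: "y \<ge> 0"
  shows "(x * y) powr (1 + 1 / (m - 1)) \<le> x powr (2 * m / (m - 2)) + y\<^sup>2"
proof (cases "x = 0 \<or> y = 0")
  case True
  then show ?thesis using m by auto
next
  case False
  then have x: "x > 0" and y: "y > 0" using x y by auto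
  let ?r = "1 + 1 / (m - 1)" and ?p = "2 * m / (m - 2)"
  have r: "?r > 0" using m by (auto intro: add_pos_pos)
  have e1: "(1 + (m - 2) / m) * ?r = 2" using m by (simp add: field_simps)
  have e2: "(1 + m / (m - 2)) * ?r = ?p"
  proof -
    have "1 + m / (m - 2) = 2 * (m - 1) / (m - 2)" "?r = m / (m - 1)" using m by (simp_all add: field_simps)
    then have "(1 + m / (m - 2)) * ?r = (2 * m) * (m - 1) / ((m - 2) * (m - 1))"
      by (simp only: times_divide_times_eq mult_ac)
    also have "\<dots> = ?p" by (rule mult_divide_mult_cancel_right) (use m in simp)
    finally show ?thesis .
  qed
  have nn: "x powr ?p \<ge> 0" "y\<^sup>2 \<ge> 0" by auto
  show ?thesis
  proof (cases "x \<le> y powr ((m - 2) / m)")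
    case True
    have "x * y \<le> y powr ((m - 2) / m) * y powr 1" using True y by (intro mult_mono) auto
    also have "\<dots> = y powr (1 + (m - 2) / m)" by (simp only: powr_add[symmetric] add.commute)
    finally have "(x * y) powr ?r \<le> (y powr (1 + (m - 2) / m)) powr ?r" using x y r by (intro powr_mono2) auto
    also have "\<dots> = y\<^sup>2" using y by (simp only: powr_powr e1) (simp add: powr_numeral)
    finally show ?thesis using nn by linarith
  next
    case False
    then have "(y powr ((m - 2) / m)) powr (m / (m - 2)) \<le> x powr (m / (m - 2))" using m by (intro powr_mono2) auto
    then have "y \<le> x powr (m / (m - 2))" using m y by (simp add: powr_powr)
    then have "x * y \<le> x powr 1 * x powr (m / (m - 2))" using x y by (intro mult_mono) auto
    also have "\<dots> = x powr (1 + m / (m - 2))" by (simp only: powr_add)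
    finally have "(x * y) powr ?r \<le> (x powr (1 + m / (m - 2))) powr ?r" using x y r by (intro powr_mono2) auto
    also have "\<dots> = x powr ?p" by (simp only: powr_powr e2)
    finally show ?thesis using nn by linarith
  qed
qed

definition l2 :: "(int ^ 'n::finite \<Rightarrow> complex) \<Rightarrow> bool" where
  "l2 c \<longleftrightarrow> (\<lambda>\<xi>. (cmod (c \<xi>))\<^sup>2) summable_on UNIV"

lemma l2_add: assumes "l2 c" "l2 d" shows "l2 (\<lambda>\<xi>. c \<xi> + d \<xi>)"
  unfolding l2_def
proof (rule summable_on_comparison_test)
  show "(\<lambda>\<xi>. 2 * (cmod (c \<xi>))\<^sup>2 + 2 * (cmod (d \<xi>))\<^sup>2) summable_on UNIV"
    using assms unfolding l2_def by (intro summable_on_add summable_on_cmult_right)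
  fix \<xi>
  have "(cmod (c \<xi> + d \<xi>))\<^sup>2 \<le> (cmod (c \<xi>) + cmod (d \<xi>))\<^sup>2" by (intro power_mono norm_triangle_ineq) simp
  also have "\<dots> \<le> 2 * (cmod (c \<xi>))\<^sup>2 + 2 * (cmod (d \<xi>))\<^sup>2"
    using sum_squares_bound[of "cmod (c \<xi>)" "cmod (d \<xi>)"] by (simp add: power2_sum)
  finally show "(cmod (c \<xi> + d \<xi>))\<^sup>2 \<le> 2 * (cmod (c \<xi>))\<^sup>2 + 2 * (cmod (d \<xi>))\<^sup>2" .
qed simp

lemma l2_sum: "finite I \<Longrightarrow> (\<And>i. i \<in> I \<Longrightarrow> l2 (c i)) \<Longrightarrow> l2 (\<lambda>\<xi>. \<Sum>i\<in>I. c i \<xi>)"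
  by (induction I rule: finite_induct) (simp_all add: l2_add, simp add: l2_def)

lemma l2_uminus: "l2 c \<Longrightarrow> l2 (\<lambda>\<xi>. - c \<xi>)" by (simp add: l2_def)

lemma l2_le:
  assumes "(\<lambda>\<xi>. r \<xi>) summable_on UNIV" "\<And>\<xi>. (cmod (c \<xi>))\<^sup>2 \<le> B * r \<xi>"
  shows "l2 c"
  unfolding l2_def by (rule summable_on_comparison_test[OF summable_on_cmult_right[OF assms(1), of B]]) (use assms(2) in auto)

section \<open>The Stokes operator on Fourier coefficients\<close>

lemma Hterm_1: "Hterm 1 T = (\<lambda>\<xi>. (1 + (norm (freq \<xi>))\<^sup>2) * (cmod (fourier T \<xi>))\<^sup>2)"
  by (simp add: fun_eq_iff Hterm_def add_nonneg_nonneg)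

lemma Hterm_minus_1: "Hterm (- 1) T = (\<lambda>\<xi>. (cmod (fourier T \<xi>))\<^sup>2 / (1 + (norm (freq \<xi>))\<^sup>2))"
  by (simp add: fun_eq_iff Hterm_def powr_minus_divide add_nonneg_nonneg)

lemma Hnorm_vec_eq:
  assumes "\<And>k \<xi>. Hterm s (w k) \<xi> \<ge> 0"
  shows "Hnorm_vec s w = sqrt (\<Sum>k\<in>UNIV. \<Sum>\<^sub>\<infinity>\<xi>. Hterm s (w k) \<xi>)"
  using assms by (simp add: Hnorm_vec_def Hnorm_def infsum_nonneg)

lemma distribution_strain:
  assumes "\<And>k. distribution (u k)" shows "distribution (strain u j \<beta>)"
  using distribution_lin[OF distribution_dpartial[OF assms] distribution_dpartial[OF assms], of "1/2" j \<beta> "1/2" \<beta> j]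
  by (simp add: strain_def[abs_def] add_divide_distrib)

lemma fourier_strain:
  assumes "\<And>k. distribution (u k)"
  shows "fourier (strain u j \<beta>) \<xi> = pi * \<i> * (of_int (\<xi> $ j) * fourier (u \<beta>) \<xi> + of_int (\<xi> $ \<beta>) * fourier (u j) \<xi>)"
proof -
  have "strain u j \<beta> = (\<lambda>\<phi>. (1/2) * dpartial j (u \<beta>) \<phi> + (1/2) * dpartial \<beta> (u j) \<phi>)"
    by (simp add: strain_def add_divide_distrib)
  then show ?thesis by (simp only: fourier_lin fourier_dpartial assms) (simp add: algebra_simps)
qed

text \<open>By the symmetry of \<open>a\<close> in j and \<open>\<beta>\<close> both halves of the
  strain contribute equally, so the operator has the symbol of the unsymmetrized form.\<close>

lemma stokes_fourier:
  fixes a :: "'n::finite tensor"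
  assumes u: "\<And>k. distribution (u k)" and a: "tensor_symmetric a"
  shows "distribution (stokes_op a u k)"
    "fourier (stokes_op a u k) \<xi> = - of_real (4 * pi\<^sup>2) * symb a \<xi> (\<lambda>k. fourier (u k) \<xi>) k"
proof -
  let ?S = "\<lambda>\<alpha> \<psi>. \<Sum>j\<in>UNIV. \<Sum>\<beta>\<in>UNIV. a k j \<alpha> \<beta> * strain u j \<beta> \<psi>"
  have d: "distribution (?S \<alpha>)" for \<alpha>
  proof -
    have "distribution (\<lambda>\<psi>. \<Sum>\<beta>\<in>UNIV. a k j \<alpha> \<beta> * strain u j \<beta> \<psi>)" for j
      by (intro distribution_sum distribution_strain u) simp
    then show ?thesis
      using distribution_sum[of UNIV "\<lambda>j \<psi>. \<Sum>\<beta>\<in>UNIV. a k j \<alpha> \<beta> * strain u j \<beta> \<psi>" "\<lambda>_. 1"] by simp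
  qed
  have op: "stokes_op a u k = (\<lambda>\<phi>. \<Sum>\<alpha>\<in>UNIV. 1 * dpartial \<alpha> (?S \<alpha>) \<phi>)"
    by (simp add: stokes_op_def)
  show "distribution (stokes_op a u k)"
    unfolding op by (intro distribution_sum distribution_dpartial d) simp
  let ?w = "\<lambda>k. fourier (u k) \<xi>"
  have fS: "fourier (?S \<alpha>) \<xi> = 2 * pi * \<i> * (\<Sum>j\<in>UNIV. \<Sum>\<beta>\<in>UNIV. of_real (a k j \<alpha> \<beta> * real_of_int (\<xi> $ \<beta>)) * ?w j)" for \<alpha>
  proof -
    have "fourier (?S \<alpha>) \<xi> = (\<Sum>j\<in>UNIV. \<Sum>\<beta>\<in>UNIV. of_real (a k j \<alpha> \<beta>) * fourier (strain u j \<beta>) \<xi>)"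
      using fourier_sum[where I = UNIV and r = "\<lambda>_. 1" and T = "\<lambda>j \<psi>. \<Sum>\<beta>\<in>UNIV. a k j \<alpha> \<beta> * strain u j \<beta> \<psi>" and \<xi> = \<xi>]
      by (simp add: fourier_sum)
    also have "\<dots> = pi * \<i> * (\<Sum>j\<in>UNIV. \<Sum>\<beta>\<in>UNIV. of_real (a k j \<alpha> \<beta>) * (of_int (\<xi> $ j) * ?w \<beta>))
        + pi * \<i> * (\<Sum>j\<in>UNIV. \<Sum>\<beta>\<in>UNIV. of_real (a k j \<alpha> \<beta>) * (of_int (\<xi> $ \<beta>) * ?w j))"
      unfolding sum_distrib_left sum.distrib[symmetric] by (intro sum.cong refl) (simp add: fourier_strain[OF u] algebra_simps)
    also have "(\<Sum>j\<in>UNIV. \<Sum>\<beta>\<in>UNIV. of_real (a k j \<alpha> \<beta>) * (of_int (\<xi> $ j) * ?w \<beta>))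
        = (\<Sum>j\<in>UNIV. \<Sum>\<beta>\<in>UNIV. of_real (a k j \<alpha> \<beta>) * (of_int (\<xi> $ \<beta>) * ?w j))"
    proof -
      have "a k \<beta> \<alpha> j = a k j \<alpha> \<beta>" for j \<beta> using a unfolding tensor_symmetric_def by metis
      then show ?thesis by (subst sum.swap) simp
    qed
    finally show ?thesis by (simp add: mult_ac)
  qed
  have "fourier (stokes_op a u k) \<xi> = (\<Sum>\<alpha>\<in>UNIV. of_real 1 * fourier (dpartial \<alpha> (?S \<alpha>)) \<xi>)"
    unfolding op by (rule fourier_sum)
  also have "\<dots> = (\<Sum>\<alpha>\<in>UNIV. (2 * pi * \<i> * of_int (\<xi> $ \<alpha>)) * (2 * pi * \<i> * (\<Sum>j\<in>UNIV. \<Sum>\<beta>\<in>UNIV. of_real (a k j \<alpha> \<beta> * real_of_int (\<xi> $ \<beta>)) * ?w j)))"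
    by (simp only: fourier_dpartial[OF d] fS of_real_1 mult_1)
  also have "\<dots> = (\<Sum>\<alpha>\<in>UNIV. \<Sum>j\<in>UNIV. \<Sum>\<beta>\<in>UNIV. - of_real (4 * pi\<^sup>2) * (of_real (a k j \<alpha> \<beta> * real_of_int (\<xi> $ \<alpha>) * real_of_int (\<xi> $ \<beta>)) * ?w j))"
    unfolding sum_distrib_left by (intro sum.cong refl) (simp add: power2_eq_square algebra_simps)
  also have "\<dots> = (\<Sum>j\<in>UNIV. \<Sum>\<alpha>\<in>UNIV. \<Sum>\<beta>\<in>UNIV. - of_real (4 * pi\<^sup>2) * (of_real (a k j \<alpha> \<beta> * real_of_int (\<xi> $ \<alpha>) * real_of_int (\<xi> $ \<beta>)) * ?w j))"
    by (rule sum.swap)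
  also have "\<dots> = - of_real (4 * pi\<^sup>2) * symb a \<xi> ?w k"
    unfolding symb_def of_real_sum sum_distrib_left sum_distrib_right ..
  finally show "fourier (stokes_op a u k) \<xi> = - of_real (4 * pi\<^sup>2) * symb a \<xi> ?w k" .
qed

text \<open>The gain of one derivative, which makes the linear part of the pressure square
  integrable.\<close>

lemma norm_riesz_freq: "cmod (riesz j \<xi>) * norm (freq \<xi>) \<le> 1"
proof (cases "\<xi> = 0")
  case False
  define y where "y = norm (freq \<xi>)"
  have y: "y \<ge> 1" using norm_freq_ge_1[OF False] by (simp add: y_def)
  have "\<bar>real_of_int (\<xi> $ j)\<bar> \<le> y" using component_le_norm_cart[of "freq \<xi>" j] by (simp add: y_def)
  then have "\<bar>real_of_int (\<xi> $ j)\<bar> * y \<le> y * y" using y by (intro mult_right_mono) auto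
  also have "\<dots> \<le> (2 * pi) * (y * y)" using mult_right_mono[of 1 "2 * pi" "y * y"] pi_gt3 y by simp
  finally show ?thesis using y by (simp add: norm_riesz y_def[symmetric] divide_le_eq power2_eq_square)
qed simp

theorem theorem6p1:
  fixes a :: "'n::finite tensor"
    and C :: real
    and f :: "'n \<Rightarrow> 'n distr"
  assumes "CARD('n) \<ge> 2"
    and "tensor_symmetric a"
    and "C > 0"
    and "relaxed_elliptic a C"
    and "f \<in> Hdot_vec (-1)"
  shows "\<exists>u p. u \<in> Hdot_sol 1 \<and>
           p \<in> Lq_dot (if CARD('n) \<le> 4 then 2 else real CARD('n) / (real CARD('n) - 2)) \<and>
           navier_stokes a u p f \<and>
           Hnorm_vec 1 u \<le> C / pi\<^sup>2 * Hnorm_vec (-1) f"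
proof -
  note n2 = assms(1) and sym = assms(2) and C = assms(3) and ell = assms(4)

  \<comment> \<open>Coefficients of the data and of a weak solution\<close>
  define F where "F k \<xi> = fourier (f k) \<xi>" for k \<xi>
  have fd: "distribution (f k)" and fs: "(\<lambda>\<xi>. Hterm (-1) (f k) \<xi>) summable_on UNIV" and F0: "F k 0 = 0" for k
    using assms(5) by (auto simp: Hdot_vec_def Hdot_def Hspace_def F_def)
  have Fh: "hermitian (F k)" for k unfolding hermitian_def F_def using fourier_uminus[OF fd] by blast
  have Fs: "(\<lambda>\<xi>. (cmod (F k \<xi>))\<^sup>2 / (1 + (norm (freq \<xi>))\<^sup>2)) summable_on UNIV" for k
    using fs[of k] by (simp add: Hterm_minus_1 F_def)
  define M where "M = sqrt (\<Sum>k\<in>UNIV. \<Sum>\<^sub>\<infinity>\<xi>. (cmod (F k \<xi>))\<^sup>2 / (1 + (norm (freq \<xi>))\<^sup>2))"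
  have fnorm: "Hnorm_vec (-1) f = M"
    by (subst Hnorm_vec_eq) (auto simp: M_def Hterm_minus_1 F_def intro!: divide_nonneg_nonneg)
  have "\<exists>w. solenoidal (- {0}) w
    \<and> (\<forall>k. (\<lambda>\<xi>. (1 + (norm (freq \<xi>))\<^sup>2) * (cmod (w k \<xi>))\<^sup>2) summable_on UNIV)
    \<and> (\<Sum>k\<in>UNIV. \<Sum>\<^sub>\<infinity>\<xi>. (1 + (norm (freq \<xi>))\<^sup>2) * (cmod (w k \<xi>))\<^sup>2) \<le> (C * M / pi\<^sup>2)\<^sup>2
    \<and> (\<forall>\<xi> \<beta>. \<xi> \<noteq> 0 \<longrightarrow> (\<forall>k. (\<lambda>K. conv (Lam K) w k \<xi>) \<longlonglongrightarrow> \<beta> k) \<longrightarrow>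
        (\<forall>k. leray \<xi> (\<lambda>k. of_real (4 * pi\<^sup>2) * symb a \<xi> (\<lambda>k. w k \<xi>) k + \<beta> k - F k \<xi>) k = 0))"
    unfolding M_def by (rule weak_solution[OF sym ell C Fh Fs])
  then obtain w where w: "solenoidal (- {0}) w"
    and ws0: "\<forall>k. (\<lambda>\<xi>. (1 + (norm (freq \<xi>))\<^sup>2) * (cmod (w k \<xi>))\<^sup>2) summable_on UNIV"
    and wM: "(\<Sum>k\<in>UNIV. \<Sum>\<^sub>\<infinity>\<xi>. (1 + (norm (freq \<xi>))\<^sup>2) * (cmod (w k \<xi>))\<^sup>2) \<le> (C * M / pi\<^sup>2)\<^sup>2"
    and weq0: "\<forall>\<xi> \<beta>. \<xi> \<noteq> 0 \<longrightarrow> (\<forall>k. (\<lambda>K. conv (Lam K) w k \<xi>) \<longlonglongrightarrow> \<beta> k) \<longrightarrow>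
        (\<forall>k. leray \<xi> (\<lambda>k. of_real (4 * pi\<^sup>2) * symb a \<xi> (\<lambda>k. w k \<xi>) k + \<beta> k - F k \<xi>) k = 0)"
    by (elim exE conjE)
  note ws = ws0[rule_format] and weq = weq0[rule_format]
  have wh: "hermitian (w k)" and w0: "w k 0 = 0" and wdiv: "sdot \<xi> (\<lambda>k. w k \<xi>) = 0" for k \<xi>
    using w by (auto simp: solenoidal_def)
  have wl2: "l2 (w k)" for k by (rule l2_le[OF ws[of k], where B = 1]) (simp add: algebra_simps)
  note wl2' = wl2[unfolded l2_def]

  \<comment> \<open>The velocity and its gradient as square integrable functions\<close>
  define h where "h j k \<xi> = 2 * pi * \<i> * of_int (\<xi> $ j) * w k \<xi>" for j k \<xi>
  have hh: "hermitian (h j k)" for j k using wh by (simp add: hermitian_def h_def)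
  have comp: "(real_of_int (\<xi> $ j))\<^sup>2 \<le> 1 + (norm (freq \<xi>))\<^sup>2" for j and \<xi> :: "int ^ 'n"
  proof -
    have "\<bar>real_of_int (\<xi> $ j)\<bar>\<^sup>2 \<le> (norm (freq \<xi>))\<^sup>2" using component_le_norm_cart[of "freq \<xi>" j] by (intro power_mono) auto
    then show ?thesis by simp
  qed
  have hl2: "l2 (h j k)" for j k
  proof (rule l2_le[OF ws[of k], where B = "4 * pi\<^sup>2"])
    fix \<xi>
    have "(cmod (h j k \<xi>))\<^sup>2 = 4 * pi\<^sup>2 * ((real_of_int (\<xi> $ j))\<^sup>2 * (cmod (w k \<xi>))\<^sup>2)"
      by (simp add: h_def norm_mult power_mult_distrib)
    also have "\<dots> \<le> 4 * pi\<^sup>2 * ((1 + (norm (freq \<xi>))\<^sup>2) * (cmod (w k \<xi>))\<^sup>2)"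
      by (intro mult_left_mono mult_right_mono comp) auto
    finally show "(cmod (h j k \<xi>))\<^sup>2 \<le> 4 * pi\<^sup>2 * ((1 + (norm (freq \<xi>))\<^sup>2) * (cmod (w k \<xi>))\<^sup>2)" .
  qed
  note hl2' = hl2[unfolded l2_def]
  define U where "U k = l2_fun (w k)" for k
  define H where "H j k = l2_fun (h j k)" for j k
  have Um [measurable]: "U k \<in> borel_measurable borel" and Up: "U k (x + axis i 1) = U k x"
    and U2: "integrable tor (\<lambda>x. (U k x)\<^sup>2)" and Ui: "integrable tor (U k)" and Uf: "fc (U k) \<xi> = w k \<xi>" for k x i \<xi>
    unfolding U_def
    by (rule l2_fun_measurable l2_fun_periodic l2_fun_square l2_fun_integrable fc_l2_fun, rule wh, rule wl2')+
  have Hm [measurable]: "H j k \<in> borel_measurable borel" and Hp: "H j k (x + axis i 1) = H j k x"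
    and H2: "integrable tor (\<lambda>x. (H j k x)\<^sup>2)" and Hi: "integrable tor (H j k)" and Hf: "fc (H j k) \<xi> = h j k \<xi>" for j k x i \<xi>
    unfolding H_def
    by (rule l2_fun_measurable l2_fun_periodic l2_fun_square l2_fun_integrable fc_l2_fun, rule hh, rule hl2')+
  define u where "u k = distr_of (U k)" for k
  have ud: "distribution (u k)" for k unfolding u_def by (rule distribution_distr_of[OF Um Ui])
  have uf: "fourier (u k) \<xi> = w k \<xi>" for k \<xi> unfolding u_def by (simp add: fourier_distr_of[OF Um Ui] Uf)
  have "u \<in> Hdot_vec 1"
    using ud ws w0 by (auto simp: Hdot_vec_def Hdot_def Hspace_def Hterm_1 uf)
  moreover have "divergence u \<phi> = 0" if "\<phi> \<in> test_fun" for \<phi>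
  proof -
    have eq: "divergence u = (\<lambda>\<phi>. \<Sum>k\<in>UNIV. 1 * dpartial k (u k) \<phi>)" by (simp add: divergence_def)
    have "fourier (divergence u) \<xi> = 2 * pi * \<i> * sdot \<xi> (\<lambda>k. w k \<xi>)" for \<xi>
      unfolding eq fourier_sum by (simp add: fourier_dpartial ud uf sdot_def sum_distrib_left mult_ac)
    then have "fourier (divergence u) \<xi> = 0" for \<xi> by (simp add: wdiv)
    moreover have "distribution (divergence u)"
      unfolding eq by (intro distribution_sum distribution_dpartial ud) simp
    ultimately show ?thesis using distribution_eq_0 that by blast
  qed
  ultimately have usol: "u \<in> Hdot_sol 1" by (simp add: Hdot_sol_def)
  have unorm: "Hnorm_vec 1 u \<le> C / pi\<^sup>2 * M"
  proof -
    have "M \<ge> 0" unfolding M_def by (intro real_sqrt_ge_zero sum_nonneg infsum_nonneg divide_nonneg_nonneg) auto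
    then have "0 \<le> C * M / pi\<^sup>2" using C by simp
    then have "sqrt (\<Sum>k\<in>UNIV. \<Sum>\<^sub>\<infinity>\<xi>. (1 + (norm (freq \<xi>))\<^sup>2) * (cmod (w k \<xi>))\<^sup>2) \<le> C * M / pi\<^sup>2"
      using real_sqrt_le_mono[OF wM] by simp
    then show ?thesis by (subst Hnorm_vec_eq) (auto simp: Hterm_1 uf)
  qed

  \<comment> \<open>The convection term: integrability and Fourier coefficients\<close>
  define m where "m = max CARD('n) 3"
  have m: "m \<ge> CARD('n)" "m \<ge> 3" by (auto simp: m_def)
  have m2: "real m > 2" using m by simp
  define g where "g k = (\<lambda>x. \<Sum>j\<in>UNIV. H j k x * U j x)" for k
  have HUi: "integrable tor (\<lambda>x. H j k x * U j x)" for j k by (rule L2_mult(1)[OF Hm H2 Um U2])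
  have gm [measurable]: "g k \<in> borel_measurable borel" for k unfolding g_def by measurable
  have gi: "integrable tor (g k)" for k unfolding g_def by (intro Bochner_Integration.integrable_sum HUi)
  have gr: "integrable tor (\<lambda>x. \<bar>g k x\<bar> powr (1 + 1 / (real m - 1)))" for k
    unfolding g_def
  proof (rule integrable_powr_sum)
    fix j
    show "integrable tor (\<lambda>x. \<bar>H j k x * U j x\<bar> powr (1 + 1 / (real m - 1)))"
    proof (rule Bochner_Integration.integrable_bound)
      have "integrable tor (\<lambda>x. \<bar>U j x\<bar> powr (2 * real m / (real m - 2)))"
        unfolding U_def by (rule sobolev[OF wh ws m])
      then show "integrable tor (\<lambda>x. \<bar>U j x\<bar> powr (2 * real m / (real m - 2)) + (H j k x)\<^sup>2)" using H2 by simp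
      show "(\<lambda>x. \<bar>H j k x * U j x\<bar> powr (1 + 1 / (real m - 1))) \<in> borel_measurable tor" by (rule measurable_tor) measurable
      show "AE x in tor. norm (\<bar>H j k x * U j x\<bar> powr (1 + 1 / (real m - 1))) \<le> norm (\<bar>U j x\<bar> powr (2 * real m / (real m - 2)) + (H j k x)\<^sup>2)"
        using young_powr[OF m2 abs_ge_zero abs_ge_zero] by (simp add: abs_mult mult.commute)
    qed
  qed (use m in \<open>auto intro: add_nonneg_nonneg\<close>)
  have conv: "(\<lambda>N. conv (Lam N) w k \<xi>) \<longlonglongrightarrow> fc (g k) \<xi>" for k \<xi>
  proof -
    have "fc (g k) \<xi> = (\<Sum>j\<in>UNIV. fc (\<lambda>x. H j k x * U j x) \<xi>)"
      unfolding g_def fc_def of_real_sum sum_distrib_right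
      by (intro Bochner_Integration.integral_sum integrable_fc HUi) measurable
    moreover have "(\<lambda>N. \<Sum>j\<in>UNIV. \<Sum>\<eta>\<in>Lam N. h j k \<eta> * fc (U j) (\<xi> - \<eta>)) \<longlonglongrightarrow> (\<Sum>j\<in>UNIV. fc (\<lambda>x. H j k x * U j x) \<xi>)"
      unfolding H_def by (intro tendsto_sum fc_l2_fun_mult hh hl2' Um U2)
    moreover have "(\<Sum>j\<in>UNIV. \<Sum>\<eta>\<in>Lam N. h j k \<eta> * fc (U j) (\<xi> - \<eta>)) = conv (Lam N) w k \<xi>" for N
    proof -
      have "(\<Sum>j\<in>UNIV. h j k \<eta> * fc (U j) (\<xi> - \<eta>)) = 2 * pi * \<i> * (sdot \<xi> (\<lambda>j. w j (\<xi> - \<eta>)) * w k \<eta>)" for \<eta>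
      proof -
        have "(\<Sum>j\<in>UNIV. h j k \<eta> * fc (U j) (\<xi> - \<eta>)) = 2 * pi * \<i> * (sdot \<eta> (\<lambda>j. w j (\<xi> - \<eta>)) * w k \<eta>)"
          by (simp add: h_def Uf sdot_def sum_distrib_left sum_distrib_right mult_ac)
        \<comment> \<open>The difference of the two sides is the divergence of \<open>w\<close> at
          \<open>\<xi> - \<eta>\<close>. This identifies the product with a derivative on the second
          factor and the divergence form in \<open>conv\<close>.\<close>
        moreover have "sdot \<eta> (\<lambda>j. w j (\<xi> - \<eta>)) = sdot \<xi> (\<lambda>j. w j (\<xi> - \<eta>))"
          using sdot_add_freq[of "\<xi> - \<eta>" \<eta> "\<lambda>j. w j (\<xi> - \<eta>)"] wdiv[of "\<xi> - \<eta>"] by simp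
        ultimately show ?thesis by simp
      qed
      then show ?thesis unfolding conv_def by (subst sum.swap) (simp add: sum_distrib_left)
    qed
    ultimately show ?thesis by simp
  qed

  \<comment> \<open>The pressure\<close>
  have "\<forall>j. \<exists>v. v \<in> borel_measurable borel \<and> (\<forall>x i. v (x + axis i 1) = v x) \<and> integrable tor v
    \<and> integrable tor (\<lambda>x. \<bar>v x\<bar> powr (real m / (real m - 2))) \<and> (\<forall>\<xi>. fc v \<xi> = riesz j \<xi> * fc (g j) \<xi>)"
    using fractional_integral[OF m gm gi gr] by blast
  then obtain v where vm [measurable]: "\<And>j. v j \<in> borel_measurable borel" and vp: "\<And>j x i. v j (x + axis i 1) = v j x"
    and vi: "\<And>j. integrable tor (v j)" and vq: "\<And>j. integrable tor (\<lambda>x. \<bar>v j x\<bar> powr (real m / (real m - 2)))"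
    and vf: "\<And>j \<xi>. fc (v j) \<xi> = riesz j \<xi> * fc (g j) \<xi>" by metis
  \<comment> \<open>The contribution of the viscous term and of the force; the convection term is
    already carried by the functions \<open>v j\<close>.\<close>
  define d where "d \<xi> = (\<Sum>j\<in>UNIV. riesz j \<xi> * (of_real (4 * pi\<^sup>2) * symb a \<xi> (\<lambda>k. w k \<xi>) j - F j \<xi>))" for \<xi>
  have dh: "hermitian d"
    unfolding hermitian_def d_def
  proof
    fix \<xi>
    have "symb a (- \<xi>) (\<lambda>k. w k (- \<xi>)) j = cnj (symb a \<xi> (\<lambda>k. w k \<xi>) j)" for j
      using wh by (simp add: symb_uminus hermitian_def symb_cnj)
    then show "(\<Sum>j\<in>UNIV. riesz j (- \<xi>) * (of_real (4 * pi\<^sup>2) * symb a (- \<xi>) (\<lambda>k. w k (- \<xi>)) j - F j (- \<xi>)))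
        = cnj (\<Sum>j\<in>UNIV. riesz j \<xi> * (of_real (4 * pi\<^sup>2) * symb a \<xi> (\<lambda>k. w k \<xi>) j - F j \<xi>))"
      using Fh by (simp add: riesz_uminus hermitian_def)
  qed
  have dl2: "l2 d"
  proof -
    \<comment> \<open>The symbol costs two powers of the frequency, \<open>riesz\<close> returns
      one, and the other is covered by the weight in the energy.\<close>
    have t1: "l2 (\<lambda>\<xi>. riesz j \<xi> * of_real (4 * pi\<^sup>2 * (b * real_of_int (\<xi> $ \<alpha>) * real_of_int (\<xi> $ \<beta>))) * w i \<xi>)" for j \<alpha> \<beta> i b
    proof (rule l2_le[OF ws[of i], where B = "(4 * pi\<^sup>2 * b)\<^sup>2"])
      fix \<xi> :: "int ^ 'n"
      let ?y = "norm (freq \<xi>)"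
      have c: "\<bar>real_of_int (\<xi> $ l)\<bar> \<le> ?y" for l using component_le_norm_cart[of "freq \<xi>" l] by simp
      have "cmod (riesz j \<xi>) * (\<bar>real_of_int (\<xi> $ \<alpha>)\<bar> * \<bar>real_of_int (\<xi> $ \<beta>)\<bar>) \<le> cmod (riesz j \<xi>) * (?y * ?y)"
        by (intro mult_left_mono mult_mono c) auto
      also have "\<dots> \<le> 1 * ?y" using norm_riesz_freq[of j \<xi>] by (simp only: mult.assoc[symmetric]) (intro mult_right_mono, auto)
      finally have "(cmod (riesz j \<xi>) * (\<bar>real_of_int (\<xi> $ \<alpha>)\<bar> * \<bar>real_of_int (\<xi> $ \<beta>)\<bar>))\<^sup>2 \<le> ?y\<^sup>2"
        by (intro power_mono) auto
      then have "(cmod (riesz j \<xi>) * (\<bar>real_of_int (\<xi> $ \<alpha>)\<bar> * \<bar>real_of_int (\<xi> $ \<beta>)\<bar>))\<^sup>2 \<le> 1 + ?y\<^sup>2" by linarith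
      then have "(4 * pi\<^sup>2 * b)\<^sup>2 * ((cmod (riesz j \<xi>) * (\<bar>real_of_int (\<xi> $ \<alpha>)\<bar> * \<bar>real_of_int (\<xi> $ \<beta>)\<bar>))\<^sup>2 * (cmod (w i \<xi>))\<^sup>2)
          \<le> (4 * pi\<^sup>2 * b)\<^sup>2 * ((1 + ?y\<^sup>2) * (cmod (w i \<xi>))\<^sup>2)"
        by (intro mult_left_mono mult_right_mono) auto
      moreover have "(cmod (riesz j \<xi> * of_real (4 * pi\<^sup>2 * (b * real_of_int (\<xi> $ \<alpha>) * real_of_int (\<xi> $ \<beta>))) * w i \<xi>))\<^sup>2
          = (4 * pi\<^sup>2 * b)\<^sup>2 * ((cmod (riesz j \<xi>) * (\<bar>real_of_int (\<xi> $ \<alpha>)\<bar> * \<bar>real_of_int (\<xi> $ \<beta>)\<bar>))\<^sup>2 * (cmod (w i \<xi>))\<^sup>2)"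
        unfolding norm_mult norm_of_real by (simp add: power_mult_distrib abs_mult mult_ac)
      ultimately show "(cmod (riesz j \<xi> * of_real (4 * pi\<^sup>2 * (b * real_of_int (\<xi> $ \<alpha>) * real_of_int (\<xi> $ \<beta>))) * w i \<xi>))\<^sup>2
          \<le> (4 * pi\<^sup>2 * b)\<^sup>2 * ((1 + ?y\<^sup>2) * (cmod (w i \<xi>))\<^sup>2)" by simp
    qed
    \<comment> \<open>The force lacks exactly one derivative to be square integrable, and
      \<open>riesz\<close> supplies it.\<close>
    have t2: "l2 (\<lambda>\<xi>. riesz j \<xi> * F j \<xi>)" for j
    proof (rule l2_le[OF Fs[of j], where B = 2])
      fix \<xi> :: "int ^ 'n"
      let ?y = "norm (freq \<xi>)"
      have "(cmod (riesz j \<xi>))\<^sup>2 * (1 + ?y\<^sup>2) = (cmod (riesz j \<xi>))\<^sup>2 + (cmod (riesz j \<xi>) * ?y)\<^sup>2"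
        by (simp add: power_mult_distrib algebra_simps)
      also have "\<dots> \<le> 1\<^sup>2 + 1\<^sup>2" by (intro add_mono power_mono norm_riesz_le norm_riesz_freq) auto
      finally have r2: "(cmod (riesz j \<xi>))\<^sup>2 * (1 + ?y\<^sup>2) \<le> 2" by simp
      have yp: "1 + ?y\<^sup>2 > 0" by (simp add: add_pos_nonneg)
      have "(cmod (riesz j \<xi> * F j \<xi>))\<^sup>2 = ((cmod (riesz j \<xi>))\<^sup>2 * (1 + ?y\<^sup>2)) * ((cmod (F j \<xi>))\<^sup>2 / (1 + ?y\<^sup>2))"
        using yp by (simp add: norm_mult power_mult_distrib)
      also have "\<dots> \<le> 2 * ((cmod (F j \<xi>))\<^sup>2 / (1 + ?y\<^sup>2))" using yp by (intro mult_right_mono r2) auto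
      finally show "(cmod (riesz j \<xi> * F j \<xi>))\<^sup>2 \<le> 2 * ((cmod (F j \<xi>))\<^sup>2 / (1 + ?y\<^sup>2))" .
    qed
    have "d = (\<lambda>\<xi>. \<Sum>j\<in>UNIV. (\<Sum>i\<in>UNIV. \<Sum>\<alpha>\<in>UNIV. \<Sum>\<beta>\<in>UNIV.
        riesz j \<xi> * of_real (4 * pi\<^sup>2 * (a j i \<alpha> \<beta> * real_of_int (\<xi> $ \<alpha>) * real_of_int (\<xi> $ \<beta>))) * w i \<xi>) + - (riesz j \<xi> * F j \<xi>))"
      unfolding d_def symb_def
      by (intro ext sum.cong refl) (simp add: right_diff_distrib sum_distrib_left sum_distrib_right mult_ac)
    then show ?thesis by (simp only:) (intro l2_sum l2_add l2_uminus t1 t2 finite_class.finite_UNIV)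
  qed
  note dl2' = dl2[unfolded l2_def]
  define D where "D = l2_fun d"
  have Dm [measurable]: "D \<in> borel_measurable borel" and Dp: "D (x + axis i 1) = D x"
    and D2: "integrable tor (\<lambda>x. (D x)\<^sup>2)" and Di: "integrable tor D" and Df: "fc D \<xi> = d \<xi>" for x i \<xi>
    unfolding D_def
    by (rule l2_fun_measurable l2_fun_periodic l2_fun_square l2_fun_integrable fc_l2_fun, rule dh, rule dl2')+
  define p where "p x = D x + (\<Sum>j\<in>UNIV. v j x)" for x
  have sm: "(\<lambda>x. \<Sum>j\<in>UNIV. v j x) \<in> borel_measurable borel" and si: "integrable tor (\<lambda>x. \<Sum>j\<in>UNIV. v j x)"
    by (measurable, intro Bochner_Integration.integrable_sum vi)
  have pm [measurable]: "p \<in> borel_measurable borel" unfolding p_def by measurable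
  have pint: "integrable tor p" unfolding p_def using Di si by simp
  have pf: "fc p \<xi> = (\<Sum>j\<in>UNIV. riesz j \<xi> * (of_real (4 * pi\<^sup>2) * symb a \<xi> (\<lambda>k. w k \<xi>) j + fc (g j) \<xi> - F j \<xi>))" for \<xi>
  proof -
    have "fc (\<lambda>x. \<Sum>j\<in>UNIV. v j x) \<xi> = (\<Sum>j\<in>UNIV. fc (v j) \<xi>)"
      unfolding fc_def of_real_sum sum_distrib_right
      by (intro Bochner_Integration.integral_sum integrable_fc vi vm)
    then have "fc p \<xi> = d \<xi> + (\<Sum>j\<in>UNIV. riesz j \<xi> * fc (g j) \<xi>)"
      unfolding p_def by (subst fc_add[OF Di Dm si sm]) (simp add: Df vf)
    then show ?thesis unfolding d_def sum.distrib[symmetric] by (simp add: algebra_simps)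
  qed
  define q where "q = (if CARD('n) \<le> 4 then 2 else real CARD('n) / (real CARD('n) - 2))"
  \<comment> \<open>\<open>D\<close> is controlled in \<open>L_2\<close> and the \<open>v j\<close>
    with exponent \<open>m / (m - 2)\<close>, so q must not exceed either. The latter exponent is at
    least 2 exactly for dimensions up to 4, with m = 3 in dimension 2; from 5 on it equals
    q.\<close>
  have q0: "q \<ge> 0" and q2: "q \<le> 2" and qm: "q \<le> real m / (real m - 2)"
  proof -
    consider "CARD('n) \<le> 3" | "CARD('n) = 4" | "CARD('n) \<ge> 5" by linarith
    then have "q \<ge> 0 \<and> q \<le> 2 \<and> q \<le> real m / (real m - 2)"
      by cases (auto simp: q_def m_def field_simps max_def)
    then show "q \<ge> 0" "q \<le> 2" "q \<le> real m / (real m - 2)" by auto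
  qed
  have pq: "integrable tor (\<lambda>x. \<bar>p x\<bar> powr q)"
    unfolding p_def
  proof (rule integrable_powr_add[OF Dm sm q0])
    show "integrable tor (\<lambda>x. \<bar>D x\<bar> powr q)"
      by (rule integrable_powr_le[OF Dm _ q0 q2]) (use D2 in simp)
    show "integrable tor (\<lambda>x. \<bar>\<Sum>j\<in>UNIV. v j x\<bar> powr q)"
      by (intro integrable_powr_sum integrable_powr_le[OF vm vq q0 qm] q0 vm) simp
  qed
  have pper: "periodic p" by (simp add: periodic_def p_def Dp vp)
  have pL: "p \<in> Lq_dot q"
  proof -
    have "p \<in> borel_measurable lebesgue" using pm by (intro measurable_completion) simp
    moreover have "set_integrable lebesgue torus (\<lambda>x. \<bar>p x\<bar> powr q)"
      by (subst set_integral_torus(2)) (use pq in measurable)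
    moreover have "(LINT x:torus|lebesgue. p x) = 0"
    proof -
      have "complex_of_real (LINT x|tor. p x) = fc p 0" by (simp add: fc_def)
      also have "\<dots> = 0" by (simp add: pf riesz_def)
      finally show ?thesis by (simp add: set_integral_torus(1)[OF pm])
    qed
    ultimately show ?thesis using pper by (simp add: Lq_dot_def)
  qed

  \<comment> \<open>The momentum equation in the sense of distributions\<close>
  have rep: "represents G T"
    if "G \<in> borel_measurable borel" "\<And>x i. G (x + axis i 1) = G x" "integrable tor G"
      "distribution T" "\<And>\<xi>. fourier T \<xi> = fc G \<xi>" for G :: "real ^ 'n \<Rightarrow> real" and T :: "'n distr"
    unfolding represents_def
  proof (intro conjI ballI)
    show "periodic G" using that(2) by (simp add: periodic_def)
    show "G absolutely_integrable_on torus" using set_integral_torus(2)[OF that(1)] that(3) by simp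
    fix \<phi> :: "real ^ 'n \<Rightarrow> real" assume \<phi>: "\<phi> \<in> test_fun"
    have "(\<lambda>\<phi>. 1 * T \<phi> + (-1) * distr_of G \<phi>) \<phi> = 0"
      by (rule distribution_eq_0[OF distribution_lin[OF that(4) distribution_distr_of[OF that(1,3)]] _ \<phi>])
        (simp only: fourier_lin that(5) fourier_distr_of[OF that(1,3)], simp)
    then show "T \<phi> = distr_of G \<phi>" by simp
  qed
  define N where "N j k = distr_of (\<lambda>x. U j x * H j k x)" for j k
  have UHi: "integrable tor (\<lambda>x. U j x * H j k x)" for j k by (rule L2_mult(1)[OF Um U2 Hm H2])
  have UHm: "(\<lambda>x. U j x * H j k x) \<in> borel_measurable borel" for j k by measurable
  have Nd: "distribution (N j k)" for j k unfolding N_def by (rule distribution_distr_of[OF UHm UHi])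
  have Nf: "fourier (N j k) \<xi> = fc (\<lambda>x. H j k x * U j x) \<xi>" for j k \<xi>
    unfolding N_def by (simp add: fourier_distr_of[OF UHm UHi] mult.commute)
  have prod: "is_product (u j) (dpartial j (u k)) (N j k)" for j k
    unfolding is_product_def
  proof (intro exI conjI)
    show "represents (U j) (u j)" by (rule rep[OF Um Up Ui ud]) (simp add: uf Uf)
    show "represents (H j k) (dpartial j (u k))"
      by (rule rep[OF Hm Hp Hi distribution_dpartial[OF ud]]) (simp add: fourier_dpartial[OF ud] uf Hf h_def)
    show "represents (\<lambda>x. U j x * H j k x) (N j k)"
      by (rule rep[OF UHm _ UHi Nd]) (simp_all add: Up Hp Nf mult.commute)
  qed
  have eqn: "- stokes_op a u k \<phi> + dpartial k (distr_of p) \<phi> + (\<Sum>j\<in>UNIV. N j k \<phi>) = f k \<phi>" if \<phi>: "\<phi> \<in> test_fun" for k \<phi>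
  proof -
    note Sd = stokes_fourier(1)[OF ud sym, where k = k] and pd = distribution_dpartial[OF distribution_distr_of[OF pm pint], where j = k]
    have Ns: "distribution (\<lambda>\<phi>. \<Sum>j\<in>UNIV. 1 * N j k \<phi>)" by (intro distribution_sum Nd) simp
    define T where "T = (\<lambda>\<phi>. 1 * (1 * (- 1 * stokes_op a u k \<phi> + 1 * dpartial k (distr_of p) \<phi>) + 1 * (\<Sum>j\<in>UNIV. 1 * N j k \<phi>)) + (-1) * f k \<phi>)"
    have Td: "distribution T" unfolding T_def by (intro distribution_lin Sd pd Ns fd)
    have "fourier T \<xi> = 0" for \<xi>
    proof -
      let ?Q = "\<lambda>k. of_real (4 * pi\<^sup>2) * symb a \<xi> (\<lambda>k. w k \<xi>) k + fc (g k) \<xi> - F k \<xi>"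
      have gN: "(\<Sum>j\<in>UNIV. fourier (N j k) \<xi>) = fc (g k) \<xi>"
        unfolding Nf g_def fc_def of_real_sum sum_distrib_right
        by (intro Bochner_Integration.integral_sum[symmetric] integrable_fc HUi) measurable
      have "fourier T \<xi> = ?Q k + 2 * pi * \<i> * of_int (\<xi> $ k) * fc p \<xi>"
        unfolding T_def fourier_lin fourier_sum stokes_fourier(2)[OF ud sym] fourier_dpartial[OF distribution_distr_of[OF pm pint]]
          fourier_distr_of[OF pm pint]
        by (simp add: gN uf F_def algebra_simps)
      also have "\<dots> = 0"
      \<comment> \<open>At frequency 0 there is no equation from the Galerkin limit. All terms
        vanish separately: the force has mean zero, and the divergence form shows that the
        convection term has mean zero too.\<close>
      proof (cases "\<xi> = 0")
        case True
        have "fc (g k) 0 = 0"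
          by (rule LIMSEQ_unique[OF conv]) (simp add: conv_def sdot_def)
        then show ?thesis using True by (simp add: symb_def F0)
      next
        case False
        \<comment> \<open>The residual is therefore parallel to \<open>\<xi>\<close>, that is, a
          gradient; the coefficients of \<open>p\<close> were chosen so that
          \<open>2 pi \<i> \<xi>_k\<close> times them is its negative.\<close>
        have "leray \<xi> ?Q k = 0" by (rule weq[OF False conv])
        then have "?Q k = of_int (\<xi> $ k) * sdot \<xi> ?Q / of_real ((norm (freq \<xi>))\<^sup>2)" by (simp add: leray_def)
        moreover have "fc p \<xi> = \<i> * sdot \<xi> ?Q / of_real (2 * pi * (norm (freq \<xi>))\<^sup>2)"
          unfolding pf riesz_def sdot_def by (simp add: sum_distrib_left sum_divide_distrib mult_ac)
        moreover have "of_int x * S / of_real r + 2 * pi * \<i> * of_int x * (\<i> * S / of_real (2 * pi * r)) = 0" for x S r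
          by (cases "r = 0") (auto simp: field_simps)
        ultimately show ?thesis by (simp only:)
      qed
      finally show ?thesis .
    qed
    then have "T \<phi> = 0" using distribution_eq_0[OF Td _ \<phi>] by blast
    then show ?thesis by (simp add: T_def)
  qed
  have "navier_stokes a u p f"
    unfolding navier_stokes_def using prod eqn by blast
  then show ?thesis
    using usol pL unorm unfolding q_def fnorm by blast
qed

end
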